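(* Let $\ell>0$ and $\mathcal V_{\mathcal T}=\mathcal S^{-1,\ell}_{\mathcal T}$ ($\mathcal T\in\mathbb T$). The biorthogonal projectors $$P_{\mathcal T}u=\sum_{\{T\in\mathcal T,\,0\le i\le m\}}\frac{\langle u,\xi_{T,i}\rangle_{L_2(\Omega)}}{\langle\psi_{\mathcal T,T,i},\xi_{T,i}\rangle_{L_2(\Omega)}}\,\psi_{\mathcal T,T,i}$$ satisfy $$\sup_{\mathcal T\in\mathbb T}\|P_{\mathcal T}\|_{\mathcal L(\mathcal W,\mathcal W)}<\infty.$$
   Context: Let $\Omega\subset\mathbb R^d$ be a bounded polytopal domain, $\gamma\subset\partial\Omega$ a measurable, closed, possibly empty set, and $s\in[0,1]$. $H^1_{0,\gamma}(\Omega)$ is the closure in $H^1(\Omega)$ of the functions in $C^\infty(\Omega)\cap H^1(\Omega)$ that vanish at $\gamma$. $\mathcal W:=[L_2(\Omega),H^1_{0,\gamma}(\Omega)]_{s,2}$ (real interpolation; read as $L_2(\Omega)$ for $s=0$ and $H^1_{0,\gamma}(\Omega)$ for $s=1$). $\mathcal L(\mathcal W,\mathcal W)$ is the space of bounded linear maps $\mathcal W\to\mathcal W$ with the operator norm. $\mathbf 1$ is the constant function $1$. $\mathbb T$ is a family of conforming partitions $\mathcal T$ of $\Omega$ into (open) uniformly shape regular $d$-simplices, such that $\gamma$ is the (possibly empty) union of $(d-1)$-faces of $T\in\mathcal T$; for $d=1$ neighbouring elements are moreover assumed to have uniformly comparable sizes. For $\mathcal T\in\mathbb T$: $N^0_{\mathcal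 T}$ is the set of vertices of $\mathcal T$ not on $\gamma$; $d_{\mathcal T,\nu}:=\#\{T\in\mathcal T\colon \nu\in\overline T\}$; $N^0_{\mathcal T,T}$ is the set of vertices of $T$ in $N^0_{\mathcal T}$; $h_T:=|T|^{1/d}$. $\mathcal S^{0,1}_{\mathcal T,0}:=\{u\in H^1_{0,\gamma}(\Omega)\colon u|_T\in\mathcal P_1\ (T\in\mathcal T)\}$ has nodal basis $\{\phi_{\mathcal T,\nu}\}_{\nu\in N^0_{\mathcal T}}$, $\phi_{\mathcal T,\nu}(\nu')=\delta_{\nu,\nu'}$. All constants in $\lesssim,\gtrsim,\eqsim$ are independent of $\mathcal T\in\mathbb T$. Lowest order collections. $\Xi^0_{\mathcal T}=\{\xi_T\colon T\in\mathcal T\}$, where $\xi_T$ is the characteristic function of $T$. $\Theta^0_{\mathcal T}=\{\theta_T\colon T\in\mathcal T\}\subset H^1_{0,\gamma}(\Omega)$ is a collection of bubbles such that for $T,T'\in\mathcal T$ and $k\in\{0,1\}$: $\theta_T\ge 0$; $\mathrm{supp}\,\theta_T\subset\overline T$; $\langle\theta_T,\xi_{T'}\rangle_{L_2(\Omega)}\eqsim\delta_{TT'}\|\theta_T\|_{L_2(\Omega)}\|\xi_{T'}\|_{L_2(\Omega)}$; $\langle\theta_T,\xi_T\rangle_{L_2(\Omega)}=|T|$; $\|\theta_T\|_{H^1(\Omega)}\lesssim h_T^{-1}\|\theta_T\|_{L_2(\Omega)}$; $\|\sum_{T}c_T\theta_T\|_{H^k(\Omega)}^2\eqsim\sum_T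 h_T^{-2k}|c_T|^2\|\theta_T\|^2_{L_2(\Omega)}$; and $\|u+v\|_{H^k(\Omega)}^2\gtrsim\|u\|_{H^k(\Omega)}^2+\|v\|_{H^k(\Omega)}^2$ for $u\in\mathcal S^{0,1}_{\mathcal T,0}$, $v\in\mathrm{span}\,\Theta^0_{\mathcal T}$. With $\sigma_{\mathcal T,T}:=\sum_{\nu\in N^0_{\mathcal T,T}}d_{\mathcal T,\nu}^{-1}\phi_{\mathcal T,\nu}$, $$\psi^0_{\mathcal T,T}:=\sigma_{\mathcal T,T}+\frac{\langle\mathbf 1-\sigma_{\mathcal T,T},\xi_T\rangle_{L_2(\Omega)}}{\langle\theta_T,\xi_T\rangle_{L_2(\Omega)}}\theta_T-\sum_{T'\in\mathcal T\setminus\{T\}}\frac{\langle\sigma_{\mathcal T,T},\xi_{T'}\rangle_{L_2(\Omega)}}{\langle\theta_{T'},\xi_{T'}\rangle_{L_2(\Omega)}}\theta_{T'}.$$ Higher order collections. $\mathcal S^{-1,\ell}_{\mathcal T}$ is the space of discontinuous piecewise polynomials of degree $\ell$ w.r.t. $\mathcal T$. With $m:=\binom{d+\ell}{\ell}-1$, it is equipped with a basis $\Xi_{\mathcal T}=\{\xi_{T,i}\colon T\in\mathcal T,\,0\le i\le m\}$, where for each $T$, $\{\xi_{T,i}\}_{0\le i\le m}$ is obtained by affine lifting from a basis of the polynomials of degree $\ell$ on a reference $d$-simplex, such that $\{\xi_{T,0}\colon T\in\mathcal T\}=\Xi^0_{\mathcal T}$ (with $\xi_{T,0}=\xi_T$),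 $\mathrm{supp}\,\xi_{T,i}\subset\overline T$ and $\|\xi_{T,i}\|_{L_2(\Omega)}\eqsim|T|^{1/2}$. $\Theta_{\mathcal T}=\{\theta_{T,i}\colon T\in\mathcal T,\,0\le i\le m\}\subset H^1_{0,\gamma}(\Omega)$ is a set of bubbles such that for $T,T'\in\mathcal T$, $0\le i,i'\le m$, $k\in\{0,1\}$: $\delta_{(T,i),(T',i')}|T|=\langle\theta_{T,i},\xi_{T',i'}\rangle_{L_2(\Omega)}\eqsim\delta_{(T,i),(T',i')}\|\theta_{T,i}\|_{L_2(\Omega)}\|\xi_{T',i'}\|_{L_2(\Omega)}$; $\|\theta_{T,i}\|_{H^1(\Omega)}\lesssim h_T^{-1}\|\theta_{T,i}\|_{L_2(\Omega)}$; $\mathrm{supp}\,\theta_{T,i}\subset\overline T$; $\|\sum_{T,i}c_{T,i}\theta_{T,i}\|_{H^k(\Omega)}^2\eqsim\sum_{T,i}h_T^{-2k}|c_{T,i}|^2\|\theta_{T,i}\|_{L_2(\Omega)}^2$; $\|u+v\|_{H^k(\Omega)}^2\gtrsim\|u\|_{H^k(\Omega)}^2+\|v\|_{H^k(\Omega)}^2$ for $u\in\mathcal S^{0,1}_{\mathcal T,0}$, $v\in\mathrm{span}\,\Theta_{\mathcal T}$; and $\{\theta_{T,0}\colon T\in\mathcal T\}=\Theta^0_{\mathcal T}$ (with $\theta_{T,0}=\theta_T$). Then $$\psi_{\mathcal T,T,0}:=\psi^0_{\mathcal T,T}-\sum_{\{T'\in\mathcal T,\,1\le i'\le m\}}\frac{\langle\psi^0_{\mathcal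 T,T},\xi_{T',i'}\rangle_{L_2(\Omega)}}{\langle\theta_{T',i'},\xi_{T',i'}\rangle_{L_2(\Omega)}}\theta_{T',i'},\qquad\psi_{\mathcal T,T,i}:=\theta_{T,i}\quad(1\le i\le m),$$ and $\mathcal W_{\mathcal T}:=\mathrm{span}\{\psi_{\mathcal T,T,i}\colon T\in\mathcal T,\,0\le i\le m\}$. $P_{\mathcal T}\colon L_2(\Omega)\to H^1_{0,\gamma}(\Omega)$ is the projector with $\mathrm{ran}\,P_{\mathcal T}=\mathcal W_{\mathcal T}$ and $\mathrm{ran}(\mathrm{Id}-P_{\mathcal T})=\mathcal V_{\mathcal T}^{\perp_{L_2(\Omega)}}$. *)

theory Defs
  imports "HOL-Analysis.Analysis"
begin

section \<open>Sobolev spaces and real interpolation\<close>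

text \<open>
  Elements of $L_2(\Omega)$ are represented by functions on the whole space; only their values on
  \<open>\<Omega>\<close>, up to null sets, matter, since all integrals are taken with respect to
  \<open>lebesgue_on \<Omega>\<close>.
\<close>

definition L2_space :: "'a::euclidean_space set \<Rightarrow> ('a \<Rightarrow> real) set" where
  "L2_space \<Omega> =
     {u \<in> borel_measurable (lebesgue_on \<Omega>). integrable (lebesgue_on \<Omega>) (\<lambda>x. (u x)\<^sup>2)}"

definition L2_inner :: "'a::euclidean_space set \<Rightarrow> ('a \<Rightarrow> real) \<Rightarrow> ('a \<Rightarrow> real) \<Rightarrow> real" where
  "L2_inner \<Omega> u v = (\<integral>x. u x * v x \<partial>lebesgue_on \<Omega>)"

definition L2_norm :: "'a::euclidean_space set \<Rightarrow> ('a \<Rightarrow> real) \<Rightarrow> real" where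
  "L2_norm \<Omega> u = sqrt (L2_inner \<Omega> u u)"

text \<open>Meant for open \<open>S\<close>; the base case and all derivatives are then continuous.\<close>

primrec Ck_on :: "nat \<Rightarrow> 'a::euclidean_space set \<Rightarrow> ('a \<Rightarrow> real) \<Rightarrow> bool" where
  "Ck_on 0 S f \<longleftrightarrow> continuous_on S f"
| "Ck_on (Suc k) S f \<longleftrightarrow>
     (\<forall>x\<in>S. f differentiable (at x)) \<and>
     (\<forall>b\<in>Basis. Ck_on k S (\<lambda>x. frechet_derivative f (at x) b))"

definition smooth_on :: "'a::euclidean_space set \<Rightarrow> ('a \<Rightarrow> real) \<Rightarrow> bool" where
  "smooth_on S f \<longleftrightarrow> (\<forall>k. Ck_on k S f)"

definition test_function :: "'a::euclidean_space set \<Rightarrow> ('a \<Rightarrow> real) \<Rightarrow> bool" where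
  "test_function \<Omega> \<eta> \<longleftrightarrow>
     smooth_on UNIV \<eta> \<and> (\<exists>K. compact K \<and> K \<subseteq> \<Omega> \<and> (\<forall>x. x \<notin> K \<longrightarrow> \<eta> x = 0))"

definition is_weak_partial ::
    "'a::euclidean_space set \<Rightarrow> 'a \<Rightarrow> ('a \<Rightarrow> real) \<Rightarrow> ('a \<Rightarrow> real) \<Rightarrow> bool" where
  "is_weak_partial \<Omega> b u g \<longleftrightarrow>
     g \<in> L2_space \<Omega> \<and>
     (\<forall>\<eta>. test_function \<Omega> \<eta> \<longrightarrow>
        L2_inner \<Omega> u (\<lambda>x. frechet_derivative \<eta> (at x) b) = - L2_inner \<Omega> g \<eta>)"

definition H1_space :: "'a::euclidean_space set \<Rightarrow> ('a \<Rightarrow> real) set" where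
  "H1_space \<Omega> = {u \<in> L2_space \<Omega>. \<forall>b\<in>Basis. \<exists>g. is_weak_partial \<Omega> b u g}"

text \<open>The choice is immaterial: weak derivatives are unique up to null sets.\<close>

definition weak_partial :: "'a::euclidean_space set \<Rightarrow> 'a \<Rightarrow> ('a \<Rightarrow> real) \<Rightarrow> 'a \<Rightarrow> real" where
  "weak_partial \<Omega> b u = (SOME g. is_weak_partial \<Omega> b u g)"

definition H1_norm :: "'a::euclidean_space set \<Rightarrow> ('a \<Rightarrow> real) \<Rightarrow> real" where
  "H1_norm \<Omega> u = sqrt ((L2_norm \<Omega> u)\<^sup>2 + (\<Sum>b\<in>Basis. (L2_norm \<Omega> (weak_partial \<Omega> b u))\<^sup>2))"

definition Hk_norm :: "nat \<Rightarrow> 'a::euclidean_space set \<Rightarrow> ('a \<Rightarrow> real) \<Rightarrow> real" where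
  "Hk_norm k = (if k = 0 then L2_norm else H1_norm)"

text \<open>
  A function on the open set \<open>\<Omega>\<close> vanishes at \<open>\<gamma>\<close>, a part of the boundary, if it
  extends continuously by zero to \<open>\<gamma>\<close>.
\<close>

definition vanishes_at :: "'a::euclidean_space set \<Rightarrow> 'a set \<Rightarrow> ('a \<Rightarrow> real) \<Rightarrow> bool" where
  "vanishes_at \<Omega> \<gamma> v \<longleftrightarrow> (\<forall>y\<in>\<gamma>. (v \<longlongrightarrow> 0) (at y within \<Omega>))"

definition H10_space :: "'a::euclidean_space set \<Rightarrow> 'a set \<Rightarrow> ('a \<Rightarrow> real) set" where
  "H10_space \<Omega> \<gamma> =
     {u \<in> H1_space \<Omega>. \<forall>\<epsilon>>0. \<exists>v \<in> H1_space \<Omega>.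
        smooth_on \<Omega> v \<and> vanishes_at \<Omega> \<gamma> v \<and> H1_norm \<Omega> (\<lambda>x. u x - v x) < \<epsilon>}"

text \<open>
  Real interpolation $[X_0,X_1]_{s,2}$, $0<s<1$, by the K-method. Here $X_1 \subseteq X_0$, so that
  $X_0 + X_1 = X_0$ and every decomposition of \<open>u\<close> has the form $(u - v) + v$ with $v \in X_1$.
\<close>

definition K_functional ::
    "(('a \<Rightarrow> real) \<Rightarrow> real) \<Rightarrow> ('a \<Rightarrow> real) set \<Rightarrow> (('a \<Rightarrow> real) \<Rightarrow> real) \<Rightarrow> real \<Rightarrow> ('a \<Rightarrow> real) \<Rightarrow> real"
  where "K_functional n0 X1 n1 t u = (INF v\<in>X1. n0 (\<lambda>x. u x - v x) + t * n1 v)"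

definition interp_energy ::
    "(('a \<Rightarrow> real) \<Rightarrow> real) \<Rightarrow> ('a \<Rightarrow> real) set \<Rightarrow> (('a \<Rightarrow> real) \<Rightarrow> real) \<Rightarrow> real \<Rightarrow> ('a \<Rightarrow> real) \<Rightarrow> ennreal"
  where "interp_energy n0 X1 n1 s u =
    (\<integral>\<^sup>+t\<in>{0<..}. ennreal ((t powr (- s) * K_functional n0 X1 n1 t u)\<^sup>2 / t) \<partial>lborel)"

definition W_space :: "'a::euclidean_space set \<Rightarrow> 'a set \<Rightarrow> real \<Rightarrow> ('a \<Rightarrow> real) set" where
  "W_space \<Omega> \<gamma> s =
     (if s = 0 then L2_space \<Omega>
      else if s = 1 then H10_space \<Omega> \<gamma>
      else {u \<in> L2_space \<Omega>.
              interp_energy (L2_norm \<Omega>) (H10_space \<Omega> \<gamma>) (H1_norm \<Omega>) s u < \<infinity>})"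

definition W_norm :: "'a::euclidean_space set \<Rightarrow> 'a set \<Rightarrow> real \<Rightarrow> ('a \<Rightarrow> real) \<Rightarrow> real" where
  "W_norm \<Omega> \<gamma> s u =
     (if s = 0 then L2_norm \<Omega> u
      else if s = 1 then H1_norm \<Omega> u
      else sqrt (enn2real (interp_energy (L2_norm \<Omega>) (H10_space \<Omega> \<gamma>) (H1_norm \<Omega>) s u)))"

definition linear_op ::
    "'a::euclidean_space set \<Rightarrow> ('a \<Rightarrow> real) set \<Rightarrow> (('a \<Rightarrow> real) \<Rightarrow> 'a \<Rightarrow> real) \<Rightarrow> bool" where
  "linear_op \<Omega> X A \<longleftrightarrow>
     (\<forall>u\<in>X. \<forall>v\<in>X. \<forall>a b. AE x in lebesgue_on \<Omega>.
        A (\<lambda>y. a * u y + b * v y) x = a * A u x + b * A v x)"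

definition bounded_op ::
    "'a::euclidean_space set \<Rightarrow> ('a \<Rightarrow> real) set \<Rightarrow> (('a \<Rightarrow> real) \<Rightarrow> real) \<Rightarrow>
     (('a \<Rightarrow> real) \<Rightarrow> 'a \<Rightarrow> real) \<Rightarrow> bool" where
  "bounded_op \<Omega> X n A \<longleftrightarrow>
     linear_op \<Omega> X A \<and> (\<forall>u\<in>X. A u \<in> X) \<and> (\<exists>C. \<forall>u\<in>X. n (A u) \<le> C * n u)"

definition op_norm ::
    "('a \<Rightarrow> real) set \<Rightarrow> (('a \<Rightarrow> real) \<Rightarrow> real) \<Rightarrow> (('a \<Rightarrow> real) \<Rightarrow> 'a \<Rightarrow> real) \<Rightarrow> real" where
  "op_norm X n A = (SUP u\<in>{u \<in> X. n u \<le> 1}. n (A u))"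


section \<open>Polytopal domains and their partitions\<close>

text \<open>
  The interior of a finite union of polytopes. The last condition says that \<open>\<Omega>\<close> does not touch
  itself at a boundary point; every Lipschitz polytope satisfies it. For, e.g., a planar domain
  whose closure is pinched at a vertex, the space $\mathcal S^{0,1}_{\mathcal T,0}$ defined below
  contains functions that are discontinuous at that vertex, and hence has no nodal basis.
\<close>

definition polytopal_domain :: "'a::euclidean_space set \<Rightarrow> bool" where
  "polytopal_domain \<Omega> \<longleftrightarrow>
     \<Omega> \<noteq> {} \<and> open \<Omega> \<and> connected \<Omega> \<and> bounded \<Omega> \<and>
     (\<exists>\<P>. finite \<P> \<and> (\<forall>Q\<in>\<P>. polytope Q) \<and> closure \<Omega> = \<Union>\<P> \<and> \<Omega> = interior (\<Union>\<P>)) \<and>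
     (\<forall>x\<in>frontier \<Omega>. \<exists>r0>0. \<forall>r. 0 < r \<and> r < r0 \<longrightarrow> connected (\<Omega> \<inter> ball x r))"

text \<open>The elements of a partition are open simplices.\<close>

definition conforming_partition :: "'a::euclidean_space set \<Rightarrow> 'a set set \<Rightarrow> bool" where
  "conforming_partition \<Omega> \<T> \<longleftrightarrow>
     finite \<T> \<and> (\<forall>T\<in>\<T>. \<exists>S. int DIM('a) simplex S \<and> T = interior S) \<and>
     disjoint \<T> \<and> \<Union>\<T> \<subseteq> \<Omega> \<and> closure \<Omega> = (\<Union>T\<in>\<T>. closure T) \<and>
     triangulation (closure ` \<T>)"

definition shape_regular :: "real \<Rightarrow> 'a::euclidean_space set \<Rightarrow> bool" where
  "shape_regular \<kappa> T \<longleftrightarrow> (\<exists>x r. 0 < r \<and> ball x r \<subseteq> T \<and> diameter T \<le> \<kappa> * r)"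

abbreviation vol :: "'a::euclidean_space set \<Rightarrow> real" where
  "vol T \<equiv> measure lebesgue T"

definition admissible_family :: "'a::euclidean_space set \<Rightarrow> 'a set \<Rightarrow> 'a set set set \<Rightarrow> bool" where
  "admissible_family \<Omega> \<gamma> TT \<longleftrightarrow>
     (\<forall>\<T>\<in>TT. conforming_partition \<Omega> \<T>) \<and>
     (\<forall>\<T>\<in>TT. \<exists>\<F>. (\<forall>F\<in>\<F>. \<exists>T\<in>\<T>. F facet_of closure T) \<and> \<gamma> = \<Union>\<F>) \<and>
     (\<exists>\<kappa>. \<forall>\<T>\<in>TT. \<forall>T\<in>\<T>. shape_regular \<kappa> T) \<and>
     (DIM('a) = 1 \<longrightarrow>
        (\<exists>\<kappa>. \<forall>\<T>\<in>TT. \<forall>T\<in>\<T>. \<forall>T'\<in>\<T>.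
           closure T \<inter> closure T' \<noteq> {} \<longrightarrow> vol T \<le> \<kappa> * vol T'))"

definition mesh_size :: "'a::euclidean_space set \<Rightarrow> real" where
  "mesh_size T = root DIM('a) (vol T)"

definition vertices_of :: "'a::euclidean_space set \<Rightarrow> 'a set" where
  "vertices_of T = {\<nu>. \<nu> extreme_point_of closure T}"

definition free_vertices :: "'a::euclidean_space set \<Rightarrow> 'a set set \<Rightarrow> 'a set" where
  "free_vertices \<gamma> \<T> = (\<Union>T\<in>\<T>. vertices_of T) - \<gamma>"

definition valence :: "'a::euclidean_space set set \<Rightarrow> 'a \<Rightarrow> nat" where
  "valence \<T> \<nu> = card {T \<in> \<T>. \<nu> \<in> closure T}"


section \<open>Piecewise polynomial spaces and their bases\<close>

definition poly_space :: "nat \<Rightarrow> ('a::euclidean_space \<Rightarrow> real) set" where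
  "poly_space n =
     {q. \<exists>c. \<forall>x. q x = (\<Sum>\<alpha> \<in> {\<alpha> \<in> Basis \<rightarrow>\<^sub>E (UNIV :: nat set). (\<Sum>b\<in>Basis. \<alpha> b) \<le> n}.
                          c \<alpha> * (\<Prod>b\<in>Basis. (x \<bullet> b) ^ \<alpha> b))}"

text \<open>$\mathcal S^{-1,n}_{\mathcal T}$; the values on the null set outside the elements are free.\<close>

definition dg_space :: "nat \<Rightarrow> 'a::euclidean_space set set \<Rightarrow> ('a \<Rightarrow> real) set" where
  "dg_space n \<T> = {v. \<forall>T\<in>\<T>. \<exists>q\<in>poly_space n. \<forall>x\<in>T. v x = q x}"

text \<open>$\mathcal S^{0,1}_{\mathcal T,0}$\<close>

definition S01_space :: "'a::euclidean_space set \<Rightarrow> 'a set \<Rightarrow> 'a set set \<Rightarrow> ('a \<Rightarrow> real) set" where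
  "S01_space \<Omega> \<gamma> \<T> = {u \<in> H10_space \<Omega> \<gamma>. \<forall>T\<in>\<T>. \<exists>q\<in>poly_space 1. \<forall>x\<in>T. u x = q x}"

text \<open>
  Point values refer to the representative that is continuous up to the boundary. Linear
  independence follows from the Kronecker property.
\<close>

definition nodal_basis ::
    "'a::euclidean_space set \<Rightarrow> 'a set \<Rightarrow> 'a set set \<Rightarrow> ('a \<Rightarrow> 'a \<Rightarrow> real) \<Rightarrow> bool" where
  "nodal_basis \<Omega> \<gamma> \<T> \<phi> \<longleftrightarrow>
     (\<forall>\<nu>\<in>free_vertices \<gamma> \<T>.
        \<phi> \<nu> \<in> S01_space \<Omega> \<gamma> \<T> \<and> continuous_on (closure \<Omega>) (\<phi> \<nu>) \<and>
        (\<forall>\<nu>'\<in>free_vertices \<gamma> \<T>. \<phi> \<nu> \<nu>' = (if \<nu> = \<nu>' then 1 else 0))) \<and>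
     (\<forall>u\<in>S01_space \<Omega> \<gamma> \<T>. \<exists>c. AE x in lebesgue_on \<Omega>.
        u x = (\<Sum>\<nu>\<in>free_vertices \<gamma> \<T>. c \<nu> * \<phi> \<nu> x))"

definition reference_basis ::
    "'a::euclidean_space set \<Rightarrow> nat \<Rightarrow> nat \<Rightarrow> (nat \<Rightarrow> 'a \<Rightarrow> real) \<Rightarrow> bool" where
  "reference_basis R n m p \<longleftrightarrow>
     (\<forall>i\<le>m. p i \<in> poly_space n) \<and>
     (\<forall>q\<in>poly_space n. \<exists>c. \<forall>x\<in>R. q x = (\<Sum>i\<le>m. c i * p i x)) \<and>
     (\<forall>c. (\<forall>x\<in>R. (\<Sum>i\<le>m. c i * p i x) = 0) \<longrightarrow> (\<forall>i\<le>m. c i = 0))"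

text \<open>
  The collections $\Xi_{\mathcal T}$: \<open>R\<close> is the (closed) reference simplex, \<open>p\<close> the basis on
  it, and \<open>L\<close> followed by the shift by \<open>a\<close> is the inverse of the affine parametrization of \<open>T\<close>.
\<close>

definition lifted_bases ::
    "'a::euclidean_space set \<Rightarrow> 'a set set set \<Rightarrow> 'a set \<Rightarrow> nat \<Rightarrow> (nat \<Rightarrow> 'a \<Rightarrow> real) \<Rightarrow>
     ('a set set \<Rightarrow> 'a set \<Rightarrow> nat \<Rightarrow> 'a \<Rightarrow> real) \<Rightarrow> bool" where
  "lifted_bases \<Omega> TT R m p \<xi> \<longleftrightarrow>
     (\<forall>\<T>\<in>TT. \<forall>T\<in>\<T>. \<exists>L a. linear L \<and> (\<lambda>x. L x + a) ` T = interior R \<and>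
        (\<forall>i\<le>m. \<forall>x. \<xi> \<T> T i x = (if x \<in> T then p i (L x + a) else 0))) \<and>
     (\<forall>\<T>\<in>TT. \<forall>T\<in>\<T>. \<xi> \<T> T 0 = indicator T) \<and>
     (\<exists>C. \<forall>\<T>\<in>TT. \<forall>T\<in>\<T>. \<forall>i\<le>m.
        L2_norm \<Omega> (\<xi> \<T> T i) \<le> C * sqrt (vol T) \<and> sqrt (vol T) \<le> C * L2_norm \<Omega> (\<xi> \<T> T i))"

definition span_of :: "'a set set \<Rightarrow> nat \<Rightarrow> ('a set \<Rightarrow> nat \<Rightarrow> 'a \<Rightarrow> real) \<Rightarrow> ('a \<Rightarrow> real) set" where
  "span_of \<T> m f = {\<lambda>x. \<Sum>T\<in>\<T>. \<Sum>i\<le>m. c T i * f T i x | c. True}"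

text \<open>
  The collections $\Theta_{\mathcal T}$. The conditions on $\Theta^0_{\mathcal T}$ are those for
  the index 0 (take $c_{T,i} = 0$ for $i > 0$), together with nonnegativity.
\<close>

definition bubble_collections ::
    "'a::euclidean_space set \<Rightarrow> 'a set \<Rightarrow> 'a set set set \<Rightarrow> nat \<Rightarrow>
     ('a set set \<Rightarrow> 'a set \<Rightarrow> nat \<Rightarrow> 'a \<Rightarrow> real) \<Rightarrow>
     ('a set set \<Rightarrow> 'a set \<Rightarrow> nat \<Rightarrow> 'a \<Rightarrow> real) \<Rightarrow> bool" where
  "bubble_collections \<Omega> \<gamma> TT m \<xi> \<theta> \<longleftrightarrow>
     (\<forall>\<T>\<in>TT. \<forall>T\<in>\<T>. \<forall>i\<le>m.
        \<theta> \<T> T i \<in> H10_space \<Omega> \<gamma> \<and>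
        (AE x in lebesgue_on \<Omega>. x \<notin> closure T \<longrightarrow> \<theta> \<T> T i x = 0)) \<and>
     (\<forall>\<T>\<in>TT. \<forall>T\<in>\<T>. AE x in lebesgue_on \<Omega>. 0 \<le> \<theta> \<T> T 0 x) \<and>
     (\<forall>\<T>\<in>TT. \<forall>T\<in>\<T>. \<forall>T'\<in>\<T>. \<forall>i\<le>m. \<forall>i'\<le>m.
        L2_inner \<Omega> (\<theta> \<T> T i) (\<xi> \<T> T' i') = (if (T, i) = (T', i') then vol T else 0)) \<and>
     (\<exists>C. \<forall>\<T>\<in>TT. \<forall>T\<in>\<T>. \<forall>i\<le>m.
        L2_inner \<Omega> (\<theta> \<T> T i) (\<xi> \<T> T i) \<le> C * (L2_norm \<Omega> (\<theta> \<T> T i) * L2_norm \<Omega> (\<xi> \<T> T i)) \<and>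
        L2_norm \<Omega> (\<theta> \<T> T i) * L2_norm \<Omega> (\<xi> \<T> T i) \<le> C * L2_inner \<Omega> (\<theta> \<T> T i) (\<xi> \<T> T i)) \<and>
     (\<exists>C. \<forall>\<T>\<in>TT. \<forall>T\<in>\<T>. \<forall>i\<le>m.
        H1_norm \<Omega> (\<theta> \<T> T i) \<le> C * (inverse (mesh_size T) * L2_norm \<Omega> (\<theta> \<T> T i))) \<and>
     (\<exists>C. \<forall>\<T>\<in>TT. \<forall>k\<in>{0, 1}. \<forall>c.
        let lhs = (Hk_norm k \<Omega> (\<lambda>x. \<Sum>T\<in>\<T>. \<Sum>i\<le>m. c T i * \<theta> \<T> T i x))\<^sup>2;
            rhs = (\<Sum>T\<in>\<T>. \<Sum>i\<le>m.
                     inverse (mesh_size T) ^ (2 * k) * \<bar>c T i\<bar>\<^sup>2 * (L2_norm \<Omega> (\<theta> \<T> T i))\<^sup>2)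
        in lhs \<le> C * rhs \<and> rhs \<le> C * lhs) \<and>
     (\<exists>C. \<forall>\<T>\<in>TT. \<forall>k\<in>{0, 1}. \<forall>u\<in>S01_space \<Omega> \<gamma> \<T>. \<forall>v\<in>span_of \<T> m (\<theta> \<T>).
        (Hk_norm k \<Omega> u)\<^sup>2 + (Hk_norm k \<Omega> v)\<^sup>2 \<le> C * (Hk_norm k \<Omega> (\<lambda>x. u x + v x))\<^sup>2)"


section \<open>The biorthogonal projector\<close>

text \<open>
  From here on \<open>\<phi>\<close>, \<open>\<xi>\<close>, \<open>\<theta>\<close> belong to one partition \<open>\<T>\<close>; $\xi_T$ and $\theta_T$ are
  \<open>\<xi> T 0\<close> and \<open>\<theta> T 0\<close>.
\<close>

definition sigma_fun ::
    "'a::euclidean_space set \<Rightarrow> 'a set set \<Rightarrow> ('a \<Rightarrow> 'a \<Rightarrow> real) \<Rightarrow> 'a set \<Rightarrow> 'a \<Rightarrow> real" where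
  "sigma_fun \<gamma> \<T> \<phi> T x =
     (\<Sum>\<nu> \<in> vertices_of T \<inter> free_vertices \<gamma> \<T>. inverse (real (valence \<T> \<nu>)) * \<phi> \<nu> x)"

definition psi0 ::
    "'a::euclidean_space set \<Rightarrow> 'a set \<Rightarrow> 'a set set \<Rightarrow> ('a \<Rightarrow> 'a \<Rightarrow> real) \<Rightarrow>
     ('a set \<Rightarrow> nat \<Rightarrow> 'a \<Rightarrow> real) \<Rightarrow> ('a set \<Rightarrow> nat \<Rightarrow> 'a \<Rightarrow> real) \<Rightarrow> 'a set \<Rightarrow> 'a \<Rightarrow> real" where
  "psi0 \<Omega> \<gamma> \<T> \<phi> \<xi> \<theta> T x =
     sigma_fun \<gamma> \<T> \<phi> T x
     + L2_inner \<Omega> (\<lambda>y. 1 - sigma_fun \<gamma> \<T> \<phi> T y) (\<xi> T 0) / L2_inner \<Omega> (\<theta> T 0) (\<xi> T 0) * \<theta> T 0 x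
     - (\<Sum>T'\<in>\<T> - {T}.
          L2_inner \<Omega> (sigma_fun \<gamma> \<T> \<phi> T) (\<xi> T' 0) / L2_inner \<Omega> (\<theta> T' 0) (\<xi> T' 0) * \<theta> T' 0 x)"

definition psi ::
    "'a::euclidean_space set \<Rightarrow> 'a set \<Rightarrow> 'a set set \<Rightarrow> nat \<Rightarrow> ('a \<Rightarrow> 'a \<Rightarrow> real) \<Rightarrow>
     ('a set \<Rightarrow> nat \<Rightarrow> 'a \<Rightarrow> real) \<Rightarrow> ('a set \<Rightarrow> nat \<Rightarrow> 'a \<Rightarrow> real) \<Rightarrow> 'a set \<Rightarrow> nat \<Rightarrow> 'a \<Rightarrow> real" where
  "psi \<Omega> \<gamma> \<T> m \<phi> \<xi> \<theta> T i x =
     (if i = 0 then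
        psi0 \<Omega> \<gamma> \<T> \<phi> \<xi> \<theta> T x
        - (\<Sum>T'\<in>\<T>. \<Sum>i'\<in>{1..m}.
             L2_inner \<Omega> (psi0 \<Omega> \<gamma> \<T> \<phi> \<xi> \<theta> T) (\<xi> T' i') / L2_inner \<Omega> (\<theta> T' i') (\<xi> T' i')
             * \<theta> T' i' x)
      else \<theta> T i x)"

definition biorth_proj ::
    "'a::euclidean_space set \<Rightarrow> 'a set \<Rightarrow> 'a set set \<Rightarrow> nat \<Rightarrow> ('a \<Rightarrow> 'a \<Rightarrow> real) \<Rightarrow>
     ('a set \<Rightarrow> nat \<Rightarrow> 'a \<Rightarrow> real) \<Rightarrow> ('a set \<Rightarrow> nat \<Rightarrow> 'a \<Rightarrow> real) \<Rightarrow> ('a \<Rightarrow> real) \<Rightarrow> 'a \<Rightarrow> real" where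
  "biorth_proj \<Omega> \<gamma> \<T> m \<phi> \<xi> \<theta> u x =
     (\<Sum>T\<in>\<T>. \<Sum>i\<le>m.
        L2_inner \<Omega> u (\<xi> T i) / L2_inner \<Omega> (psi \<Omega> \<gamma> \<T> m \<phi> \<xi> \<theta> T i) (\<xi> T i)
        * psi \<Omega> \<gamma> \<T> m \<phi> \<xi> \<theta> T i x)"

definition is_projector ::
    "'a::euclidean_space set \<Rightarrow> 'a set \<Rightarrow> ('a \<Rightarrow> real) set \<Rightarrow> ('a \<Rightarrow> real) set \<Rightarrow>
     (('a \<Rightarrow> real) \<Rightarrow> 'a \<Rightarrow> real) \<Rightarrow> bool" where
  "is_projector \<Omega> \<gamma> W V P \<longleftrightarrow>
     linear_op \<Omega> (L2_space \<Omega>) P \<and>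
     (\<forall>u\<in>L2_space \<Omega>. P u \<in> H10_space \<Omega> \<gamma> \<and> (AE x in lebesgue_on \<Omega>. P (P u) x = P u x)) \<and>
     P ` L2_space \<Omega> = W \<and>
     (\<lambda>u x. u x - P u x) ` L2_space \<Omega> = {w \<in> L2_space \<Omega>. \<forall>v\<in>V. L2_inner \<Omega> w v = 0}"

end

theory Submission
  imports Defs "HOL-Analysis.Analysis"
begin

text \<open>
  Write $P$ for the biorthogonal projector of one partition. The reason for its uniform stability is
  the splitting \<open>P_decomp\<close>,
  $$P u = Q u + B(u - Q u).$$
  Here $Q u = \sum_T |T|^{-1}\langle u, \xi_T\rangle\, \sigma_{\mathcal T,T}$ is an averaging
  quasi-interpolant: its value at a free vertex is the average of the means of $u$ over the elements
  at this vertex, and its value at a vertex on $\gamma$ is zero. The operator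
  $B w = \sum_{T,i} |T|^{-1} \langle w, \xi_{T,i}\rangle\,\theta_{T,i}$ adds bubbles so as to
  restore the inner products with the $\xi_{T,i}$; it absorbs both correction terms in the definition
  of $\psi_{\mathcal T,T,0}$.

  Boundedness on $L_2(\Omega)$ is local: the coefficients are means over stars of boundedly many
  elements of comparable size, and the bubbles are stable. In $H^1(\Omega)$ the operator $B$ loses
  a factor $h_T^{-1}$ on each element, which is regained from
  $\sum_T h_T^{-2}\|u - Q u\|^2_{L_2(T)} \lesssim \|u\|^2_{H^1(\Omega)}$ (\<open>quasi_interp_weighted_error\<close>).
  As $Q$ averages means, this reduces to comparing the means of $u$ over two elements at the same vertex
  (\<open>star_mean_diff\<close>) and, at a vertex on $\gamma$, with zero (\<open>star_mean_gamma\<close>). Two elements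
  that share a facet contain the two halves of a ball around the barycentre of this facet, so that the
  Poincare inequality on the ball compares their means; two arbitrary elements at a vertex are connected
  by a chain of such neighbours (\<open>star_connected\<close>), because sets of codimension two do not disconnect
  the small connected neighbourhood of the vertex in $\Omega$. At a facet on $\gamma$ a Friedrichs
  inequality on a half ball takes the place of the Poincare inequality.

  These estimates are made for smooth functions that vanish at $\gamma$, where the gradient is a classical
  one. They carry over to $H^1_{0,\gamma}(\Omega)$ by density, since $P$ is bounded from $L_2(\Omega)$ to
  $H^1(\Omega)$ for a fixed partition, with a constant that disappears in the limit (\<open>P_H1_bound\<close>). The
  nodal functions are specified only as members of the closure $H^1_{0,\gamma}(\Omega)$; that they are the
  barycentric coordinates on each element, and in particular vanish at vertices on $\gamma$, is
  \<open>nodal_on_simplex\<close>.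

  The bounds at the end points give the bound on $\mathcal W$, as every decomposition in the K-functional
  of $u$ is mapped to one of $P u$ (\<open>interpolation_of_operators\<close>). The projector property is algebra
  from the biorthogonality of the $\psi$ and the $\xi$, together with the fact that the $\xi$ span the
  piecewise polynomials on each element.
\<close>

section \<open>Test functions\<close>

text \<open>
  A one-dimensional form of \<^const>\<open>Ck_on\<close> on the whole line. Its recursion on an existential
  derivative makes closure under sums and products a plain induction, with no differentiability
  side conditions on \<^const>\<open>frechet_derivative\<close>.
\<close>

primrec smooth_real :: "nat \<Rightarrow> (real \<Rightarrow> real) \<Rightarrow> bool" where
  "smooth_real 0 f \<longleftrightarrow> continuous_on UNIV f"
| "smooth_real (Suc k) f \<longleftrightarrow>
     (\<exists>f'. (\<forall>x. (f has_real_derivative f' x) (at x)) \<and> smooth_real k f')"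

lemma smooth_real_Suc: "smooth_real (Suc k) f \<Longrightarrow> smooth_real k f"
proof (induction k arbitrary: f)
  case 0
  then show ?case
    by (auto intro!: continuous_at_imp_continuous_on intro: DERIV_isCont)
next
  case (Suc k)
  then show ?case by (metis smooth_real.simps(2))
qed

lemma smooth_real_const: "smooth_real k (\<lambda>x. c)"
  by (induction k arbitrary: c) (auto intro!: exI[of _ "\<lambda>x. 0"] derivative_eq_intros)

lemma smooth_real_add:
  "smooth_real k f \<Longrightarrow> smooth_real k g \<Longrightarrow> smooth_real k (\<lambda>x. f x + g x)"
proof (induction k arbitrary: f g)
  case 0 then show ?case by (auto intro: continuous_on_add continuous_on_mult)
next
  case (Suc k)
  from Suc.prems obtain f' g' where
    "\<forall>x. (f has_real_derivative f' x) (at x)" "smooth_real k f'"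
    "\<forall>x. (g has_real_derivative g' x) (at x)" "smooth_real k g'" by auto
  then show ?case
    using Suc.IH by (auto intro!: exI[of _ "\<lambda>x. f' x + g' x"] derivative_eq_intros)
qed

lemma smooth_real_mult:
  "smooth_real k f \<Longrightarrow> smooth_real k g \<Longrightarrow> smooth_real k (\<lambda>x. f x * g x)"
proof (induction k arbitrary: f g)
  case 0 then show ?case by (auto intro: continuous_on_add continuous_on_mult)
next
  case (Suc k)
  from Suc.prems obtain f' g' where
    d: "\<forall>x. (f has_real_derivative f' x) (at x)" "smooth_real k f'"
    "\<forall>x. (g has_real_derivative g' x) (at x)" "smooth_real k g'" by auto
  moreover have "smooth_real k f" "smooth_real k g"
    using Suc.prems smooth_real_Suc by blast+
  ultimately show ?case
    using Suc.IH
    by (auto intro!: exI[of _ "\<lambda>x. f' x * g x + g' x * f x"] derivative_eq_intros smooth_real_add)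
qed

lemma smooth_real_affine: "smooth_real k f \<Longrightarrow> smooth_real k (\<lambda>x. f (a * x + b))"
proof (induction k arbitrary: f)
  case 0
  then show ?case by (auto intro!: continuous_on_compose2[of UNIV f] continuous_on_add continuous_on_mult continuous_on_id continuous_on_const)
next
  case (Suc k)
  from Suc.prems obtain f' where
    d: "\<forall>x. (f has_real_derivative f' x) (at x)" "smooth_real k f'" by auto
  have "((\<lambda>x. f (a * x + b)) has_real_derivative f' (a * x + b) * a) (at x)" for x
    by (rule DERIV_chain2[OF d(1)[rule_format]]) (auto intro!: derivative_eq_intros)
  moreover have "smooth_real k (\<lambda>x. f' (a * x + b) * a)"
    using Suc.IH[OF d(2)] smooth_real_const by (rule smooth_real_mult)
  ultimately show ?case unfolding smooth_real.simps by (intro exI conjI allI)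
qed

lemma tendsto_poly_exp_at_right:
  "((\<lambda>h::real. poly r (1/h) * exp (- (1/h))) \<longlongrightarrow> 0) (at_right 0)"
proof -
  have "((\<lambda>y. \<Sum>i\<le>degree r. coeff r i * (y ^ i / exp y)) \<longlongrightarrow> (\<Sum>i\<le>degree r. coeff r i * 0)) (at_top::real filter)"
    by (intro tendsto_intros tendsto_power_div_exp_0)
  then have "((\<lambda>y. poly r y * exp (- y)) \<longlongrightarrow> 0) (at_top::real filter)"
    by (simp add: poly_altdef sum_distrib_right exp_minus divide_inverse mult.assoc)
  then show ?thesis
    unfolding filterlim_at_top_to_right by (simp add: divide_inverse)
qed

text \<open>
  Differentiating $q(1/t) e^{-1/t}$ gives $((q - q') X^2)(1/t) e^{-1/t}$, which has the same form.
  So the induction over the order of differentiation has to run over all polynomials \<open>q\<close>; at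
  $t = 0$ the difference quotient tends to 0 since the exponential beats every polynomial.
\<close>

lemma smooth_real_poly_exp:
  "smooth_real k (\<lambda>t. if t > 0 then poly q (1/t) * exp (- (1/t)) else 0)"
proof (induction k arbitrary: q)
  have D: "((\<lambda>t. if t > 0 then poly q (1/t) * exp (- (1/t)) else 0) has_real_derivative
     (if t > 0 then poly ((q - pderiv q) * [:0,0,1:]) (1/t) * exp (- (1/t)) else 0)) (at t)"
    (is "(?f q has_real_derivative _) (at t)") for q and t :: real
  proof -
    consider "t > 0" | "t < 0" | "t = 0" by linarith
    then show ?thesis
    proof cases
      case 1
      have "((\<lambda>t. poly q (1/t) * exp (- (1/t))) has_real_derivative
          poly ((q - pderiv q) * [:0,0,1:]) (1/t) * exp (- (1/t))) (at t)"
        using 1 by (auto intro!: derivative_eq_intros DERIV_chain2[OF poly_DERIV]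
            simp: field_simps power2_eq_square)
      moreover have "\<forall>\<^sub>F x in nhds t. ?f q x = poly q (1/x) * exp (- (1/x))"
        using eventually_nhds_in_open[of "{0<..}" t] 1 by (auto elim!: eventually_mono)
      ultimately show ?thesis using 1 by (subst DERIV_cong_ev[OF refl _ refl]) auto
    next
      case 2
      have "\<forall>\<^sub>F x in nhds t. ?f q x = 0"
        using eventually_nhds_in_open[of "{..<0}" t] 2 by (auto elim!: eventually_mono)
      then show ?thesis using 2 by (subst DERIV_cong_ev[OF refl _ refl]) auto
    next
      case 3
      have "((\<lambda>h. ?f q h / h) \<longlongrightarrow> 0) (at_left 0)"
        by (rule tendsto_eventually) (auto simp: eventually_at_left_field intro: exI[of _ "-1"])
      moreover have "((\<lambda>h. ?f q h / h) \<longlongrightarrow> 0) (at_right 0)"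
      proof (rule Lim_transform_eventually[OF tendsto_poly_exp_at_right[of "q * [:0,1:]"]])
        show "\<forall>\<^sub>F h in at_right 0. poly (q * [:0,1:]) (1/h) * exp (- (1/h)) = ?f q h / h"
          by (auto simp: eventually_at_right_field field_simps intro!: exI[of _ 1])
      qed
      ultimately have "((\<lambda>h. ?f q h / h) \<longlongrightarrow> 0) (at 0)"
        by (simp add: filterlim_split_at)
      then show ?thesis using 3 by (simp add: DERIV_def cong: if_cong)
    qed
  qed
  {
    case 0
    have "isCont (?f q) x" for x by (rule DERIV_isCont[OF D])
    then show ?case by (auto intro: continuous_at_imp_continuous_on)
  next
    case (Suc k)
    show ?case unfolding smooth_real.simps
      by (rule exI, rule conjI, rule allI, rule D[of q], rule Suc)
  }
qed

definition bump_tail :: "real \<Rightarrow> real" where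
  "bump_tail t = (if t > 0 then exp (- (1/t)) else 0)"

lemma smooth_real_bump_tail: "smooth_real k bump_tail"
  using smooth_real_poly_exp[of k 1] unfolding bump_tail_def poly_1 mult_1 .

lemma bump_tail_bounds: "0 \<le> bump_tail t" "bump_tail t \<le> 1"
  by (auto simp: bump_tail_def)

lemma has_derivative_prod_coord:
  fixes x :: "'a::euclidean_space"
  assumes "\<And>b t. (f b has_real_derivative f' b t) (at t)"
  shows "((\<lambda>x. \<Prod>b\<in>Basis. f b (x \<bullet> b)) has_derivative
     (\<lambda>h. \<Sum>i\<in>Basis. (f' i (x \<bullet> i) * (h \<bullet> i)) * (\<Prod>j\<in>Basis - {i}. f j (x \<bullet> j)))) (at x)"
proof (rule has_derivative_prod)
  fix i :: 'a assume "i \<in> Basis"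
  have "((\<lambda>x. x \<bullet> i) has_derivative (\<lambda>h. h \<bullet> i)) (at x)"
    by (auto intro!: derivative_eq_intros)
  then show "((\<lambda>x. f i (x \<bullet> i)) has_derivative (\<lambda>h. f' i (x \<bullet> i) * (h \<bullet> i))) (at x)"
    using has_derivative_compose[of "\<lambda>x. x \<bullet> i" _ x UNIV "f i" "\<lambda>h. f' i (x \<bullet> i) * h"] assms[of i "x \<bullet> i"]
    by (simp add: has_field_derivative_def)
qed

text \<open>
  A partial derivative of $\prod_b f_b(x_b)$ replaces one factor by its derivative and so is again
  such a product; hence the induction over the order with the factors arbitrary. The hypothesis
  is first weakened to orders up to \<open>k\<close>, since $f_b'$ loses one order.
\<close>

lemma Ck_on_prod_coord:
  fixes f :: "'a::euclidean_space \<Rightarrow> real \<Rightarrow> real"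
  assumes "\<And>b k. smooth_real k (f b)"
  shows "Ck_on k UNIV (\<lambda>x. \<Prod>b\<in>Basis. f b (x \<bullet> b))"
proof -
  have "(\<And>b j. j \<le> k \<Longrightarrow> smooth_real j (f b)) \<Longrightarrow> Ck_on k UNIV (\<lambda>x. \<Prod>b\<in>Basis. f b (x \<bullet> b))"
    for f :: "'a \<Rightarrow> real \<Rightarrow> real"
  proof (induction k arbitrary: f)
    case 0
    have c: "continuous_on UNIV (f b)" for b using 0[of 0 b] by simp
    have "continuous_on UNIV (\<lambda>x::'a. f b (x \<bullet> b))" for b
      by (rule continuous_on_compose2[OF c[of b]]) (auto intro: continuous_on_inner)
    then show ?case
      unfolding Ck_on.simps by (intro continuous_on_prod) auto
  next
    case (Suc k)
    have "\<forall>b. \<exists>f'. (\<forall>x. (f b has_real_derivative f' x) (at x)) \<and> smooth_real k f'"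
      using Suc.prems[of "Suc k"] by auto
    then obtain f' where f': "\<And>b x. (f b has_real_derivative f' b x) (at x)"
      "\<And>b. smooth_real k (f' b)" by metis
    have f'2: "smooth_real j (f' b)" if "j \<le> k" for j b
      using that f'(2)[of b]
      by (induction rule: inc_induct) (assumption, rule smooth_real_Suc)
    note D = has_derivative_prod_coord[of f f', OF f'(1)]
    have fd: "frechet_derivative (\<lambda>x. \<Prod>b\<in>Basis. f b (x \<bullet> b)) (at x) c
        = (\<Prod>b\<in>Basis. (f(c := f' c)) b (x \<bullet> b))" if c: "c \<in> Basis" for x c
    proof -
      have "frechet_derivative (\<lambda>x. \<Prod>b\<in>Basis. f b (x \<bullet> b)) (at x) c
         = (\<Sum>i\<in>Basis. (f' i (x \<bullet> i) * (c \<bullet> i)) * (\<Prod>j\<in>Basis - {i}. f j (x \<bullet> j)))"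
        using frechet_derivative_at[OF D, of x] by (metis (no_types))
      also have "\<dots> = (\<Sum>i\<in>Basis. if i = c then f' i (x \<bullet> i) * (\<Prod>j\<in>Basis - {i}. f j (x \<bullet> j)) else 0)"
        using c by (intro sum.cong) (auto simp: inner_Basis)
      also have "\<dots> = f' c (x \<bullet> c) * (\<Prod>j\<in>Basis - {c}. f j (x \<bullet> j))"
        using c by simp
      also have "\<dots> = (\<Prod>b\<in>Basis. (f(c := f' c)) b (x \<bullet> b))"
        using c by (subst prod.remove[of _ c]) (auto intro!: prod.cong)
      finally show ?thesis .
    qed
    have "Ck_on k UNIV (\<lambda>x. \<Prod>b\<in>Basis. (f(c := f' c)) b (x \<bullet> b))" for c
      using Suc.prems f'2 by (intro Suc.IH) auto
    then have "\<forall>c\<in>Basis. Ck_on k UNIV (\<lambda>x. frechet_derivative (\<lambda>x. \<Prod>b\<in>Basis. f b (x \<bullet> b)) (at x) c)"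
      using fd by (simp del: fun_upd_apply)
    moreover have "\<forall>x\<in>UNIV. (\<lambda>x. \<Prod>b\<in>Basis. f b (x \<bullet> b)) differentiable (at x)"
      using D unfolding differentiable_def by blast
    ultimately show ?case unfolding Ck_on.simps by blast
  qed
  then show ?thesis using assms by blast
qed

text \<open>
  Boxes form an intersection-stable generator of the Borel sets, and the sets over which \<open>g\<close>
  integrates to zero form a Dynkin system; so \<open>g\<close> integrates to zero over every Borel set.
\<close>

lemma AE_zero_if_box_integrals_zero:
  fixes g :: "'a::euclidean_space \<Rightarrow> real"
  assumes g: "integrable lebesgue g" and tot: "(\<integral>x. g x \<partial>lebesgue) = 0"
    and box: "\<And>a b. (LINT x:box a b|lebesgue. g x) = 0"
  shows "AE x in lebesgue. g x = 0"
proof -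
  have si: "set_integrable lebesgue A g" if "A \<in> sets lebesgue" for A
    using g that by (simp add: set_integrable_def integrable_mult_indicator del: real_scaleR_def)
  have "A \<in> sigma_sets UNIV (range (\<lambda>(a, b). box a b :: 'a set))" if "A \<in> sets borel" for A
    using that unfolding borel_eq_box by simp
  moreover have "(LINT x:A|lebesgue. g x) = 0"
    if "Int_stable (range (\<lambda>(a, b). box a b :: 'a set))"
      "range (\<lambda>(a, b). box a b :: 'a set) \<subseteq> Pow UNIV"
      "A \<in> sigma_sets UNIV (range (\<lambda>(a, b). box a b :: 'a set))" for A
    using that
  proof (induction rule: sigma_sets_induct_disjoint)
    case (basic A) then show ?case using box by auto
  next
    case empty then show ?case by (simp add: set_lebesgue_integral_def)
  next
    case (compl A)
    then have A: "A \<in> sets lebesgue"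
      using borel_eq_box by (metis sets_completionI_sets sets_lborel sets_measure_of top_greatest Pow_UNIV)
    have "(LINT x:A \<union> (UNIV - A)|lebesgue. g x) = (LINT x:A|lebesgue. g x) + (LINT x:UNIV - A|lebesgue. g x)"
      by (rule set_integral_Un) (use A in \<open>auto intro!: si sets.Diff\<close>)
    moreover have "A \<union> (UNIV - A) = UNIV" by blast
    ultimately show ?case using compl tot by (simp add: set_lebesgue_integral_def)
  next
    case (union A)
    have A: "A i \<in> sets lebesgue" for i
      using union(2) borel_eq_box
      by (metis (no_types, lifting) range_subsetD sets_completionI_sets sets_lborel sets_measure_of top_greatest Pow_UNIV)
    have "(LINT x:(\<Union>i. A i)|lebesgue. g x) = (\<Sum>i. (LINT x:A i|lebesgue. g x))"
      by (rule lebesgue_integral_countable_add)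
        (use A si union(1) in \<open>auto simp: disjoint_family_on_def\<close>)
    then show ?case using union by simp
  qed
  moreover have "Int_stable (range (\<lambda>(a, b). box a b :: 'a set))"
    by (auto simp: Int_stable_def box_Int_box)
  ultimately have bor: "(LINT x:A|lebesgue. g x) = 0" if "A \<in> sets borel" for A using that by blast
  obtain g' where g': "g' \<in> borel_measurable lborel" "AE x in lborel. g x = g' x"
    using completion_ex_borel_measurable_real[of g lborel] g by auto
  have ae: "AE x in lebesgue. g x = g' x" using g'(2) by (rule AE_completion)
  have g'_int: "integrable lborel g'"
  proof -
    have "integrable lebesgue g'"
      using g'(1) by (intro integrable_cong_AE_imp[OF g measurable_completion ae])
    then show ?thesis using g'(1) by (simp add: integrable_completion)
  qed
  have "(LINT x:A|lborel. g' x) = 0" if A: "A \<in> sets lborel" for A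
  proof -
    have m: "(\<lambda>x. indicator A x *\<^sub>R g' x) \<in> borel_measurable lborel" using A g'(1) by measurable
    have "(LINT x:A|lborel. g' x) = (LINT x:A|lebesgue. g' x)"
      unfolding set_lebesgue_integral_def by (rule integral_completion[OF m, symmetric])
    also have "\<dots> = (LINT x:A|lebesgue. g x)"
      unfolding set_lebesgue_integral_def
      using si[of A] A measurable_completion[OF m] ae
      by (intro integral_cong_AE) (auto simp: set_integrable_def elim!: eventually_mono)
    finally show ?thesis using bor A by simp
  qed
  then have "AE x in lborel. g' x = 0" using sigma_finite_measure.density_zero[OF lborel.sigma_finite_measure_axioms g'_int] by blast
  then have "AE x in lborel. g x = 0" using g'(2) by eventually_elim simp
  then show ?thesis by (rule AE_completion)
qed

text \<open>
  The bump in direction $c$ is the product of the two one-sided exponential tails, both steepened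
  by the factor $n+1$: it vanishes outside the box and tends to 1 inside.
\<close>

lemma test_functions_approximating_box:
  fixes a b :: "'a::euclidean_space"
  assumes "cbox a b \<subseteq> S"
  obtains \<eta> :: "nat \<Rightarrow> 'a \<Rightarrow> real" where
    "\<And>n. test_function S (\<eta> n)" "\<And>n x. 0 \<le> \<eta> n x" "\<And>n x. \<eta> n x \<le> 1"
    "\<And>n x. x \<notin> box a b \<Longrightarrow> \<eta> n x = 0" "\<And>x. x \<in> box a b \<Longrightarrow> (\<lambda>n. \<eta> n x) \<longlonglongrightarrow> 1"
proof
  define f where "f n c t = bump_tail (real (Suc n) * (t - a \<bullet> c)) * bump_tail (real (Suc n) * (b \<bullet> c - t))" for n c t
  define \<eta> where "\<eta> n x = (\<Prod>c\<in>Basis. f n c (x \<bullet> c))" for n x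
  have "smooth_real k (f n c)" for k n c
  proof -
    have "smooth_real k (\<lambda>t. bump_tail (real (Suc n) * t + - (real (Suc n) * (a \<bullet> c))) *
             bump_tail (- real (Suc n) * t + real (Suc n) * (b \<bullet> c)))"
      by (intro smooth_real_mult smooth_real_affine smooth_real_bump_tail)
    then show ?thesis by (simp add: f_def[abs_def] algebra_simps)
  qed
  then have sm: "smooth_on UNIV (\<eta> n)" for n
    unfolding smooth_on_def \<eta>_def[abs_def] by (blast intro: Ck_on_prod_coord)
  have f01: "0 \<le> f n c t" "f n c t \<le> 1" for n c t
    unfolding f_def using bump_tail_bounds by (auto intro: mult_le_one)
  have out: "\<eta> n x = 0" if "x \<notin> box a b" for n x
  proof -
    from that have "\<exists>c\<in>Basis. x \<bullet> c \<le> a \<bullet> c \<or> b \<bullet> c \<le> x \<bullet> c"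
      by (auto simp: mem_box not_less)
    then obtain c where c: "c \<in> Basis" "x \<bullet> c \<le> a \<bullet> c \<or> b \<bullet> c \<le> x \<bullet> c" by blast
    then have "f n c (x \<bullet> c) = 0"
      by (auto simp: f_def bump_tail_def zero_less_mult_iff)
    then show ?thesis using c by (auto simp: \<eta>_def intro!: prod_zero)
  qed
  then show "x \<notin> box a b \<Longrightarrow> \<eta> n x = 0" for n x .
  show "test_function S (\<eta> n)" for n
    unfolding test_function_def using sm out box_subset_cbox[of a b] assms
    by (auto intro!: exI[of _ "cbox a b"])
  show "0 \<le> \<eta> n x" for n x by (auto simp: \<eta>_def intro!: prod_nonneg f01)
  show "\<eta> n x \<le> 1" for n x by (auto simp: \<eta>_def intro!: prod_le_1 f01)
  show "(\<lambda>n. \<eta> n x) \<longlonglongrightarrow> 1" if x: "x \<in> box a b" for x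
  proof -
    have bt: "(\<lambda>n. bump_tail (real (Suc n) * t)) \<longlonglongrightarrow> 1" if "t > 0" for t
    proof -
      have "(\<lambda>n. exp (- ((1 / t) * inverse (real (Suc n))))) \<longlonglongrightarrow> exp (- ((1 / t) * 0))"
        by (intro tendsto_intros LIMSEQ_inverse_real_of_nat)
      then show ?thesis using that by (simp add: bump_tail_def field_simps del: of_nat_Suc)
    qed
    have "(\<lambda>n. f n c (x \<bullet> c)) \<longlonglongrightarrow> 1 * 1" if "c \<in> Basis" for c
      unfolding f_def using x that by (intro tendsto_mult bt) (auto simp: mem_box)
    then have "(\<lambda>n. \<eta> n x) \<longlonglongrightarrow> (\<Prod>c\<in>(Basis::'a set). 1)"
      unfolding \<eta>_def by (intro tendsto_prod) auto
    then show ?thesis by simp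
  qed
qed

lemma test_function_Ck: "test_function S \<eta> \<Longrightarrow> Ck_on k UNIV \<eta>"
  by (auto simp: test_function_def smooth_on_def)

lemma test_function_continuous: "test_function S \<eta> \<Longrightarrow> continuous_on UNIV \<eta>"
  using test_function_Ck[of S \<eta> 0] by simp

lemma continuous_imp_measurable_lebesgue:
  fixes f :: "'a::euclidean_space \<Rightarrow> real"
  shows "continuous_on UNIV f \<Longrightarrow> f \<in> borel_measurable lebesgue"
  by (simp add: borel_measurable_continuous_onI measurable_completion)

text \<open>
  The fundamental lemma of the calculus of variations. Integrating against test functions that
  converge to the indicator of a box (dominated convergence) shows that \<open>f\<close> has zero integral over
  every box compactly inside \<open>S\<close>, and \<open>S\<close> is a countable union of such boxes.
\<close>

lemma test_function_fundamental_lemma: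
  fixes f :: "'a::euclidean_space \<Rightarrow> real"
  assumes S: "open S"
    and f: "\<And>a b. cbox a b \<subseteq> S \<Longrightarrow> integrable (lebesgue_on (cbox a b)) f"
    and z: "\<And>\<eta>. test_function S \<eta> \<Longrightarrow> (\<integral>x. f x * \<eta> x \<partial>lebesgue_on S) = 0"
  shows "AE x in lebesgue_on S. f x = 0"
proof -
  have S': "S \<in> sets lebesgue" using S by simp
  have boxes: "(LINT x:box a b|lebesgue. f x) = 0" if ab: "cbox a b \<subseteq> S" for a b
  proof -
    obtain \<eta> :: "nat \<Rightarrow> 'a \<Rightarrow> real" where
      \<eta>: "\<And>n. test_function S (\<eta> n)" "\<And>n x. 0 \<le> \<eta> n x" "\<And>n x. \<eta> n x \<le> 1"
      "\<And>n x. x \<notin> box a b \<Longrightarrow> \<eta> n x = 0" "\<And>x. x \<in> box a b \<Longrightarrow> (\<lambda>n. \<eta> n x) \<longlonglongrightarrow> 1"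
      using test_functions_approximating_box[OF ab] by blast
    have int: "integrable lebesgue (\<lambda>x. indicator (cbox a b) x * f x)"
      using f[OF ab] by (simp add: integrable_restrict_space)
    then have meas: "(\<lambda>x. indicator (cbox a b) x * f x) \<in> borel_measurable lebesgue" by simp
    have "(\<lambda>n. \<integral>x. \<eta> n x * (indicator (cbox a b) x * f x) \<partial>lebesgue)
        \<longlonglongrightarrow> (\<integral>x. indicator (box a b) x * (indicator (cbox a b) x * f x) \<partial>lebesgue)"
    proof (rule integral_dominated_convergence[where w = "\<lambda>x. norm (indicator (cbox a b) x * f x)"])
      show "(\<lambda>x. \<eta> n x * (indicator (cbox a b) x * f x)) \<in> borel_measurable lebesgue" for n
        using meas continuous_imp_measurable_lebesgue[OF test_function_continuous[OF \<eta>(1)]] by (rule borel_measurable_times[rotated])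
      show "(\<lambda>x. indicator (box a b) x * (indicator (cbox a b) x * f x)) \<in> borel_measurable lebesgue"
        by (rule borel_measurable_times[OF _ meas]) (rule borel_measurable_indicator, simp)
      show "integrable lebesgue (\<lambda>x. norm (indicator (cbox a b) x * f x))" using int by (rule integrable_norm)
      show "AE x in lebesgue. (\<lambda>n. \<eta> n x * (indicator (cbox a b) x * f x))
          \<longlonglongrightarrow> indicator (box a b) x * (indicator (cbox a b) x * f x)"
      proof (rule AE_I2)
        fix x
        show "(\<lambda>n. \<eta> n x * (indicator (cbox a b) x * f x))
          \<longlonglongrightarrow> indicator (box a b) x * (indicator (cbox a b) x * f x)"
          using \<eta>(4,5) using tendsto_mult_right[of "\<lambda>n. \<eta> n x" 1 sequentially] by (cases "x \<in> box a b") auto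
      qed
      show "AE x in lebesgue. norm (\<eta> n x * (indicator (cbox a b) x * f x)) \<le> norm (indicator (cbox a b) x * f x)" for n
        using \<eta>(2,3) by (intro AE_I2) (simp add: abs_mult mult_left_le_one_le)
    qed
    moreover have "(\<integral>x. \<eta> n x * (indicator (cbox a b) x * f x) \<partial>lebesgue) = 0" for n
    proof -
      have "(\<integral>x. \<eta> n x * (indicator (cbox a b) x * f x) \<partial>lebesgue) = (\<integral>x. indicator S x *\<^sub>R (f x * \<eta> n x) \<partial>lebesgue)"
        using \<eta>(4)[of _ n] box_subset_cbox[of a b] ab
        by (intro Bochner_Integration.integral_cong refl) (auto simp: indicator_def)
      also have "\<dots> = (\<integral>x. f x * \<eta> n x \<partial>lebesgue_on S)"
        using S' by (simp add: integral_restrict_space)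
      finally show ?thesis using z[OF \<eta>(1)] by simp
    qed
    ultimately have "(\<integral>x. indicator (box a b) x * (indicator (cbox a b) x * f x) \<partial>lebesgue) = 0"
      by (simp add: LIMSEQ_const_iff)
    moreover have "indicator (box a b) x * (indicator (cbox a b) x * f x) = indicator (box a b) x *\<^sub>R f x" for x
      using box_subset_cbox[of a b] by (auto simp: indicator_def)
    ultimately show ?thesis by (simp add: set_lebesgue_integral_def)
  qed
  have loc: "AE x in lebesgue. x \<in> box a b \<longrightarrow> f x = 0" if ab: "cbox a b \<subseteq> S" for a b
  proof -
    define g where "g x = indicator (box a b) x * f x" for x
    have "integrable lebesgue (\<lambda>x. indicator (cbox a b) x * f x)"
      using f[OF ab] by (simp add: integrable_restrict_space)
    then have "integrable lebesgue (\<lambda>x. indicator (box a b) x *\<^sub>R (indicator (cbox a b) x * f x))"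
      by (rule integrable_mult_indicator[rotated]) auto
    moreover have "indicator (box a b) x *\<^sub>R (indicator (cbox a b) x * f x) = g x" for x
      using box_subset_cbox[of a b] by (auto simp: indicator_def g_def)
    ultimately have g: "integrable lebesgue g" by simp
    have "AE x in lebesgue. g x = 0"
    proof (rule AE_zero_if_box_integrals_zero[OF g])
      show "(\<integral>x. g x \<partial>lebesgue) = 0"
        using boxes[OF ab] by (simp add: set_lebesgue_integral_def g_def)
      fix c d
      obtain a' b' where ab': "box c d \<inter> box a b = box a' b'" using box_Int_box by blast
      have "(LINT x:box c d|lebesgue. g x) = (LINT x:box a' b'|lebesgue. f x)"
        unfolding set_lebesgue_integral_def g_def ab'[symmetric]
        by (intro Bochner_Integration.integral_cong) (auto simp: indicator_def)
      also have "\<dots> = 0"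
      proof (cases "box a' b' = {}")
        case True then show ?thesis by (simp add: set_lebesgue_integral_def)
      next
        case False
        have sub: "box a' b' \<subseteq> box a b" using ab' by blast
        then have "box a b \<noteq> {}" using False by blast
        then have "cbox a' b' \<subseteq> cbox a b"
          using closure_mono[OF sub] closure_box[OF False] closure_box[OF \<open>box a b \<noteq> {}\<close>] by simp
        then have "cbox a' b' \<subseteq> S" using ab by blast
        then show ?thesis by (rule boxes)
      qed
      finally show "(LINT x:box c d|lebesgue. g x) = 0" .
    qed
    then show ?thesis by (auto simp: g_def indicator_def elim!: eventually_mono)
  qed
  define \<B> where "\<B> = {box a b | a b. cbox a b \<subseteq> S}"
  have "\<Union>\<B> = S"
  proof
    show "\<Union>\<B> \<subseteq> S" using box_subset_cbox by (fastforce simp: \<B>_def)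
    show "S \<subseteq> \<Union>\<B>"
    proof
      fix x assume "x \<in> S"
      then obtain a b where "cbox a b \<subseteq> S" "x \<in> box a b"
        using open_contains_cbox[OF S] by metis
      then show "x \<in> \<Union>\<B>" unfolding \<B>_def by blast
    qed
  qed
  moreover have "\<And>X. X \<in> \<B> \<Longrightarrow> open X" by (auto simp: \<B>_def)
  ultimately obtain \<D> where \<D>: "\<D> \<subseteq> \<B>" "countable \<D>" "\<Union>\<D> = S"
    using Lindelof[of \<B>] by metis
  have "AE x in lebesgue. \<forall>X\<in>\<D>. x \<in> X \<longrightarrow> f x = 0"
    unfolding AE_ball_countable[OF \<D>(2)]
    using \<D>(1) loc by (auto simp: \<B>_def)
  then have "AE x in lebesgue. x \<in> S \<longrightarrow> f x = 0"
    using \<D>(3) by (auto elim!: eventually_mono)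
  then show ?thesis using S' by (simp add: AE_restrict_space_iff)
qed

text \<open>
  The integral of $(w(x + tb) - w(x))/t$ vanishes for each $t$ because Lebesgue measure is
  translation invariant; let $t$ tend to 0 with dominated convergence. This replaces the usual
  iterated integration and needs no coordinates.
\<close>

lemma integral_directional_derivative_eq_0:
  fixes w :: "'a::euclidean_space \<Rightarrow> real"
  assumes d: "\<And>x. (w has_derivative w' x) (at x)"
    and cont: "continuous_on UNIV (\<lambda>x. w' x b)"
    and supp: "compact K" "\<And>x. x \<notin> K \<Longrightarrow> w x = 0"
  shows "(\<integral>x. w' x b \<partial>lebesgue) = 0"
proof -
  have wc: "continuous_on UNIV w"
    using d by (auto intro!: continuous_at_imp_continuous_on has_derivative_continuous)
  define t where "t n = inverse (real (Suc n))" for n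
  have t: "0 < t n" "t n \<le> 1" for n by (auto simp: t_def inverse_le_1_iff)
  have t0: "t \<longlonglongrightarrow> 0" unfolding t_def by (rule LIMSEQ_inverse_real_of_nat)
  define q where "q n x = (w (x + t n *\<^sub>R b) - w x) / t n" for n x
  obtain R where R: "\<And>x. x \<in> K \<Longrightarrow> norm x \<le> R"
    using compact_imp_bounded[OF supp(1)] by (auto simp: bounded_iff)
  have w'0: "w' x b = 0" if "x \<notin> K" for x
  proof -
    have "((\<lambda>_. 0) has_derivative w' x) (at x)"
      by (rule has_derivative_transform_within_open[OF d[of x], of "- K"])
        (use supp that in \<open>auto simp: compact_imp_closed open_Compl\<close>)
    then have "w' x = (\<lambda>_. 0)" by (metis has_derivative_const has_derivative_unique)
    then show ?thesis by simp
  qed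
  obtain M where M: "\<And>x. \<bar>w' x b\<bar> \<le> M" "0 \<le> M"
  proof -
    have "compact ((\<lambda>x. w' x b) ` K)"
      using cont supp(1) by (intro compact_continuous_image) (auto intro: continuous_on_subset)
    then obtain M where "\<And>x. x \<in> K \<Longrightarrow> \<bar>w' x b\<bar> \<le> M"
      by (fastforce dest: compact_imp_bounded simp: bounded_iff)
    then have "\<bar>w' x b\<bar> \<le> max M 0" for x
      by (cases "x \<in> K") (auto simp: w'0 le_max_iff_disj)
    then show ?thesis by (intro that[of "max M 0"]) auto
  qed
  have line: "\<exists>s\<in>{0..1}. w (x + r *\<^sub>R b) - w x = r * w' (x + (s * r) *\<^sub>R b) b" if "0 < r" for x r
  proof -
    have D: "((\<lambda>s. w (x + s *\<^sub>R b)) has_real_derivative w' (x + s *\<^sub>R b) b) (at s)" for s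
    proof -
      have "((\<lambda>s. x + s *\<^sub>R b) has_derivative (\<lambda>h. h *\<^sub>R b)) (at s)"
        by (auto intro!: derivative_eq_intros)
      from has_derivative_compose[OF this d]
      have "((\<lambda>s. w (x + s *\<^sub>R b)) has_derivative (\<lambda>h. w' (x + s *\<^sub>R b) (h *\<^sub>R b))) (at s)" .
      moreover have "linear (w' (x + s *\<^sub>R b))"
        using d has_derivative_linear by blast
      ultimately show ?thesis
        by (simp add: has_field_derivative_def linear_cmul mult.commute[of _ "w' _ b"])
    qed
    obtain z where z: "0 < z" "z < r" "w (x + r *\<^sub>R b) - w (x + 0 *\<^sub>R b) = (r - 0) * w' (x + z *\<^sub>R b) b"
      using MVT2[OF \<open>0 < r\<close>, of "\<lambda>s. w (x + s *\<^sub>R b)" "\<lambda>s. w' (x + s *\<^sub>R b) b"] D by auto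
    then show ?thesis
      by (intro bexI[of _ "z / r"]) auto
  qed
  have q_bound: "\<bar>q n x\<bar> \<le> indicator (cball 0 (R + norm b)) x * M" for n x
  proof (cases "norm x \<le> R + norm b")
    case True
    obtain s where "w (x + t n *\<^sub>R b) - w x = t n * w' (x + (s * t n) *\<^sub>R b) b"
      using line[OF t(1)] by blast
    then have "q n x = w' (x + (s * t n) *\<^sub>R b) b" using t(1)[of n] by (simp add: q_def)
    then show ?thesis using M True by (simp add: indicator_def)
  next
    case False
    have "norm (t n *\<^sub>R b) \<le> norm b" using t[of n] by (simp add: mult_left_le_one_le)
    moreover have "norm x \<le> norm (x + t n *\<^sub>R b) + norm (t n *\<^sub>R b)"
      by (metis add_diff_cancel_right' norm_triangle_ineq4)
    ultimately have "x \<notin> K" "x + t n *\<^sub>R b \<notin> K"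
      using False R[of x] R[of "x + t n *\<^sub>R b"] norm_ge_zero[of b] by linarith+
    then show ?thesis using supp M(2) by (simp add: q_def)
  qed
  have wm: "w \<in> borel_measurable borel" using wc by (rule borel_measurable_continuous_onI)
  have w_int: "integrable lborel w"
  proof -
    have "integrable lborel (\<lambda>x. indicator K x *\<^sub>R w x)"
      using supp(1) wc by (intro borel_integrable_compact) (auto intro: continuous_on_subset)
    moreover have "indicator K x *\<^sub>R w x = w x" for x
      using supp(2)[of x] by (cases "x \<in> K") auto
    ultimately show ?thesis by (simp only:)
  qed
  have "(\<integral>x. q n x \<partial>lborel) = 0" for n
  proof -
    have m: "(\<lambda>x. t n *\<^sub>R b + x) \<in> lborel \<rightarrow>\<^sub>M borel" by simp
    have "integrable (distr lborel borel (\<lambda>x. t n *\<^sub>R b + x)) w"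
      using w_int by (simp only: lborel_distr_plus)
    then have i: "integrable lborel (\<lambda>x. w (t n *\<^sub>R b + x))"
      by (rule integrable_distr_eq[OF m wm, THEN iffD1])
    have e: "(\<integral>x. w (t n *\<^sub>R b + x) \<partial>lborel) = (\<integral>x. w x \<partial>lborel)"
      using integral_distr[OF m wm] by (simp only: lborel_distr_plus)
    have "(\<integral>x. q n x \<partial>lborel) = (\<integral>x. (w (t n *\<^sub>R b + x) - w x) \<partial>lborel) / t n"
      unfolding q_def add.commute[of _ "t n *\<^sub>R b"] by (rule integral_divide_zero)
    then show ?thesis using Bochner_Integration.integral_diff[OF i w_int] e by simp
  qed
  moreover have "(\<lambda>n. \<integral>x. q n x \<partial>lborel) \<longlonglongrightarrow> (\<integral>x. w' x b \<partial>lborel)"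
  proof (rule integral_dominated_convergence[where w = "\<lambda>x. indicator (cball 0 (R + norm b)) x * M"])
    show "(\<lambda>x. w' x b) \<in> borel_measurable lborel"
      using cont by (simp add: borel_measurable_continuous_onI)
    show "q n \<in> borel_measurable lborel" for n
    proof -
      have "(\<lambda>x. w (x + t n *\<^sub>R b)) \<in> borel_measurable borel"
        by (rule measurable_compose[OF _ wm]) simp
      then show ?thesis using wm unfolding q_def by simp
    qed
    show "integrable lborel (\<lambda>x. indicator (cball 0 (R + norm b)) x * M :: real)"
      using borel_integrable_compact[of "cball 0 (R + norm b)" "\<lambda>_. M"] by simp
    show "AE x in lborel. norm (q n x) \<le> indicator (cball 0 (R + norm b)) x * M" for n
      using q_bound by simp
    show "AE x in lborel. (\<lambda>n. q n x) \<longlonglongrightarrow> w' x b"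
    proof (rule AE_I2)
      fix x
      have D: "((\<lambda>s. w (x + s *\<^sub>R b)) has_derivative (\<lambda>h. w' x (h *\<^sub>R b))) (at 0)"
        by (rule has_derivative_compose[of "\<lambda>s. x + s *\<^sub>R b" "\<lambda>h. h *\<^sub>R b" 0 UNIV w "w' x", simplified])
          (use d in \<open>auto intro!: derivative_eq_intros\<close>)
      have "linear (w' x)" using d has_derivative_linear by blast
      with D have "((\<lambda>s. w (x + s *\<^sub>R b)) has_real_derivative w' x b) (at 0)"
        by (simp add: has_field_derivative_def linear_cmul mult.commute[of _ "w' _ b"])
      then have "((\<lambda>h. (w (x + h *\<^sub>R b) - w x) / h) \<longlongrightarrow> w' x b) (at 0)"
        by (simp add: DERIV_def)
      moreover have "filterlim t (at 0) sequentially"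
        using t0 t(1) by (auto simp: filterlim_at less_imp_neq[symmetric])
      ultimately show "(\<lambda>n. q n x) \<longlonglongrightarrow> w' x b"
        unfolding q_def by (rule filterlim_compose)
    qed
  qed
  ultimately have "(\<integral>x. w' x b \<partial>lborel) = 0" by (simp add: LIMSEQ_const_iff)
  then show ?thesis using cont
    by (subst integral_completion) (simp_all add: borel_measurable_continuous_onI)
qed

section \<open>Square-integrable functions\<close>

lemma L2_spaceD:
  assumes "u \<in> L2_space S"
  shows "u \<in> borel_measurable (lebesgue_on S)" "integrable (lebesgue_on S) (\<lambda>x. (u x)\<^sup>2)"
  using assms by (auto simp: L2_space_def)

lemma L2_mult_integrable:
  assumes "u \<in> L2_space S" "v \<in> L2_space S"
  shows "integrable (lebesgue_on S) (\<lambda>x. u x * v x)"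
proof (rule Bochner_Integration.integrable_bound)
  show "integrable (lebesgue_on S) (\<lambda>x. (u x)\<^sup>2 + (v x)\<^sup>2)"
    using assms by (intro Bochner_Integration.integrable_add L2_spaceD)
  show "(\<lambda>x. u x * v x) \<in> borel_measurable (lebesgue_on S)"
    using assms by (intro borel_measurable_times L2_spaceD)
  have "\<bar>u x * v x\<bar> \<le> (u x)\<^sup>2 + (v x)\<^sup>2" for x
    using sum_squares_bound[of "\<bar>u x\<bar>" "\<bar>v x\<bar>"] zero_le_power2[of "u x"] zero_le_power2[of "v x"]
      abs_ge_zero[of "u x * v x"]
    unfolding abs_mult power2_abs by linarith
  then show "AE x in lebesgue_on S. norm (u x * v x) \<le> norm ((u x)\<^sup>2 + (v x)\<^sup>2)"
    by (intro AE_I2) simp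
qed

lemma L2_space_lincomb:
  assumes "u \<in> L2_space S" "v \<in> L2_space S"
  shows "(\<lambda>x. a * u x + b * v x) \<in> L2_space S"
proof -
  have "integrable (lebesgue_on S) (\<lambda>x. a\<^sup>2 * (u x)\<^sup>2 + 2 * a * b * (u x * v x) + b\<^sup>2 * (v x)\<^sup>2)"
    using assms by (intro Bochner_Integration.integrable_add integrable_mult_right L2_spaceD L2_mult_integrable)
  moreover have "(a * u x + b * v x)\<^sup>2 = a\<^sup>2 * (u x)\<^sup>2 + 2 * a * b * (u x * v x) + b\<^sup>2 * (v x)\<^sup>2" for x
    by (simp add: power2_eq_square algebra_simps)
  moreover have "(\<lambda>x. a * u x + b * v x) \<in> borel_measurable (lebesgue_on S)"
    using L2_spaceD(1)[OF assms(1)] L2_spaceD(1)[OF assms(2)] by simp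
  ultimately show ?thesis by (simp add: L2_space_def)
qed

lemma L2_space_zero: "(\<lambda>x. 0) \<in> L2_space S"
  by (simp add: L2_space_def)

lemma L2_space_add: "u \<in> L2_space S \<Longrightarrow> v \<in> L2_space S \<Longrightarrow> (\<lambda>x. u x + v x) \<in> L2_space S"
  using L2_space_lincomb[of u S v 1 1] by simp

lemma L2_space_diff: "u \<in> L2_space S \<Longrightarrow> v \<in> L2_space S \<Longrightarrow> (\<lambda>x. u x - v x) \<in> L2_space S"
  using L2_space_lincomb[of u S v 1 "-1"] by simp

lemma L2_space_cmult: "u \<in> L2_space S \<Longrightarrow> (\<lambda>x. a * u x) \<in> L2_space S"
  using L2_space_lincomb[of u S u a 0] by simp

lemma L2_space_sum:
  "finite I \<Longrightarrow> (\<And>i. i \<in> I \<Longrightarrow> u i \<in> L2_space S) \<Longrightarrow> (\<lambda>x. \<Sum>i\<in>I. u i x) \<in> L2_space S"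
  by (induction I rule: finite_induct) (auto intro: L2_space_zero L2_space_add)

lemma L2_inner_commute: "L2_inner S u v = L2_inner S v u"
  by (simp add: L2_inner_def mult.commute)

lemma L2_inner_lincomb_left:
  assumes "u \<in> L2_space S" "v \<in> L2_space S" "w \<in> L2_space S"
  shows "L2_inner S (\<lambda>x. a * u x + b * v x) w = a * L2_inner S u w + b * L2_inner S v w"
proof -
  have "L2_inner S (\<lambda>x. a * u x + b * v x) w = (\<integral>x. a * (u x * w x) + b * (v x * w x) \<partial>lebesgue_on S)"
    unfolding L2_inner_def by (simp add: algebra_simps)
  then show ?thesis
    unfolding L2_inner_def using assms
    by (simp add: L2_mult_integrable)
qed

lemma L2_inner_add_left:
  "u \<in> L2_space S \<Longrightarrow> v \<in> L2_space S \<Longrightarrow> w \<in> L2_space S \<Longrightarrow>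
     L2_inner S (\<lambda>x. u x + v x) w = L2_inner S u w + L2_inner S v w"
  using L2_inner_lincomb_left[of u S v w 1 1] by simp

lemma L2_inner_diff_left:
  "u \<in> L2_space S \<Longrightarrow> v \<in> L2_space S \<Longrightarrow> w \<in> L2_space S \<Longrightarrow>
     L2_inner S (\<lambda>x. u x - v x) w = L2_inner S u w - L2_inner S v w"
  using L2_inner_lincomb_left[of u S v w 1 "-1"] by simp

lemma L2_inner_zero_left [simp]: "L2_inner S (\<lambda>x. 0) w = 0"
  by (simp add: L2_inner_def)

lemma L2_inner_cmult_left:
  "L2_inner S (\<lambda>x. a * u x) w = a * L2_inner S u w"
  by (simp add: L2_inner_def mult.assoc)

lemma L2_inner_sum_left:
  "finite I \<Longrightarrow> (\<And>i. i \<in> I \<Longrightarrow> u i \<in> L2_space S) \<Longrightarrow> w \<in> L2_space S \<Longrightarrow>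
   L2_inner S (\<lambda>x. \<Sum>i\<in>I. u i x) w = (\<Sum>i\<in>I. L2_inner S (u i) w)"
  by (induction I rule: finite_induct) (simp_all add: L2_inner_add_left L2_space_sum)

lemma L2_inner_self_nonneg: "0 \<le> L2_inner S u u"
  unfolding L2_inner_def by (rule integral_nonneg_AE) simp

lemma L2_norm_nonneg [simp]: "0 \<le> L2_norm S u"
  by (simp add: L2_norm_def L2_inner_self_nonneg)

lemma L2_norm_sq: "(L2_norm S u)\<^sup>2 = L2_inner S u u"
  by (simp add: L2_norm_def L2_inner_self_nonneg)

lemma L2_norm_sq_integral: "(L2_norm S u)\<^sup>2 = (\<integral>x. (u x)\<^sup>2 \<partial>lebesgue_on S)"
  unfolding L2_norm_sq L2_inner_def by (simp add: power2_eq_square)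

lemma L2_norm_zero [simp]: "L2_norm S (\<lambda>x. 0) = 0"
  by (simp add: L2_norm_def)

lemma L2_inner_cong_AE:
  assumes "AE x in lebesgue_on S. u x = u' x"
    and "u \<in> borel_measurable (lebesgue_on S)" "u' \<in> borel_measurable (lebesgue_on S)"
    and "w \<in> borel_measurable (lebesgue_on S)"
  shows "L2_inner S u w = L2_inner S u' w"
  unfolding L2_inner_def
  by (rule integral_cong_AE) (use assms in \<open>auto elim!: eventually_mono\<close>)

lemma L2_norm_sq_mono_AE:
  assumes "AE x in lebesgue_on S. \<bar>u x\<bar> \<le> \<bar>v x\<bar>" "v \<in> L2_space S"
  shows "(L2_norm S u)\<^sup>2 \<le> (L2_norm S v)\<^sup>2"
  unfolding L2_norm_sq_integral
  by (rule integral_mono_AE') (use assms in \<open>auto simp: L2_space_def abs_le_square_iff elim!: eventually_mono\<close>)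

lemma L2_norm_cong_AE:
  assumes ae: "AE x in lebesgue_on S. u x = v x" and "u \<in> L2_space S" "v \<in> L2_space S"
  shows "L2_norm S u = L2_norm S v"
proof (rule antisym)
  show "L2_norm S u \<le> L2_norm S v"
    by (rule power2_le_imp_le[OF L2_norm_sq_mono_AE]) (use assms in \<open>auto elim!: eventually_mono\<close>)
  show "L2_norm S v \<le> L2_norm S u"
    by (rule power2_le_imp_le[OF L2_norm_sq_mono_AE]) (use assms in \<open>auto elim!: eventually_mono\<close>)
qed

lemma L2_norm_sq_lincomb_le:
  assumes "u \<in> L2_space S" "v \<in> L2_space S"
  shows "(L2_norm S (\<lambda>x. a * u x + b * v x))\<^sup>2 \<le> 2 * a\<^sup>2 * (L2_norm S u)\<^sup>2 + 2 * b\<^sup>2 * (L2_norm S v)\<^sup>2"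
proof -
  have "(L2_norm S (\<lambda>x. a * u x + b * v x))\<^sup>2 \<le> (\<integral>x. 2 * a\<^sup>2 * (u x)\<^sup>2 + 2 * b\<^sup>2 * (v x)\<^sup>2 \<partial>lebesgue_on S)"
    unfolding L2_norm_sq_integral
  proof (rule integral_mono)
    show "integrable (lebesgue_on S) (\<lambda>x. (a * u x + b * v x)\<^sup>2)"
      using L2_space_lincomb[OF assms] by (rule L2_spaceD)
    show "integrable (lebesgue_on S) (\<lambda>x. 2 * a\<^sup>2 * (u x)\<^sup>2 + 2 * b\<^sup>2 * (v x)\<^sup>2)"
      using assms by (intro Bochner_Integration.integrable_add integrable_mult_right L2_spaceD)
    show "(a * u x + b * v x)\<^sup>2 \<le> 2 * a\<^sup>2 * (u x)\<^sup>2 + 2 * b\<^sup>2 * (v x)\<^sup>2" for x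
      using zero_le_power2[of "a * u x - b * v x"] by (simp add: power2_eq_square algebra_simps)
  qed
  also have "\<dots> = 2 * a\<^sup>2 * (L2_norm S u)\<^sup>2 + 2 * b\<^sup>2 * (L2_norm S v)\<^sup>2"
    unfolding L2_norm_sq_integral using assms by (simp add: L2_spaceD(2))
  finally show ?thesis .
qed

lemma L2_Cauchy_Schwarz:
  assumes "u \<in> L2_space S" "v \<in> L2_space S"
  shows "(L2_inner S u v)\<^sup>2 \<le> (L2_norm S u)\<^sup>2 * (L2_norm S v)\<^sup>2"
proof -
  let ?A = "L2_inner S u u" and ?B = "L2_inner S v v" and ?C = "L2_inner S u v"
  have q: "0 \<le> ?A + 2 * t * ?C + t\<^sup>2 * ?B" for t
  proof -
    have "0 \<le> L2_inner S (\<lambda>x. 1 * u x + t * v x) (\<lambda>x. 1 * u x + t * v x)" by (rule L2_inner_self_nonneg)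
    also have "\<dots> = 1 * L2_inner S u (\<lambda>x. 1 * u x + t * v x) + t * L2_inner S v (\<lambda>x. 1 * u x + t * v x)"
      by (rule L2_inner_lincomb_left[OF assms L2_space_lincomb[OF assms]])
    also have "L2_inner S u (\<lambda>x. 1 * u x + t * v x) = 1 * ?A + t * L2_inner S v u"
      by (subst L2_inner_commute) (rule L2_inner_lincomb_left[OF assms assms(1)])
    also have "L2_inner S v (\<lambda>x. 1 * u x + t * v x) = 1 * ?C + t * ?B"
      by (subst L2_inner_commute) (rule L2_inner_lincomb_left[OF assms assms(2)])
    also have "L2_inner S v u = ?C" by (rule L2_inner_commute)
    finally have "0 \<le> 1 * (1 * ?A + t * ?C) + t * (1 * ?C + t * ?B)" .
    also have "\<dots> = ?A + 2 * t * ?C + t\<^sup>2 * ?B" by (simp add: power2_eq_square algebra_simps)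
    finally show ?thesis .
  qed
  show ?thesis
  proof (cases "?B = 0")
    case True
    have "?C = 0"
    proof (rule ccontr)
      assume C: "?C \<noteq> 0"
      then show False using q[of "- (?A + 1) / (2 * ?C)"] True by (simp add: field_simps)
    qed
    then show ?thesis by simp
  next
    case False
    then have B: "0 < ?B" using L2_inner_self_nonneg[of S v] by simp
    have "0 \<le> (?A + 2 * (- ?C / ?B) * ?C + (- ?C / ?B)\<^sup>2 * ?B) * ?B"
      by (rule mult_nonneg_nonneg[OF q less_imp_le[OF B]])
    also have "\<dots> = ?A * ?B - ?C\<^sup>2" using B by (simp add: field_simps power2_eq_square)
    finally show ?thesis by (simp add: L2_norm_sq)
  qed
qed

lemma L2_space_subset:
  assumes "u \<in> L2_space S" "T \<subseteq> S" "T \<in> sets lebesgue" "S \<in> sets lebesgue"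
  shows "u \<in> L2_space T"
proof -
  have "integrable lebesgue (\<lambda>x. indicator S x *\<^sub>R (u x)\<^sup>2)"
    using assms by (simp add: L2_space_def integrable_restrict_space)
  then have "integrable lebesgue (\<lambda>x. indicator T x *\<^sub>R (indicator S x *\<^sub>R (u x)\<^sup>2))"
    by (rule integrable_mult_indicator[OF assms(3)])
  moreover have "(\<lambda>x. indicator T x *\<^sub>R (indicator S x *\<^sub>R (u x)\<^sup>2)) = (\<lambda>x. indicator T x *\<^sub>R (u x)\<^sup>2)"
    using assms(2) by (intro ext) (auto simp: indicator_def)
  ultimately have "integrable lebesgue (\<lambda>x. indicator T x *\<^sub>R (u x)\<^sup>2)" by (rule back_subst)
  then have "integrable (lebesgue_on T) (\<lambda>x. (u x)\<^sup>2)"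
    using assms(3) by (simp add: integrable_restrict_space)
  moreover have "u \<in> borel_measurable (lebesgue_on T)"
    by (rule measurable_restrict_mono[OF L2_spaceD(1)[OF assms(1)] assms(2)])
  ultimately show ?thesis by (simp add: L2_space_def)
qed

lemma continuous_imp_L2_space:
  assumes "continuous_on UNIV f" "compact K" "\<And>x. x \<notin> K \<Longrightarrow> f x = 0" "S \<in> sets lebesgue"
  shows "f \<in> L2_space S"
proof -
  have "integrable lborel (\<lambda>x. indicator K x *\<^sub>R (f x)\<^sup>2)"
    using assms by (intro borel_integrable_compact continuous_on_power) (auto intro: continuous_on_subset)
  moreover have "indicator K x *\<^sub>R (f x)\<^sup>2 = (f x)\<^sup>2" for x
    using assms(3)[of x] by (cases "x \<in> K") auto
  ultimately have "integrable lborel (\<lambda>x. (f x)\<^sup>2)" by (simp only:)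
  moreover have m: "f \<in> borel_measurable borel" using assms(1) by (rule borel_measurable_continuous_onI)
  ultimately have "integrable lebesgue (\<lambda>x. (f x)\<^sup>2)" by (subst integrable_completion) auto
  then have "integrable (lebesgue_on S) (\<lambda>x. (f x)\<^sup>2)"
    using assms(4) integrable_mult_indicator[of S lebesgue "\<lambda>x. (f x)\<^sup>2"]
    by (simp add: integrable_restrict_space)
  moreover have "f \<in> borel_measurable (lebesgue_on S)"
    using m by (intro measurable_restrict_space1 measurable_completion) simp
  ultimately show ?thesis by (simp add: L2_space_def)
qed

lemma L2_integrable_bounded:
  assumes "u \<in> L2_space S" "emeasure lebesgue S < \<infinity>" "S \<in> sets lebesgue"
  shows "integrable (lebesgue_on S) u"
proof (rule Bochner_Integration.integrable_bound)
  have "integrable (lebesgue_on S) (\<lambda>x. 1::real)"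
    using assms by (simp add: integrable_restrict_space)
  then show "integrable (lebesgue_on S) (\<lambda>x. 1 + (u x)\<^sup>2)"
    using assms by (intro Bochner_Integration.integrable_add L2_spaceD)
  show "u \<in> borel_measurable (lebesgue_on S)" using assms L2_spaceD by blast
  have "\<bar>u x\<bar> \<le> 1 + (u x)\<^sup>2" for x
    using zero_le_power2[of "\<bar>u x\<bar> - 1"] by (simp add: power2_eq_square algebra_simps abs_mult flip: power2_abs)
  then show "AE x in lebesgue_on S. norm (u x) \<le> norm (1 + (u x)\<^sup>2)"
    by (intro AE_I2) (simp add: abs_of_nonneg)
qed


section \<open>Continuously differentiable functions\<close>

lemma frechet_derivative_cong_open:
  assumes "open S" "x \<in> S" "\<And>y. y \<in> S \<Longrightarrow> f y = g y"
  shows "f differentiable (at x) \<longleftrightarrow> g differentiable (at x)"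
    and "frechet_derivative f (at x) = frechet_derivative g (at x)"
proof -
  have "(f has_derivative D) (at x) \<longleftrightarrow> (g has_derivative D) (at x)" for D
    using has_derivative_transform_within_open[of f D x UNIV S g]
      has_derivative_transform_within_open[of g D x UNIV S f] assms by auto
  then show "f differentiable (at x) \<longleftrightarrow> g differentiable (at x)"
    and "frechet_derivative f (at x) = frechet_derivative g (at x)"
    by (simp_all add: differentiable_def frechet_derivative_def)
qed

lemma Ck_on_cong:
  assumes "open S" "\<And>x. x \<in> S \<Longrightarrow> f x = g x"
  shows "Ck_on k S f \<longleftrightarrow> Ck_on k S g"
  using assms(2)
proof (induction k arbitrary: f g)
  case 0
  then show ?case by (simp cong: continuous_on_cong)
next
  case (Suc k)
  have "Ck_on k S (\<lambda>x. frechet_derivative f (at x) b) \<longleftrightarrow> Ck_on k S (\<lambda>x. frechet_derivative g (at x) b)" for b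
    by (rule Suc.IH) (use frechet_derivative_cong_open(2)[OF assms(1) _ Suc.prems] in auto)
  moreover have "\<forall>x\<in>S. f differentiable (at x) \<longleftrightarrow> g differentiable (at x)"
    using frechet_derivative_cong_open(1)[OF assms(1) _ Suc.prems] by auto
  ultimately show ?case by auto
qed

lemma frechet_derivative_lincomb:
  fixes f g :: "'a::euclidean_space \<Rightarrow> real"
  assumes "f differentiable (at x)" "g differentiable (at x)"
  shows "(\<lambda>x. a * f x + b * g x) differentiable (at x)"
    and "frechet_derivative (\<lambda>x. a * f x + b * g x) (at x) c
      = a * frechet_derivative f (at x) c + b * frechet_derivative g (at x) c"
proof -
  have D: "((\<lambda>x. a * f x + b * g x) has_derivative
     (\<lambda>h. a * frechet_derivative f (at x) h + b * frechet_derivative g (at x) h)) (at x)"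
    using assms unfolding frechet_derivative_works
    by (intro has_derivative_add has_derivative_mult_right)
  then show "(\<lambda>x. a * f x + b * g x) differentiable (at x)" unfolding differentiable_def by blast
  show "frechet_derivative (\<lambda>x. a * f x + b * g x) (at x) c
      = a * frechet_derivative f (at x) c + b * frechet_derivative g (at x) c"
    using frechet_derivative_at[OF D] by metis
qed

lemma Ck_on_lincomb:
  assumes "open S" "Ck_on k S f" "Ck_on k S g"
  shows "Ck_on k S (\<lambda>x. a * f x + b * g x)"
  using assms(2,3)
proof (induction k arbitrary: f g)
  case 0
  then show ?case by (auto intro!: continuous_on_add continuous_on_mult_left)
next
  case (Suc k)
  have "Ck_on k S (\<lambda>x. frechet_derivative (\<lambda>x. a * f x + b * g x) (at x) c)" if "c \<in> Basis" for c
  proof -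
    have "Ck_on k S (\<lambda>x. a * frechet_derivative f (at x) c + b * frechet_derivative g (at x) c)"
      using Suc.prems that by (intro Suc.IH) auto
    then show ?thesis
      by (rule Ck_on_cong[OF assms(1), THEN iffD2, rotated])
        (rule frechet_derivative_lincomb(2), use Suc.prems in auto)
  qed
  then show ?case using Suc.prems frechet_derivative_lincomb(1) by auto
qed

lemma Ck_on_Suc: "Ck_on (Suc k) S f \<Longrightarrow> Ck_on k S f"
proof (induction k arbitrary: f)
  case 0
  then show ?case
    by (auto intro!: continuous_at_imp_continuous_on simp: differentiable_imp_continuous_within)
next
  case (Suc k)
  then show ?case by auto
qed

lemma Ck_on_1: "Ck_on 1 S f \<longleftrightarrow> (\<forall>x\<in>S. f differentiable (at x)) \<and>
     (\<forall>b\<in>Basis. continuous_on S (\<lambda>x. frechet_derivative f (at x) b))"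
  by (simp add: One_nat_def del: One_nat_def[symmetric])

lemma Ck_on_subset: "Ck_on k S f \<Longrightarrow> T \<subseteq> S \<Longrightarrow> Ck_on k T f"
  by (induction k arbitrary: f) (auto intro: continuous_on_subset)

lemma smooth_on_Ck: "smooth_on S f \<Longrightarrow> Ck_on k S f"
  by (simp add: smooth_on_def)

lemma test_function_subset: "test_function T \<eta> \<Longrightarrow> T \<subseteq> S \<Longrightarrow> test_function S \<eta>"
  by (auto simp: test_function_def)

lemma test_function_L2:
  assumes "test_function S \<eta>" "U \<in> sets lebesgue"
  shows "\<eta> \<in> L2_space U"
  using assms test_function_continuous continuous_imp_L2_space
  by (metis test_function_def)

lemma frechet_derivative_eq_0:
  assumes "open U" "x \<in> U" "\<And>y. y \<in> U \<Longrightarrow> f y = 0"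
  shows "frechet_derivative f (at x) = (\<lambda>h. 0)"
  using frechet_derivative_cong_open(2)[OF assms(1,2), of f "\<lambda>_. 0"] assms(3) by simp

lemma test_function_derivative_L2:
  assumes \<eta>: "test_function S \<eta>" and U: "U \<in> sets lebesgue" and b: "b \<in> Basis"
  shows "(\<lambda>x. frechet_derivative \<eta> (at x) b) \<in> L2_space U"
proof -
  obtain K where K: "compact K" "\<And>x. x \<notin> K \<Longrightarrow> \<eta> x = 0"
    using \<eta> by (auto simp: test_function_def)
  show ?thesis
  proof (rule continuous_imp_L2_space[OF _ K(1) _ U])
    show "continuous_on UNIV (\<lambda>x. frechet_derivative \<eta> (at x) b)"
      using test_function_Ck[OF \<eta>, of 1] b unfolding Ck_on_1 by auto
    show "frechet_derivative \<eta> (at x) b = 0" if "x \<notin> K" for x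
      using frechet_derivative_eq_0[of "- K" x \<eta>] K that
      by (simp add: compact_imp_closed open_Compl)
  qed
qed

section \<open>Weak derivatives and Sobolev spaces\<close>

lemma test_function_integration_by_parts:
  fixes f :: "'a::euclidean_space \<Rightarrow> real"
  assumes T: "open T" and f: "Ck_on 1 T f" and \<eta>: "test_function T \<eta>" and b: "b \<in> Basis"
  shows "(\<integral>x. frechet_derivative f (at x) b * \<eta> x + f x * frechet_derivative \<eta> (at x) b \<partial>lebesgue_on T) = 0"
proof -
  obtain K where K: "compact K" "K \<subseteq> T" "\<And>x. x \<notin> K \<Longrightarrow> \<eta> x = 0"
    using \<eta> by (auto simp: test_function_def)
  define w where "w x = (if x \<in> T then f x * \<eta> x else 0)" for x
  define w' where "w' x = (if x \<in> T then (\<lambda>h. f x * frechet_derivative \<eta> (at x) h + frechet_derivative f (at x) h * \<eta> x) else (\<lambda>h. 0))" for x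
  have oK: "open (- K)" using K(1) by (simp add: compact_imp_closed open_Compl)
  have \<eta>d: "\<eta> differentiable (at x)" and \<eta>c: "continuous_on UNIV (\<lambda>x. frechet_derivative \<eta> (at x) b)" for x
    using test_function_Ck[OF \<eta>, of 1] b unfolding Ck_on_1 by auto
  have \<eta>0: "frechet_derivative \<eta> (at x) = (\<lambda>h. 0)" if "x \<notin> K" for x
    using frechet_derivative_eq_0[OF oK, of x \<eta>] K that by auto
  have fd: "f differentiable (at x)" if "x \<in> T" for x using f that unfolding Ck_on_1 by auto
  have "(w has_derivative w' x) (at x)" for x
  proof (cases "x \<in> T")
    case True
    have "((\<lambda>x. f x * \<eta> x) has_derivative w' x) (at x)"
      using True has_derivative_mult[OF fd[OF True, unfolded frechet_derivative_works] \<eta>d[of x, unfolded frechet_derivative_works]]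
      by (simp add: w'_def)
    then show ?thesis
      by (rule has_derivative_transform_within_open[OF _ T True]) (simp add: w_def)
  next
    case False
    then have "x \<in> - K" using K by auto
    have "((\<lambda>x. 0) has_derivative w' x) (at x)" using False by (simp add: w'_def)
    then show ?thesis
      by (rule has_derivative_transform_within_open[OF _ oK \<open>x \<in> - K\<close>]) (use K in \<open>auto simp: w_def\<close>)
  qed
  moreover have "continuous_on UNIV (\<lambda>x. w' x b)"
  proof -
    have "continuous_on T (\<lambda>x. f x * frechet_derivative \<eta> (at x) b + frechet_derivative f (at x) b * \<eta> x)"
      using f b fd \<eta>c test_function_continuous[OF \<eta>] unfolding Ck_on_1
      by (intro continuous_on_add continuous_on_mult)
        (auto intro: continuous_on_subset continuous_at_imp_continuous_on differentiable_imp_continuous_within)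
    then have "continuous_on T (\<lambda>x. w' x b)"
      by (rule continuous_on_eq) (simp add: w'_def)
    moreover have "continuous_on (- K) (\<lambda>x. w' x b)"
      by (rule continuous_on_eq[of _ "\<lambda>_. 0"]) (use \<eta>0 K in \<open>auto simp: w'_def\<close>)
    ultimately have "continuous_on (T \<union> - K) (\<lambda>x. w' x b)"
      by (rule continuous_on_open_Un[OF T oK])
    moreover have "T \<union> - K = UNIV" using K by auto
    ultimately show ?thesis by simp
  qed
  ultimately have "(\<integral>x. w' x b \<partial>lebesgue) = 0"
    by (rule integral_directional_derivative_eq_0) (use K in \<open>auto simp: w_def\<close>)
  moreover have "w' x b = indicator T x *\<^sub>R (frechet_derivative f (at x) b * \<eta> x + f x * frechet_derivative \<eta> (at x) b)" for x
    by (simp add: w'_def)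
  ultimately show ?thesis using T by (simp add: integral_restrict_space)
qed


lemma L2_inner_integral_restrict:
  assumes "T \<subseteq> S" "T \<in> sets lebesgue" "S \<in> sets lebesgue" "\<And>x. x \<in> S - T \<Longrightarrow> v x = 0"
  shows "L2_inner S u v = L2_inner T u v"
proof -
  have "(\<integral>x. indicator S x *\<^sub>R (u x * v x) \<partial>lebesgue) = (\<integral>x. indicator T x *\<^sub>R (u x * v x) \<partial>lebesgue)"
    using assms(1,4) by (intro Bochner_Integration.integral_cong refl) (auto simp: indicator_def)
  then show ?thesis
    using assms(2,3) by (simp add: L2_inner_def integral_restrict_space)
qed

lemma test_function_vanishes: "test_function S \<eta> \<Longrightarrow> x \<notin> S \<Longrightarrow> \<eta> x = 0 \<and> frechet_derivative \<eta> (at x) b = 0"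
proof -
  assume "test_function S \<eta>" "x \<notin> S"
  then obtain K where "compact K" "K \<subseteq> S" "\<And>x. x \<notin> K \<Longrightarrow> \<eta> x = 0"
    by (auto simp: test_function_def)
  with \<open>x \<notin> S\<close> show ?thesis
    using frechet_derivative_eq_0[of "- K" x \<eta>] by (metis ComplI compact_imp_closed ComplD open_Compl subsetD)
qed

lemma Ck_on_1_frechet_integrable:
  assumes "Ck_on 1 T f" "b \<in> Basis" "cbox c d \<subseteq> T"
  shows "integrable (lebesgue_on (cbox c d)) (\<lambda>x. frechet_derivative f (at x) b)"
proof -
  have "continuous_on (cbox c d) (\<lambda>x. frechet_derivative f (at x) b)"
    using assms unfolding Ck_on_1 by (auto intro: continuous_on_subset)
  then have "integrable lborel (\<lambda>x. indicator (cbox c d) x *\<^sub>R frechet_derivative f (at x) b)"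
    by (intro borel_integrable_compact) auto
  moreover then have "(\<lambda>x. indicator (cbox c d) x *\<^sub>R frechet_derivative f (at x) b) \<in> borel_measurable lborel"
    by (rule borel_measurable_integrable)
  ultimately have "integrable lebesgue (\<lambda>x. indicator (cbox c d) x *\<^sub>R frechet_derivative f (at x) b)"
    by (simp only: integrable_completion)
  then show ?thesis by (simp add: integrable_restrict_space)
qed

text \<open>
  Localization: on an open part of \<open>\<Omega>\<close> where \<open>u\<close> agrees with a $C^1$ function, every weak
  derivative is the classical one. With \<open>T = \<Omega>\<close> this identifies the gradient of smooth
  $H^1$ functions; with \<open>T\<close> an element it identifies that of piecewise affine functions.
\<close>

lemma weak_partial_eq_frechet_derivative:
  fixes u f :: "'a::euclidean_space \<Rightarrow> real"
  assumes \<Omega>: "open \<Omega>" and T: "open T" "T \<subseteq> \<Omega>" and b: "b \<in> Basis"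
    and g: "is_weak_partial \<Omega> b u g" and u: "u \<in> L2_space \<Omega>"
    and f: "Ck_on 1 T f" and eq: "\<And>x. x \<in> T \<Longrightarrow> u x = f x"
  shows "AE x in lebesgue_on T. g x = frechet_derivative f (at x) b"
proof -
  have g2: "g \<in> L2_space \<Omega>" using g by (simp add: is_weak_partial_def)
  have gT: "g \<in> L2_space T" and uT: "u \<in> L2_space T"
    using L2_space_subset[OF g2 T(2)] L2_space_subset[OF u T(2)] T \<Omega> by auto
  have "AE x in lebesgue_on T. g x - frechet_derivative f (at x) b = 0"
  proof (rule test_function_fundamental_lemma[OF T(1)])
    fix c d assume cd: "cbox c d \<subseteq> T"
    have "g \<in> L2_space (cbox c d)" using L2_space_subset[OF gT cd] T by auto
    then have "integrable (lebesgue_on (cbox c d)) g"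
      by (rule L2_integrable_bounded) (use emeasure_compact_finite[of "cbox c d"] in auto)
    then show "integrable (lebesgue_on (cbox c d)) (\<lambda>x. g x - frechet_derivative f (at x) b)"
      using Ck_on_1_frechet_integrable[OF f b cd] by (rule Bochner_Integration.integrable_diff)
  next
    fix \<eta> assume \<eta>: "test_function T \<eta>"
    have \<eta>': "test_function \<Omega> \<eta>" using \<eta> T(2) by (rule test_function_subset)
    let ?d = "\<lambda>x. frechet_derivative \<eta> (at x) b"
    have i1: "integrable (lebesgue_on T) (\<lambda>x. g x * \<eta> x)"
      using gT test_function_L2[OF \<eta>] T by (intro L2_mult_integrable) auto
    have i2: "integrable (lebesgue_on T) (\<lambda>x. u x * ?d x)"
      using uT test_function_derivative_L2[OF \<eta> _ b] T by (intro L2_mult_integrable) auto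
    have i3: "integrable (lebesgue_on T) (\<lambda>x. frechet_derivative f (at x) b * \<eta> x)"
    proof -
      obtain K where K: "compact K" "K \<subseteq> T" "\<And>x. x \<notin> K \<Longrightarrow> \<eta> x = 0"
        using \<eta> by (auto simp: test_function_def)
      have "continuous_on K (\<lambda>x. frechet_derivative f (at x) b * \<eta> x)"
        using f b K(2) test_function_continuous[OF \<eta>] unfolding Ck_on_1
        by (intro continuous_on_mult) (auto intro: continuous_on_subset)
      then have 1: "integrable lborel (\<lambda>x. indicator K x *\<^sub>R (frechet_derivative f (at x) b * \<eta> x))"
        by (rule borel_integrable_compact[OF K(1)])
      then have "integrable lebesgue (\<lambda>x. indicator K x *\<^sub>R (frechet_derivative f (at x) b * \<eta> x))"
        by (subst integrable_completion) (rule borel_measurable_integrable)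
      moreover have "indicator K x *\<^sub>R (frechet_derivative f (at x) b * \<eta> x) = indicator T x *\<^sub>R (frechet_derivative f (at x) b * \<eta> x)" for x
        using K(2,3) by (auto simp: indicator_def)
      ultimately have "integrable lebesgue (\<lambda>x. indicator T x *\<^sub>R (frechet_derivative f (at x) b * \<eta> x))" by (simp only:)
      then show ?thesis using T by (simp add: integrable_restrict_space)
    qed
    have "L2_inner \<Omega> u ?d = L2_inner T u ?d" "L2_inner \<Omega> g \<eta> = L2_inner T g \<eta>"
      using test_function_vanishes[OF \<eta>] T \<Omega> by (auto intro!: L2_inner_integral_restrict)
    moreover have "L2_inner \<Omega> u ?d = - L2_inner \<Omega> g \<eta>"
      using g \<eta>' by (simp add: is_weak_partial_def)
    ultimately have a: "(\<integral>x. u x * ?d x \<partial>lebesgue_on T) + (\<integral>x. g x * \<eta> x \<partial>lebesgue_on T) = 0"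
      by (simp add: L2_inner_def)
    have "(\<integral>x. frechet_derivative f (at x) b * \<eta> x + u x * ?d x \<partial>lebesgue_on T)
        = (\<integral>x. frechet_derivative f (at x) b * \<eta> x + f x * ?d x \<partial>lebesgue_on T)"
      using eq by (intro Bochner_Integration.integral_cong) auto
    also have "\<dots> = 0" by (rule test_function_integration_by_parts[OF T(1) f \<eta> b])
    finally have "(\<integral>x. frechet_derivative f (at x) b * \<eta> x \<partial>lebesgue_on T) + (\<integral>x. u x * ?d x \<partial>lebesgue_on T) = 0"
      using Bochner_Integration.integral_add[OF i3 i2] by simp
    then have "(\<integral>x. g x * \<eta> x \<partial>lebesgue_on T) - (\<integral>x. frechet_derivative f (at x) b * \<eta> x \<partial>lebesgue_on T) = 0"
      using a by linarith
    then show "(\<integral>x. (g x - frechet_derivative f (at x) b) * \<eta> x \<partial>lebesgue_on T) = 0"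
      using Bochner_Integration.integral_diff[OF i1 i3] by (simp add: left_diff_distrib)
  qed
  then show ?thesis by simp
qed

lemma is_weak_partial_unique:
  assumes \<Omega>: "open \<Omega>" and g: "is_weak_partial \<Omega> b u g" and h: "is_weak_partial \<Omega> b u h"
  shows "AE x in lebesgue_on \<Omega>. g x = h x"
proof -
  have g2: "g \<in> L2_space \<Omega>" and h2: "h \<in> L2_space \<Omega>"
    using g h by (auto simp: is_weak_partial_def)
  have "AE x in lebesgue_on \<Omega>. g x - h x = 0"
  proof (rule test_function_fundamental_lemma[OF \<Omega>])
    fix c d assume cd: "cbox c d \<subseteq> \<Omega>"
    have "(\<lambda>x. g x - h x) \<in> L2_space (cbox c d)"
      using L2_space_subset[OF L2_space_diff[OF g2 h2] cd] \<Omega> by auto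
    then show "integrable (lebesgue_on (cbox c d)) (\<lambda>x. g x - h x)"
      by (rule L2_integrable_bounded) (use emeasure_compact_finite[of "cbox c d"] in auto)
  next
    fix \<eta> assume \<eta>: "test_function \<Omega> \<eta>"
    have "L2_inner \<Omega> (\<lambda>x. g x - h x) \<eta> = 0"
      using L2_inner_diff_left[OF g2 h2 test_function_L2[OF \<eta>]] g h \<eta> \<Omega>
      by (simp add: is_weak_partial_def)
    then show "(\<integral>x. (g x - h x) * \<eta> x \<partial>lebesgue_on \<Omega>) = 0" by (simp add: L2_inner_def)
  qed
  then show ?thesis by simp
qed

lemma is_weak_partial_lincomb:
  assumes "open \<Omega>" "b \<in> Basis" "u \<in> L2_space \<Omega>" "v \<in> L2_space \<Omega>"
    and g: "is_weak_partial \<Omega> b u g" and h: "is_weak_partial \<Omega> b v h"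
  shows "is_weak_partial \<Omega> b (\<lambda>x. \<alpha> * u x + \<beta> * v x) (\<lambda>x. \<alpha> * g x + \<beta> * h x)"
proof -
  have g2: "g \<in> L2_space \<Omega>" and h2: "h \<in> L2_space \<Omega>"
    using g h by (auto simp: is_weak_partial_def)
  moreover have "L2_inner \<Omega> (\<lambda>x. \<alpha> * u x + \<beta> * v x) (\<lambda>x. frechet_derivative \<eta> (at x) b) =
      - L2_inner \<Omega> (\<lambda>x. \<alpha> * g x + \<beta> * h x) \<eta>" if \<eta>: "test_function \<Omega> \<eta>" for \<eta>
    using g h \<eta> assms(1)
    by (simp add: L2_inner_lincomb_left[OF assms(3,4) test_function_derivative_L2[OF \<eta> _ assms(2)]]
        L2_inner_lincomb_left[OF g2 h2 test_function_L2[OF \<eta>]] is_weak_partial_def)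
  ultimately show ?thesis by (auto simp: is_weak_partial_def intro: L2_space_lincomb)
qed

lemma H1_space_L2: "u \<in> H1_space \<Omega> \<Longrightarrow> u \<in> L2_space \<Omega>"
  by (simp add: H1_space_def)

lemma is_weak_partial_weak_partial:
  "u \<in> H1_space \<Omega> \<Longrightarrow> b \<in> Basis \<Longrightarrow> is_weak_partial \<Omega> b u (weak_partial \<Omega> b u)"
  unfolding weak_partial_def using someI_ex[of "is_weak_partial \<Omega> b u"] by (simp add: H1_space_def)

lemma weak_partial_L2: "u \<in> H1_space \<Omega> \<Longrightarrow> b \<in> Basis \<Longrightarrow> weak_partial \<Omega> b u \<in> L2_space \<Omega>"
  using is_weak_partial_weak_partial by (auto simp: is_weak_partial_def)

lemma H1_space_lincomb:
  assumes "open \<Omega>" "u \<in> H1_space \<Omega>" "v \<in> H1_space \<Omega>"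
  shows "(\<lambda>x. a * u x + b * v x) \<in> H1_space \<Omega>"
proof -
  have "\<exists>g. is_weak_partial \<Omega> c (\<lambda>x. a * u x + b * v x) g" if "c \<in> Basis" for c
    using is_weak_partial_lincomb[OF assms(1) that H1_space_L2[OF assms(2)] H1_space_L2[OF assms(3)]
      is_weak_partial_weak_partial[OF assms(2) that] is_weak_partial_weak_partial[OF assms(3) that]] by blast
  then show ?thesis
    using L2_space_lincomb[OF H1_space_L2[OF assms(2)] H1_space_L2[OF assms(3)]]
    by (simp add: H1_space_def)
qed

lemma weak_partial_lincomb:
  assumes "open \<Omega>" "u \<in> H1_space \<Omega>" "v \<in> H1_space \<Omega>" "c \<in> Basis"
  shows "AE x in lebesgue_on \<Omega>. weak_partial \<Omega> c (\<lambda>x. a * u x + b * v x) x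
      = a * weak_partial \<Omega> c u x + b * weak_partial \<Omega> c v x"
  using assms
  by (intro is_weak_partial_unique[OF assms(1), of c "\<lambda>x. a * u x + b * v x"] is_weak_partial_weak_partial
      is_weak_partial_lincomb H1_space_lincomb H1_space_L2)

lemma H1_norm_nonneg [simp]: "0 \<le> H1_norm \<Omega> u"
  by (simp add: H1_norm_def sum_nonneg)

lemma H1_norm_sq: "(H1_norm \<Omega> u)\<^sup>2 = (L2_norm \<Omega> u)\<^sup>2 + (\<Sum>b\<in>Basis. (L2_norm \<Omega> (weak_partial \<Omega> b u))\<^sup>2)"
  by (simp add: H1_norm_def sum_nonneg)

text \<open>
  The weak derivative is an unspecified representative, so that it is linear only almost
  everywhere; squared norms with the factor 2 avoid the triangle inequality, and the factor is
  harmless in all later estimates.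
\<close>

lemma H1_norm_sq_lincomb_le:
  assumes "open \<Omega>" "u \<in> H1_space \<Omega>" "v \<in> H1_space \<Omega>"
  shows "(H1_norm \<Omega> (\<lambda>x. a * u x + b * v x))\<^sup>2 \<le> 2 * a\<^sup>2 * (H1_norm \<Omega> u)\<^sup>2 + 2 * b\<^sup>2 * (H1_norm \<Omega> v)\<^sup>2"
proof -
  have "(L2_norm \<Omega> (weak_partial \<Omega> c (\<lambda>x. a * u x + b * v x)))\<^sup>2
      \<le> 2 * a\<^sup>2 * (L2_norm \<Omega> (weak_partial \<Omega> c u))\<^sup>2 + 2 * b\<^sup>2 * (L2_norm \<Omega> (weak_partial \<Omega> c v))\<^sup>2"
    if c: "c \<in> Basis" for c
    using L2_norm_cong_AE[OF weak_partial_lincomb[OF assms c, of a b]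
        weak_partial_L2[OF H1_space_lincomb[OF assms] c]
        L2_space_lincomb[OF weak_partial_L2[OF assms(2) c] weak_partial_L2[OF assms(3) c]]]
      L2_norm_sq_lincomb_le[OF weak_partial_L2[OF assms(2) c] weak_partial_L2[OF assms(3) c], of a b]
    by simp
  then have "(\<Sum>c\<in>Basis. (L2_norm \<Omega> (weak_partial \<Omega> c (\<lambda>x. a * u x + b * v x)))\<^sup>2)
    \<le> (\<Sum>c\<in>Basis. 2 * a\<^sup>2 * (L2_norm \<Omega> (weak_partial \<Omega> c u))\<^sup>2 + 2 * b\<^sup>2 * (L2_norm \<Omega> (weak_partial \<Omega> c v))\<^sup>2)"
    by (rule sum_mono)
  also have "\<dots> = 2 * a\<^sup>2 * (\<Sum>c\<in>Basis. (L2_norm \<Omega> (weak_partial \<Omega> c u))\<^sup>2)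
     + 2 * b\<^sup>2 * (\<Sum>c\<in>Basis. (L2_norm \<Omega> (weak_partial \<Omega> c v))\<^sup>2)"
    by (simp add: sum.distrib sum_distrib_left)
  finally show ?thesis
    using L2_norm_sq_lincomb_le[OF H1_space_L2[OF assms(2)] H1_space_L2[OF assms(3)], of a b]
    by (simp add: H1_norm_sq algebra_simps)
qed

lemma H10_space_H1: "u \<in> H10_space \<Omega> \<gamma> \<Longrightarrow> u \<in> H1_space \<Omega>"
  by (simp add: H10_space_def)

lemma H10_space_L2: "u \<in> H10_space \<Omega> \<gamma> \<Longrightarrow> u \<in> L2_space \<Omega>"
  by (simp add: H10_space_def H1_space_L2)

lemma H1_space_zero: "(\<lambda>x. 0) \<in> H1_space \<Omega>"
  by (auto simp: H1_space_def is_weak_partial_def L2_space_zero intro!: exI[of _ "\<lambda>x. 0"])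

lemma H1_norm_zero: "open \<Omega> \<Longrightarrow> H1_norm \<Omega> (\<lambda>x. 0) = 0"
  using H1_norm_sq_lincomb_le[OF _ H1_space_zero H1_space_zero, of \<Omega> 0 0] by simp

lemma smooth_on_lincomb: "open S \<Longrightarrow> smooth_on S f \<Longrightarrow> smooth_on S g \<Longrightarrow> smooth_on S (\<lambda>x. a * f x + b * g x)"
  by (simp add: smooth_on_def Ck_on_lincomb)

lemma H10_space_zero:
  assumes "open \<Omega>" shows "(\<lambda>x. 0) \<in> H10_space \<Omega> \<gamma>"
proof -
  have "Ck_on k \<Omega> (\<lambda>x. 0)" for k
    by (induction k) auto
  then show ?thesis
    using H1_norm_zero[OF assms] H1_space_zero
    by (auto simp: H10_space_def smooth_on_def vanishes_at_def intro!: bexI[of _ "\<lambda>x. 0"])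
qed

lemma H10_space_lincomb:
  assumes \<Omega>: "open \<Omega>" and u: "u \<in> H10_space \<Omega> \<gamma>" and v: "v \<in> H10_space \<Omega> \<gamma>"
  shows "(\<lambda>x. a * u x + b * v x) \<in> H10_space \<Omega> \<gamma>"
proof -
  have "\<exists>w \<in> H1_space \<Omega>. smooth_on \<Omega> w \<and> vanishes_at \<Omega> \<gamma> w \<and>
      H1_norm \<Omega> (\<lambda>x. (a * u x + b * v x) - w x) < \<epsilon>" if \<epsilon>: "\<epsilon> > 0" for \<epsilon> :: real
  proof -
    define M where "M = 2 * (\<bar>a\<bar> + \<bar>b\<bar> + 1)"
    have M: "M > 0" by (simp add: M_def)
    obtain u' where u': "u' \<in> H1_space \<Omega>" "smooth_on \<Omega> u'" "vanishes_at \<Omega> \<gamma> u'" "H1_norm \<Omega> (\<lambda>x. u x - u' x) < \<epsilon> / M"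
      using u \<epsilon> M unfolding H10_space_def by (auto dest: spec[of _ "\<epsilon> / M"])
    obtain v' where v': "v' \<in> H1_space \<Omega>" "smooth_on \<Omega> v'" "vanishes_at \<Omega> \<gamma> v'" "H1_norm \<Omega> (\<lambda>x. v x - v' x) < \<epsilon> / M"
      using v \<epsilon> M unfolding H10_space_def by (auto dest: spec[of _ "\<epsilon> / M"])
    let ?w = "\<lambda>x. a * u' x + b * v' x"
    have uu: "(\<lambda>x. u x - u' x) \<in> H1_space \<Omega>" and vv: "(\<lambda>x. v x - v' x) \<in> H1_space \<Omega>"
      using H1_space_lincomb[OF \<Omega> H10_space_H1[OF u] u'(1), of 1 "-1"]
        H1_space_lincomb[OF \<Omega> H10_space_H1[OF v] v'(1), of 1 "-1"] by simp_all
    have "(H1_norm \<Omega> (\<lambda>x. (a * u x + b * v x) - ?w x))\<^sup>2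
        = (H1_norm \<Omega> (\<lambda>x. a * (u x - u' x) + b * (v x - v' x)))\<^sup>2"
      by (simp add: algebra_simps)
    also have "\<dots> \<le> 2 * a\<^sup>2 * (H1_norm \<Omega> (\<lambda>x. u x - u' x))\<^sup>2 + 2 * b\<^sup>2 * (H1_norm \<Omega> (\<lambda>x. v x - v' x))\<^sup>2"
      by (rule H1_norm_sq_lincomb_le[OF \<Omega> uu vv])
    also have "\<dots> \<le> 2 * a\<^sup>2 * (\<epsilon> / M)\<^sup>2 + 2 * b\<^sup>2 * (\<epsilon> / M)\<^sup>2"
      using u'(4) v'(4) by (intro add_mono mult_left_mono power_mono) auto
    also have "\<dots> = (2 * a\<^sup>2 + 2 * b\<^sup>2) * (\<epsilon> / M)\<^sup>2" by (simp add: algebra_simps)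
    also have "\<dots> < M\<^sup>2 * (\<epsilon> / M)\<^sup>2"
    proof (rule mult_strict_right_mono)
      have "M\<^sup>2 = 4 * (\<bar>a\<bar>\<^sup>2 + \<bar>b\<bar>\<^sup>2 + 1 + 2 * \<bar>a\<bar> * \<bar>b\<bar> + 2 * \<bar>a\<bar> + 2 * \<bar>b\<bar>)"
        by (simp add: M_def power2_eq_square algebra_simps)
      moreover have "0 \<le> \<bar>a\<bar> * \<bar>b\<bar>" "0 \<le> \<bar>a\<bar>\<^sup>2" "0 \<le> \<bar>b\<bar>\<^sup>2" "0 \<le> \<bar>a\<bar>" "0 \<le> \<bar>b\<bar>" by auto
      ultimately have "2 * \<bar>a\<bar>\<^sup>2 + 2 * \<bar>b\<bar>\<^sup>2 < M\<^sup>2" unfolding mult.assoc by argo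
      then show "2 * a\<^sup>2 + 2 * b\<^sup>2 < M\<^sup>2" by simp
      show "0 < (\<epsilon> / M)\<^sup>2" using \<epsilon> M by simp
    qed
    also have "\<dots> = \<epsilon>\<^sup>2" using M by (simp add: power_divide)
    finally have "H1_norm \<Omega> (\<lambda>x. (a * u x + b * v x) - ?w x) < \<epsilon>"
      using \<epsilon> by (simp add: power2_less_imp_less)
    moreover have "vanishes_at \<Omega> \<gamma> ?w"
      using tendsto_add[OF tendsto_mult_right_zero tendsto_mult_right_zero] u'(3) v'(3)
      by (fastforce simp: vanishes_at_def)
    ultimately show ?thesis
      using H1_space_lincomb[OF \<Omega> u'(1) v'(1)] smooth_on_lincomb[OF \<Omega> u'(2) v'(2)] by blast
  qed
  then show ?thesis
    using H1_space_lincomb[OF \<Omega> H10_space_H1[OF u] H10_space_H1[OF v]] by (simp add: H10_space_def)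
qed

lemma H10_space_cmult: "open \<Omega> \<Longrightarrow> u \<in> H10_space \<Omega> \<gamma> \<Longrightarrow> (\<lambda>x. a * u x) \<in> H10_space \<Omega> \<gamma>"
  using H10_space_lincomb[of \<Omega> u \<gamma> u a 0] by simp

lemma H10_space_add:
  "open \<Omega> \<Longrightarrow> u \<in> H10_space \<Omega> \<gamma> \<Longrightarrow> v \<in> H10_space \<Omega> \<gamma> \<Longrightarrow> (\<lambda>x. u x + v x) \<in> H10_space \<Omega> \<gamma>"
  using H10_space_lincomb[of \<Omega> u \<gamma> v 1 1] by simp

lemma H10_space_sum:
  "open \<Omega> \<Longrightarrow> finite I \<Longrightarrow> (\<And>i. i \<in> I \<Longrightarrow> u i \<in> H10_space \<Omega> \<gamma>) \<Longrightarrow> (\<lambda>x. \<Sum>i\<in>I. u i x) \<in> H10_space \<Omega> \<gamma>"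
  by (rotate_tac 1, induction I rule: finite_induct) (auto intro: H10_space_zero H10_space_add)

section \<open>A Poincare inequality on convex sets\<close>

definition grad_sq :: "('a::euclidean_space \<Rightarrow> real) \<Rightarrow> 'a \<Rightarrow> real" where
  "grad_sq v x = (\<Sum>b\<in>Basis. (frechet_derivative v (at x) b)\<^sup>2)"

lemma grad_sq_nonneg [simp]: "0 \<le> grad_sq v x"
  by (simp add: grad_sq_def sum_nonneg)

lemma continuous_on_grad_sq: "Ck_on 1 S v \<Longrightarrow> continuous_on S (grad_sq v)"
  unfolding Ck_on_1 grad_sq_def[abs_def] by (intro continuous_on_sum continuous_on_power) auto

lemma linear_eq_sum_Basis:
  fixes f :: "'a::euclidean_space \<Rightarrow> real"
  assumes "linear f" shows "f w = (\<Sum>b\<in>Basis. (w \<bullet> b) * f b)"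
proof -
  have "f w = f (\<Sum>b\<in>Basis. (w \<bullet> b) *\<^sub>R b)" by (simp add: euclidean_representation)
  also have "\<dots> = (\<Sum>b\<in>Basis. (w \<bullet> b) * f b)"
    using assms by (simp add: linear_sum linear_cmul)
  finally show ?thesis .
qed

lemma directional_derivative_sq_le:
  fixes f :: "'a::euclidean_space \<Rightarrow> real"
  assumes "linear f" shows "(f w)\<^sup>2 \<le> (norm w)\<^sup>2 * (\<Sum>b\<in>Basis. (f b)\<^sup>2)"
proof -
  have "(f w)\<^sup>2 \<le> (\<Sum>b\<in>Basis. (w \<bullet> b)\<^sup>2) * (\<Sum>b\<in>Basis. (f b)\<^sup>2)"
    unfolding linear_eq_sum_Basis[OF assms, of w] by (rule Cauchy_Schwarz_ineq_sum)
  also have "(\<Sum>b\<in>Basis. (w \<bullet> b)\<^sup>2) = (norm w)\<^sup>2"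
    unfolding power2_norm_eq_inner euclidean_inner[of w w] by (simp add: power2_eq_square)
  finally show ?thesis .
qed

lemma sq_integral_le:
  fixes f :: "real \<Rightarrow> real"
  assumes "0 < s" "continuous_on {0..s} f" "(f has_integral I) {0..s}"
  shows "I\<^sup>2 \<le> s * integral {0..s} (\<lambda>t. (f t)\<^sup>2)"
proof -
  define c where "c = I / s"
  have f2: "((\<lambda>t. (f t)\<^sup>2) has_integral integral {0..s} (\<lambda>t. (f t)\<^sup>2)) {0..s}"
    using assms(2) by (intro integrable_integral integrable_continuous_real continuous_on_power)
  have "((\<lambda>t. (f t)\<^sup>2 - 2 * c * f t + c\<^sup>2) has_integral
     integral {0..s} (\<lambda>t. (f t)\<^sup>2) - 2 * c * I + (s - 0) * c\<^sup>2) {0..s}"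
    using has_integral_const_real[of "c\<^sup>2" 0 s] assms(1)
    by (intro has_integral_add has_integral_diff f2 has_integral_mult_right assms(3)) simp
  then have "0 \<le> integral {0..s} (\<lambda>t. (f t)\<^sup>2) - 2 * c * I + (s - 0) * c\<^sup>2"
  proof (rule has_integral_nonneg)
    fix t
    have "(f t)\<^sup>2 - 2 * c * f t + c\<^sup>2 = (f t - c)\<^sup>2"
      by (simp add: power2_eq_square algebra_simps)
    then show "0 \<le> (f t)\<^sup>2 - 2 * c * f t + c\<^sup>2" by simp
  qed
  also have "\<dots> = integral {0..s} (\<lambda>t. (f t)\<^sup>2) - I\<^sup>2 / s"
    using assms(1) by (simp add: c_def field_simps power2_eq_square)
  finally show ?thesis using assms(1) by (simp add: field_simps)
qed

text \<open>
  The fundamental theorem of calculus along the segment from $x$ to $x + s w$, squared by the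
  Cauchy--Schwarz inequality.
\<close>

lemma segment_increment_sq_le:
  fixes v :: "'a::euclidean_space \<Rightarrow> real"
  assumes v: "Ck_on 1 S v" and s: "0 < s"
    and seg: "\<And>\<tau>. 0 \<le> \<tau> \<Longrightarrow> \<tau> \<le> s \<Longrightarrow> x + \<tau> *\<^sub>R w \<in> S"
  shows "ennreal ((v (x + s *\<^sub>R w) - v x)\<^sup>2) \<le>
     ennreal (s * (norm w)\<^sup>2) * (\<integral>\<^sup>+\<tau>. ennreal (grad_sq v (x + \<tau> *\<^sub>R w)) * indicator {0..s} \<tau> \<partial>lborel)"
proof -
  let ?p = "\<lambda>\<tau>. x + \<tau> *\<^sub>R w"
  define f where "f \<tau> = frechet_derivative v (at (?p \<tau>)) w" for \<tau>
  have vd: "(v has_derivative frechet_derivative v (at y)) (at y)" if "y \<in> S" for y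
    using v that unfolding Ck_on_1 by (simp add: frechet_derivative_works)
  have lin: "linear (frechet_derivative v (at y))" if "y \<in> S" for y
    using vd[OF that] by (rule has_derivative_linear)
  have D: "((\<lambda>\<tau>. v (?p \<tau>)) has_vector_derivative f \<tau>) (at \<tau> within {0..s})" if "\<tau> \<in> {0..s}" for \<tau>
  proof -
    have "?p \<tau> \<in> S" using that seg by auto
    have "(?p has_derivative (\<lambda>h. h *\<^sub>R w)) (at \<tau> within {0..s})"
      by (auto intro!: derivative_eq_intros)
    from has_derivative_compose[OF this vd[OF \<open>?p \<tau> \<in> S\<close>]]
    have "((\<lambda>\<tau>. v (?p \<tau>)) has_derivative (\<lambda>h. frechet_derivative v (at (?p \<tau>)) (h *\<^sub>R w))) (at \<tau> within {0..s})" .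
    then show ?thesis
      using lin[OF \<open>?p \<tau> \<in> S\<close>] by (simp add: has_vector_derivative_def f_def linear_cmul)
  qed
  have I: "(f has_integral (v (?p s) - v (?p 0))) {0..s}"
    using fundamental_theorem_of_calculus[of 0 s "\<lambda>\<tau>. v (?p \<tau>)" f] s D by auto
  have cp: "continuous_on {0..s} ?p" by (intro continuous_on_add continuous_on_const continuous_on_scaleR continuous_on_id)
  have sub: "?p ` {0..s} \<subseteq> S" using seg by auto
  have feq: "f \<tau> = (\<Sum>b\<in>Basis. (w \<bullet> b) * frechet_derivative v (at (?p \<tau>)) b)" if "\<tau> \<in> {0..s}" for \<tau>
    unfolding f_def using that by (intro linear_eq_sum_Basis lin seg) auto
  have sc: "continuous_on {0..s} (\<lambda>\<tau>. \<Sum>b\<in>Basis. (w \<bullet> b) * frechet_derivative v (at (?p \<tau>)) b)"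
  proof (intro continuous_on_sum continuous_on_mult_left)
    fix b :: 'a assume "b \<in> Basis"
    then have "continuous_on S (\<lambda>y. frechet_derivative v (at y) b)" using v unfolding Ck_on_1 by auto
    then show "continuous_on {0..s} (\<lambda>\<tau>. frechet_derivative v (at (?p \<tau>)) b)"
      using cp sub by (rule continuous_on_compose2)
  qed
  have fc: "continuous_on {0..s} f" by (rule continuous_on_eq[OF sc]) (simp add: feq)
  have gc: "continuous_on {0..s} (\<lambda>\<tau>. grad_sq v (?p \<tau>))"
    using continuous_on_grad_sq[OF v] cp sub by (rule continuous_on_compose2)
  have "(v (?p s) - v x)\<^sup>2 \<le> s * integral {0..s} (\<lambda>t. (f t)\<^sup>2)"
    using sq_integral_le[OF s fc I] by simp
  also have "integral {0..s} (\<lambda>t. (f t)\<^sup>2) \<le> integral {0..s} (\<lambda>t. (norm w)\<^sup>2 * grad_sq v (?p t))"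
  proof (rule integral_le)
    show "(\<lambda>t. (f t)\<^sup>2) integrable_on {0..s}"
      using fc by (intro integrable_continuous_real continuous_on_power)
    show "(\<lambda>t. (norm w)\<^sup>2 * grad_sq v (?p t)) integrable_on {0..s}"
      using gc by (intro integrable_continuous_real continuous_on_mult_left)
    show "(f t)\<^sup>2 \<le> (norm w)\<^sup>2 * grad_sq v (?p t)" if "t \<in> {0..s}" for t
      unfolding f_def grad_sq_def using that by (intro directional_derivative_sq_le lin seg) auto
  qed
  also have "\<dots> = (norm w)\<^sup>2 * integral {0..s} (\<lambda>t. grad_sq v (?p t))" by simp
  finally have *: "(v (?p s) - v x)\<^sup>2 \<le> s * (norm w)\<^sup>2 * integral {0..s} (\<lambda>t. grad_sq v (?p t))"
    using s by (simp add: mult.assoc)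
  have "(\<integral>\<^sup>+\<tau>. ennreal (indicator {0..s} \<tau> * grad_sq v (?p \<tau>)) \<partial>lborel) = ennreal (integral {0..s} (\<lambda>t. grad_sq v (?p t)))"
    by (rule nn_integral_has_integral_lebesgue) (use gc in \<open>auto intro!: integrable_integral integrable_continuous_real\<close>)
  moreover have "ennreal (indicator {0..s} \<tau> * grad_sq v (?p \<tau>)) = ennreal (grad_sq v (?p \<tau>)) * indicator {0..s} \<tau>" for \<tau>
    by (auto simp: indicator_def)
  ultimately have "(\<integral>\<^sup>+\<tau>. ennreal (grad_sq v (?p \<tau>)) * indicator {0..s} \<tau> \<partial>lborel) = ennreal (integral {0..s} (\<lambda>t. grad_sq v (?p t)))"
    by simp
  moreover have "0 \<le> integral {0..s} (\<lambda>t. grad_sq v (?p t))"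
    by (rule integral_nonneg) (use gc in \<open>auto intro!: integrable_continuous_real\<close>)
  ultimately show ?thesis
    using * s by (simp add: ennreal_mult'[symmetric] ennreal_leI)
qed

lemma nn_integral_lborel_affine:
  fixes f :: "'a::euclidean_space \<Rightarrow> ennreal"
  assumes [measurable]: "f \<in> borel_measurable borel" and c: "c \<noteq> 0"
  shows "(\<integral>\<^sup>+x. f x \<partial>lborel) = ennreal (\<bar>c\<bar> ^ DIM('a)) * (\<integral>\<^sup>+x. f (t + c *\<^sub>R x) \<partial>lborel)"
  by (subst lborel_affine[OF c, of t]) (simp add: nn_integral_density nn_integral_distr nn_integral_cmult)

lemma nn_integral_lborel_affine_le:
  fixes f :: "'a::euclidean_space \<Rightarrow> ennreal"
  assumes f: "f \<in> borel_measurable borel" and c: "1/2 \<le> c"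
  shows "(\<integral>\<^sup>+x. f (t + c *\<^sub>R x) \<partial>lborel) \<le> ennreal (2 ^ DIM('a)) * (\<integral>\<^sup>+x. f x \<partial>lborel)"
proof -
  have "1 = (2 * (1/2) :: real) ^ DIM('a)" by simp
  also have "\<dots> \<le> (2 * \<bar>c\<bar>) ^ DIM('a)" using c by (intro power_mono mult_left_mono) auto
  finally have "1 \<le> ennreal (2 ^ DIM('a)) * ennreal (\<bar>c\<bar> ^ DIM('a))"
    by (simp add: ennreal_mult[symmetric] power_mult_distrib)
  then have "1 * (\<integral>\<^sup>+x. f (t + c *\<^sub>R x) \<partial>lborel)
     \<le> (ennreal (2 ^ DIM('a)) * ennreal (\<bar>c\<bar> ^ DIM('a))) * (\<integral>\<^sup>+x. f (t + c *\<^sub>R x) \<partial>lborel)"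
    by (rule mult_right_mono) simp
  then show ?thesis
    using nn_integral_lborel_affine[OF f, of c t] c by (simp add: mult.assoc)
qed

lemma measurable_continuous_on_indicator_ennreal:
  fixes f :: "'a::euclidean_space \<Rightarrow> real"
  assumes "open D" "continuous_on D f"
  shows "(\<lambda>x. ennreal (f x) * indicator D x) \<in> borel_measurable borel"
proof -
  have "(\<lambda>x. indicator D x *\<^sub>R f x) \<in> borel_measurable borel"
    using assms by (intro borel_measurable_continuous_on_indicator) auto
  then have "(\<lambda>x. ennreal (indicator D x *\<^sub>R f x)) \<in> borel_measurable borel" by (rule measurable_compose) simp
  moreover have "ennreal (indicator D x *\<^sub>R f x) = ennreal (f x) * indicator D x" for x
    by (auto simp: indicator_def)
  ultimately show ?thesis by simp
qed

text \<open>
  The increment between $x$ and $y$ is bounded by the gradient along the segment; convexity keeps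
  the segment in \<open>D\<close>. After Fubini the inner integral at parameter $\tau$ is taken over
  $y + \tau(x - y)$: for $\tau \ge 1/2$ substitute in $x$, otherwise in $y$, so that the Jacobian
  never exceeds $2^d$.
\<close>

lemma poincare_double_integral:
  fixes v :: "'a::euclidean_space \<Rightarrow> real"
  assumes D: "open D" "convex D" and v: "Ck_on 1 D v"
    and \<delta>: "\<And>x y. x \<in> D \<Longrightarrow> y \<in> D \<Longrightarrow> dist x y \<le> \<delta>"
  shows "(\<integral>\<^sup>+y. (\<integral>\<^sup>+x. ennreal ((v x - v y)\<^sup>2) * indicator D x \<partial>lborel) * indicator D y \<partial>lborel)
     \<le> ennreal (\<delta>\<^sup>2) * (ennreal (2 ^ DIM('a)) * emeasure lborel D * (\<integral>\<^sup>+x. ennreal (grad_sq v x) * indicator D x \<partial>lborel))"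
proof -
  define G where "G z = ennreal (grad_sq v z) * indicator D z" for z
  have G[measurable]: "G \<in> borel_measurable borel"
    unfolding G_def[abs_def] by (rule measurable_continuous_on_indicator_ennreal[OF D(1) continuous_on_grad_sq[OF v]])
  have [measurable]: "D \<in> sets borel" using D by simp
  let ?I = "\<integral>\<^sup>+z. G z \<partial>lborel"
  \<comment> \<open>Increments are bounded by the gradient on the segment, extended by zero outside \<open>D\<close>.\<close>
  have pt: "ennreal ((v x - v y)\<^sup>2) \<le> ennreal (\<delta>\<^sup>2) * (\<integral>\<^sup>+\<tau>. G (y + \<tau> *\<^sub>R (x - y)) * indicator {0..1} \<tau> \<partial>lborel)"
    if "x \<in> D" "y \<in> D" for x y
  proof -
    have seg: "y + \<tau> *\<^sub>R (x - y) \<in> D" if "0 \<le> \<tau>" "\<tau> \<le> 1" for \<tau>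
    proof -
      have "(1 - \<tau>) *\<^sub>R y + \<tau> *\<^sub>R x \<in> D"
        using convexD_alt[OF D(2) \<open>y \<in> D\<close> \<open>x \<in> D\<close> that] .
      then show ?thesis by (simp add: algebra_simps)
    qed
    have "ennreal ((v x - v y)\<^sup>2) = ennreal ((v (y + 1 *\<^sub>R (x - y)) - v y)\<^sup>2)" by simp
    also have "\<dots> \<le> ennreal (1 * (norm (x - y))\<^sup>2) * (\<integral>\<^sup>+\<tau>. ennreal (grad_sq v (y + \<tau> *\<^sub>R (x - y))) * indicator {0..1} \<tau> \<partial>lborel)"
      by (rule segment_increment_sq_le[OF v]) (use seg in auto)
    also have "\<dots> \<le> ennreal (\<delta>\<^sup>2) * (\<integral>\<^sup>+\<tau>. G (y + \<tau> *\<^sub>R (x - y)) * indicator {0..1} \<tau> \<partial>lborel)"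
    proof (rule mult_mono)
      show "ennreal (1 * (norm (x - y))\<^sup>2) \<le> ennreal (\<delta>\<^sup>2)"
        using \<delta>[OF that] by (intro ennreal_leI) (simp add: dist_norm power_mono)
      show "(\<integral>\<^sup>+\<tau>. ennreal (grad_sq v (y + \<tau> *\<^sub>R (x - y))) * indicator {0..1} \<tau> \<partial>lborel)
         \<le> (\<integral>\<^sup>+\<tau>. G (y + \<tau> *\<^sub>R (x - y)) * indicator {0..1} \<tau> \<partial>lborel)"
      proof (rule nn_integral_mono)
        fix \<tau> :: real
        show "ennreal (grad_sq v (y + \<tau> *\<^sub>R (x - y))) * indicator {0..1} \<tau> \<le> G (y + \<tau> *\<^sub>R (x - y)) * indicator {0..1} \<tau>"
          using seg[of \<tau>] by (auto simp: G_def indicator_def)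
      qed
    qed auto
    finally show ?thesis .
  qed
  have J: "(\<integral>\<^sup>+y. (\<integral>\<^sup>+x. G (y + \<tau> *\<^sub>R (x - y)) * indicator D x \<partial>lborel) * indicator D y \<partial>lborel)
     \<le> ennreal (2 ^ DIM('a)) * emeasure lborel D * ?I" if \<tau>: "0 \<le> \<tau>" "\<tau> \<le> 1" for \<tau>
  proof (cases "1/2 \<le> \<tau>")
    case True
    have "(\<integral>\<^sup>+x. G (y + \<tau> *\<^sub>R (x - y)) * indicator D x \<partial>lborel) \<le> ennreal (2 ^ DIM('a)) * ?I" for y
    proof -
      have "(\<integral>\<^sup>+x. G (y + \<tau> *\<^sub>R (x - y)) * indicator D x \<partial>lborel) \<le> (\<integral>\<^sup>+x. G ((y - \<tau> *\<^sub>R y) + \<tau> *\<^sub>R x) \<partial>lborel)"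
        by (intro nn_integral_mono) (auto simp: indicator_def algebra_simps)
      also have "\<dots> \<le> ennreal (2 ^ DIM('a)) * ?I" by (rule nn_integral_lborel_affine_le[OF G True])
      finally show ?thesis .
    qed
    then have "(\<integral>\<^sup>+y. (\<integral>\<^sup>+x. G (y + \<tau> *\<^sub>R (x - y)) * indicator D x \<partial>lborel) * indicator D y \<partial>lborel)
       \<le> (\<integral>\<^sup>+y. ennreal (2 ^ DIM('a)) * ?I * indicator D y \<partial>lborel)"
      by (intro nn_integral_mono mult_right_mono) auto
    also have "\<dots> = ennreal (2 ^ DIM('a)) * ?I * emeasure lborel D" by (simp add: nn_integral_cmult_indicator)
    finally show ?thesis by (simp add: mult_ac)
  next
    case False
    have "(\<integral>\<^sup>+y. (\<integral>\<^sup>+x. G (y + \<tau> *\<^sub>R (x - y)) * indicator D x \<partial>lborel) * indicator D y \<partial>lborel)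
      = (\<integral>\<^sup>+y. (\<integral>\<^sup>+x. G (y + \<tau> *\<^sub>R (x - y)) * indicator D x * indicator D y \<partial>lborel) \<partial>lborel)"
      by (simp add: nn_integral_multc)
    also have "\<dots> = (\<integral>\<^sup>+x. (\<integral>\<^sup>+y. G (y + \<tau> *\<^sub>R (x - y)) * indicator D x * indicator D y \<partial>lborel) \<partial>lborel)"
      by (rule lborel_pair.Fubini') measurable
    also have "\<dots> \<le> (\<integral>\<^sup>+x. ennreal (2 ^ DIM('a)) * ?I * indicator D x \<partial>lborel)"
    proof (rule nn_integral_mono)
      fix x :: 'a
      have "(\<integral>\<^sup>+y. G (y + \<tau> *\<^sub>R (x - y)) * indicator D x * indicator D y \<partial>lborel)
         \<le> (\<integral>\<^sup>+y. G (\<tau> *\<^sub>R x + (1 - \<tau>) *\<^sub>R y) * indicator D x \<partial>lborel)"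
        by (intro nn_integral_mono) (auto simp: indicator_def algebra_simps)
      also have "\<dots> = (\<integral>\<^sup>+y. G (\<tau> *\<^sub>R x + (1 - \<tau>) *\<^sub>R y) \<partial>lborel) * indicator D x" by (simp add: nn_integral_multc)
      also have "\<dots> \<le> ennreal (2 ^ DIM('a)) * ?I * indicator D x"
        using False by (intro mult_right_mono nn_integral_lborel_affine_le[OF G]) auto
      finally show "(\<integral>\<^sup>+y. G (y + \<tau> *\<^sub>R (x - y)) * indicator D x * indicator D y \<partial>lborel) \<le> ennreal (2 ^ DIM('a)) * ?I * indicator D x" .
    qed
    also have "\<dots> = ennreal (2 ^ DIM('a)) * ?I * emeasure lborel D" by (simp add: nn_integral_cmult_indicator)
    finally show ?thesis by (simp add: mult_ac)
  qed
  have "(\<integral>\<^sup>+y. (\<integral>\<^sup>+x. ennreal ((v x - v y)\<^sup>2) * indicator D x \<partial>lborel) * indicator D y \<partial>lborel)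
    \<le> (\<integral>\<^sup>+y. (\<integral>\<^sup>+x. ennreal (\<delta>\<^sup>2) * (\<integral>\<^sup>+\<tau>. G (y + \<tau> *\<^sub>R (x - y)) * indicator {0..1} \<tau> \<partial>lborel) * indicator D x \<partial>lborel) * indicator D y \<partial>lborel)"
  proof (rule nn_integral_mono)
    fix y
    show "(\<integral>\<^sup>+x. ennreal ((v x - v y)\<^sup>2) * indicator D x \<partial>lborel) * indicator D y
      \<le> (\<integral>\<^sup>+x. ennreal (\<delta>\<^sup>2) * (\<integral>\<^sup>+\<tau>. G (y + \<tau> *\<^sub>R (x - y)) * indicator {0..1} \<tau> \<partial>lborel) * indicator D x \<partial>lborel) * indicator D y"
      using pt[of _ y] by (cases "y \<in> D") (auto intro!: nn_integral_mono simp: indicator_def)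
  qed
  also have "\<dots> = (\<integral>\<^sup>+y. (\<integral>\<^sup>+x. (\<integral>\<^sup>+\<tau>. ennreal (\<delta>\<^sup>2) * (G (y + \<tau> *\<^sub>R (x - y)) * indicator D x * indicator D y * indicator {0..1} \<tau>) \<partial>lborel) \<partial>lborel) \<partial>lborel)"
    by (simp add: nn_integral_multc[symmetric] nn_integral_cmult[symmetric] mult_ac)
  also have "\<dots> = ennreal (\<delta>\<^sup>2) * (\<integral>\<^sup>+y. (\<integral>\<^sup>+x. (\<integral>\<^sup>+\<tau>. G (y + \<tau> *\<^sub>R (x - y)) * indicator D x * indicator D y * indicator {0..1} \<tau> \<partial>lborel) \<partial>lborel) \<partial>lborel)"
    by (simp add: nn_integral_cmult)
  also have "(\<integral>\<^sup>+y. (\<integral>\<^sup>+x. (\<integral>\<^sup>+\<tau>. G (y + \<tau> *\<^sub>R (x - y)) * indicator D x * indicator D y * indicator {0..1::real} \<tau> \<partial>lborel) \<partial>lborel) \<partial>lborel)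
     = (\<integral>\<^sup>+y. (\<integral>\<^sup>+\<tau>. (\<integral>\<^sup>+x. G (y + \<tau> *\<^sub>R (x - y)) * indicator D x * indicator D y * indicator {0..1::real} \<tau> \<partial>lborel) \<partial>lborel) \<partial>lborel)"
    by (intro nn_integral_cong lborel_pair.Fubini') measurable
  also have "\<dots> = (\<integral>\<^sup>+\<tau>. (\<integral>\<^sup>+y. (\<integral>\<^sup>+x. G (y + \<tau> *\<^sub>R (x - y)) * indicator D x * indicator D y * indicator {0..1::real} \<tau> \<partial>lborel) \<partial>lborel) \<partial>lborel)"
    by (rule lborel_pair.Fubini') measurable
  also have "\<dots> = (\<integral>\<^sup>+\<tau>. (\<integral>\<^sup>+y. (\<integral>\<^sup>+x. G (y + \<tau> *\<^sub>R (x - y)) * indicator D x \<partial>lborel) * indicator D y \<partial>lborel) * indicator {0..1::real} \<tau> \<partial>lborel)"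
    by (simp add: nn_integral_multc)
  also have "\<dots> \<le> (\<integral>\<^sup>+\<tau>. ennreal (2 ^ DIM('a)) * emeasure lborel D * ?I * indicator {0..1::real} \<tau> \<partial>lborel)"
    using J by (intro nn_integral_mono) (auto simp: indicator_def)
  also have "\<dots> = ennreal (2 ^ DIM('a)) * emeasure lborel D * ?I"
    by (simp add: nn_integral_cmult_indicator)
  finally show ?thesis unfolding G_def by (simp add: mult_left_mono)
qed

lemma nn_integral_sq_lebesgue_on:
  assumes "S \<in> sets lebesgue"
  shows "(\<integral>\<^sup>+x. ennreal (f x) * indicator S x \<partial>lborel) = (\<integral>\<^sup>+x. ennreal (f x) \<partial>lebesgue_on S)"
proof -
  have "(\<integral>\<^sup>+x. ennreal (f x) \<partial>lebesgue_on S) = (\<integral>\<^sup>+x. ennreal (f x) * indicator S x \<partial>lebesgue)"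
    using assms by (intro nn_integral_restrict_space) auto
  then show ?thesis by (simp add: nn_integral_completion)
qed

lemma L2_norm_sq_nn_integral:
  assumes "u \<in> L2_space S" "S \<in> sets lebesgue"
  shows "(\<integral>\<^sup>+x. ennreal ((u x)\<^sup>2) * indicator S x \<partial>lborel) = ennreal ((L2_norm S u)\<^sup>2)"
  unfolding nn_integral_sq_lebesgue_on[OF assms(2)] L2_norm_sq_integral
  using assms(1) by (intro nn_integral_eq_integral) (auto simp: L2_space_def)

lemma L2_norm_sq_le_nn_integral:
  assumes u: "u \<in> borel_measurable (lebesgue_on S)" and S: "S \<in> sets lebesgue" and c: "0 \<le> c"
    and le: "(\<integral>\<^sup>+x. ennreal ((u x)\<^sup>2) * indicator S x \<partial>lborel) \<le> ennreal c"
  shows "u \<in> L2_space S" "(L2_norm S u)\<^sup>2 \<le> c"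
proof -
  have "(\<integral>\<^sup>+x. ennreal ((u x)\<^sup>2) \<partial>lebesgue_on S) < \<infinity>"
    using le unfolding nn_integral_sq_lebesgue_on[OF S] by (simp add: le_less_trans)
  moreover have "(\<lambda>x. (u x)\<^sup>2) \<in> borel_measurable (lebesgue_on S)" using u by simp
  ultimately have "integrable (lebesgue_on S) (\<lambda>x. (u x)\<^sup>2)"
    by (intro integrableI_nonneg) auto
  then show "u \<in> L2_space S" using u by (simp add: L2_space_def)
  from L2_norm_sq_nn_integral[OF this S] le c show "(L2_norm S u)\<^sup>2 \<le> c" by simp
qed

definition grad_energy :: "'a::euclidean_space set \<Rightarrow> ('a \<Rightarrow> real) \<Rightarrow> real" where
  "grad_energy S v = (\<Sum>b\<in>Basis. (L2_norm S (\<lambda>x. frechet_derivative v (at x) b))\<^sup>2)"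

lemma grad_energy_nonneg [simp]: "0 \<le> grad_energy S v"
  by (simp add: grad_energy_def sum_nonneg)

lemma nn_integral_grad_sq:
  fixes v :: "'a::euclidean_space \<Rightarrow> real"
  assumes S: "S \<in> sets lebesgue"
    and g: "\<And>b. b \<in> Basis \<Longrightarrow> (\<lambda>x. frechet_derivative v (at x) b) \<in> L2_space S"
  shows "(\<integral>\<^sup>+x. ennreal (grad_sq v x) * indicator S x \<partial>lborel) = ennreal (grad_energy S v)"
proof -
  have "(\<integral>\<^sup>+x. ennreal (grad_sq v x) \<partial>lebesgue_on S)
      = ennreal (\<integral>x. grad_sq v x \<partial>lebesgue_on S)"
    unfolding grad_sq_def using g
    by (intro nn_integral_eq_integral Bochner_Integration.integrable_sum L2_spaceD) (auto intro!: AE_I2 sum_nonneg)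
  also have "(\<integral>x. grad_sq v x \<partial>lebesgue_on S) = grad_energy S v"
    unfolding grad_sq_def grad_energy_def L2_norm_sq_integral
    using g by (intro Bochner_Integration.integral_sum) (auto simp: L2_space_def)
  finally show ?thesis using nn_integral_sq_lebesgue_on[OF S] by simp
qed

text \<open>
  If every $k = v(y)$ failed the bound, then so would the average over $y \in D$, contradicting
  the double integral estimate. Picking a value of \<open>v\<close> rather than its mean lets the proof conclude
  that $v - k$ is square integrable instead of assuming it.
\<close>

lemma poincare_constant:
  fixes v :: "'a::euclidean_space \<Rightarrow> real"
  assumes D: "open D" "convex D" "D \<noteq> {}" and v: "Ck_on 1 D v"
    and \<delta>: "\<And>x y. x \<in> D \<Longrightarrow> y \<in> D \<Longrightarrow> dist x y \<le> \<delta>"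
    and g: "\<And>b. b \<in> Basis \<Longrightarrow> (\<lambda>x. frechet_derivative v (at x) b) \<in> L2_space D"
  shows "\<exists>k. (\<lambda>x. v x - k) \<in> L2_space D \<and> (L2_norm D (\<lambda>x. v x - k))\<^sup>2 \<le> 2 ^ DIM('a) * \<delta>\<^sup>2 * grad_energy D v"
proof -
  define M where "M = 2 ^ DIM('a) * \<delta>\<^sup>2 * grad_energy D v"
  have M: "0 \<le> M" by (simp add: M_def)
  have vc: "continuous_on D v" using Ck_on_Suc[of 0 D v] v by simp
  obtain x0 where x0: "x0 \<in> D" using D by auto
  have "D \<subseteq> cball x0 \<delta>" using \<delta>[OF x0] by auto
  then have bD: "bounded D" using bounded_cball bounded_subset by blast
  have fin: "emeasure lborel D < \<infinity>" using emeasure_bounded_finite[OF bD] .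
  have "D \<notin> null_sets lebesgue"
    using open_not_negligible[OF D(1,3)] by (simp add: negligible_iff_null_sets)
  then have pos: "0 < emeasure lborel D"
    using D(1) by (auto simp: null_sets_def zero_less_iff_neq_zero)
  define I where "I y = (\<integral>\<^sup>+x. ennreal ((v x - v y)\<^sup>2) * indicator D x \<partial>lborel)" for y
  have le: "(\<integral>\<^sup>+y. I y * indicator D y \<partial>lborel) \<le> ennreal M * emeasure lborel D"
    using poincare_double_integral[OF D(1,2) v \<delta>] nn_integral_grad_sq[OF _ g] D(1)
    by (simp add: I_def M_def ennreal_mult mult_ac)
  \<comment> \<open>Some point is not worse than the average.\<close>
  have "\<exists>y\<in>D. I y \<le> ennreal M"
  proof (rule ccontr)
    assume "\<not> (\<exists>y\<in>D. I y \<le> ennreal M)"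
    then have gt: "ennreal M < I y" if "y \<in> D" for y using that by (auto simp: not_le)
    let ?w = "\<lambda>x. indicator D x *\<^sub>R v x"
    have wm[measurable]: "?w \<in> borel_measurable borel"
      using vc D(1) by (intro borel_measurable_continuous_on_indicator) auto
    have [measurable]: "D \<in> sets borel" using D by simp
    define I' where "I' y = (\<integral>\<^sup>+x. ennreal ((?w x - ?w y)\<^sup>2) * indicator D x \<partial>lborel)" for y
    have I'm: "I' \<in> borel_measurable borel" unfolding I'_def[abs_def] by measurable
    have II': "I y * indicator D y = I' y * indicator D y" for y
      by (cases "y \<in> D") (auto simp: I_def I'_def intro!: nn_integral_cong simp: indicator_def)
    have "(\<integral>\<^sup>+y. ennreal M * indicator D y \<partial>lborel) < (\<integral>\<^sup>+y. I' y * indicator D y \<partial>lborel)"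
    proof (rule nn_integral_less)
      show "(\<lambda>y. ennreal M * indicator D y) \<in> borel_measurable lborel" by simp
      show "(\<lambda>y. I' y * indicator D y) \<in> borel_measurable lborel" using I'm by simp
      show "(\<integral>\<^sup>+y. ennreal M * indicator D y \<partial>lborel) \<noteq> \<infinity>"
        using fin by (simp add: nn_integral_cmult_indicator ennreal_mult_eq_top_iff)
      show "AE y in lborel. ennreal M * indicator D y \<le> I' y * indicator D y"
      proof (rule AE_I2)
        fix y show "ennreal M * indicator D y \<le> I' y * indicator D y"
          using gt[of y] II'[of y] by (cases "y \<in> D") auto
      qed
      show "\<not> (AE y in lborel. I' y * indicator D y \<le> ennreal M * indicator D y)"
      proof
        assume "AE y in lborel. I' y * indicator D y \<le> ennreal M * indicator D y"
        then have "AE y in lborel. y \<notin> D"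
        proof (rule AE_mp, intro AE_I2 impI)
          fix y assume "I' y * indicator D y \<le> ennreal M * indicator D y"
          then show "y \<notin> D" using gt[of y] II'[of y] by (cases "y \<in> D") auto
        qed
        then have "emeasure lborel D = 0"
          using D(1) by (subst (asm) AE_iff_measurable[of D]) auto
        then show False using pos by simp
      qed
    qed
    then show False using le by (simp add: II' nn_integral_cmult_indicator)
  qed
  then obtain y where y: "y \<in> D" "I y \<le> ennreal M" by blast
  have "(\<lambda>x. v x - v y) \<in> borel_measurable (lebesgue_on D)"
    using vc D(1) by (intro continuous_imp_measurable_on_sets_lebesgue continuous_on_diff continuous_on_const) auto
  then show ?thesis
    using L2_norm_sq_le_nn_integral[of "\<lambda>x. v x - v y" D M] D(1) M y
    unfolding I_def M_def by (intro exI[of _ "v y"]) auto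
qed

lemma L2_space_const:
  assumes "emeasure lebesgue A < \<infinity>" "A \<in> sets lebesgue"
  shows "(\<lambda>x. c) \<in> L2_space A"
  using assms by (simp add: L2_space_def integrable_restrict_space)

lemma L2_norm_sq_const:
  assumes "A \<in> sets lebesgue"
  shows "(L2_norm A (\<lambda>x. c))\<^sup>2 = c\<^sup>2 * measure lebesgue A"
  using assms by (simp add: L2_norm_sq_integral measure_restrict_space)

lemma L2_norm_sq_subset_le:
  assumes "u \<in> L2_space S" "T \<subseteq> S" "T \<in> sets lebesgue" "S \<in> sets lebesgue"
  shows "(L2_norm T u)\<^sup>2 \<le> (L2_norm S u)\<^sup>2"
  unfolding L2_norm_sq_integral
  by (rule integral_mono_lebesgue_on_AE) (use assms in \<open>auto simp: L2_space_def\<close>)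

lemma grad_energy_mono:
  fixes v :: "'a::euclidean_space \<Rightarrow> real"
  assumes "\<And>b. b \<in> Basis \<Longrightarrow> (\<lambda>x. frechet_derivative v (at x) b) \<in> L2_space S"
    and "T \<subseteq> S" "T \<in> sets lebesgue" "S \<in> sets lebesgue"
  shows "grad_energy T v \<le> grad_energy S v"
  unfolding grad_energy_def using assms by (intro sum_mono L2_norm_sq_subset_le)

text \<open>
  Two constants that both approximate \<open>v\<close> on a set of positive measure are close to each other;
  this is how means over different elements are compared.
\<close>

lemma constants_overlap:
  assumes A: "A \<in> sets lebesgue" "emeasure lebesgue A < \<infinity>"
    and k: "(\<lambda>x. v x - k) \<in> L2_space A" and k': "(\<lambda>x. v x - k') \<in> L2_space A"
  shows "(k - k')\<^sup>2 * measure lebesgue A \<le> 2 * (L2_norm A (\<lambda>x. v x - k))\<^sup>2 + 2 * (L2_norm A (\<lambda>x. v x - k'))\<^sup>2"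
proof -
  have "(k - k')\<^sup>2 * measure lebesgue A = (L2_norm A (\<lambda>x. 1 * (v x - k') + (-1) * (v x - k)))\<^sup>2"
    using L2_norm_sq_const[OF A(1), of "k - k'"] by simp
  also have "\<dots> \<le> 2 * 1\<^sup>2 * (L2_norm A (\<lambda>x. v x - k'))\<^sup>2 + 2 * (-1)\<^sup>2 * (L2_norm A (\<lambda>x. v x - k))\<^sup>2"
    by (rule L2_norm_sq_lincomb_le[OF k' k])
  finally show ?thesis by simp
qed

section \<open>A Friedrichs inequality on half balls\<close>

text \<open>
  Each point of the small ball around $c + (r/2)n$ is joined to the flat part of the boundary by
  a segment in direction $-n$ that stays in the half ball. As \<open>v\<close> tends to zero at the end of the
  segment, $v(x)$ is the integral of the gradient along it. The points on the boundary are only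
  approached, never used as arguments of \<open>v\<close>.
\<close>

lemma friedrichs_nn_integral:
  fixes v :: "'a::euclidean_space \<Rightarrow> real"
  assumes S: "open S" and v: "Ck_on 1 S v" and n: "norm n = 1" and r: "0 < r"
    and H: "{x \<in> ball c r. 0 < (x - c) \<bullet> n} \<subseteq> S"
    and van: "\<And>y. y \<in> ball c r \<Longrightarrow> (y - c) \<bullet> n = 0 \<Longrightarrow> (v \<longlongrightarrow> 0) (at y within S)"
  shows "(\<integral>\<^sup>+x. ennreal ((v x)\<^sup>2) * indicator (ball (c + (r/2) *\<^sub>R n) (r/4)) x \<partial>lborel)
     \<le> ennreal (r\<^sup>2) * (\<integral>\<^sup>+x. ennreal (grad_sq v x) * indicator {x \<in> ball c r. 0 < (x - c) \<bullet> n} x \<partial>lborel)"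
proof -
  let ?H = "{x \<in> ball c r. 0 < (x - c) \<bullet> n}" and ?A = "ball (c + (r/2) *\<^sub>R n) (r/4)"
  have oH: "open ?H"
  proof -
    have "?H = ball c r \<inter> {x. n \<bullet> c < n \<bullet> x}" by (auto simp: inner_diff_left inner_commute[of n])
    then show ?thesis by (simp add: open_Int open_halfspace_gt)
  qed
  define G where "G z = ennreal (grad_sq v z) * indicator ?H z" for z
  have vH: "Ck_on 1 ?H v" using v H by (rule Ck_on_subset)
  have G[measurable]: "G \<in> borel_measurable borel"
    unfolding G_def[abs_def] by (rule measurable_continuous_on_indicator_ennreal[OF oH continuous_on_grad_sq[OF vH]])
  have nn: "n \<bullet> n = 1" using n by (simp add: dot_square_norm)
  have pt: "ennreal ((v x)\<^sup>2) \<le> ennreal r * (\<integral>\<^sup>+\<tau>. G (x - \<tau> *\<^sub>R n) * indicator {0..r} \<tau> \<partial>lborel)"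
    (is "_ \<le> ennreal r * ?R") if x: "x \<in> ?A" for x
  proof -
    define h where "h = (x - c) \<bullet> n"
    define p where "p = x - c - (r/2) *\<^sub>R n"
    have p: "norm p < r/4" using x by (simp add: p_def dist_norm norm_minus_commute algebra_simps)
    have "h = p \<bullet> n + r/2" by (simp add: h_def p_def inner_diff_left nn)
    moreover have "\<bar>p \<bullet> n\<bar> \<le> norm p" using Cauchy_Schwarz_ineq2[of p n] n by simp
    ultimately have h: "r/4 < h" "h < 3*r/4" using p by auto
    have inball: "x - s *\<^sub>R n \<in> ball c r" if "0 \<le> s" "s \<le> h" for s
    proof -
      have "x - s *\<^sub>R n - c = p + (r/2 - s) *\<^sub>R n" by (simp add: p_def algebra_simps)
      then have "norm (x - s *\<^sub>R n - c) \<le> norm p + \<bar>r/2 - s\<bar>"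
        using norm_triangle_ineq[of p "(r/2 - s) *\<^sub>R n"] n by simp
      also have "\<dots> < r" using p that h r by (auto simp: abs_if)
      finally show ?thesis by (simp add: dist_norm norm_minus_commute)
    qed
    have hs: "(x - s *\<^sub>R n - c) \<bullet> n = h - s" for s by (simp add: h_def inner_diff_left nn)
    have bd: "ennreal ((v x - v (x - s *\<^sub>R n))\<^sup>2) \<le> ennreal r * ?R" if s: "0 < s" "s < h" for s
    proof -
      have seg: "x + \<tau> *\<^sub>R (- n) \<in> ?H" if "0 \<le> \<tau>" "\<tau> \<le> s" for \<tau>
        using inball[of \<tau>] hs[of \<tau>] that s by auto
      have "ennreal ((v x - v (x - s *\<^sub>R n))\<^sup>2) = ennreal ((v (x + s *\<^sub>R (- n)) - v x)\<^sup>2)"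
        by (simp add: power2_commute)
      also have "\<dots> \<le> ennreal (s * (norm (- n))\<^sup>2) * (\<integral>\<^sup>+\<tau>. ennreal (grad_sq v (x + \<tau> *\<^sub>R (- n))) * indicator {0..s} \<tau> \<partial>lborel)"
        by (rule segment_increment_sq_le[OF vH s(1) seg])
      also have "\<dots> \<le> ennreal r * ?R"
      proof (rule mult_mono)
        show "ennreal (s * (norm (- n))\<^sup>2) \<le> ennreal r" using s h n r by (intro ennreal_leI) simp
        show "(\<integral>\<^sup>+\<tau>. ennreal (grad_sq v (x + \<tau> *\<^sub>R (- n))) * indicator {0..s} \<tau> \<partial>lborel) \<le> ?R"
        proof (rule nn_integral_mono)
          fix \<tau> :: real
          show "ennreal (grad_sq v (x + \<tau> *\<^sub>R (- n))) * indicator {0..s} \<tau> \<le> G (x - \<tau> *\<^sub>R n) * indicator {0..r} \<tau>"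
            using seg[of \<tau>] s h r by (auto simp: G_def indicator_def)
        qed
      qed auto
      finally show ?thesis .
    qed
    show ?thesis
    proof (cases "?R = \<infinity>")
      case True
      then show ?thesis using r by (simp add: ennreal_mult_top)
    next
      case False
      then obtain \<rho> where \<rho>: "0 \<le> \<rho>" "?R = ennreal \<rho>" by (metis ennreal_cases infinity_ennreal_def)
      have bd': "(v x - v (x - s *\<^sub>R n))\<^sup>2 \<le> r * \<rho>" if "0 < s" "s < h" for s
        using bd[OF that] r \<rho> by (simp add: ennreal_mult[symmetric])
      let ?y = "x - h *\<^sub>R n"
      have "?y \<in> ball c r" "(?y - c) \<bullet> n = 0" using inball[of h] hs[of h] h r by auto
      then have lim: "(v \<longlongrightarrow> 0) (at ?y within S)" by (rule van)
      have "filterlim (\<lambda>s. x - s *\<^sub>R n) (at ?y within S) (at_left h)"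
        unfolding filterlim_at
      proof
        have "((\<lambda>s. x - s *\<^sub>R n) \<longlongrightarrow> x - h *\<^sub>R n) (at_left h)" by (intro tendsto_intros)
        then show "((\<lambda>s. x - s *\<^sub>R n) \<longlongrightarrow> ?y) (at_left h)" .
        have "\<forall>\<^sub>F s in at_left h. s \<in> {0<..<h}"
          using h r by (intro eventually_at_left_real) auto
        then show "\<forall>\<^sub>F s in at_left h. x - s *\<^sub>R n \<in> S \<and> x - s *\<^sub>R n \<noteq> ?y"
        proof eventually_elim
          case (elim s)
          have "x - s *\<^sub>R n \<in> ?H" using inball[of s] hs[of s] elim by auto
          moreover have "n \<noteq> 0" using n by auto
          ultimately show ?case using H elim by auto
        qed
      qed
      then have "((\<lambda>s. v (x - s *\<^sub>R n)) \<longlongrightarrow> 0) (at_left h)" by (rule filterlim_compose[OF lim])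
      then have "((\<lambda>s. (v x - v (x - s *\<^sub>R n))\<^sup>2) \<longlongrightarrow> (v x - 0)\<^sup>2) (at_left h)"
        by (intro tendsto_intros)
      moreover have "\<forall>\<^sub>F s in at_left h. (v x - v (x - s *\<^sub>R n))\<^sup>2 \<le> r * \<rho>"
        using eventually_at_left_real[of 0 h] h r bd' by (auto elim!: eventually_mono)
      ultimately have "(v x - 0)\<^sup>2 \<le> r * \<rho>"
        by (intro tendsto_upperbound) auto
      then show ?thesis using \<rho> r by (simp add: ennreal_mult[symmetric] ennreal_leI)
    qed
  qed
  have "(\<integral>\<^sup>+x. ennreal ((v x)\<^sup>2) * indicator ?A x \<partial>lborel)
     \<le> (\<integral>\<^sup>+x. (ennreal r * (\<integral>\<^sup>+\<tau>. G (x - \<tau> *\<^sub>R n) * indicator {0..r} \<tau> \<partial>lborel)) \<partial>lborel)"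
  proof (rule nn_integral_mono)
    fix x show "ennreal ((v x)\<^sup>2) * indicator ?A x \<le> ennreal r * (\<integral>\<^sup>+\<tau>. G (x - \<tau> *\<^sub>R n) * indicator {0..r} \<tau> \<partial>lborel)"
      using pt[of x] by (cases "x \<in> ?A") auto
  qed
  also have "\<dots> = ennreal r * (\<integral>\<^sup>+x. (\<integral>\<^sup>+\<tau>. G (x - \<tau> *\<^sub>R n) * indicator {0..r} \<tau> \<partial>lborel) \<partial>lborel)"
    by (simp add: nn_integral_cmult)
  also have "(\<integral>\<^sup>+x. (\<integral>\<^sup>+\<tau>. G (x - \<tau> *\<^sub>R n) * indicator {0..r} \<tau> \<partial>lborel) \<partial>lborel)
     = (\<integral>\<^sup>+\<tau>. (\<integral>\<^sup>+x. G (x - \<tau> *\<^sub>R n) * indicator {0..r} \<tau> \<partial>lborel) \<partial>lborel)"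
    by (rule lborel_pair.Fubini') measurable
  also have "\<dots> = (\<integral>\<^sup>+\<tau>. (\<integral>\<^sup>+x. G x \<partial>lborel) * indicator {0..r} \<tau> \<partial>lborel)"
  proof (rule nn_integral_cong)
    fix \<tau> :: real
    have "(\<integral>\<^sup>+x. G (x - \<tau> *\<^sub>R n) \<partial>lborel) = (\<integral>\<^sup>+x. G x \<partial>lborel)"
      using nn_integral_lborel_affine[OF G, of 1 "- \<tau> *\<^sub>R n"] by simp
    then show "(\<integral>\<^sup>+x. G (x - \<tau> *\<^sub>R n) * indicator {0..r} \<tau> \<partial>lborel) = (\<integral>\<^sup>+x. G x \<partial>lborel) * indicator {0..r} \<tau>"
      by (simp add: nn_integral_multc)
  qed
  also have "\<dots> = (\<integral>\<^sup>+x. G x \<partial>lborel) * ennreal r"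
    using r by (simp add: nn_integral_cmult_indicator)
  finally show ?thesis
    using r by (simp add: G_def power2_eq_square ennreal_mult mult_ac)
qed

lemma friedrichs_half_ball:
  fixes v :: "'a::euclidean_space \<Rightarrow> real"
  assumes S: "open S" and v: "Ck_on 1 S v" and n: "norm n = 1" and r: "0 < r"
    and H: "{x \<in> ball c r. 0 < (x - c) \<bullet> n} \<subseteq> S"
    and van: "\<And>y. y \<in> ball c r \<Longrightarrow> (y - c) \<bullet> n = 0 \<Longrightarrow> (v \<longlongrightarrow> 0) (at y within S)"
    and vL2: "v \<in> L2_space S"
    and g: "\<And>b. b \<in> Basis \<Longrightarrow> (\<lambda>x. frechet_derivative v (at x) b) \<in> L2_space S"
  shows "(L2_norm (ball (c + (r/2) *\<^sub>R n) (r/4)) v)\<^sup>2 \<le> r\<^sup>2 * grad_energy {x \<in> ball c r. 0 < (x - c) \<bullet> n} v"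
proof -
  let ?H = "{x \<in> ball c r. 0 < (x - c) \<bullet> n}" and ?A = "ball (c + (r/2) *\<^sub>R n) (r/4)"
  have H': "?H = ball c r \<inter> {x. n \<bullet> c < n \<bullet> x}" by (auto simp: inner_diff_left inner_commute[of n])
  have Hm: "?H \<in> sets lebesgue" unfolding H' by (simp add: open_Int open_halfspace_gt)
  have nn: "n \<bullet> n = 1" using n by (simp add: dot_square_norm)
  have AH: "?A \<subseteq> ?H"
  proof
    fix x assume x: "x \<in> ?A"
    define p where "p = x - c - (r/2) *\<^sub>R n"
    have p: "norm p < r/4" using x by (simp add: p_def dist_norm norm_minus_commute algebra_simps)
    have "(x - c) \<bullet> n = p \<bullet> n + r/2" by (simp add: p_def inner_diff_left nn)
    moreover have "\<bar>p \<bullet> n\<bar> \<le> norm p" using Cauchy_Schwarz_ineq2[of p n] n by simp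
    moreover have "norm (x - c) \<le> norm p + r/2"
      using norm_triangle_ineq[of p "(r/2) *\<^sub>R n"] n r by (simp add: p_def)
    ultimately show "x \<in> ?H" using p r by (auto simp: dist_norm norm_minus_commute)
  qed
  have gH: "(\<lambda>x. frechet_derivative v (at x) b) \<in> L2_space ?H" if "b \<in> Basis" for b
    using L2_space_subset[OF g[OF that] H Hm] S by simp
  have vA: "v \<in> L2_space ?A" using L2_space_subset[OF vL2, of ?A] AH H S by auto
  show ?thesis
  proof (rule L2_norm_sq_le_nn_integral(2))
    show "v \<in> borel_measurable (lebesgue_on ?A)" using vA by (rule L2_spaceD)
    show "(\<integral>\<^sup>+x. ennreal ((v x)\<^sup>2) * indicator ?A x \<partial>lborel) \<le> ennreal (r\<^sup>2 * grad_energy ?H v)"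
      using friedrichs_nn_integral[OF S v n r H van] nn_integral_grad_sq[OF Hm gH]
      by (simp add: ennreal_mult)
  qed auto
qed

section \<open>Simplices and barycentric coordinates\<close>

definition open_simplex :: "'a::euclidean_space set \<Rightarrow> bool" where
  "open_simplex T \<longleftrightarrow> (\<exists>S. int DIM('a) simplex S \<and> T = interior S)"

lemma open_simplex_vertices:
  fixes T :: "'a::euclidean_space set"
  assumes "open_simplex T"
  shows "finite (vertices_of T)" "card (vertices_of T) = DIM('a) + 1"
    "\<not> affine_dependent (vertices_of T)" "closure T = convex hull (vertices_of T)"
    "T = interior (convex hull (vertices_of T))" "T \<noteq> {}"
proof -
  obtain C where C: "\<not> affine_dependent C" "int (card C) = int DIM('a) + 1" "T = interior (convex hull C)"
    using assms by (auto simp: open_simplex_def simplex_def)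
  have cC: "card C = Suc DIM('a)" using C(2) by linarith
  have fC: "finite C" using aff_independent_finite[OF C(1)] .
  show ne: "T \<noteq> {}" using interior_convex_hull_eq_empty[OF cC] C(1,3) by simp
  have "closure T = closure (convex hull C)"
    unfolding C(3) using ne C(3) by (intro convex_closure_interior convex_convex_hull) auto
  also have "\<dots> = convex hull C"
    using fC by (simp add: compact_imp_closed finite_imp_compact_convex_hull)
  finally have cl: "closure T = convex hull C" .
  have "vertices_of T = C"
    unfolding vertices_of_def cl using extreme_point_of_convex_hull_affine_independent[OF C(1)] by auto
  then show "finite (vertices_of T)" "card (vertices_of T) = DIM('a) + 1"
    "\<not> affine_dependent (vertices_of T)" "closure T = convex hull (vertices_of T)"
    "T = interior (convex hull (vertices_of T))"
    using C cC fC cl by auto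
qed

lemma open_simplex_basic:
  assumes "open_simplex T"
  shows "open T" "convex T" "bounded T" "T \<in> sets lebesgue"
proof -
  note V = open_simplex_vertices[OF assms]
  show "open T" by (subst V(5)) simp
  then show "T \<in> sets lebesgue" by simp
  show "convex T" by (subst V(5)) (simp add: convex_interior)
  have "bounded (convex hull (vertices_of T))" using V(1) by (simp add: finite_imp_bounded_convex_hull)
  then show "bounded T" using interior_subset V(5) bounded_subset by metis
qed

text \<open>
  The barycentric coordinate of a simplex with respect to its vertex \<open>v\<close>, as an affine function
  on the whole space.
\<close>

definition bary :: "'a::euclidean_space set \<Rightarrow> 'a \<Rightarrow> 'a \<Rightarrow> real" where
  "bary T v = (SOME f. (\<exists>a \<beta>. f = (\<lambda>x. a \<bullet> x + \<beta>)) \<and> f v = 1 \<and> (\<forall>w\<in>vertices_of T - {v}. f w = 0))"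

lemma bary_props:
  fixes T :: "'a::euclidean_space set"
  assumes T: "open_simplex T" and v: "v \<in> vertices_of T"
  shows "\<exists>a \<beta>. bary T v = (\<lambda>x. a \<bullet> x + \<beta>)" "bary T v v = 1"
    "\<And>w. w \<in> vertices_of T \<Longrightarrow> w \<noteq> v \<Longrightarrow> bary T v w = 0"
proof -
  note V = open_simplex_vertices[OF T]
  let ?V = "vertices_of T"
  have ind: "\<not> affine_dependent (?V - {v})" using V(3) affine_dependent_subset by blast
  have "int (card (?V - {v})) = aff_dim (?V - {v}) + 1" using ind by (rule aff_dim_affine_independent)
  then have "aff_dim (?V - {v}) = int DIM('a) - 1" using V(1,2) v by simp
  then obtain a b where ab: "a \<noteq> 0" "affine hull (?V - {v}) = {x. a \<bullet> x = b}"
    using aff_dim_eq_hyperplane[of "?V - {v}"] by auto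
  have "v \<notin> affine hull (?V - {v})" using V(3) v by (auto simp: affine_dependent_def)
  then have nz: "a \<bullet> v - b \<noteq> 0" using ab by auto
  define f where "f x = (inverse (a \<bullet> v - b) *\<^sub>R a) \<bullet> x + (- b * inverse (a \<bullet> v - b))" for x
  have feq: "f x = (a \<bullet> x - b) * inverse (a \<bullet> v - b)" for x by (simp add: f_def algebra_simps)
  have "f v = 1" using nz by (simp add: feq)
  moreover have "f w = 0" if "w \<in> ?V - {v}" for w
    using that ab(2) hull_inc[of w "?V - {v}" affine] by (auto simp: feq)
  ultimately have "\<exists>f. (\<exists>a \<beta>. f = (\<lambda>x. a \<bullet> x + \<beta>)) \<and> f v = 1 \<and> (\<forall>w\<in>?V - {v}. f w = 0)"
    unfolding f_def[abs_def] by blast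
  from someI_ex[OF this]
  show "\<exists>a \<beta>. bary T v = (\<lambda>x. a \<bullet> x + \<beta>)" "bary T v v = 1"
    "\<And>w. w \<in> ?V \<Longrightarrow> w \<noteq> v \<Longrightarrow> bary T v w = 0"
    unfolding bary_def by auto
qed

lemma bary_kronecker:
  assumes "open_simplex T" "v \<in> vertices_of T" "w \<in> vertices_of T"
  shows "bary T v w = (if v = w then 1 else 0)"
  using bary_props[OF assms(1,2)] assms(3) by auto

lemma affine_fun_sum:
  fixes a :: "'a::euclidean_space"
  assumes "(\<Sum>v\<in>V. u v) = 1"
  shows "a \<bullet> (\<Sum>v\<in>V. u v *\<^sub>R v) + \<beta> = (\<Sum>v\<in>V. u v * (a \<bullet> v + \<beta>))"
proof -
  have "(\<Sum>v\<in>V. u v * (a \<bullet> v + \<beta>)) = (\<Sum>v\<in>V. u v * (a \<bullet> v)) + (\<Sum>v\<in>V. u v) * \<beta>"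
    by (simp add: distrib_left sum.distrib sum_distrib_right)
  then show ?thesis using assms by (simp add: inner_sum_right)
qed

lemma bary_sum:
  fixes T :: "'a::euclidean_space set"
  assumes T: "open_simplex T"
  shows "(\<Sum>v\<in>vertices_of T. bary T v x) = 1" "(\<Sum>v\<in>vertices_of T. bary T v x *\<^sub>R v) = x"
proof -
  note V = open_simplex_vertices[OF T]
  let ?V = "vertices_of T"
  have "affine hull ?V = UNIV" using V(2,3) by (intro affine_independent_span_eq) auto
  then obtain u where u: "sum u ?V = 1" "(\<Sum>v\<in>?V. u v *\<^sub>R v) = x"
    using affine_hull_finite[OF V(1)] by blast
  have "bary T v x = u v" if v: "v \<in> ?V" for v
  proof -
    obtain a \<beta> where ab: "bary T v = (\<lambda>x. a \<bullet> x + \<beta>)" using bary_props(1)[OF T v] by blast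
    have "bary T v x = (\<Sum>w\<in>?V. u w * bary T v w)"
      unfolding ab u(2)[symmetric] by (rule affine_fun_sum[OF u(1)])
    also have "\<dots> = (\<Sum>w\<in>?V. if w = v then u w else 0)"
      by (rule sum.cong[OF refl]) (simp add: bary_kronecker[OF T v])
    also have "\<dots> = u v" using V(1) v by simp
    finally show ?thesis .
  qed
  then show "(\<Sum>v\<in>?V. bary T v x) = 1" "(\<Sum>v\<in>?V. bary T v x *\<^sub>R v) = x"
    using u by (simp_all cong: sum.cong)
qed

lemma affine_fun_bary:
  assumes "open_simplex T"
  shows "a \<bullet> x + \<beta> = (\<Sum>v\<in>vertices_of T. bary T v x * (a \<bullet> v + \<beta>))"
  using affine_fun_sum[OF bary_sum(1)[OF assms, of x], of a \<beta>] bary_sum(2)[OF assms, of x] by simp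

lemma mem_closure_simplex_iff:
  assumes T: "open_simplex T"
  shows "x \<in> closure T \<longleftrightarrow> (\<forall>v\<in>vertices_of T. 0 \<le> bary T v x)"
proof
  note V = open_simplex_vertices[OF T]
  let ?V = "vertices_of T"
  show "x \<in> closure T" if "\<forall>v\<in>?V. 0 \<le> bary T v x"
  proof -
    have "\<exists>u. (\<forall>w\<in>?V. 0 \<le> u w) \<and> sum u ?V = 1 \<and> (\<Sum>w\<in>?V. u w *\<^sub>R w) = x"
      using that bary_sum[OF T, of x] by (intro exI[of _ "\<lambda>v. bary T v x"] conjI)
    then show ?thesis unfolding V(4) convex_hull_finite[OF V(1)] by (rule CollectI)
  qed
  assume "x \<in> closure T"
  then obtain u where u: "\<forall>w\<in>?V. 0 \<le> u w" "sum u ?V = 1" "(\<Sum>v\<in>?V. u v *\<^sub>R v) = x"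
    unfolding V(4) convex_hull_finite[OF V(1)] by (elim CollectE exE conjE)
  show "\<forall>v\<in>?V. 0 \<le> bary T v x"
  proof
    fix v assume v: "v \<in> ?V"
    obtain a \<beta> where ab: "bary T v = (\<lambda>x. a \<bullet> x + \<beta>)" using bary_props(1)[OF T v] by blast
    have "bary T v x = (\<Sum>w\<in>?V. u w * bary T v w)"
      unfolding ab u(3)[symmetric] by (rule affine_fun_sum[OF u(2)])
    also have "0 \<le> \<dots>" using u(1) by (intro sum_nonneg) (simp add: bary_kronecker[OF T v])
    finally show "0 \<le> bary T v x" .
  qed
qed

lemma bary_continuous:
  assumes "open_simplex T" "v \<in> vertices_of T"
  shows "continuous_on A (bary T v)"
proof -
  obtain a \<beta> where ab: "bary T v = (\<lambda>x. a \<bullet> x + \<beta>)" using bary_props(1)[OF assms] by blast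
  show ?thesis unfolding ab by (intro continuous_on_add continuous_on_inner continuous_on_const continuous_on_id)
qed

lemma mem_simplex_iff:
  assumes T: "open_simplex T"
  shows "x \<in> T \<longleftrightarrow> (\<forall>v\<in>vertices_of T. 0 < bary T v x)"
proof
  note V = open_simplex_vertices[OF T] and B = open_simplex_basic[OF T]
  let ?V = "vertices_of T"
  let ?U = "\<Inter>v\<in>?V. {x. 0 < bary T v x}"
  have "open ?U"
    using bary_continuous[OF T] V(1) by (intro open_INT) (auto intro!: open_Collect_less continuous_on_const)
  moreover have "?U \<subseteq> convex hull ?V"
    unfolding V(4)[symmetric] by (auto simp: mem_closure_simplex_iff[OF T] less_imp_le)
  ultimately have "?U \<subseteq> T" using V(5) interior_maximal by metis
  then show "x \<in> T" if "\<forall>v\<in>?V. 0 < bary T v x" using that by auto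
  assume x: "x \<in> T"
  show "\<forall>v\<in>?V. 0 < bary T v x"
  proof
    fix v assume v: "v \<in> ?V"
    obtain a \<beta> where ab: "bary T v = (\<lambda>x. a \<bullet> x + \<beta>)" using bary_props(1)[OF T v] by blast
    obtain \<rho> where \<rho>: "\<rho> > 0" "cball x \<rho> \<subseteq> T" using B(1) x by (meson open_contains_cball)
    have "x + (\<rho> / dist v x) *\<^sub>R (x - v) \<in> T" if "v \<noteq> x"
      using \<rho> that by (intro subsetD[OF \<rho>(2)]) (simp add: dist_norm norm_minus_commute)
    moreover define t where "t = \<rho> / dist v x"
    ultimately have "0 \<le> bary T v (x + t *\<^sub>R (x - v))" if "v \<noteq> x"
      using that closure_subset mem_closure_simplex_iff[OF T] v by blast
    moreover have "bary T v (x + t *\<^sub>R (x - v)) = (1 + t) * bary T v x - t * bary T v v"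
      unfolding ab by (simp add: inner_add_right inner_diff_right algebra_simps)
    moreover have "0 < t" if "v \<noteq> x" using \<rho> that by (simp add: t_def)
    ultimately have "0 < bary T v x" if "v \<noteq> x"
    proof -
      have "0 < t" using \<open>v \<noteq> x \<Longrightarrow> 0 < t\<close> that by blast
      moreover have "t \<le> (1 + t) * bary T v x"
        using \<open>v \<noteq> x \<Longrightarrow> 0 \<le> bary T v (x + t *\<^sub>R (x - v))\<close>[OF that]
          \<open>bary T v (x + t *\<^sub>R (x - v)) = (1 + t) * bary T v x - t * bary T v v\<close> bary_props(2)[OF T v] by simp
      ultimately have "0 < (1 + t) * bary T v x" by linarith
      then show ?thesis using \<open>0 < t\<close> by (simp add: zero_less_mult_iff)
    qed
    then show "0 < bary T v x" using bary_props(2)[OF T v] by (cases "v = x") auto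
  qed
qed

lemma bary_le_1:
  assumes T: "open_simplex T" and v: "v \<in> vertices_of T" and x: "x \<in> closure T"
  shows "bary T v x \<le> 1"
proof -
  have "bary T v x \<le> (\<Sum>w\<in>vertices_of T. bary T w x)"
    using x mem_closure_simplex_iff[OF T] v open_simplex_vertices(1)[OF T]
    by (intro member_le_sum) auto
  then show ?thesis using bary_sum(1)[OF T] by simp
qed

text \<open>
  On a ball of radius $r$ inside \<open>T\<close> a barycentric coordinate varies by at most 1, while an affine
  function with gradient $a$ varies by $2r|a|$ there.
\<close>

lemma bary_grad_bound:
  assumes T: "open_simplex T" and v: "v \<in> vertices_of T" and r: "0 < r" and b: "ball x r \<subseteq> T"
    and a: "bary T v = (\<lambda>x. a \<bullet> x + \<beta>)"
  shows "norm a \<le> 1 / (2 * r)"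
proof (rule ccontr)
  assume "\<not> norm a \<le> 1 / (2 * r)"
  then have 1: "1 / (2 * r) < norm a" by simp
  moreover have "0 < 1 / (2 * r)" using r by simp
  ultimately have na2: "0 < norm a" by linarith
  have "1 < norm a * (2 * r)" using 1 r by (simp add: divide_less_eq)
  then have na1: "1 / (2 * norm a) < r" using na2 by (simp add: divide_less_eq mult_ac)
  note na = na1 na2
  define \<rho> where "\<rho> = (1 / (2 * norm a) + r) / 2"
  have \<rho>1: "1 / (2 * norm a) < \<rho>" using na(1) unfolding \<rho>_def by argo
  have \<rho>2: "\<rho> < r" using na(1) unfolding \<rho>_def by argo
  have "0 < 1 / (2 * norm a)" using na(2) by simp
  then have \<rho>3: "0 < \<rho>" using \<rho>1 by linarith
  note \<rho> = \<rho>1 \<rho>2 \<rho>3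
  define e where "e = (\<rho> / norm a) *\<^sub>R a"
  have "norm e < r" using \<rho> na by (simp add: e_def)
  then have "x + e \<in> T" "x - e \<in> T" using b by (auto simp: dist_norm subset_iff)
  then have "bary T v (x + e) \<le> 1" "0 < bary T v (x - e)"
    using bary_le_1[OF T v] closure_subset mem_simplex_iff[OF T] v by blast+
  moreover have "bary T v (x + e) - bary T v (x - e) = 2 * \<rho> * norm a"
  proof -
    have "a \<bullet> e = \<rho> * norm a" using na by (simp add: e_def dot_square_norm power2_eq_square)
    then show ?thesis by (simp add: a inner_add_right inner_diff_right)
  qed
  ultimately have "2 * \<rho> * norm a < 1" by linarith
  then show False using \<rho>(1) na(2) by (simp add: field_simps)
qed

lemma bary_lipschitz:
  assumes T: "open_simplex T" and v: "v \<in> vertices_of T" and r: "0 < r" and b: "ball x r \<subseteq> T"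
  shows "\<bar>bary T v y - bary T v z\<bar> \<le> norm (y - z) / (2 * r)"
proof -
  obtain a \<beta> where ab: "bary T v = (\<lambda>x. a \<bullet> x + \<beta>)" using bary_props(1)[OF T v] by blast
  have "\<bar>bary T v y - bary T v z\<bar> = \<bar>a \<bullet> (y - z)\<bar>" by (simp add: ab inner_diff_right)
  also have "\<dots> \<le> norm a * norm (y - z)" by (rule Cauchy_Schwarz_ineq2)
  also have "\<dots> \<le> 1 / (2 * r) * norm (y - z)"
    by (rule mult_right_mono[OF bary_grad_bound[OF T v r b ab]]) simp
  finally show ?thesis by simp
qed

text \<open>
  The barycentric coordinate of \<open>v\<close> drops from 1 to 0 along the edge, at a rate of at most $1/(2r)$.
\<close>

lemma simplex_edge_length:
  assumes T: "open_simplex T" and r: "0 < r" and b: "ball x r \<subseteq> T"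
    and v: "v \<in> vertices_of T" "w \<in> vertices_of T" "v \<noteq> w"
  shows "2 * r \<le> dist v w"
proof -
  have "1 \<le> norm (v - w) / (2 * r)"
    using bary_lipschitz[OF T v(1) r b, of v w] bary_kronecker[OF T v(1)] v by simp
  then show ?thesis using r by (simp add: field_simps dist_norm)
qed

lemma facet_of_simplex:
  assumes T: "open_simplex T" and F: "F facet_of closure T"
  obtains v where "v \<in> vertices_of T" "F = convex hull (vertices_of T - {v})"
    "F = {x \<in> closure T. bary T v x = 0}"
proof -
  note V = open_simplex_vertices[OF T]
  let ?V = "vertices_of T"
  obtain v where v: "v \<in> ?V" "F = convex hull (?V - {v})"
    using F unfolding V(4) facet_of_convex_hull_affine_independent[OF V(3)] by blast
  have "F = {x \<in> closure T. bary T v x = 0}"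
  proof safe
    fix x assume "x \<in> F"
    then have cl: "x \<in> closure T" unfolding v(2) V(4) by (meson hull_mono Diff_subset subsetD)
    then show "x \<in> closure T" .
    obtain u where u: "\<forall>w\<in>?V - {v}. 0 \<le> u w" "sum u (?V - {v}) = 1" "(\<Sum>w\<in>?V - {v}. u w *\<^sub>R w) = x"
      using \<open>x \<in> F\<close> V(1) unfolding v(2) by (auto simp: convex_hull_finite)
    obtain a \<beta> where ab: "bary T v = (\<lambda>x. a \<bullet> x + \<beta>)" using bary_props(1)[OF T v(1)] by blast
    have "bary T v x = (\<Sum>w\<in>?V - {v}. u w * bary T v w)"
      unfolding ab u(3)[symmetric] by (rule affine_fun_sum[OF u(2)])
    also have "\<dots> = 0" using bary_props(3)[OF T v(1)] by (intro sum.neutral) auto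
    finally show "bary T v x = 0" .
  next
    fix x assume x: "x \<in> closure T" "bary T v x = 0"
    have "(\<Sum>w\<in>?V - {v}. bary T w x) = 1" "(\<Sum>w\<in>?V - {v}. bary T w x *\<^sub>R w) = x"
      using bary_sum[OF T, of x] x(2) V(1) v(1) by (simp_all add: sum.remove[of ?V v])
    then show "x \<in> F" using x(1) V(1) unfolding v(2) mem_closure_simplex_iff[OF T]
      by (auto simp: convex_hull_finite intro!: exI[of _ "\<lambda>w. bary T w x"])
  qed
  then show ?thesis using that v by blast
qed

text \<open>
  Near a point $c$ of a facet at which the remaining barycentric coordinates are at least $\mu$,
  the simplex is a half space: by the Lipschitz bound these coordinates stay positive in the ball,
  so that only the sign of the coordinate vanishing at $c$ decides.
\<close>

lemma half_ball_in_simplex: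
  assumes T: "open_simplex T" and v: "v \<in> vertices_of T" and r: "0 < r" and b: "ball x r \<subseteq> T"
    and c: "bary T v c = 0" "\<And>w. w \<in> vertices_of T \<Longrightarrow> w \<noteq> v \<Longrightarrow> \<mu> \<le> bary T w c"
    and y: "y \<in> ball c (2 * r * \<mu>)"
  shows "w \<in> vertices_of T \<Longrightarrow> w \<noteq> v \<Longrightarrow> 0 < bary T w y"
    "0 < bary T v y \<Longrightarrow> y \<in> T" "bary T v y = 0 \<Longrightarrow> y \<in> closure T"
proof -
  show *: "0 < bary T w y" if w: "w \<in> vertices_of T" "w \<noteq> v" for w
  proof -
    have "bary T w c - bary T w y \<le> norm (c - y) / (2 * r)" using bary_lipschitz[OF T w(1) r b, of c y] by linarith
    also have "\<dots> < \<mu>" using y r by (simp add: dist_norm field_simps)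
    finally show ?thesis using c(2)[OF w] by linarith
  qed
  show "0 < bary T v y \<Longrightarrow> y \<in> T" unfolding mem_simplex_iff[OF T] using * by metis
  show "bary T v y = 0 \<Longrightarrow> y \<in> closure T" unfolding mem_closure_simplex_iff[OF T] using * less_imp_le order_refl by metis
qed

lemma bary_sign_normal:
  assumes T: "open_simplex T" and v: "v \<in> vertices_of T" and c: "bary T v c = 0"
  obtains n where "norm n = 1" "\<And>y. 0 < bary T v y \<longleftrightarrow> 0 < (y - c) \<bullet> n"
    "\<And>y. bary T v y = 0 \<longleftrightarrow> (y - c) \<bullet> n = 0"
proof -
  obtain a \<beta> where ab: "bary T v = (\<lambda>x. a \<bullet> x + \<beta>)" using bary_props(1)[OF T v] by blast
  have "a \<noteq> 0" using bary_props(2)[OF T v] c unfolding ab by auto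
  define n where "n = (1 / norm a) *\<^sub>R a"
  have "bary T v y = norm a * ((y - c) \<bullet> n)" for y
  proof -
    have "bary T v y = bary T v y - bary T v c" using c by simp
    also have "\<dots> = (y - c) \<bullet> a" by (simp add: ab inner_diff_right inner_commute[of _ a])
    finally show ?thesis using \<open>a \<noteq> 0\<close> by (simp add: n_def)
  qed
  moreover have "norm n = 1" using \<open>a \<noteq> 0\<close> by (simp add: n_def)
  ultimately show ?thesis using \<open>a \<noteq> 0\<close> by (intro that[of n]) (auto simp: zero_less_mult_iff)
qed

section \<open>Sets of codimension two do not disconnect\<close>

text \<open>
  Inside a ball two points can be joined via a third one, \<open>z\<close>: it suffices that \<open>z\<close> avoids
  the affine hulls of the removed sets with either end point, which are null sets by the dimension
  condition. A separation of the whole set then extends from the punctured balls to the balls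
  themselves, because the removed set is negligible.
\<close>

lemma connected_diff_codim2:
  fixes U :: "'a::euclidean_space set"
  assumes U: "open U" "connected U" and fin: "finite \<Z>"
    and Z: "\<And>Z. Z \<in> \<Z> \<Longrightarrow> closed Z" "\<And>Z. Z \<in> \<Z> \<Longrightarrow> aff_dim Z \<le> int DIM('a) - 2"
  shows "connected (U - \<Union>\<Z>)"
proof -
  define W where "W = \<Union>\<Z>"
  have cW: "closed W" unfolding W_def using fin Z(1) by (intro closed_Union) auto
  have neg: "negligible (affine hull (insert x Z))" if "Z \<in> \<Z>" for x Z
  proof -
    have "aff_dim (insert x Z) \<le> aff_dim Z + 1" by (simp add: aff_dim_insert)
    then have "aff_dim (affine hull (insert x Z)) < int DIM('a)" using Z(2)[OF that] by (simp add: aff_dim_affine_hull)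
    then obtain a b where "a \<noteq> 0" "affine hull (insert x Z) \<subseteq> {x. a \<bullet> x = b}"
      by (rule aff_lowdim_subset_hyperplane)
    then show ?thesis using negligible_hyperplane negligible_subset by blast
  qed
  have negW: "negligible W"
    unfolding W_def using fin
    by (intro negligible_Union) (auto intro: negligible_subset[OF neg[of _ 0]] hull_inc)
  have ball: "connected (ball p \<rho> - W)" for p :: 'a and \<rho>
  proof (subst connected_iff_connected_component, intro ballI)
    fix x y assume x: "x \<in> ball p \<rho> - W" and y: "y \<in> ball p \<rho> - W"
    \<comment> \<open>The intermediate point has to avoid this null set.\<close>
    define N where "N = (\<Union>Z\<in>\<Z>. affine hull (insert x Z) \<union> affine hull (insert y Z))"
    have "negligible N" unfolding N_def using fin neg by (intro negligible_Union) auto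
    moreover have "\<not> negligible (ball p \<rho>)"
      using x open_not_negligible[of "ball p \<rho>"] by blast
    ultimately obtain z where z: "z \<in> ball p \<rho>" "z \<notin> N" using negligible_subset by blast
    have seg: "closed_segment q z \<subseteq> ball p \<rho> - W" if q: "q \<in> ball p \<rho> - W" and qN: "\<And>Z. Z \<in> \<Z> \<Longrightarrow> z \<notin> affine hull (insert q Z)" for q
    proof
      fix m assume m: "m \<in> closed_segment q z"
      have "m \<in> ball p \<rho>" using closed_segment_subset[of q "ball p \<rho>" z] q z m by (auto simp: convex_ball)
      moreover have "m \<notin> W"
      proof
        assume "m \<in> W"
        then obtain Z where ZZ: "Z \<in> \<Z>" "m \<in> Z" by (auto simp: W_def)
        have "m \<noteq> q" using \<open>m \<in> W\<close> q by auto
        obtain t where t: "m = (1 - t) *\<^sub>R q + t *\<^sub>R z" "0 \<le> t" "t \<le> 1" using m by (auto simp: closed_segment_def)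
        have "t \<noteq> 0" using t \<open>m \<noteq> q\<close> by auto
        have "z = (1 - 1/t) *\<^sub>R q + (1/t) *\<^sub>R m" using \<open>t \<noteq> 0\<close> by (simp add: t(1) algebra_simps)
        moreover have "(1 - 1/t) *\<^sub>R q + (1/t) *\<^sub>R m \<in> affine hull (insert q Z)"
          using ZZ by (intro mem_affine[OF affine_affine_hull]) (auto intro: hull_inc)
        ultimately show False using qN[OF ZZ(1)] by simp
      qed
      ultimately show "m \<in> ball p \<rho> - W" by simp
    qed
    have "connected (closed_segment x z \<union> closed_segment y z)"
      by (intro connected_Un) (auto simp: connected_segment)
    moreover have "closed_segment x z \<union> closed_segment y z \<subseteq> ball p \<rho> - W"
      using seg[OF x] seg[OF y] z(2) unfolding N_def by blast
    ultimately show "connected_component (ball p \<rho> - W) x y"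
      unfolding connected_component_def by (intro exI[of _ "closed_segment x z \<union> closed_segment y z"]) auto
  qed
  have "connected (U - W)"
    unfolding connected_def
  proof (intro notI, elim exE conjE)
    fix A B assume AB: "open A" "open B" "U - W \<subseteq> A \<union> B" "A \<inter> B \<inter> (U - W) = {}"
      "A \<inter> (U - W) \<noteq> {}" "B \<inter> (U - W) \<noteq> {}"
    \<comment> \<open>The balls that lie in \<open>A\<close> except for removed points, which are filled in.\<close>
    define E where "E A = \<Union>{ball p \<rho> | p \<rho>. ball p \<rho> \<subseteq> U \<and> ball p \<rho> - W \<subseteq> A}" for A
    have "open (E A)" "open (E B)" by (auto simp: E_def)
    moreover have "U \<subseteq> E A \<union> E B"
    proof
      fix p assume "p \<in> U"
      then obtain \<rho> where \<rho>: "\<rho> > 0" "ball p \<rho> \<subseteq> U" using U(1) open_contains_ball by blast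
      have sub: "ball p \<rho> - W \<subseteq> A \<union> B" using AB(3) \<rho>(2) by blast
      have "A \<inter> B \<inter> (ball p \<rho> - W) = {}" using AB(4) \<rho>(2) by blast
      from connectedD[OF ball AB(1,2) this sub]
      have "ball p \<rho> - W \<subseteq> A \<or> ball p \<rho> - W \<subseteq> B" using sub by blast
      moreover have "p \<in> ball p \<rho>" using \<rho> by simp
      ultimately show "p \<in> E A \<union> E B" using \<rho>(2) unfolding E_def by blast
    qed
    moreover have "E A \<inter> E B \<inter> U = {}"
    proof (rule ccontr)
      assume "E A \<inter> E B \<inter> U \<noteq> {}"
      then obtain p1 r1 p2 r2 where p: "ball p1 r1 \<subseteq> U" "ball p1 r1 - W \<subseteq> A" "ball p2 r2 - W \<subseteq> B"
        "ball p1 r1 \<inter> ball p2 r2 \<noteq> {}" unfolding E_def by blast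
      then have "ball p1 r1 \<inter> ball p2 r2 \<subseteq> W" using AB(4) by blast
      then have "negligible (ball p1 r1 \<inter> ball p2 r2)" using negW negligible_subset by blast
      then show False using open_not_negligible[of "ball p1 r1 \<inter> ball p2 r2"] p(4) by auto
    qed
    moreover have "E A \<inter> U \<noteq> {}" if oA: "open A" and neA: "A \<inter> (U - W) \<noteq> {}" for A
    proof -
      from neA obtain p where p: "p \<in> A" "p \<in> U" by blast
      have "open (A \<inter> U)" using U(1) oA by (rule open_Int[rotated])
      then obtain \<rho> where \<rho>: "\<rho> > 0" "ball p \<rho> \<subseteq> A \<inter> U"
        using p by (meson IntI open_contains_ball)
      have "p \<in> ball p \<rho>" using \<rho> by simp
      moreover have "ball p \<rho> \<subseteq> U \<and> ball p \<rho> - W \<subseteq> A" using \<rho> by blast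
      ultimately have "p \<in> E A" unfolding E_def by blast
      then show ?thesis using p by blast
    qed
    moreover note AB(1,2,5,6)
    ultimately show False using connectedD[OF U(2), of "E A" "E B"] by blast
  qed
  then show ?thesis by (simp add: W_def)
qed

section \<open>Shape regular conforming partitions\<close>

text \<open>
  A single partition together with the regularity constant \<open>\<kappa>\<close>. All constants below are defined
  from \<open>\<kappa>\<close> and the dimension only (later also from the constants of the bubble functions), so
  that they are the same for all partitions of a family.
\<close>

locale mesh =
  fixes \<Omega> :: "'a::euclidean_space set" and \<T> :: "'a set set" and \<kappa> :: real
  assumes dom: "polytopal_domain \<Omega>"
    and conf: "conforming_partition \<Omega> \<T>"
    and \<kappa>: "0 < \<kappa>"
    and reg: "\<And>T. T \<in> \<T> \<Longrightarrow> shape_regular \<kappa> T"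
    and dim1: "\<And>T T'. DIM('a) = 1 \<Longrightarrow> T \<in> \<T> \<Longrightarrow> T' \<in> \<T> \<Longrightarrow>
        closure T \<inter> closure T' \<noteq> {} \<Longrightarrow> vol T \<le> \<kappa> * vol T'"
begin

definition star :: "'a \<Rightarrow> 'a set set" where
  "star \<nu> = {T \<in> \<T>. \<nu> \<in> closure T}"

text \<open>
  Neighbours that share a facet, that is, all vertices except one each.
\<close>

definition adj :: "'a set \<Rightarrow> 'a set \<Rightarrow> bool" where
  "adj T T' \<longleftrightarrow> T \<noteq> T' \<and> card (vertices_of T \<inter> vertices_of T') = DIM('a)"

lemma open_\<Omega>: "open \<Omega>" and bounded_\<Omega>: "bounded \<Omega>"
  using dom by (auto simp: polytopal_domain_def)

lemma \<Omega>_meas [simp]: "\<Omega> \<in> sets lebesgue"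
  using open_\<Omega> by simp

lemma \<Omega>_interior: "interior (closure \<Omega>) = \<Omega>"
  using dom by (auto simp: polytopal_domain_def)

lemma finite_\<T>: "finite \<T>"
  using conf by (simp add: conforming_partition_def)

lemma mesh_simplex: "T \<in> \<T> \<Longrightarrow> open_simplex T"
  using conf by (auto simp: conforming_partition_def open_simplex_def)

lemma mesh_subset: "T \<in> \<T> \<Longrightarrow> T \<subseteq> \<Omega>"
  using conf by (auto simp: conforming_partition_def)

lemma mesh_closure_subset: "T \<in> \<T> \<Longrightarrow> closure T \<subseteq> closure \<Omega>"
  by (simp add: closure_mono mesh_subset)

lemma mesh_disjoint: "T \<in> \<T> \<Longrightarrow> T' \<in> \<T> \<Longrightarrow> T \<noteq> T' \<Longrightarrow> T \<inter> T' = {}"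
  using conf by (auto simp: conforming_partition_def disjoint_def)

lemma mesh_cover: "closure \<Omega> = (\<Union>T\<in>\<T>. closure T)"
  using conf by (simp add: conforming_partition_def)

lemma mesh_meas [simp]: "T \<in> \<T> \<Longrightarrow> T \<in> sets lebesgue"
  using open_simplex_basic mesh_simplex by blast

lemma mesh_null: "\<Omega> - \<Union>\<T> \<in> null_sets lebesgue"
proof -
  have "\<Omega> - \<Union>\<T> \<subseteq> (\<Union>T\<in>\<T>. frontier T)"
  proof
    fix x assume x: "x \<in> \<Omega> - \<Union>\<T>"
    then have "x \<in> closure \<Omega>" using closure_subset by blast
    then obtain X where X: "X \<in> \<T>" "x \<in> closure X" unfolding mesh_cover by blast
    then have "x \<in> frontier X" using x interior_subset[of X] by (auto simp: frontier_def)
    then show "x \<in> (\<Union>T\<in>\<T>. frontier T)" using X(1) by blast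
  qed
  moreover have "negligible (\<Union>T\<in>\<T>. frontier T)"
    using finite_\<T> by (intro negligible_Union) (auto intro!: negligible_convex_frontier open_simplex_basic mesh_simplex)
  ultimately show ?thesis using negligible_subset negligible_iff_null_sets by blast
qed

lemma mesh_dist_le: "T \<in> \<T> \<Longrightarrow> x \<in> closure T \<Longrightarrow> y \<in> closure T \<Longrightarrow> dist x y \<le> diameter T"
  using diameter_bounded_bound[of "closure T" x y] open_simplex_basic(3)[OF mesh_simplex]
  by (simp add: bounded_closure diameter_closure)

lemma mesh_diameter_pos: "T \<in> \<T> \<Longrightarrow> 0 < diameter T"
proof -
  assume T: "T \<in> \<T>"
  obtain x r where r: "0 < r" "ball x r \<subseteq> T" using reg[OF T] by (auto simp: shape_regular_def)
  obtain b :: 'a where b: "b \<in> Basis" by (meson nonempty_Basis equals0I)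
  have "x \<in> T" "x + (r/2) *\<^sub>R b \<in> T" using r b by (auto intro!: subsetD[OF r(2)] simp: dist_norm)
  then have "dist x (x + (r/2) *\<^sub>R b) \<le> diameter T" using mesh_dist_le[OF T] closure_subset by blast
  then show ?thesis using r b by (simp add: dist_norm)
qed

lemma mesh_ball: assumes T: "T \<in> \<T>" obtains x where "ball x (diameter T / \<kappa>) \<subseteq> T"
proof -
  obtain x r where r: "0 < r" "ball x r \<subseteq> T" "diameter T \<le> \<kappa> * r" using reg[OF T] by (auto simp: shape_regular_def)
  have "diameter T / \<kappa> \<le> r" using r(3) \<kappa> by (simp add: divide_le_eq mult.commute)
  then show ?thesis using r(2) that[of x] subset_ball[of "diameter T / \<kappa>" r x] by blast
qed

definition \<omega> :: real where "\<omega> = unit_ball_vol (real DIM('a))"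

lemma \<omega>_pos: "0 < \<omega>" by (simp add: \<omega>_def)

lemma vol_ball: "0 \<le> r \<Longrightarrow> vol (ball (c::'a) r) = \<omega> * r ^ DIM('a)"
  by (simp add: \<omega>_def content_ball)

lemma mesh_lmeasurable: "T \<in> \<T> \<Longrightarrow> T \<in> lmeasurable"
  using open_simplex_basic[OF mesh_simplex] by (simp add: lmeasurable_open)

lemma mesh_emeasure: "T \<in> \<T> \<Longrightarrow> emeasure lebesgue T < \<infinity>"
  using mesh_lmeasurable fmeasurableD2 by (simp add: fmeasurable_def)

lemma mesh_vol_ge: assumes T: "T \<in> \<T>" shows "\<omega> * (diameter T / \<kappa>) ^ DIM('a) \<le> vol T"
proof -
  obtain x where x: "ball x (diameter T / \<kappa>) \<subseteq> T" using mesh_ball[OF T] .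
  have "vol (ball x (diameter T / \<kappa>)) \<le> vol T"
    using x mesh_lmeasurable[OF T] by (intro measure_mono_fmeasurable) auto
  then show ?thesis using vol_ball mesh_diameter_pos[OF T] \<kappa> by (simp add: less_imp_le)
qed

lemma mesh_vol_le: assumes T: "T \<in> \<T>" shows "vol T \<le> \<omega> * diameter T ^ DIM('a)"
proof -
  obtain x where x: "x \<in> T" using open_simplex_vertices(6)[OF mesh_simplex[OF T]] by blast
  have "T \<subseteq> cball x (diameter T)"
  proof
    fix y assume "y \<in> T"
    then show "y \<in> cball x (diameter T)" using mesh_dist_le[OF T, of x y] x closure_subset[of T] by auto
  qed
  then have "vol T \<le> vol (cball x (diameter T))"
    using mesh_meas[OF T] by (intro measure_mono_fmeasurable) auto
  also have "\<dots> = \<omega> * diameter T ^ DIM('a)"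
    using mesh_diameter_pos[OF T] by (simp add: \<omega>_def content_cball)
  finally show ?thesis .
qed

lemma mesh_vol_pos: "T \<in> \<T> \<Longrightarrow> 0 < vol T"
  using mesh_vol_ge mesh_diameter_pos \<kappa> \<omega>_pos by (meson divide_pos_pos less_le_trans mult_pos_pos zero_less_power)

definition star_card_bound :: nat where "star_card_bound = nat \<lceil>\<kappa> ^ DIM('a)\<rceil>"

lemma finite_star: "finite (star \<nu>)"
  using finite_\<T> by (simp add: star_def)

text \<open>
  Shrinking each element of the star towards the vertex \<open>\<nu>\<close> to the size $\varepsilon$ of the
  smallest one gives disjoint balls of radius $\varepsilon/\kappa$ inside the ball of radius
  $\varepsilon$ around \<open>\<nu>\<close>; compare volumes.
\<close>

lemma card_star_le: "card (star \<nu>) \<le> star_card_bound"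
proof (cases "star \<nu> = {}")
  case False
  define \<epsilon> where "\<epsilon> = Min (diameter ` star \<nu>)"
  have \<epsilon>: "0 < \<epsilon>" using False finite_star mesh_diameter_pos by (simp add: \<epsilon>_def star_def)
  have \<epsilon>le: "\<epsilon> \<le> diameter T" if "T \<in> star \<nu>" for T using that finite_star by (simp add: \<epsilon>_def)
  have "\<exists>c. ball c (\<epsilon> / \<kappa>) \<subseteq> T \<inter> cball \<nu> \<epsilon>" if T: "T \<in> star \<nu>" for T
  proof -
    have T': "T \<in> \<T>" "\<nu> \<in> closure T" using T by (auto simp: star_def)
    note B = open_simplex_basic[OF mesh_simplex[OF T'(1)]]
    have dp: "0 < diameter T" using mesh_diameter_pos[OF T'(1)] .
    obtain x where x: "ball x (diameter T / \<kappa>) \<subseteq> T" using mesh_ball[OF T'(1)] .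
    \<comment> \<open>The homothety with centre \<open>\<nu>\<close> and factor \<open>t\<close> maps \<open>T\<close> into itself.\<close>
    define t where "t = \<epsilon> / diameter T"
    have t: "0 < t" "t \<le> 1" "t * diameter T = \<epsilon>" using \<epsilon> \<epsilon>le[OF T] dp by (auto simp: t_def)
    have "ball (\<nu> + t *\<^sub>R (x - \<nu>)) (\<epsilon> / \<kappa>) \<subseteq> T \<inter> cball \<nu> \<epsilon>"
    proof
      fix y assume y: "y \<in> ball (\<nu> + t *\<^sub>R (x - \<nu>)) (\<epsilon> / \<kappa>)"
      define z where "z = \<nu> + (1/t) *\<^sub>R (y - \<nu>)"
      have yz: "y = \<nu> - t *\<^sub>R (\<nu> - z)" using t by (simp add: z_def)
      have "x - z = (1/t) *\<^sub>R (\<nu> + t *\<^sub>R (x - \<nu>) - y)" using t by (simp add: z_def algebra_simps)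
      then have "dist x z = (1/t) * dist (\<nu> + t *\<^sub>R (x - \<nu>)) y" using t by (simp add: dist_norm)
      also have "\<dots> < (1/t) * (\<epsilon> / \<kappa>)" using y t by (intro mult_strict_left_mono) auto
      also have "\<dots> = diameter T / \<kappa>" using t \<epsilon> by (simp add: field_simps flip: t(3))
      finally have z: "z \<in> T" using x by auto
      have "y \<in> interior T"
        unfolding yz using z B(1,2) t T'(2) by (intro mem_interior_closure_convex_shrink) (auto simp: interior_open)
      then have "y \<in> T" using interior_subset by blast
      moreover have "dist \<nu> y \<le> \<epsilon>"
      proof -
        have "dist \<nu> y = t * dist \<nu> z" using t by (simp add: yz dist_norm)
        also have "\<dots> \<le> t * diameter T"
          using mesh_dist_le[OF T'(1,2), of z] z closure_subset[of T] t by (intro mult_left_mono) auto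
        finally show ?thesis using t(3) by simp
      qed
      ultimately show "y \<in> T \<inter> cball \<nu> \<epsilon>" by simp
    qed
    then show ?thesis by blast
  qed
  then obtain c where c: "\<And>T. T \<in> star \<nu> \<Longrightarrow> ball (c T) (\<epsilon> / \<kappa>) \<subseteq> T \<inter> cball \<nu> \<epsilon>" by metis
  have dis: "disjoint_family_on (\<lambda>T. ball (c T) (\<epsilon> / \<kappa>)) (star \<nu>)"
    unfolding disjoint_family_on_def
  proof (intro ballI impI)
    fix T T' assume "T \<in> star \<nu>" "T' \<in> star \<nu>" "T \<noteq> T'"
    then show "ball (c T) (\<epsilon> / \<kappa>) \<inter> ball (c T') (\<epsilon> / \<kappa>) = {}"
      using c[of T] c[of T'] mesh_disjoint[of T T'] unfolding star_def by blast
  qed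
  have "(\<Sum>T\<in>star \<nu>. emeasure lborel (ball (c T) (\<epsilon> / \<kappa>))) = emeasure lborel (\<Union>T\<in>star \<nu>. ball (c T) (\<epsilon> / \<kappa>))"
    using dis finite_star by (intro sum_emeasure) auto
  also have "\<dots> \<le> emeasure lborel (cball \<nu> \<epsilon>)"
    using c by (intro emeasure_mono) auto
  finally have "(\<Sum>T\<in>star \<nu>. ennreal (\<omega> * (\<epsilon> / \<kappa>) ^ DIM('a))) \<le> ennreal (\<omega> * \<epsilon> ^ DIM('a))"
    using \<epsilon> \<kappa> by (simp add: emeasure_ball emeasure_cball \<omega>_def less_imp_le)
  then have "ennreal (real (card (star \<nu>)) * (\<omega> * (\<epsilon> / \<kappa>) ^ DIM('a))) \<le> ennreal (\<omega> * \<epsilon> ^ DIM('a))"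
    by (simp add: ennreal_mult' ennreal_of_nat_eq_real_of_nat)
  then have "real (card (star \<nu>)) * (\<omega> * (\<epsilon> / \<kappa>) ^ DIM('a)) \<le> \<omega> * \<epsilon> ^ DIM('a)"
    using \<omega>_pos \<epsilon> by simp
  then have "real (card (star \<nu>)) \<le> \<kappa> ^ DIM('a)"
    using \<omega>_pos \<epsilon> \<kappa> by (simp add: power_divide field_simps)
  then show ?thesis unfolding star_card_bound_def by linarith
qed simp

lemma vertex_shared:
  assumes T: "T \<in> \<T>" and T': "T' \<in> \<T>" and \<nu>: "\<nu> \<in> vertices_of T" "\<nu> \<in> closure T'"
  shows "\<nu> \<in> vertices_of T'"
proof -
  have tri: "triangulation (closure ` \<T>)" using conf by (simp add: conforming_partition_def)
  have "closure X \<inter> closure Y face_of closure X" if "X \<in> \<T>" "Y \<in> \<T>" for X Y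
    using tri that by (auto simp: triangulation_def)
  from this[OF T T'] this[OF T' T]
  have f: "closure T \<inter> closure T' face_of closure T" "closure T \<inter> closure T' face_of closure T'"
    by (simp_all add: Int_commute)
  have "\<nu> extreme_point_of closure T" using \<nu>(1) by (simp add: vertices_of_def)
  moreover have "\<nu> \<in> closure T" using calculation by (simp add: extreme_point_of_def)
  ultimately have "\<nu> extreme_point_of (closure T \<inter> closure T')"
    using extreme_point_of_face[OF f(1)] \<nu>(2) by blast
  then show ?thesis using extreme_point_of_face[OF f(2)] by (simp add: vertices_of_def)
qed

lemma vertex_in_closure: "\<nu> \<in> vertices_of T \<Longrightarrow> \<nu> \<in> closure T"
  by (simp add: vertices_of_def extreme_point_of_def)

lemma common_face:
  assumes T: "T \<in> \<T>" and T': "T' \<in> \<T>"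
  shows "closure T \<inter> closure T' = convex hull (vertices_of T \<inter> vertices_of T')"
proof -
  note V = open_simplex_vertices[OF mesh_simplex[OF T]] and V' = open_simplex_vertices[OF mesh_simplex[OF T']]
  have tri: "triangulation (closure ` \<T>)" using conf by (simp add: conforming_partition_def)
  have f: "closure T \<inter> closure T' face_of closure T" using tri T T' by (auto simp: triangulation_def)
  obtain c where c: "c \<subseteq> vertices_of T" "closure T \<inter> closure T' = convex hull c"
    using f unfolding V(4) face_of_convex_hull_affine_independent[OF V(3)] by blast
  have "c \<subseteq> vertices_of T'"
  proof
    fix w assume "w \<in> c"
    then have "w \<in> closure T \<inter> closure T'" unfolding c(2) by (rule hull_inc)
    then show "w \<in> vertices_of T'" using vertex_shared[OF T T'] \<open>w \<in> c\<close> c(1) by blast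
  qed
  then have "closure T \<inter> closure T' \<subseteq> convex hull (vertices_of T \<inter> vertices_of T')"
    unfolding c(2) using c(1) by (intro hull_mono) auto
  moreover have "convex hull (vertices_of T \<inter> vertices_of T') \<subseteq> closure T \<inter> closure T'"
    unfolding V(4) V'(4) using hull_mono[of "vertices_of T \<inter> vertices_of T'"] by blast
  ultimately show ?thesis by blast
qed

lemma common_vertices_card:
  assumes T: "T \<in> \<T>" and T': "T' \<in> \<T>" and ne: "T \<noteq> T'"
  shows "card (vertices_of T \<inter> vertices_of T') \<le> DIM('a)"
proof (rule ccontr)
  note V = open_simplex_vertices[OF mesh_simplex[OF T]] and V' = open_simplex_vertices[OF mesh_simplex[OF T']]
  assume "\<not> card (vertices_of T \<inter> vertices_of T') \<le> DIM('a)"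
  then have "card (vertices_of T) \<le> card (vertices_of T \<inter> vertices_of T')"
    "card (vertices_of T') \<le> card (vertices_of T \<inter> vertices_of T')" using V(2) V'(2) by auto
  then have "vertices_of T \<inter> vertices_of T' = vertices_of T" "vertices_of T \<inter> vertices_of T' = vertices_of T'"
    using card_seteq[OF V(1) Int_lower1] card_seteq[OF V'(1) Int_lower2] by blast+
  then have "vertices_of T = vertices_of T'" by simp
  then show False using ne V(5) V'(5) by metis
qed

text \<open>
  The intersection of two elements is the convex hull of their common vertices, of which there are
  at most $d-1$.
\<close>

lemma nonadjacent_aff_dim:
  assumes T: "T \<in> \<T>" and T': "T' \<in> \<T>" and ne: "T \<noteq> T'" and na: "\<not> adj T T'"
  shows "aff_dim (closure T \<inter> closure T') \<le> int DIM('a) - 2"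
proof -
  note V = open_simplex_vertices[OF mesh_simplex[OF T]]
  have "card (vertices_of T \<inter> vertices_of T') < DIM('a)"
    using common_vertices_card[OF T T' ne] na ne by (auto simp: adj_def)
  moreover have "\<not> affine_dependent (vertices_of T \<inter> vertices_of T')"
    using V(3) affine_dependent_subset[of "vertices_of T \<inter> vertices_of T'" "vertices_of T"] by blast
  then have "int (card (vertices_of T \<inter> vertices_of T')) = aff_dim (vertices_of T \<inter> vertices_of T') + 1"
    by (rule aff_dim_affine_independent)
  ultimately show ?thesis unfolding common_face[OF T T'] by (simp add: aff_dim_convex_hull)
qed

text \<open>
  The barycentre of a facet, given by its set of \<open>d\<close> vertices.
\<close>

definition barycenter :: "'a set \<Rightarrow> 'a" where
  "barycenter F = (1 / real DIM('a)) *\<^sub>R (\<Sum>w\<in>F. w)"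

lemma bary_barycenter:
  assumes T: "open_simplex T" and v: "v \<in> vertices_of T" and w: "w \<in> vertices_of T"
  shows "bary T w (barycenter (vertices_of T - {v})) = (if w = v then 0 else 1 / real DIM('a))"
proof -
  note V = open_simplex_vertices[OF T]
  let ?F = "vertices_of T - {v}"
  have cF: "card ?F = DIM('a)" using V(1,2) v by simp
  obtain a \<beta> where ab: "bary T w = (\<lambda>x. a \<bullet> x + \<beta>)" using bary_props(1)[OF T w] by blast
  have "barycenter ?F = (\<Sum>u\<in>?F. (1 / real DIM('a)) *\<^sub>R u)" by (simp add: barycenter_def scaleR_sum_right)
  moreover have "(\<Sum>u\<in>?F. 1 / real DIM('a)) = 1" using cF by simp
  ultimately have "bary T w (barycenter ?F) = (\<Sum>u\<in>?F. 1 / real DIM('a) * bary T w u)"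
    unfolding ab using affine_fun_sum[of "\<lambda>u. 1 / real DIM('a)" ?F a \<beta>] by metis
  also have "\<dots> = (\<Sum>u\<in>?F. if u = w then 1 / real DIM('a) else 0)"
    by (rule sum.cong[OF refl]) (use bary_kronecker[OF T w] in auto)
  also have "\<dots> = (if w = v then 0 else 1 / real DIM('a))" using V(1) w by simp
  finally show ?thesis .
qed

text \<open>
  Around the barycentre of the common facet the two elements fill a ball up to the hyperplane of
  the facet. On that ball the sign of one affine function distinguishes them: the two barycentric
  coordinates that vanish on the facet are proportional, and the factor is negative, for else the
  elements would overlap.
\<close>

lemma adjacent_ball:
  assumes T: "T \<in> \<T>" and T': "T' \<in> \<T>" and ad: "adj T T'"
  obtains c n \<delta> where "norm n = 1" "\<delta> = 2 * min (diameter T / \<kappa>) (diameter T' / \<kappa>) * (1 / real DIM('a))"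
    "ball c \<delta> \<subseteq> \<Omega>" "{y \<in> ball c \<delta>. 0 < (y - c) \<bullet> n} \<subseteq> T" "{y \<in> ball c \<delta>. (y - c) \<bullet> n < 0} \<subseteq> T'"
proof -
  note sT = mesh_simplex[OF T] and sT' = mesh_simplex[OF T']
  note V = open_simplex_vertices[OF sT] and V' = open_simplex_vertices[OF sT']
  let ?F = "vertices_of T \<inter> vertices_of T'"
  have cF: "card ?F = DIM('a)" using ad by (simp add: adj_def)
  have ex: "\<exists>v. v \<in> A \<and> ?F = A - {v}" if "finite A" "card A = DIM('a) + 1" "?F \<subseteq> A" for A
  proof -
    have "card (A - ?F) = 1" using that cF by (subst card_Diff_subset) (auto intro: finite_subset)
    then obtain v where v: "A - ?F = {v}" by (auto simp: card_1_singleton_iff)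
    then have "?F = A - {v}" using that(3) by blast
    moreover have "v \<in> A" using v by blast
    ultimately show ?thesis by blast
  qed
  obtain a where a: "a \<in> vertices_of T" "?F = vertices_of T - {a}" using ex[OF V(1,2)] by blast
  obtain b where b: "b \<in> vertices_of T'" "?F = vertices_of T' - {b}" using ex[OF V'(1,2)] by blast
  define c where "c = barycenter ?F"
  have c: "bary T w c = (if w = a then 0 else 1 / real DIM('a))" if "w \<in> vertices_of T" for w
    unfolding c_def a(2) using bary_barycenter[OF sT a(1) that] .
  have c': "bary T' w c = (if w = b then 0 else 1 / real DIM('a))" if "w \<in> vertices_of T'" for w
    unfolding c_def b(2) using bary_barycenter[OF sT' b(1) that] .
  obtain x where x: "ball x (diameter T / \<kappa>) \<subseteq> T" using mesh_ball[OF T] .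
  obtain x' where x': "ball x' (diameter T' / \<kappa>) \<subseteq> T'" using mesh_ball[OF T'] .
  have rp: "0 < diameter T / \<kappa>" "0 < diameter T' / \<kappa>" using mesh_diameter_pos[OF T] mesh_diameter_pos[OF T'] \<kappa> by auto
  define \<delta> where "\<delta> = 2 * min (diameter T / \<kappa>) (diameter T' / \<kappa>) * (1 / real DIM('a))"
  have \<delta>: "0 < \<delta>" using rp by (simp add: \<delta>_def)
  have \<delta>le: "\<delta> \<le> 2 * (diameter T / \<kappa>) * (1 / real DIM('a))" "\<delta> \<le> 2 * (diameter T' / \<kappa>) * (1 / real DIM('a))"
    unfolding \<delta>_def by (intro mult_right_mono mult_left_mono; simp)+
  have inT: "y \<in> ball c \<delta> \<Longrightarrow> 0 < bary T a y \<Longrightarrow> y \<in> T" "y \<in> ball c \<delta> \<Longrightarrow> bary T a y = 0 \<Longrightarrow> y \<in> closure T" for y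
    using half_ball_in_simplex(2,3)[OF sT a(1) rp(1) x, of c "1 / real DIM('a)" y] c a(1) \<delta>le(1) by auto
  have inT': "y \<in> ball c \<delta> \<Longrightarrow> 0 < bary T' b y \<Longrightarrow> y \<in> T'" for y
    using half_ball_in_simplex(2)[OF sT' b(1) rp(2) x', of c "1 / real DIM('a)" y] c' b(1) \<delta>le(2) by auto
  define s where "s = bary T' b a"
  \<comment> \<open>An affine function is determined by its values at the vertices of \<open>T\<close>, and this one vanishes at all of them but \<open>a\<close>.\<close>
  have rel: "bary T' b y = bary T a y * s" for y
  proof -
    obtain g \<beta> where g: "bary T' b = (\<lambda>x. g \<bullet> x + \<beta>)" using bary_props(1)[OF sT' b(1)] by blast
    have "bary T' b y = (\<Sum>v\<in>vertices_of T. bary T v y * bary T' b v)"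
      unfolding g by (rule affine_fun_bary[OF sT])
    also have "\<dots> = bary T a y * bary T' b a + (\<Sum>v\<in>?F. bary T v y * bary T' b v)"
      unfolding a(2) using V(1) a(1) by (rule sum.remove)
    also have "(\<Sum>v\<in>?F. bary T v y * bary T' b v) = 0"
      using bary_props(3)[OF sT' b(1)] b(2) by (intro sum.neutral) auto
    finally show ?thesis by (simp add: s_def)
  qed
  obtain n where n: "norm n = 1" "\<And>y. 0 < bary T a y \<longleftrightarrow> 0 < (y - c) \<bullet> n" "\<And>y. bary T a y = 0 \<longleftrightarrow> (y - c) \<bullet> n = 0"
    using bary_sign_normal[OF sT a(1), of c] c[OF a(1)] by auto
  have nn: "n \<bullet> n = 1" using n(1) by (simp add: dot_square_norm)
  have "s \<noteq> 0" using rel[of b] bary_props(2)[OF sT' b(1)] by auto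
  moreover have "\<not> 0 < s"
  proof
    assume s: "0 < s"
    define y where "y = c + (\<delta>/2) *\<^sub>R n"
    have y: "y \<in> ball c \<delta>" using n(1) \<delta> by (simp add: y_def dist_norm)
    have "0 < bary T a y" unfolding n(2) using \<delta> nn by (simp add: y_def)
    then have "y \<in> T" "y \<in> T'" using inT(1)[OF y] inT'[OF y] rel[of y] s by auto
    then show False using mesh_disjoint[OF T T'] ad by (auto simp: adj_def)
  qed
  ultimately have s: "s < 0" by linarith
  have T'iff: "0 < bary T' b y \<longleftrightarrow> bary T a y < 0" for y using rel[of y] s by (simp add: zero_less_mult_iff)
  have cl: "ball c \<delta> \<subseteq> closure \<Omega>"
  proof
    fix y assume y: "y \<in> ball c \<delta>"
    consider "0 < bary T a y" | "bary T a y = 0" | "bary T a y < 0" by linarith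
    then have "y \<in> closure T \<or> y \<in> closure T'"
      using inT[OF y] inT'[OF y] T'iff[of y] closure_subset[of T] closure_subset[of T'] by cases auto
    then show "y \<in> closure \<Omega>" using mesh_closure_subset T T' by blast
  qed
  show ?thesis
  proof (rule that[OF n(1) \<delta>_def])
    show "ball c \<delta> \<subseteq> \<Omega>" using interior_maximal[OF cl] \<Omega>_interior by simp
    show "{y \<in> ball c \<delta>. 0 < (y - c) \<bullet> n} \<subseteq> T" using inT(1) n(2) by blast
    show "{y \<in> ball c \<delta>. (y - c) \<bullet> n < 0} \<subseteq> T'"
    proof
      fix y assume "y \<in> {y \<in> ball c \<delta>. (y - c) \<bullet> n < 0}"
      then have y: "y \<in> ball c \<delta>" "(y - c) \<bullet> n < 0" by auto
      then have "\<not> 0 < bary T a y" "bary T a y \<noteq> 0" using n(2)[of y] n(3)[of y] by auto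
      then have "0 < bary T' b y" using T'iff[of y] by linarith
      then show "y \<in> T'" using inT'[OF y(1)] by simp
    qed
  qed
qed

text \<open>
  Dominates both $\kappa$ (case $d \ge 2$) and $\kappa^2$ (case $d = 1$), and is at least 1.
\<close>

definition adj_size_ratio :: real where "adj_size_ratio = 1 + \<kappa> + \<kappa>\<^sup>2"

lemma adj_size_ratio_ge_1: "1 \<le> adj_size_ratio" using \<kappa> by (simp add: adj_size_ratio_def)

text \<open>
  For $d \ge 2$ the neighbours share an edge, which is not shorter than the diameter of an inscribed
  ball of the first and not longer than the diameter of the second. For $d = 1$ they only share
  a point and the comparability of sizes is a hypothesis.
\<close>

lemma adjacent_diameter:
  assumes T: "T \<in> \<T>" and T': "T' \<in> \<T>" and ad: "adj T T'"
  shows "diameter T \<le> adj_size_ratio * diameter T'"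
proof (cases "DIM('a) = 1")
  case True
  have "vertices_of T \<inter> vertices_of T' \<noteq> {}" using ad by (auto simp: adj_def)
  then have "closure T \<inter> closure T' \<noteq> {}" using vertex_in_closure by blast
  then have "vol T \<le> \<kappa> * vol T'" by (rule dim1[OF True T T'])
  then have "\<omega> * (diameter T / \<kappa>) \<le> \<kappa> * (\<omega> * diameter T')"
    using mesh_vol_ge[OF T] mesh_vol_le[OF T'] \<kappa> True
    by (smt (verit) mult_left_mono power_one_right)
  then have "diameter T \<le> \<kappa>\<^sup>2 * diameter T'"
    using \<omega>_pos \<kappa> by (simp add: field_simps power2_eq_square)
  also have "\<dots> \<le> adj_size_ratio * diameter T'"
    using mesh_diameter_pos[OF T'] \<kappa> by (intro mult_right_mono) (auto simp: adj_size_ratio_def)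
  finally show ?thesis .
next
  case False
  then have "2 \<le> card (vertices_of T \<inter> vertices_of T')"
    using ad DIM_positive[where 'a='a] unfolding adj_def by linarith
  then obtain v w where vw: "v \<in> vertices_of T" "v \<in> vertices_of T'" "w \<in> vertices_of T" "w \<in> vertices_of T'" "v \<noteq> w"
    by (auto simp: card_le_Suc_iff numeral_2_eq_2)
  obtain x where x: "ball x (diameter T / \<kappa>) \<subseteq> T" using mesh_ball[OF T] .
  have rp: "0 < diameter T / \<kappa>" using mesh_diameter_pos[OF T] \<kappa> by auto
  have "2 * (diameter T / \<kappa>) \<le> dist v w"
    by (rule simplex_edge_length[OF mesh_simplex[OF T] rp x vw(1,3,5)])
  also have "\<dots> \<le> diameter T'"
    using mesh_dist_le[OF T'] vw vertex_in_closure by blast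
  finally have "2 * diameter T \<le> \<kappa> * diameter T'" using \<kappa> by (simp add: field_simps)
  then have "diameter T \<le> \<kappa> * diameter T'" using mesh_diameter_pos[OF T] by linarith
  also have "\<dots> \<le> adj_size_ratio * diameter T'"
    using mesh_diameter_pos[OF T'] \<kappa> by (intro mult_right_mono) (auto simp: adj_size_ratio_def)
  finally show ?thesis .
qed

definition adj_rel :: "'a \<Rightarrow> ('a set \<times> 'a set) set" where
  "adj_rel \<nu> = {(T, T'). T \<in> star \<nu> \<and> T' \<in> star \<nu> \<and> adj T T'}"

text \<open>
  Any two elements at a vertex are connected by a chain of facet neighbours at the same vertex.
  A small neighbourhood of the vertex in \<open>\<Omega>\<close> is connected (for boundary vertices by the
  assumption on the domain) and remains so after removing the intersections of elements that are
  not facet neighbours. If the chain-connected elements and the others did not communicate, their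
  closures would separate this set.
\<close>

lemma star_connected:
  assumes T: "T \<in> star \<nu>" and T': "T' \<in> star \<nu>"
  shows "(T, T') \<in> (adj_rel \<nu>)\<^sup>*"
proof (rule ccontr)
  assume nc: "(T, T') \<notin> (adj_rel \<nu>)\<^sup>*"
  have \<nu>\<Omega>: "\<nu> \<in> closure \<Omega>" using T mesh_closure_subset by (auto simp: star_def)
  obtain r0 where r0: "0 < r0" "\<And>r. 0 < r \<Longrightarrow> r < r0 \<Longrightarrow> connected (\<Omega> \<inter> ball \<nu> r)"
  proof (cases "\<nu> \<in> \<Omega>")
    case True
    then obtain e where e: "e > 0" "ball \<nu> e \<subseteq> \<Omega>" using open_\<Omega> open_contains_ball by blast
    have "connected (\<Omega> \<inter> ball \<nu> r)" if "0 < r" "r < e" for r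
    proof -
      have "\<Omega> \<inter> ball \<nu> r = ball \<nu> r" using e(2) that by (auto simp: subset_iff)
      then show ?thesis by (simp add: connected_ball)
    qed
    then show ?thesis using that e(1) by blast
  next
    case False
    then have "\<nu> \<in> frontier \<Omega>" using \<nu>\<Omega> open_\<Omega> by (simp add: frontier_def interior_open)
    then show ?thesis using dom that unfolding polytopal_domain_def by blast
  qed
  \<comment> \<open>Close to \<open>\<nu>\<close> only the elements of the star are met.\<close>
  define far where "far = (\<Union>X\<in>\<T> - star \<nu>. closure X)"
  have "closed far" unfolding far_def using finite_\<T> by (intro closed_UN) auto
  moreover have "\<nu> \<notin> far" by (auto simp: far_def star_def)
  ultimately have "open (- far)" "\<nu> \<in> - far" by auto
  then obtain e where e: "e > 0" "ball \<nu> e \<subseteq> - far" using open_contains_ball by blast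
  define r where "r = min e (r0 / 2)"
  have r: "0 < r" "r < r0" "ball \<nu> r \<subseteq> - far" using e r0(1) by (auto simp: r_def)
  define U where "U = \<Omega> \<inter> ball \<nu> r"
  have U: "open U" "connected U" using r0(2)[OF r(1,2)] open_\<Omega> by (auto simp: U_def)
  define \<Z> where "\<Z> = {closure X \<inter> closure Y | X Y. X \<in> \<T> \<and> Y \<in> \<T> \<and> X \<noteq> Y \<and> \<not> adj X Y}"
  have "\<Z> \<subseteq> (\<lambda>(X, Y). closure X \<inter> closure Y) ` (\<T> \<times> \<T>)" by (auto simp: \<Z>_def)
  then have "finite \<Z>" using finite_\<T> finite_subset by blast
  then have con: "connected (U - \<Union>\<Z>)"
    using U nonadjacent_aff_dim by (intro connected_diff_codim2) (auto simp: \<Z>_def)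
  \<comment> \<open>The elements that a chain from \<open>T\<close> reaches; their closures and those of the others form a closed cover.\<close>
  define \<A> where "\<A> = {X \<in> star \<nu>. (T, X) \<in> (adj_rel \<nu>)\<^sup>*}"
  define A B where "A = (\<Union>X\<in>\<A>. closure X)" and "B = (\<Union>X\<in>star \<nu> - \<A>. closure X)"
  have closed: "closed A" "closed B" unfolding A_def B_def \<A>_def using finite_star by (auto intro!: closed_UN)
  have cover: "U - \<Union>\<Z> \<subseteq> A \<union> B"
  proof
    fix x assume x: "x \<in> U - \<Union>\<Z>"
    then have "x \<in> closure \<Omega>" using closure_subset by (auto simp: U_def)
    then obtain X where X: "X \<in> \<T>" "x \<in> closure X" unfolding mesh_cover by blast
    have "x \<notin> far" using x r(3) by (auto simp: U_def)
    then have "X \<in> star \<nu>" using X by (auto simp: far_def)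
    then show "x \<in> A \<union> B" using X(2) by (auto simp: A_def B_def)
  qed
  have disj: "A \<inter> B \<inter> (U - \<Union>\<Z>) = {}"
  proof (rule ccontr)
    assume "A \<inter> B \<inter> (U - \<Union>\<Z>) \<noteq> {}"
    then obtain x X Y where x: "x \<notin> \<Union>\<Z>" "X \<in> \<A>" "x \<in> closure X" "Y \<in> star \<nu>" "Y \<notin> \<A>" "x \<in> closure Y"
      unfolding A_def B_def by blast
    have XY: "X \<in> star \<nu>" "(T, X) \<in> (adj_rel \<nu>)\<^sup>*" "X \<noteq> Y" using x(2,5) by (auto simp: \<A>_def)
    have "X \<in> \<T>" "Y \<in> \<T>" using XY(1) x(4) by (auto simp: star_def)
    then have "adj X Y" using x(1,3,6) XY(3) unfolding \<Z>_def by blast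
    then have "(X, Y) \<in> adj_rel \<nu>" using XY(1) x(4) by (simp add: adj_rel_def)
    then have "(T, Y) \<in> (adj_rel \<nu>)\<^sup>*" using XY(2) by (rule rtrancl_into_rtrancl[rotated])
    then show False using x(4,5) by (simp add: \<A>_def)
  qed
  have ne: "\<exists>x \<in> X. x \<in> U - \<Union>\<Z>" if X: "X \<in> star \<nu>" for X
  proof -
    have X': "X \<in> \<T>" "\<nu> \<in> closure X" using X by (auto simp: star_def)
    have "X \<inter> ball \<nu> r \<noteq> {}"
      using X'(2) r(1) by (metis centre_in_ball disjoint_iff open_ball open_Int_closure_eq_empty Int_commute)
    then obtain x where x: "x \<in> X" "x \<in> ball \<nu> r" by blast
    let ?O = "X \<inter> ball \<nu> r"
    have oO: "open ?O" using open_simplex_basic(1)[OF mesh_simplex[OF X'(1)]] by auto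
    have "negligible (\<Union>\<Z>)"
    proof (intro negligible_Union \<open>finite \<Z>\<close>)
      fix Z assume "Z \<in> \<Z>"
      then have "aff_dim Z < int DIM('a)" using nonadjacent_aff_dim by (fastforce simp: \<Z>_def)
      then obtain g \<beta> where "g \<noteq> 0" "Z \<subseteq> {x. g \<bullet> x = \<beta>}" by (rule aff_lowdim_subset_hyperplane)
      then show "negligible Z" using negligible_hyperplane negligible_subset by blast
    qed
    moreover have "\<not> negligible ?O" using open_not_negligible[OF oO] x by blast
    ultimately have "\<not> ?O \<subseteq> \<Union>\<Z>" using negligible_subset by blast
    then show ?thesis using mesh_subset[OF X'(1)] by (auto simp: U_def)
  qed
  have "T \<in> \<A>" using T by (simp add: \<A>_def)
  then have "A \<inter> (U - \<Union>\<Z>) \<noteq> {}" using ne[OF T] closure_subset[of T] unfolding A_def by blast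
  moreover have "T' \<notin> \<A>" using nc by (simp add: \<A>_def)
  then have "B \<inter> (U - \<Union>\<Z>) \<noteq> {}" using ne[OF T'] T' closure_subset[of T'] unfolding B_def by blast
  ultimately show False using con cover disj closed unfolding connected_closed by blast
qed

lemma chain_bound:
  assumes R: "(x, y) \<in> R ^^ n" and f: "\<And>a b. (a, b) \<in> R \<Longrightarrow> \<bar>f a - f b\<bar> \<le> E"
  shows "\<bar>f x - f y\<bar> \<le> real n * (E::real)"
  using R
proof (induction n arbitrary: y)
  case (Suc n)
  then obtain z where "(x, z) \<in> R ^^ n" "(z, y) \<in> R" by auto
  with Suc.IH[of z] f[of z y] show ?case by (simp add: algebra_simps)
qed auto

lemma chain_diameter:
  assumes R: "(x, y) \<in> (adj_rel \<nu>) ^^ n" and y: "x \<in> star \<nu>"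
  shows "diameter x \<le> adj_size_ratio ^ n * diameter y \<and> diameter y \<le> adj_size_ratio ^ n * diameter x"
  using R
proof (induction n arbitrary: y)
  case (Suc n)
  then obtain z where z: "(x, z) \<in> (adj_rel \<nu>) ^^ n" "(z, y) \<in> adj_rel \<nu>" by auto
  then have zy: "z \<in> \<T>" "y \<in> \<T>" "adj z y" "adj y z" by (auto simp: adj_rel_def star_def adj_def Int_commute)
  have "diameter x \<le> adj_size_ratio ^ n * diameter z" "diameter z \<le> adj_size_ratio ^ n * diameter x" using Suc.IH[OF z(1)] by auto
  moreover have "diameter z \<le> adj_size_ratio * diameter y" "diameter y \<le> adj_size_ratio * diameter z"
    using adjacent_diameter zy by auto
  moreover have "adj_size_ratio ^ n * diameter z \<le> adj_size_ratio ^ n * (adj_size_ratio * diameter y)" "adj_size_ratio * diameter z \<le> adj_size_ratio * (adj_size_ratio ^ n * diameter x)"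
    using calculation adj_size_ratio_ge_1 by (intro mult_left_mono; simp)+
  ultimately show ?case by (simp add: mult_ac)
qed auto

text \<open>
  A path in a finite relation can be shortened to at most as many steps as the relation has pairs.
\<close>

lemma star_chain:
  assumes T: "T \<in> star \<nu>" and T': "T' \<in> star \<nu>"
  obtains n where "n \<le> star_card_bound\<^sup>2" "(T, T') \<in> (adj_rel \<nu>) ^^ n"
proof -
  have sub: "adj_rel \<nu> \<subseteq> star \<nu> \<times> star \<nu>" by (auto simp: adj_rel_def)
  have fin: "finite (adj_rel \<nu>)" using finite_subset[OF sub] finite_star by blast
  have "card (adj_rel \<nu>) \<le> card (star \<nu> \<times> star \<nu>)" using sub finite_star by (intro card_mono) auto
  also have "\<dots> \<le> star_card_bound\<^sup>2" using card_star_le[of \<nu>] by (simp add: card_cartesian_product power2_eq_square mult_le_mono)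
  finally have "card (adj_rel \<nu>) \<le> star_card_bound\<^sup>2" .
  moreover obtain n where "n \<le> card (adj_rel \<nu>)" "(T, T') \<in> (adj_rel \<nu>) ^^ n"
    using star_connected[OF T T'] unfolding rtrancl_finite_eq_relpow[OF fin] by blast
  ultimately show ?thesis using that[of n] le_trans by blast
qed

definition star_size_ratio :: real where "star_size_ratio = adj_size_ratio ^ (star_card_bound\<^sup>2)"

lemma star_size_ratio_ge_1: "1 \<le> star_size_ratio" using adj_size_ratio_ge_1 by (simp add: star_size_ratio_def)

lemma star_diameter:
  assumes T: "T \<in> star \<nu>" and T': "T' \<in> star \<nu>"
  shows "diameter T \<le> star_size_ratio * diameter T'"
proof -
  obtain n where n: "n \<le> star_card_bound\<^sup>2" "(T, T') \<in> (adj_rel \<nu>) ^^ n" using star_chain[OF T T'] .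
  have "diameter T \<le> adj_size_ratio ^ n * diameter T'" using chain_diameter[OF n(2) T] by simp
  also have "\<dots> \<le> star_size_ratio * diameter T'"
    unfolding star_size_ratio_def using n(1) adj_size_ratio_ge_1 mesh_diameter_pos T'
    by (intro mult_right_mono power_increasing) (auto simp: star_def less_imp_le)
  finally show ?thesis .
qed

end

section \<open>Means over the elements of a star\<close>

lemma AE_eq_L2_space:
  assumes "AE x in lebesgue_on S. f x = g x" "g \<in> L2_space S" "f \<in> borel_measurable (lebesgue_on S)"
  shows "f \<in> L2_space S"
proof -
  have "integrable (lebesgue_on S) (\<lambda>x. (f x)\<^sup>2)"
  proof (rule integrable_cong_AE_imp[OF L2_spaceD(2)[OF assms(2)]])
    show "(\<lambda>x. (f x)\<^sup>2) \<in> borel_measurable (lebesgue_on S)" using assms(3) by simp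
    show "AE x in lebesgue_on S. (g x)\<^sup>2 = (f x)\<^sup>2" using assms(1) by (auto elim!: eventually_mono)
  qed
  then show ?thesis using assms(3) by (simp add: L2_space_def)
qed

lemma smooth_H1_gradient:
  assumes \<Omega>: "open \<Omega>" and v: "v \<in> H1_space \<Omega>" and c: "Ck_on 1 \<Omega> v" and b: "b \<in> Basis"
  shows "(\<lambda>x. frechet_derivative v (at x) b) \<in> L2_space \<Omega>"
    "L2_norm \<Omega> (\<lambda>x. frechet_derivative v (at x) b) = L2_norm \<Omega> (weak_partial \<Omega> b v)"
proof -
  have ae: "AE x in lebesgue_on \<Omega>. weak_partial \<Omega> b v x = frechet_derivative v (at x) b"
    by (rule weak_partial_eq_frechet_derivative[OF \<Omega> \<Omega> order_refl b is_weak_partial_weak_partial[OF v b]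
          H1_space_L2[OF v] c]) simp
  then have ae': "AE x in lebesgue_on \<Omega>. frechet_derivative v (at x) b = weak_partial \<Omega> b v x"
    by (auto elim!: eventually_mono)
  have "(\<lambda>x. frechet_derivative v (at x) b) \<in> borel_measurable (lebesgue_on \<Omega>)"
    using c b \<Omega> unfolding Ck_on_1 by (intro continuous_imp_measurable_on_sets_lebesgue) auto
  then show *: "(\<lambda>x. frechet_derivative v (at x) b) \<in> L2_space \<Omega>"
    using AE_eq_L2_space[OF ae' weak_partial_L2[OF v b]] by simp
  show "L2_norm \<Omega> (\<lambda>x. frechet_derivative v (at x) b) = L2_norm \<Omega> (weak_partial \<Omega> b v)"
    by (rule L2_norm_cong_AE[OF ae' * weak_partial_L2[OF v b]])
qed

context mesh
begin

definition mean :: "'a set \<Rightarrow> ('a \<Rightarrow> real) \<Rightarrow> real" where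
  "mean T u = (\<integral>x. u x \<partial>lebesgue_on T) / vol T"

lemma mesh_L2: "u \<in> L2_space \<Omega> \<Longrightarrow> T \<in> \<T> \<Longrightarrow> u \<in> L2_space T"
  by (rule L2_space_subset[OF _ mesh_subset mesh_meas \<Omega>_meas])

lemma mesh_const_L2: "T \<in> \<T> \<Longrightarrow> (\<lambda>x. k) \<in> L2_space T"
  using L2_space_const[OF mesh_emeasure mesh_meas] .

lemma mesh_shift_L2: "u \<in> L2_space \<Omega> \<Longrightarrow> T \<in> \<T> \<Longrightarrow> (\<lambda>x. u x - k) \<in> L2_space T"
  using L2_space_diff[OF mesh_L2 mesh_const_L2] .

lemma mean_diff_const_le:
  assumes T: "T \<in> \<T>" and u: "u \<in> L2_space \<Omega>"
  shows "(mean T u - k)\<^sup>2 * vol T \<le> (L2_norm T (\<lambda>x. u x - k))\<^sup>2"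
proof -
  have vp: "0 < vol T" using mesh_vol_pos[OF T] .
  have i: "integrable (lebesgue_on T) u" using L2_integrable_bounded[OF mesh_L2[OF u T] mesh_emeasure[OF T]] T by simp
  have ik: "integrable (lebesgue_on T) (\<lambda>x. k)"
    using L2_integrable_bounded[OF mesh_const_L2[OF T] mesh_emeasure[OF T]] T by simp
  have "L2_inner T (\<lambda>x. u x - k) (\<lambda>x. 1) = (\<integral>x. u x \<partial>lebesgue_on T) - (\<integral>x. k \<partial>lebesgue_on T)"
    unfolding L2_inner_def using Bochner_Integration.integral_diff[OF i ik] by simp
  also have "(\<integral>x. k \<partial>lebesgue_on T) = k * vol T" using T by (simp add: measure_restrict_space)
  also have "(\<integral>x. u x \<partial>lebesgue_on T) = mean T u * vol T" using vp by (simp add: mean_def)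
  finally have "L2_inner T (\<lambda>x. u x - k) (\<lambda>x. 1) = (mean T u - k) * vol T"
    by (simp add: left_diff_distrib)
  then have "((mean T u - k) * vol T)\<^sup>2 \<le> (L2_norm T (\<lambda>x. u x - k))\<^sup>2 * (L2_norm T (\<lambda>x. 1))\<^sup>2"
    using L2_Cauchy_Schwarz[OF mesh_shift_L2[OF u T, of k] mesh_const_L2[OF T, of 1]] by simp
  also have "(L2_norm T (\<lambda>x. 1))\<^sup>2 = vol T" using L2_norm_sq_const[of T 1] T by simp
  finally have "((mean T u - k)\<^sup>2 * vol T) * vol T \<le> (L2_norm T (\<lambda>x. u x - k))\<^sup>2 * vol T"
    by (simp add: power2_eq_square mult_ac)
  then show ?thesis using vp by simp
qed

text \<open>
  The constants of the successive comparisons of means: with the best constant on an element,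
  between facet neighbours, with zero at a facet in \<open>\<gamma>\<close>, and between all elements of a star.
\<close>

definition poincare_const :: real where "poincare_const = 4 * 2 ^ DIM('a)"
definition facet_ball_ratio :: real where "facet_ball_ratio = 2 / \<kappa>"
definition mean_const :: real where "mean_const = 2 * poincare_const + 8 * 2 ^ DIM('a) * facet_ball_ratio\<^sup>2"
definition adj_mean_const :: real where "adj_mean_const = (star_size_ratio * \<kappa> * real DIM('a)) ^ DIM('a) * (4 * mean_const * star_size_ratio\<^sup>2)"
definition gamma_mean_const :: real where "gamma_mean_const = (2 * star_size_ratio * \<kappa> * real DIM('a)) ^ DIM('a) * (mean_const * star_size_ratio\<^sup>2)"
definition star_mean_const :: real where "star_mean_const = 2 * (real (star_card_bound\<^sup>2))\<^sup>2 * adj_mean_const + 2 * gamma_mean_const"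

lemma consts_nonneg: "0 \<le> poincare_const" "0 \<le> facet_ball_ratio" "0 \<le> mean_const" "0 \<le> adj_mean_const" "0 \<le> gamma_mean_const" "0 \<le> star_mean_const" "0 \<le> star_size_ratio"
proof -
  show "0 \<le> poincare_const" "0 \<le> facet_ball_ratio" using \<kappa> by (auto simp: poincare_const_def facet_ball_ratio_def)
  then show 1: "0 \<le> mean_const" by (simp add: mean_const_def)
  show S: "0 \<le> star_size_ratio" using star_size_ratio_ge_1 by simp
  show 2: "0 \<le> adj_mean_const" "0 \<le> gamma_mean_const" using 1 S \<kappa> by (auto simp: adj_mean_const_def gamma_mean_const_def intro!: mult_nonneg_nonneg)
  show "0 \<le> star_mean_const" using 2 by (simp add: star_mean_const_def)
qed

end

locale mesh_fun = mesh +
  fixes v :: "'a::euclidean_space \<Rightarrow> real"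
  assumes vH1: "v \<in> H1_space \<Omega>" and vC: "Ck_on 1 \<Omega> v"
begin

lemma vL2: "v \<in> L2_space \<Omega>" using vH1 by (rule H1_space_L2)

lemma gL2: "b \<in> Basis \<Longrightarrow> (\<lambda>x. frechet_derivative v (at x) b) \<in> L2_space \<Omega>"
  using smooth_H1_gradient(1)[OF open_\<Omega> vH1 vC] .

lemma grad_energy_le_H1: "grad_energy \<Omega> v \<le> (H1_norm \<Omega> v)\<^sup>2"
  unfolding H1_norm_sq grad_energy_def using smooth_H1_gradient(2)[OF open_\<Omega> vH1 vC] by simp

abbreviation e :: "'a set \<Rightarrow> real" where "e T \<equiv> grad_energy T v"

text \<open>
  The squared $L_2$ norm of the gradient over the star of \<open>\<nu>\<close>; bounds for differences of means are
  stated with it because the chains of neighbours do not leave the star.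
\<close>

definition star_energy :: "'a \<Rightarrow> real" where "star_energy \<nu> = (\<Sum>T\<in>star \<nu>. e T)"

lemma e_le_star_energy: "T \<in> star \<nu> \<Longrightarrow> e T \<le> star_energy \<nu>"
  unfolding star_energy_def using finite_star by (intro member_le_sum) auto

lemma star_energy_nonneg: "0 \<le> star_energy \<nu>" by (simp add: star_energy_def sum_nonneg)

text \<open>
  The mean is a best constant up to a factor, so the constant provided by \<open>poincare_constant\<close> may be
  replaced by it.
\<close>

lemma mean_poincare:
  assumes T: "T \<in> \<T>"
  shows "(L2_norm T (\<lambda>x. v x - mean T v))\<^sup>2 \<le> poincare_const * (diameter T)\<^sup>2 * e T"
proof -
  note B = open_simplex_basic[OF mesh_simplex[OF T]]
  have Tsub: "T \<subseteq> \<Omega>" using mesh_subset[OF T] .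
  have "\<exists>k. (\<lambda>x. v x - k) \<in> L2_space T \<and> (L2_norm T (\<lambda>x. v x - k))\<^sup>2 \<le> 2 ^ DIM('a) * (diameter T)\<^sup>2 * e T"
  proof (rule poincare_constant)
    show "open T" "convex T" "T \<noteq> {}" using B open_simplex_vertices(6)[OF mesh_simplex[OF T]] by auto
    show "Ck_on 1 T v" using Ck_on_subset[OF vC Tsub] .
    show "dist x y \<le> diameter T" if "x \<in> T" "y \<in> T" for x y
      using mesh_dist_le[OF T, of x y] that closure_subset[of T] by blast
    show "(\<lambda>x. frechet_derivative v (at x) b) \<in> L2_space T" if "b \<in> Basis" for b
      using mesh_L2[OF gL2[OF that] T] .
  qed
  then obtain k where k: "(L2_norm T (\<lambda>x. v x - k))\<^sup>2 \<le> 2 ^ DIM('a) * (diameter T)\<^sup>2 * e T" by blast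
  have "(L2_norm T (\<lambda>x. v x - mean T v))\<^sup>2 = (L2_norm T (\<lambda>x. 1 * (v x - k) + (-1) * (mean T v - k)))\<^sup>2" by simp
  also have "\<dots> \<le> 2 * 1\<^sup>2 * (L2_norm T (\<lambda>x. v x - k))\<^sup>2 + 2 * (-1)\<^sup>2 * (L2_norm T (\<lambda>x. mean T v - k))\<^sup>2"
    by (rule L2_norm_sq_lincomb_le[OF mesh_shift_L2[OF vL2 T] mesh_const_L2[OF T]])
  also have "\<dots> = 2 * (L2_norm T (\<lambda>x. v x - k))\<^sup>2 + 2 * ((mean T v - k)\<^sup>2 * vol T)"
    using L2_norm_sq_const[of T "mean T v - k"] T by simp
  also have "\<dots> \<le> 4 * (2 ^ DIM('a) * (diameter T)\<^sup>2 * e T)"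
    using mean_diff_const_le[OF T vL2, of k] k by linarith
  finally show ?thesis by (simp add: poincare_const_def mult_ac)
qed

lemma mean_on_subset:
  assumes T: "T \<in> \<T>" and A: "A \<subseteq> T" "open A" and k: "(\<lambda>x. v x - k) \<in> L2_space A"
  shows "(mean T v - k)\<^sup>2 * vol A \<le> 2 * (poincare_const * (diameter T)\<^sup>2 * e T) + 2 * (L2_norm A (\<lambda>x. v x - k))\<^sup>2"
proof -
  have Am: "A \<in> sets lebesgue" using A by simp
  have fin: "emeasure lebesgue A < \<infinity>"
    using emeasure_mono[OF A(1) mesh_meas[OF T]] mesh_emeasure[OF T] by (rule le_less_trans)
  have 1: "(\<lambda>x. v x - mean T v) \<in> L2_space T" using mesh_shift_L2[OF vL2 T] .
  have "(L2_norm A (\<lambda>x. v x - mean T v))\<^sup>2 \<le> (L2_norm T (\<lambda>x. v x - mean T v))\<^sup>2"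
    using L2_norm_sq_subset_le[OF 1 A(1) Am] T by simp
  also have "\<dots> \<le> poincare_const * (diameter T)\<^sup>2 * e T" by (rule mean_poincare[OF T])
  finally show ?thesis
    using constants_overlap[OF Am fin L2_space_subset[OF 1 A(1) Am mesh_meas[OF T]] k] by linarith
qed

lemma half_ball_subball:
  fixes n :: 'a
  assumes "norm n = 1" "0 < \<delta>"
  shows "ball (c + (\<delta>/2) *\<^sub>R n) (\<delta>/2) \<subseteq> {y \<in> ball c \<delta>. 0 < (y - c) \<bullet> n}"
proof
  fix y assume y: "y \<in> ball (c + (\<delta>/2) *\<^sub>R n) (\<delta>/2)"
  define p where "p = y - c - (\<delta>/2) *\<^sub>R n"
  have p: "norm p < \<delta>/2" using y by (simp add: p_def dist_norm norm_minus_commute algebra_simps)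
  have "n \<bullet> n = 1" using assms(1) by (simp add: dot_square_norm)
  then have "(y - c) \<bullet> n = p \<bullet> n + \<delta>/2" by (simp add: p_def inner_diff_left)
  moreover have "\<bar>p \<bullet> n\<bar> \<le> norm p" using Cauchy_Schwarz_ineq2[of p n] assms(1) by simp
  moreover have "norm (y - c) \<le> norm p + \<delta>/2"
    using norm_triangle_ineq[of p "(\<delta>/2) *\<^sub>R n"] assms by (simp add: p_def)
  ultimately show "y \<in> {y \<in> ball c \<delta>. 0 < (y - c) \<bullet> n}" using p by (auto simp: dist_norm norm_minus_commute)
qed

text \<open>
  Apply the Poincare inequality on the ball around the barycentre of the common facet. Both
  elements contain a ball of half its radius, on which their means are compared with the constant
  of the big ball.
\<close>

lemma adjacent_mean_diff:
  assumes T: "T \<in> \<T>" and T': "T' \<in> \<T>" and ad: "adj T T'"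
    and M: "diameter T \<le> M" "diameter T' \<le> M"
  defines "\<rho> \<equiv> min (diameter T) (diameter T') / (\<kappa> * real DIM('a))"
  shows "(mean T v - mean T' v)\<^sup>2 * (\<omega> * \<rho> ^ DIM('a)) \<le> 4 * mean_const * M\<^sup>2 * (e T + e T')"
proof -
  obtain c n \<delta> where cn: "norm n = 1" "\<delta> = 2 * min (diameter T / \<kappa>) (diameter T' / \<kappa>) * (1 / real DIM('a))"
    "ball c \<delta> \<subseteq> \<Omega>" "{y \<in> ball c \<delta>. 0 < (y - c) \<bullet> n} \<subseteq> T" "{y \<in> ball c \<delta>. (y - c) \<bullet> n < 0} \<subseteq> T'"
    using adjacent_ball[OF T T' ad] .
  have dp: "0 < diameter T" "0 < diameter T'" using mesh_diameter_pos T T' by auto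
  have "min (diameter T / \<kappa>) (diameter T' / \<kappa>) = min (diameter T) (diameter T') / \<kappa>"
    using \<kappa> by (simp add: min_def divide_right_mono divide_le_cancel)
  then have \<delta>\<rho>: "\<delta> = 2 * \<rho>" unfolding cn(2) \<rho>_def by simp
  have \<rho>0: "0 < \<rho>" using dp \<kappa> by (simp add: \<rho>_def)
  then have \<delta>0: "0 < \<delta>" using \<delta>\<rho> by simp
  have "\<rho> \<le> M / \<kappa>"
  proof -
    have "\<rho> \<le> M / (\<kappa> * real DIM('a))" unfolding \<rho>_def using M \<kappa> by (intro divide_right_mono) auto
    also have "\<dots> \<le> M / (\<kappa> * 1)" using M dp \<kappa> by (intro divide_left_mono mult_left_mono) (auto simp: DIM_ge_Suc0 Suc_leI)
    finally show ?thesis by simp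
  qed
  then have \<delta>M: "\<delta> \<le> facet_ball_ratio * M" unfolding \<delta>\<rho> facet_ball_ratio_def by simp
  let ?B = "ball c \<delta>"
  have gB: "(\<lambda>x. frechet_derivative v (at x) b) \<in> L2_space ?B" if "b \<in> Basis" for b
    using L2_space_subset[OF gL2[OF that] cn(3)] by simp
  have "\<exists>k. (\<lambda>x. v x - k) \<in> L2_space ?B \<and> (L2_norm ?B (\<lambda>x. v x - k))\<^sup>2 \<le> 2 ^ DIM('a) * (2 * \<delta>)\<^sup>2 * e ?B"
  proof (rule poincare_constant)
    show "?B \<noteq> {}" using \<delta>0 by simp
    show "Ck_on 1 ?B v" using Ck_on_subset[OF vC cn(3)] .
    show "dist x y \<le> 2 * \<delta>" if "x \<in> ?B" "y \<in> ?B" for x y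
      using that dist_triangle2[of x y c] by (simp add: dist_commute)
  qed (use gB in \<open>auto simp: convex_ball\<close>)
  then obtain k where k: "(\<lambda>x. v x - k) \<in> L2_space ?B" "(L2_norm ?B (\<lambda>x. v x - k))\<^sup>2 \<le> 2 ^ DIM('a) * (2 * \<delta>)\<^sup>2 * e ?B" by blast
  \<comment> \<open>The hyperplane of the facet is a null set.\<close>
  have eB: "e ?B \<le> e T + e T'"
  proof -
    have "(L2_norm ?B f)\<^sup>2 \<le> (L2_norm T f)\<^sup>2 + (L2_norm T' f)\<^sup>2" if f: "f \<in> L2_space \<Omega>" for f
    proof -
      let ?h = "{y. n \<bullet> y = n \<bullet> c}"
      have "n \<noteq> 0" using cn(1) by auto
      then have "negligible ?h" by (simp add: negligible_hyperplane)
      then have "AE x in lebesgue. x \<notin> ?h" using negligible_iff_null_sets AE_not_in by blast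
      then have ae: "AE x in lebesgue. x \<in> ?B \<longrightarrow> x \<in> T \<or> x \<in> T'"
      proof eventually_elim
        case (elim x)
        have "(x - c) \<bullet> n \<noteq> 0" using elim by (simp add: inner_diff_left inner_commute[of n])
        then consider "0 < (x - c) \<bullet> n" | "(x - c) \<bullet> n < 0" by linarith
        then show ?case using cn(4,5) by cases blast+
      qed
      have "(\<integral>\<^sup>+x. ennreal ((f x)\<^sup>2) * indicator ?B x \<partial>lebesgue)
         \<le> (\<integral>\<^sup>+x. ennreal ((f x)\<^sup>2) * indicator T x + ennreal ((f x)\<^sup>2) * indicator T' x \<partial>lebesgue)"
        by (rule nn_integral_mono_AE) (use ae in \<open>auto simp: indicator_def elim!: eventually_mono\<close>)
      also have "\<dots> = (\<integral>\<^sup>+x. ennreal ((f x)\<^sup>2) * indicator T x \<partial>lebesgue) + (\<integral>\<^sup>+x. ennreal ((f x)\<^sup>2) * indicator T' x \<partial>lebesgue)"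
      proof (rule nn_integral_add)
        have "(\<lambda>x. ennreal ((f x)\<^sup>2) * indicator X x) \<in> borel_measurable lebesgue" if X: "X \<in> \<T>" for X
        proof -
          have "(\<lambda>x. if x \<in> X then f x else 0) \<in> borel_measurable lebesgue"
            by (rule borel_measurable_if_I[OF L2_spaceD(1)[OF mesh_L2[OF f X]] mesh_meas[OF X]])
          then have "(\<lambda>x. ennreal ((if x \<in> X then f x else 0)\<^sup>2)) \<in> borel_measurable lebesgue" by simp
          moreover have "ennreal ((if x \<in> X then f x else 0)\<^sup>2) = ennreal ((f x)\<^sup>2) * indicator X x" for x by simp
          ultimately show ?thesis by simp
        qed
        then show "(\<lambda>x. ennreal ((f x)\<^sup>2) * indicator T x) \<in> borel_measurable lebesgue"
          "(\<lambda>x. ennreal ((f x)\<^sup>2) * indicator T' x) \<in> borel_measurable lebesgue" using T T' by auto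
      qed
      finally have "ennreal ((L2_norm ?B f)\<^sup>2) \<le> ennreal ((L2_norm T f)\<^sup>2) + ennreal ((L2_norm T' f)\<^sup>2)"
        using L2_norm_sq_nn_integral[OF L2_space_subset[OF f cn(3)]]
          L2_norm_sq_nn_integral[OF mesh_L2[OF f T]] L2_norm_sq_nn_integral[OF mesh_L2[OF f T']] T T'
        by (simp add: nn_integral_completion)
      then show ?thesis by (simp flip: ennreal_plus)
    qed
    then show ?thesis unfolding grad_energy_def by (simp add: gL2 sum_mono flip: sum.distrib)
  qed
  have e0: "0 \<le> e T" "0 \<le> e T'" by auto
  define Q where "Q = 2 ^ DIM('a) * (2 * \<delta>)\<^sup>2 * (e T + e T')"
  have Q: "(L2_norm ?B (\<lambda>x. v x - k))\<^sup>2 \<le> Q"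
    unfolding Q_def using k(2) by (rule order_trans) (intro mult_left_mono eB; simp)
  \<comment> \<open>Applied to each side of the facet, with \<open>z\<close> the centre of a ball in the half ball.\<close>
  have side: "(mean X v - k)\<^sup>2 * (\<omega> * \<rho> ^ DIM('a)) \<le> mean_const * M\<^sup>2 * (e T + e T')"
    if X: "X \<in> \<T>" "diameter X \<le> M" "e X \<le> e T + e T'" and A: "ball z (\<delta>/2) \<subseteq> X" "ball z (\<delta>/2) \<subseteq> ?B" for X z
  proof -
    let ?A = "ball z (\<delta>/2)"
    have adj_mean_const': "(\<lambda>x. v x - k) \<in> L2_space ?A" using L2_space_subset[OF k(1) A(2)] by simp
    have "(L2_norm ?A (\<lambda>x. v x - k))\<^sup>2 \<le> (L2_norm ?B (\<lambda>x. v x - k))\<^sup>2"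
      using L2_norm_sq_subset_le[OF k(1) A(2)] by simp
    then have "(mean X v - k)\<^sup>2 * vol ?A \<le> 2 * (poincare_const * (diameter X)\<^sup>2 * e X) + 2 * Q"
      using mean_on_subset[OF X(1) A(1) open_ball adj_mean_const'] Q by linarith
    also have "\<dots> \<le> 2 * (poincare_const * M\<^sup>2 * (e T + e T')) + 2 * (2 ^ DIM('a) * (4 * (facet_ball_ratio * M)\<^sup>2) * (e T + e T'))"
    proof (intro add_mono mult_left_mono mult_mono power_mono)
      show "Q \<le> 2 ^ DIM('a) * (4 * (facet_ball_ratio * M)\<^sup>2) * (e T + e T')"
        unfolding Q_def power_mult_distrib[of 2 \<delta>] using \<delta>M \<delta>0 e0
        by (intro mult_right_mono mult_left_mono mult_mono power_mono) auto
    qed (use X e0 consts_nonneg mesh_diameter_pos[OF X(1)] in auto)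
    also have "\<dots> = mean_const * M\<^sup>2 * (e T + e T')" by (simp add: mean_const_def power_mult_distrib algebra_simps)
    finally show ?thesis using vol_ball[of "\<delta>/2" z] \<delta>0 \<delta>\<rho> by simp
  qed
  have sT: "(mean T v - k)\<^sup>2 * (\<omega> * \<rho> ^ DIM('a)) \<le> mean_const * M\<^sup>2 * (e T + e T')"
    using half_ball_subball[OF cn(1) \<delta>0, of c] cn(4) e0 M by (intro side[OF T]) auto
  have sub': "ball (c + (\<delta>/2) *\<^sub>R (- n)) (\<delta>/2) \<subseteq> {y \<in> ball c \<delta>. 0 < (y - c) \<bullet> (- n)}"
    using cn(1) \<delta>0 by (intro half_ball_subball) auto
  have sT': "(mean T' v - k)\<^sup>2 * (\<omega> * \<rho> ^ DIM('a)) \<le> mean_const * M\<^sup>2 * (e T + e T')"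
    using sub' cn(5) e0 M by (intro side[OF T', of "c + (\<delta>/2) *\<^sub>R (- n)"]) auto
  have "(mean T v - mean T' v)\<^sup>2 \<le> 2 * (mean T v - k)\<^sup>2 + 2 * (mean T' v - k)\<^sup>2"
    using zero_le_power2[of "(mean T v - k) + (mean T' v - k)"] by (simp add: power2_eq_square algebra_simps)
  then have "(mean T v - mean T' v)\<^sup>2 * (\<omega> * \<rho> ^ DIM('a))
      \<le> (2 * (mean T v - k)\<^sup>2 + 2 * (mean T' v - k)\<^sup>2) * (\<omega> * \<rho> ^ DIM('a))"
    using \<omega>_pos \<rho>0 by (intro mult_right_mono) auto
  also have "\<dots> = 2 * ((mean T v - k)\<^sup>2 * (\<omega> * \<rho> ^ DIM('a))) + 2 * ((mean T' v - k)\<^sup>2 * (\<omega> * \<rho> ^ DIM('a)))"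
    by (simp add: algebra_simps)
  finally show ?thesis using sT sT' by linarith
qed

lemma adjacent_star_mean_diff:
  assumes TT: "(T, T') \<in> adj_rel \<nu>" and T0: "T0 \<in> star \<nu>"
  shows "(mean T v - mean T' v)\<^sup>2 * vol T0 \<le> adj_mean_const * (diameter T0)\<^sup>2 * star_energy \<nu>"
proof -
  have T: "T \<in> star \<nu>" "T' \<in> star \<nu>" "adj T T'" using TT by (auto simp: adj_rel_def)
  then have T': "T \<in> \<T>" "T' \<in> \<T>" and T0': "T0 \<in> \<T>" using T0 by (auto simp: star_def)
  let ?d = "real DIM('a)"
  define \<rho> where "\<rho> = min (diameter T) (diameter T') / (\<kappa> * ?d)"
  define \<rho>0 where "\<rho>0 = diameter T0 / (star_size_ratio * \<kappa> * ?d)"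
  have S1: "0 < star_size_ratio" using star_size_ratio_ge_1 by simp
  have D0: "0 < diameter T0" using mesh_diameter_pos[OF T0'] .
  have "diameter T0 / star_size_ratio \<le> diameter X" if "X \<in> star \<nu>" for X
    using star_diameter[OF T0 that] S1 by (simp add: pos_divide_le_eq mult.commute)
  then have "diameter T0 / star_size_ratio \<le> min (diameter T) (diameter T')" using T by simp
  then have "diameter T0 / star_size_ratio / (\<kappa> * ?d) \<le> \<rho>" unfolding \<rho>_def using \<kappa> by (intro divide_right_mono) auto
  then have \<rho>0: "\<rho>0 \<le> \<rho>" by (simp add: \<rho>0_def mult.assoc)
  have \<rho>0p: "0 < \<rho>0" using D0 S1 \<kappa> by (simp add: \<rho>0_def)
  have ee: "e T + e T' \<le> star_energy \<nu>"
  proof -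
    have "(\<Sum>X\<in>{T, T'}. e X) \<le> star_energy \<nu>" unfolding star_energy_def using T finite_star by (intro sum_mono2) auto
    then show ?thesis using T(3) by (simp add: adj_def)
  qed
  let ?X = "(mean T v - mean T' v)\<^sup>2"
  have "vol T0 \<le> \<omega> * diameter T0 ^ DIM('a)" by (rule mesh_vol_le[OF T0'])
  also have "\<dots> = (star_size_ratio * \<kappa> * ?d) ^ DIM('a) * (\<omega> * \<rho>0 ^ DIM('a))"
    using S1 \<kappa> by (simp add: \<rho>0_def power_divide)
  finally have "?X * vol T0 \<le> ?X * ((star_size_ratio * \<kappa> * ?d) ^ DIM('a) * (\<omega> * \<rho>0 ^ DIM('a)))"
    by (intro mult_left_mono) auto
  also have "\<dots> = (star_size_ratio * \<kappa> * ?d) ^ DIM('a) * (?X * (\<omega> * \<rho>0 ^ DIM('a)))" by (simp add: mult_ac)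
  also have "\<dots> \<le> (star_size_ratio * \<kappa> * ?d) ^ DIM('a) * (?X * (\<omega> * \<rho> ^ DIM('a)))"
    using S1 \<kappa> \<omega>_pos \<rho>0 \<rho>0p by (intro mult_left_mono power_mono) auto
  also have "\<dots> \<le> (star_size_ratio * \<kappa> * ?d) ^ DIM('a) * (4 * mean_const * (star_size_ratio * diameter T0)\<^sup>2 * (e T + e T'))"
  proof (rule mult_left_mono)
    show "?X * (\<omega> * \<rho> ^ DIM('a)) \<le> 4 * mean_const * (star_size_ratio * diameter T0)\<^sup>2 * (e T + e T')"
      unfolding \<rho>_def using star_diameter[OF T(1) T0] star_diameter[OF T(2) T0]
      by (intro adjacent_mean_diff T' T)
    show "0 \<le> (star_size_ratio * \<kappa> * ?d) ^ DIM('a)" using S1 \<kappa> by simp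
  qed
  also have "\<dots> = adj_mean_const * (diameter T0)\<^sup>2 * (e T + e T')" by (simp add: adj_mean_const_def power_mult_distrib mult_ac)
  also have "\<dots> \<le> adj_mean_const * (diameter T0)\<^sup>2 * star_energy \<nu>" using ee consts_nonneg by (intro mult_left_mono) auto
  finally show ?thesis .
qed

lemma star_mean_diff_aux:
  assumes T: "T \<in> star \<nu>" and T': "T' \<in> star \<nu>" and T0: "T0 \<in> star \<nu>"
  shows "(mean T v - mean T' v)\<^sup>2 * vol T0 \<le> (real (star_card_bound\<^sup>2))\<^sup>2 * adj_mean_const * (diameter T0)\<^sup>2 * star_energy \<nu>"
proof -
  have vp: "0 < vol T0" using mesh_vol_pos T0 by (simp add: star_def)
  define Q where "Q = adj_mean_const * (diameter T0)\<^sup>2 * star_energy \<nu>"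
  have Q0: "0 \<le> Q" unfolding Q_def using consts_nonneg star_energy_nonneg by (intro mult_nonneg_nonneg) auto
  define E where "E = sqrt (Q / vol T0)"
  have E2: "E\<^sup>2 = Q / vol T0" and E0: "0 \<le> E" using Q0 vp by (auto simp: E_def)
  have step: "\<bar>mean a v - mean b v\<bar> \<le> E" if "(a, b) \<in> adj_rel \<nu>" for a b
  proof -
    have "(mean a v - mean b v)\<^sup>2 \<le> E\<^sup>2"
      unfolding E2 using adjacent_star_mean_diff[OF that T0] vp by (simp add: Q_def pos_le_divide_eq)
    then show ?thesis using E0 by (metis abs_le_square_iff abs_of_nonneg)
  qed
  obtain n where n: "n \<le> star_card_bound\<^sup>2" "(T, T') \<in> (adj_rel \<nu>) ^^ n" using star_chain[OF T T'] .
  have "\<bar>mean T v - mean T' v\<bar> \<le> real n * E"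
    using chain_bound[OF n(2), of "\<lambda>T. mean T v" E] step by blast
  also have "\<dots> \<le> real (star_card_bound\<^sup>2) * E" using n(1) E0 by (intro mult_right_mono) (simp_all only: of_nat_le_iff)
  finally have "\<bar>mean T v - mean T' v\<bar>\<^sup>2 \<le> (real (star_card_bound\<^sup>2) * E)\<^sup>2" by (intro power_mono) auto
  then have "(mean T v - mean T' v)\<^sup>2 * vol T0 \<le> (real (star_card_bound\<^sup>2) * E)\<^sup>2 * vol T0" using vp by simp
  also have "\<dots> = (real (star_card_bound\<^sup>2))\<^sup>2 * Q" using vp by (simp only: power_mult_distrib E2) simp
  finally show ?thesis by (simp add: Q_def mult.assoc)
qed

lemma star_mean_diff:
  assumes T: "T \<in> star \<nu>" and T': "T' \<in> star \<nu>" and T0: "T0 \<in> star \<nu>"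
  shows "(mean T v - mean T' v)\<^sup>2 * vol T0 \<le> star_mean_const * (diameter T0)\<^sup>2 * star_energy \<nu>"
proof -
  have "(real (star_card_bound\<^sup>2))\<^sup>2 * adj_mean_const \<le> star_mean_const" unfolding star_mean_const_def using consts_nonneg by (simp add: add_increasing2)
  then have "(real (star_card_bound\<^sup>2))\<^sup>2 * adj_mean_const * (diameter T0)\<^sup>2 * star_energy \<nu> \<le> star_mean_const * (diameter T0)\<^sup>2 * star_energy \<nu>"
    using star_energy_nonneg by (intro mult_right_mono) auto
  then show ?thesis using star_mean_diff_aux[OF assms] by linarith
qed

end

locale mesh_fun_gamma = mesh_fun +
  fixes \<gamma> :: "'a set" and \<F> :: "'a set set"
  assumes facets: "\<And>F. F \<in> \<F> \<Longrightarrow> \<exists>T\<in>\<T>. F facet_of closure T" and \<gamma>: "\<gamma> = \<Union>\<F>"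
    and van: "vanishes_at \<Omega> \<gamma> v"
begin

lemma half_space_ball_open: "open {y \<in> ball (c::'a) \<delta>. 0 < (y - c) \<bullet> n}"
proof -
  have "{y \<in> ball c \<delta>. 0 < (y - c) \<bullet> n} = ball c \<delta> \<inter> {x. n \<bullet> c < n \<bullet> x}"
    by (auto simp: inner_diff_left inner_commute[of n])
  then show ?thesis by (simp add: open_Int open_halfspace_gt)
qed

text \<open>
  At a facet contained in \<open>\<gamma>\<close> the role of the constant on the ball is played by zero, by the
  Friedrichs inequality on the half ball at the barycentre of the facet.
\<close>

lemma gamma_mean_facet:
  assumes T: "T \<in> \<T>" and F: "F facet_of closure T" and F\<gamma>: "F \<subseteq> \<gamma>"
  shows "(mean T v)\<^sup>2 * (\<omega> * (diameter T / (2 * \<kappa> * real DIM('a))) ^ DIM('a)) \<le> mean_const * (diameter T)\<^sup>2 * e T"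
proof -
  note sT = mesh_simplex[OF T]
  obtain a where a: "a \<in> vertices_of T" "F = convex hull (vertices_of T - {a})" "F = {x \<in> closure T. bary T a x = 0}"
    using facet_of_simplex[OF sT F] .
  define c where "c = barycenter (vertices_of T - {a})"
  have c: "bary T w c = (if w = a then 0 else 1 / real DIM('a))" if "w \<in> vertices_of T" for w
    unfolding c_def using bary_barycenter[OF sT a(1) that] .
  obtain x where x: "ball x (diameter T / \<kappa>) \<subseteq> T" using mesh_ball[OF T] .
  have rp: "0 < diameter T / \<kappa>" using mesh_diameter_pos[OF T] \<kappa> by auto
  define \<delta> where "\<delta> = 2 * (diameter T / \<kappa>) * (1 / real DIM('a))"
  have \<delta>0: "0 < \<delta>" unfolding \<delta>_def by (intro mult_pos_pos rp) auto
  have inT: "y \<in> ball c \<delta> \<Longrightarrow> 0 < bary T a y \<Longrightarrow> y \<in> T" "y \<in> ball c \<delta> \<Longrightarrow> bary T a y = 0 \<Longrightarrow> y \<in> closure T" for y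
    using half_ball_in_simplex(2,3)[OF sT a(1) rp x, of c "1 / real DIM('a)" y] c a(1) by (auto simp: \<delta>_def)
  obtain n where n: "norm n = 1" "\<And>y. 0 < bary T a y \<longleftrightarrow> 0 < (y - c) \<bullet> n" "\<And>y. bary T a y = 0 \<longleftrightarrow> (y - c) \<bullet> n = 0"
    using bary_sign_normal[OF sT a(1), of c] c[OF a(1)] by auto
  let ?H = "{y \<in> ball c \<delta>. 0 < (y - c) \<bullet> n}" and ?A = "ball (c + (\<delta>/2) *\<^sub>R n) (\<delta>/4)"
  have HT: "?H \<subseteq> T" using inT(1) n(2) by blast
  have Hm: "?H \<in> sets lebesgue" using half_space_ball_open[of c \<delta> n] by simp
  have AH: "?A \<subseteq> ?H" using half_ball_subball[OF n(1) \<delta>0, of c] \<delta>0 by (auto simp: subset_iff)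
  have fr: "(L2_norm ?A v)\<^sup>2 \<le> \<delta>\<^sup>2 * e ?H"
  proof (rule friedrichs_half_ball[OF open_\<Omega> vC n(1) \<delta>0 _ _ vL2 gL2])
    show "?H \<subseteq> \<Omega>" using HT mesh_subset[OF T] by blast
    fix y assume y: "y \<in> ball c \<delta>" "(y - c) \<bullet> n = 0"
    then have "y \<in> F" unfolding a(3) using inT(2)[OF y(1)] n(3)[of y] by simp
    then show "(v \<longlongrightarrow> 0) (at y within \<Omega>)" using van F\<gamma> unfolding vanishes_at_def by blast
  qed
  have "e ?H \<le> e T"
    by (rule grad_energy_mono[OF mesh_L2[OF gL2 T] HT Hm mesh_meas[OF T]])
  then have sA: "(L2_norm ?A v)\<^sup>2 \<le> \<delta>\<^sup>2 * e T" using fr by (meson mult_left_mono order_trans zero_le_power2)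
  have AT: "?A \<subseteq> T" using AH HT by blast
  have vA: "(\<lambda>x. v x - 0) \<in> L2_space ?A" using L2_space_subset[OF mesh_L2[OF vL2 T] AT] T by simp
  have "(mean T v)\<^sup>2 * vol ?A \<le> 2 * (poincare_const * (diameter T)\<^sup>2 * e T) + 2 * (\<delta>\<^sup>2 * e T)"
    using mean_on_subset[OF T AT _ vA] sA by simp
  also have "\<dots> \<le> 2 * (poincare_const * (diameter T)\<^sup>2 * e T) + 2 * ((facet_ball_ratio * diameter T)\<^sup>2 * e T)"
  proof -
    have "2 * (diameter T / \<kappa>) * (1 / real DIM('a)) \<le> 2 * (diameter T / \<kappa>) * 1"
      using rp by (intro mult_left_mono) (auto simp: DIM_ge_Suc0 Suc_leI)
    then have "\<delta> \<le> facet_ball_ratio * diameter T" by (simp add: \<delta>_def facet_ball_ratio_def)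
    then have "\<delta>\<^sup>2 \<le> (facet_ball_ratio * diameter T)\<^sup>2" using \<delta>0 by (intro power_mono) auto
    then show ?thesis by (simp add: mult_right_mono)
  qed
  also have "\<dots> \<le> mean_const * (diameter T)\<^sup>2 * e T"
  proof -
    have "2 * poincare_const + 2 * facet_ball_ratio\<^sup>2 \<le> mean_const"
    proof -
      have "1 \<le> (2::real) ^ DIM('a)" by simp
      then have "2 \<le> 8 * (2::real) ^ DIM('a)" by linarith
      then have "2 * facet_ball_ratio\<^sup>2 \<le> 8 * 2 ^ DIM('a) * facet_ball_ratio\<^sup>2" by (intro mult_right_mono) auto
      then show ?thesis by (simp add: mean_const_def)
    qed
    then have "(2 * poincare_const + 2 * facet_ball_ratio\<^sup>2) * ((diameter T)\<^sup>2 * e T) \<le> mean_const * ((diameter T)\<^sup>2 * e T)"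
      by (intro mult_right_mono) auto
    then show ?thesis by (simp add: power_mult_distrib algebra_simps)
  qed
  finally have fin: "(mean T v)\<^sup>2 * vol ?A \<le> mean_const * (diameter T)\<^sup>2 * e T" .
  have \<delta>4: "\<delta>/4 = diameter T / (2 * \<kappa> * real DIM('a))" by (simp add: \<delta>_def)
  have "vol ?A = \<omega> * (\<delta>/4) ^ DIM('a)" using \<delta>0 by (intro vol_ball) simp
  then show ?thesis using fin by (simp only: \<delta>4)
qed

text \<open>
  A point of \<open>\<gamma>\<close> lies on a facet in \<open>\<gamma>\<close> of some element \<open>T1\<close> of its star; compare the mean on
  \<open>T\<close> with that on \<open>T1\<close>, and the latter with zero.
\<close>

lemma star_mean_gamma:
  assumes \<nu>: "\<nu> \<in> \<gamma>" and T: "T \<in> star \<nu>" and T0: "T0 \<in> star \<nu>"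
  shows "(mean T v)\<^sup>2 * vol T0 \<le> star_mean_const * (diameter T0)\<^sup>2 * star_energy \<nu>"
proof -
  let ?d = "real DIM('a)"
  obtain F T1 where F: "F \<in> \<F>" "\<nu> \<in> F" "T1 \<in> \<T>" "F facet_of closure T1" using \<nu> \<gamma> facets by blast
  have "F \<subseteq> closure T1" using F(4) by (simp add: facet_of_def face_of_def)
  then have T1: "T1 \<in> star \<nu>" using F by (auto simp: star_def)
  have T0': "T0 \<in> \<T>" using T0 by (simp add: star_def)
  have S1: "0 < star_size_ratio" using star_size_ratio_ge_1 by simp
  have D0: "0 < diameter T0" and D1: "0 < diameter T1" using mesh_diameter_pos T0' F(3) by auto
  define \<rho> where "\<rho> = diameter T1 / (2 * \<kappa> * ?d)"
  define \<rho>0 where "\<rho>0 = diameter T0 / (2 * star_size_ratio * \<kappa> * ?d)"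
  have "diameter T0 / star_size_ratio \<le> diameter T1" using star_diameter[OF T0 T1] S1 by (simp add: pos_divide_le_eq mult.commute)
  then have "diameter T0 / star_size_ratio / (2 * \<kappa> * ?d) \<le> \<rho>" unfolding \<rho>_def using \<kappa> by (intro divide_right_mono) auto
  then have \<rho>0: "\<rho>0 \<le> \<rho>" by (simp add: \<rho>0_def mult_ac)
  have \<rho>0p: "0 < \<rho>0" using D0 S1 \<kappa> by (simp add: \<rho>0_def)
  let ?X = "(mean T1 v)\<^sup>2"
  have "vol T0 \<le> \<omega> * diameter T0 ^ DIM('a)" by (rule mesh_vol_le[OF T0'])
  also have "\<dots> = (2 * star_size_ratio * \<kappa> * ?d) ^ DIM('a) * (\<omega> * \<rho>0 ^ DIM('a))"
    using S1 \<kappa> by (simp add: \<rho>0_def power_divide)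
  finally have "?X * vol T0 \<le> ?X * ((2 * star_size_ratio * \<kappa> * ?d) ^ DIM('a) * (\<omega> * \<rho>0 ^ DIM('a)))"
    by (intro mult_left_mono) auto
  also have "\<dots> = (2 * star_size_ratio * \<kappa> * ?d) ^ DIM('a) * (?X * (\<omega> * \<rho>0 ^ DIM('a)))" by (simp add: mult_ac)
  also have "\<dots> \<le> (2 * star_size_ratio * \<kappa> * ?d) ^ DIM('a) * (?X * (\<omega> * \<rho> ^ DIM('a)))"
    using S1 \<kappa> \<omega>_pos \<rho>0 \<rho>0p by (intro mult_left_mono power_mono) auto
  also have "\<dots> \<le> (2 * star_size_ratio * \<kappa> * ?d) ^ DIM('a) * (mean_const * (star_size_ratio * diameter T0)\<^sup>2 * star_energy \<nu>)"
  proof (rule mult_left_mono)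
    have "F \<subseteq> \<gamma>" using F(1) \<gamma> by blast
    then have "?X * (\<omega> * \<rho> ^ DIM('a)) \<le> mean_const * (diameter T1)\<^sup>2 * e T1"
      unfolding \<rho>_def by (rule gamma_mean_facet[OF F(3,4)])
    also have "\<dots> \<le> mean_const * (star_size_ratio * diameter T0)\<^sup>2 * star_energy \<nu>"
      using star_diameter[OF T1 T0] D1 consts_nonneg e_le_star_energy[OF T1]
      by (intro mult_mono power_mono) auto
    finally show "?X * (\<omega> * \<rho> ^ DIM('a)) \<le> mean_const * (star_size_ratio * diameter T0)\<^sup>2 * star_energy \<nu>" .
    show "0 \<le> (2 * star_size_ratio * \<kappa> * ?d) ^ DIM('a)" using S1 \<kappa> by simp
  qed
  also have "\<dots> = gamma_mean_const * (diameter T0)\<^sup>2 * star_energy \<nu>" by (simp add: gamma_mean_const_def power_mult_distrib mult_ac)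
  finally have 1: "?X * vol T0 \<le> gamma_mean_const * (diameter T0)\<^sup>2 * star_energy \<nu>" .
  have 2: "(mean T v - mean T1 v)\<^sup>2 * vol T0 \<le> (real (star_card_bound\<^sup>2))\<^sup>2 * adj_mean_const * (diameter T0)\<^sup>2 * star_energy \<nu>"
    by (rule star_mean_diff_aux[OF T T1 T0])
  have "(mean T v)\<^sup>2 \<le> 2 * (mean T v - mean T1 v)\<^sup>2 + 2 * (mean T1 v)\<^sup>2"
    using zero_le_power2[of "mean T v - 2 * mean T1 v"] by (simp add: power2_eq_square algebra_simps)
  then have "(mean T v)\<^sup>2 * vol T0 \<le> (2 * (mean T v - mean T1 v)\<^sup>2 + 2 * (mean T1 v)\<^sup>2) * vol T0"
    by (rule mult_right_mono) simp
  also have "\<dots> = 2 * ((mean T v - mean T1 v)\<^sup>2 * vol T0) + 2 * (?X * vol T0)" by (simp add: algebra_simps)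
  also have "\<dots> \<le> 2 * ((real (star_card_bound\<^sup>2))\<^sup>2 * adj_mean_const * (diameter T0)\<^sup>2 * star_energy \<nu>) + 2 * (gamma_mean_const * (diameter T0)\<^sup>2 * star_energy \<nu>)"
    using 1 2 by linarith
  also have "\<dots> = star_mean_const * (diameter T0)\<^sup>2 * star_energy \<nu>" by (simp add: star_mean_const_def algebra_simps)
  finally show ?thesis .
qed

end

section \<open>The nodal basis on an element\<close>

lemma affine_fun_finite_sum:
  assumes "\<And>i. i \<in> I \<Longrightarrow> \<exists>a \<beta>. f i = (\<lambda>x. a \<bullet> x + \<beta>)"
  shows "\<exists>a \<beta>. (\<lambda>x. \<Sum>i\<in>I. c i * f i x) = (\<lambda>x. (a::'a::euclidean_space) \<bullet> x + \<beta>)"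
proof -
  have "\<forall>i. \<exists>a \<beta>. i \<in> I \<longrightarrow> f i = (\<lambda>x. a \<bullet> x + \<beta>)" using assms by blast
  then obtain a \<beta> where ab: "\<And>i. i \<in> I \<Longrightarrow> f i = (\<lambda>x. a i \<bullet> x + \<beta> i)" by metis
  have "(\<Sum>i\<in>I. c i * f i x) = (\<Sum>i\<in>I. c i *\<^sub>R a i) \<bullet> x + (\<Sum>i\<in>I. c i * \<beta> i)" for x
  proof -
    have "(\<Sum>i\<in>I. c i * f i x) = (\<Sum>i\<in>I. (c i *\<^sub>R a i) \<bullet> x + c i * \<beta> i)"
      by (rule sum.cong[OF refl]) (simp add: ab distrib_left)
    then show ?thesis by (simp add: sum.distrib inner_sum_left)
  qed
  then show ?thesis by blast
qed

lemma monomial_degree_1_affine: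
  fixes \<alpha> :: "'a::euclidean_space \<Rightarrow> nat"
  assumes "(\<Sum>b\<in>Basis. \<alpha> b) \<le> 1"
  shows "\<exists>a \<beta>. (\<lambda>x::'a. \<Prod>b\<in>Basis. (x \<bullet> b) ^ \<alpha> b) = (\<lambda>x. a \<bullet> x + \<beta>)"
proof (cases "\<exists>b\<in>Basis. \<alpha> b \<noteq> 0")
  case False
  then show ?thesis by (intro exI[of _ 0] exI[of _ 1]) simp
next
  case True
  then obtain b where b: "b \<in> Basis" "\<alpha> b \<noteq> 0" by blast
  have s: "\<alpha> b + (\<Sum>c\<in>Basis - {b}. \<alpha> c) \<le> 1" using assms b(1) by (simp add: sum.remove)
  have 1: "\<alpha> b = 1" using s b(2) by linarith
  have "(\<Sum>c\<in>Basis - {b}. \<alpha> c) = 0" using s b(2) by linarith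
  then have 0: "\<alpha> c = 0" if "c \<in> Basis - {b}" for c using that by (simp only: sum_eq_0_iff finite_Diff finite_Basis)
  have "(\<Prod>c\<in>Basis. (x \<bullet> c) ^ \<alpha> c) = b \<bullet> x + 0" for x :: 'a
  proof -
    have "(\<Prod>c\<in>Basis. (x \<bullet> c) ^ \<alpha> c) = (x \<bullet> b) ^ \<alpha> b * (\<Prod>c\<in>Basis - {b}. (x \<bullet> c) ^ \<alpha> c)"
      using b(1) by (simp add: prod.remove)
    also have "(\<Prod>c\<in>Basis - {b}. (x \<bullet> c) ^ \<alpha> c) = 1" using 0 by (intro prod.neutral) auto
    finally show ?thesis using 1 by (simp add: inner_commute)
  qed
  then show ?thesis by blast
qed

lemma poly_space_1_affine:
  assumes "q \<in> poly_space 1"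
  obtains a \<beta> where "q = (\<lambda>x. a \<bullet> x + \<beta>)"
proof -
  let ?I = "{\<alpha> \<in> Basis \<rightarrow>\<^sub>E (UNIV :: nat set). (\<Sum>b\<in>Basis. \<alpha> b) \<le> 1}"
  obtain c where c: "\<And>x. q x = (\<Sum>\<alpha>\<in>?I. c \<alpha> * (\<Prod>b\<in>Basis. (x \<bullet> b) ^ \<alpha> b))"
    using assms unfolding poly_space_def by blast
  have "\<exists>a \<beta>. (\<lambda>x. \<Sum>\<alpha>\<in>?I. c \<alpha> * (\<Prod>b\<in>Basis. (x \<bullet> b) ^ \<alpha> b)) = (\<lambda>x. a \<bullet> x + \<beta>)"
    by (rule affine_fun_finite_sum) (use monomial_degree_1_affine in auto)
  then obtain a \<beta> where ab: "(\<lambda>x. \<Sum>\<alpha>\<in>?I. c \<alpha> * (\<Prod>b\<in>Basis. (x \<bullet> b) ^ \<alpha> b)) = (\<lambda>x. a \<bullet> x + \<beta>)" by blast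
  have "q = (\<lambda>x. \<Sum>\<alpha>\<in>?I. c \<alpha> * (\<Prod>b\<in>Basis. (x \<bullet> b) ^ \<alpha> b))" using c by blast
  with ab show ?thesis using that by simp
qed

lemma affine_fun_Ck:
  fixes a :: "'a::euclidean_space"
  shows "Ck_on 1 T (\<lambda>x. a \<bullet> x + \<beta>)" "frechet_derivative (\<lambda>x. a \<bullet> x + \<beta>) (at x) b = a \<bullet> b"
proof -
  have D: "((\<lambda>x. a \<bullet> x + \<beta>) has_derivative (\<lambda>h. a \<bullet> h)) (at x)" for x
    by (auto intro!: derivative_eq_intros)
  have fd: "frechet_derivative (\<lambda>x. a \<bullet> x + \<beta>) (at x) = (\<lambda>h. a \<bullet> h)" for x
    using frechet_derivative_at[OF D] by simp
  show "frechet_derivative (\<lambda>x. a \<bullet> x + \<beta>) (at x) b = a \<bullet> b" by (simp add: fd)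
  show "Ck_on 1 T (\<lambda>x. a \<bullet> x + \<beta>)"
    unfolding Ck_on_1 fd using D by (auto simp: differentiable_def)
qed

lemma sum_inner_Basis_sq: "(\<Sum>b\<in>Basis. (a \<bullet> b)\<^sup>2) = (norm (a::'a::euclidean_space))\<^sup>2"
  unfolding power2_norm_eq_inner euclidean_inner[of a a] by (simp add: power2_eq_square)

lemma AE_lebesgue_on_subset:
  assumes "AE x in lebesgue_on S. P x" "T \<subseteq> S" "T \<in> sets lebesgue" "S \<in> sets lebesgue"
  shows "AE x in lebesgue_on T. P x"
  using assms by (auto simp: AE_restrict_space_iff elim!: eventually_mono)

lemma weak_partial_affine_sq:
  fixes u :: "'a::euclidean_space \<Rightarrow> real"
  assumes \<Omega>: "open \<Omega>" and u: "u \<in> H1_space \<Omega>" and T: "open T" "T \<subseteq> \<Omega>"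
    and eq: "\<And>x. x \<in> T \<Longrightarrow> u x = a \<bullet> x + \<beta>" and H: "H \<subseteq> T" "H \<in> sets lebesgue" "emeasure lebesgue H < \<infinity>"
  shows "(\<Sum>b\<in>Basis. (L2_norm H (weak_partial \<Omega> b u))\<^sup>2) = (norm a)\<^sup>2 * vol H"
proof -
  have "(L2_norm H (weak_partial \<Omega> b u))\<^sup>2 = (a \<bullet> b)\<^sup>2 * vol H" if b: "b \<in> Basis" for b
  proof -
    have "AE x in lebesgue_on T. weak_partial \<Omega> b u x = frechet_derivative (\<lambda>x. a \<bullet> x + \<beta>) (at x) b"
      by (rule weak_partial_eq_frechet_derivative[OF \<Omega> T b is_weak_partial_weak_partial[OF u b]
            H1_space_L2[OF u] affine_fun_Ck(1) eq])
    then have "AE x in lebesgue_on H. weak_partial \<Omega> b u x = a \<bullet> b"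
      using AE_lebesgue_on_subset[OF _ H(1,2)] T(1) by (simp add: affine_fun_Ck(2))
    moreover have "weak_partial \<Omega> b u \<in> L2_space H"
      by (rule L2_space_subset[OF weak_partial_L2[OF u b]]) (use H T \<Omega> in auto)
    ultimately have "L2_norm H (weak_partial \<Omega> b u) = L2_norm H (\<lambda>x. a \<bullet> b)"
      by (rule L2_norm_cong_AE[OF _ _ L2_space_const[OF H(3,2)]])
    then show ?thesis using L2_norm_sq_const[OF H(2)] by simp
  qed
  then have "(\<Sum>b\<in>Basis. (L2_norm H (weak_partial \<Omega> b u))\<^sup>2) = (\<Sum>b\<in>Basis. (a \<bullet> b)\<^sup>2) * vol H"
    by (simp add: sum_distrib_right)
  then show ?thesis by (simp add: sum_inner_Basis_sq)
qed

text \<open>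
  Holds for the smooth functions vanishing at \<open>\<gamma>\<close> by \<open>friedrichs_half_ball\<close> and passes to the
  closure.
\<close>

lemma friedrichs_H10:
  fixes u :: "'a::euclidean_space \<Rightarrow> real"
  assumes \<Omega>: "open \<Omega>" and u: "u \<in> H10_space \<Omega> \<gamma>" and n: "norm n = 1" and r: "0 < r"
    and H: "{x \<in> ball c r. 0 < (x - c) \<bullet> n} \<subseteq> \<Omega>" and Hm: "{x \<in> ball c r. 0 < (x - c) \<bullet> n} \<in> sets lebesgue"
    and flat: "\<And>y. y \<in> ball c r \<Longrightarrow> (y - c) \<bullet> n = 0 \<Longrightarrow> y \<in> \<gamma>"
    and A: "ball (c + (r/2) *\<^sub>R n) (r/4) \<subseteq> \<Omega>"
  shows "(L2_norm (ball (c + (r/2) *\<^sub>R n) (r/4)) u)\<^sup>2 \<le>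
     4 * r\<^sup>2 * (\<Sum>b\<in>Basis. (L2_norm {x \<in> ball c r. 0 < (x - c) \<bullet> n} (weak_partial \<Omega> b u))\<^sup>2)"
    (is "(L2_norm ?A u)\<^sup>2 \<le> 4 * r\<^sup>2 * ?S")
proof -
  let ?H = "{x \<in> ball c r. 0 < (x - c) \<bullet> n}"
  have \<Omega>m: "\<Omega> \<in> sets lebesgue" using \<Omega> by simp
  note u1 = H10_space_H1[OF u]
  have main: "(L2_norm ?A u)\<^sup>2 \<le> 4 * r\<^sup>2 * ?S + (4 * r\<^sup>2 + 2) * \<epsilon>\<^sup>2" if \<epsilon>: "0 < \<epsilon>" for \<epsilon>
  proof -
    obtain v where v: "v \<in> H1_space \<Omega>" "smooth_on \<Omega> v" "vanishes_at \<Omega> \<gamma> v" "H1_norm \<Omega> (\<lambda>x. u x - v x) < \<epsilon>"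
      using u \<epsilon> unfolding H10_space_def by blast
    have vC: "Ck_on 1 \<Omega> v" using v(2) by (rule smooth_on_Ck)
    let ?w = "\<lambda>x. u x - v x"
    have w1: "?w \<in> H1_space \<Omega>" using H1_space_lincomb[OF \<Omega> u1 v(1), of 1 "-1"] by simp
    have w\<epsilon>: "(H1_norm \<Omega> ?w)\<^sup>2 \<le> \<epsilon>\<^sup>2" using v(4) by (intro power_mono) auto
    have wL2: "(L2_norm \<Omega> ?w)\<^sup>2 \<le> \<epsilon>\<^sup>2" and wg: "(\<Sum>b\<in>Basis. (L2_norm \<Omega> (weak_partial \<Omega> b ?w))\<^sup>2) \<le> \<epsilon>\<^sup>2"
    proof -
      have "0 \<le> (\<Sum>b\<in>Basis. (L2_norm \<Omega> (weak_partial \<Omega> b ?w))\<^sup>2)" by (rule sum_nonneg) simp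
      moreover have "0 \<le> (L2_norm \<Omega> ?w)\<^sup>2" by simp
      ultimately show "(L2_norm \<Omega> ?w)\<^sup>2 \<le> \<epsilon>\<^sup>2" "(\<Sum>b\<in>Basis. (L2_norm \<Omega> (weak_partial \<Omega> b ?w))\<^sup>2) \<le> \<epsilon>\<^sup>2"
        using w\<epsilon> unfolding H1_norm_sq by linarith+
    qed
    have A2: "f \<in> L2_space ?A" if "f \<in> L2_space \<Omega>" for f using L2_space_subset[OF that A] \<Omega>m by simp
    have H2: "f \<in> L2_space ?H" if "f \<in> L2_space \<Omega>" for f using L2_space_subset[OF that H Hm \<Omega>m] .
    have g: "(\<lambda>x. frechet_derivative v (at x) b) \<in> L2_space \<Omega>" if "b \<in> Basis" for b
      using smooth_H1_gradient(1)[OF \<Omega> v(1) vC that] .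
    have "(L2_norm ?A v)\<^sup>2 \<le> r\<^sup>2 * grad_energy ?H v"
      using flat v(3) by (intro friedrichs_half_ball[OF \<Omega> vC n r H _ H1_space_L2[OF v(1)] g]) (auto simp: vanishes_at_def)
    also have "grad_energy ?H v \<le> 2 * ?S + 2 * \<epsilon>\<^sup>2"
    proof -
      have "(L2_norm ?H (\<lambda>x. frechet_derivative v (at x) b))\<^sup>2
         \<le> 2 * (L2_norm ?H (weak_partial \<Omega> b u))\<^sup>2 + 2 * (L2_norm \<Omega> (weak_partial \<Omega> b ?w))\<^sup>2" if b: "b \<in> Basis" for b
      proof -
        have "AE x in lebesgue_on \<Omega>. weak_partial \<Omega> b v x = frechet_derivative v (at x) b"
          by (rule weak_partial_eq_frechet_derivative[OF \<Omega> \<Omega> order_refl b is_weak_partial_weak_partial[OF v(1) b]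
                H1_space_L2[OF v(1)] vC]) simp
        moreover have "AE x in lebesgue_on \<Omega>. weak_partial \<Omega> b ?w x = weak_partial \<Omega> b u x - weak_partial \<Omega> b v x"
          using weak_partial_lincomb[OF \<Omega> u1 v(1) b, of 1 "-1"] by simp
        ultimately have "AE x in lebesgue_on \<Omega>. frechet_derivative v (at x) b = 1 * weak_partial \<Omega> b u x + (-1) * weak_partial \<Omega> b ?w x"
          by eventually_elim simp
        then have ae: "AE x in lebesgue_on ?H. frechet_derivative v (at x) b = 1 * weak_partial \<Omega> b u x + (-1) * weak_partial \<Omega> b ?w x"
          by (rule AE_lebesgue_on_subset[OF _ H Hm \<Omega>m])
        have uH: "weak_partial \<Omega> b u \<in> L2_space ?H" and wH: "weak_partial \<Omega> b ?w \<in> L2_space ?H"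
          using H2 weak_partial_L2[OF u1 b] weak_partial_L2[OF w1 b] by auto
        have "(L2_norm ?H (\<lambda>x. frechet_derivative v (at x) b))\<^sup>2
           = (L2_norm ?H (\<lambda>x. 1 * weak_partial \<Omega> b u x + (-1) * weak_partial \<Omega> b ?w x))\<^sup>2"
          using L2_norm_cong_AE[OF ae H2[OF g[OF b]] L2_space_lincomb[OF uH wH]] by simp
        also have "\<dots> \<le> 2 * 1\<^sup>2 * (L2_norm ?H (weak_partial \<Omega> b u))\<^sup>2 + 2 * (-1)\<^sup>2 * (L2_norm ?H (weak_partial \<Omega> b ?w))\<^sup>2"
          by (rule L2_norm_sq_lincomb_le[OF uH wH])
        also have "(L2_norm ?H (weak_partial \<Omega> b ?w))\<^sup>2 \<le> (L2_norm \<Omega> (weak_partial \<Omega> b ?w))\<^sup>2"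
          by (rule L2_norm_sq_subset_le[OF weak_partial_L2[OF w1 b] H Hm \<Omega>m])
        finally show ?thesis by simp
      qed
      then have "grad_energy ?H v \<le> (\<Sum>b\<in>Basis. 2 * (L2_norm ?H (weak_partial \<Omega> b u))\<^sup>2 + 2 * (L2_norm \<Omega> (weak_partial \<Omega> b ?w))\<^sup>2)"
        unfolding grad_energy_def by (rule sum_mono)
      also have "\<dots> = 2 * ?S + 2 * (\<Sum>b\<in>Basis. (L2_norm \<Omega> (weak_partial \<Omega> b ?w))\<^sup>2)"
        by (simp add: sum.distrib sum_distrib_left)
      finally show ?thesis using wg by linarith
    qed
    finally have vA: "(L2_norm ?A v)\<^sup>2 \<le> r\<^sup>2 * (2 * ?S + 2 * \<epsilon>\<^sup>2)" by (simp add: mult_left_mono)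
    have "(L2_norm ?A u)\<^sup>2 = (L2_norm ?A (\<lambda>x. 1 * v x + 1 * ?w x))\<^sup>2" by simp
    also have "\<dots> \<le> 2 * 1\<^sup>2 * (L2_norm ?A v)\<^sup>2 + 2 * 1\<^sup>2 * (L2_norm ?A ?w)\<^sup>2"
      by (rule L2_norm_sq_lincomb_le[OF A2[OF H1_space_L2[OF v(1)]] A2[OF H1_space_L2[OF w1]]])
    also have "(L2_norm ?A ?w)\<^sup>2 \<le> (L2_norm \<Omega> ?w)\<^sup>2"
      by (rule L2_norm_sq_subset_le[OF H1_space_L2[OF w1] A]) (use \<Omega>m in auto)
    finally have "(L2_norm ?A u)\<^sup>2 \<le> 2 * (L2_norm ?A v)\<^sup>2 + 2 * (L2_norm \<Omega> ?w)\<^sup>2" by simp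
    then have "(L2_norm ?A u)\<^sup>2 \<le> 2 * (r\<^sup>2 * (2 * ?S + 2 * \<epsilon>\<^sup>2)) + 2 * \<epsilon>\<^sup>2" using vA wL2 by linarith
    then show ?thesis by (simp add: algebra_simps)
  qed
  show ?thesis
  proof (rule field_le_epsilon)
    fix e :: real assume e: "0 < e"
    define \<epsilon> where "\<epsilon> = sqrt (e / (4 * r\<^sup>2 + 2))"
    have p: "0 < 4 * r\<^sup>2 + 2" by (simp add: add_nonneg_pos)
    have "0 < \<epsilon>" "(4 * r\<^sup>2 + 2) * \<epsilon>\<^sup>2 = e" using e p by (auto simp: \<epsilon>_def)
    then show "(L2_norm ?A u)\<^sup>2 \<le> 4 * r\<^sup>2 * ?S + e" using main[of \<epsilon>] by simp
  qed
qed


locale mesh_gamma = mesh +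
  fixes \<gamma> :: "'a set" and \<F> :: "'a set set"
  assumes facets: "\<And>F. F \<in> \<F> \<Longrightarrow> \<exists>T\<in>\<T>. F facet_of closure T" and \<gamma>: "\<gamma> = \<Union>\<F>"
begin

text \<open>
  Membership of $H^1_{0,\gamma}$ is a statement about a closure, so vanishing on \<open>\<gamma>\<close> has to be
  recovered from an estimate. On a half ball of radius $r$ at $c$ the Friedrichs inequality bounds
  the mean square of \<open>u\<close> by a multiple of $r^2|a|^2$; if the affine function were nonzero at $c$,
  its mean square would not tend to zero with $r$.
\<close>

lemma H10_affine_zero_relint:
  assumes T: "T \<in> \<T>" and v: "v \<in> vertices_of T"
    and F\<gamma>: "{x \<in> closure T. bary T v x = 0} \<subseteq> \<gamma>"
    and u: "u \<in> H10_space \<Omega> \<gamma>" and eq: "\<And>x. x \<in> T \<Longrightarrow> u x = a \<bullet> x + \<beta>"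
    and c: "bary T v c = 0" and \<mu>: "0 < \<mu>" "\<And>w. w \<in> vertices_of T \<Longrightarrow> w \<noteq> v \<Longrightarrow> \<mu> \<le> bary T w c"
  shows "a \<bullet> c + \<beta> = 0"
proof (rule ccontr)
  note sT = mesh_simplex[OF T]
  note B = open_simplex_basic[OF sT]
  define fc where "fc = \<bar>a \<bullet> c + \<beta>\<bar>"
  assume "a \<bullet> c + \<beta> \<noteq> 0"
  then have fc: "0 < fc" by (simp add: fc_def)
  obtain x where x: "ball x (diameter T / \<kappa>) \<subseteq> T" using mesh_ball[OF T] .
  have rp: "0 < diameter T / \<kappa>" using mesh_diameter_pos[OF T] \<kappa> by auto
  define \<delta> where "\<delta> = 2 * (diameter T / \<kappa>) * \<mu>"
  have \<delta>0: "0 < \<delta>" unfolding \<delta>_def by (intro mult_pos_pos rp \<mu>) auto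
  obtain n where n: "norm n = 1" "\<And>y. 0 < bary T v y \<longleftrightarrow> 0 < (y - c) \<bullet> n" "\<And>y. bary T v y = 0 \<longleftrightarrow> (y - c) \<bullet> n = 0"
    using bary_sign_normal[OF sT v c] by auto
  \<comment> \<open>With $r \le |a \cdot c + \beta|/q$ the affine function keeps half of its value at $c$ in the ball, and there the Friedrichs bound fails: the small ball has $4^{-d}$ times the volume of the big one, and $2^{-d}$ is the square root of this ratio.\<close>
  define q where "q = 8 * 2 ^ DIM('a) * (norm a + 1)"
  have q: "0 < q" by (simp add: q_def add_nonneg_pos)
  define r where "r = min \<delta> (fc / q)"
  have r: "0 < r" "r \<le> \<delta>" "r \<le> fc / q" using \<delta>0 fc q by (auto simp: r_def)
  have rq: "q * r \<le> fc" using r(3) q by (simp add: pos_le_divide_eq mult.commute)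
  have in\<delta>: "y \<in> ball c \<delta>" if "y \<in> ball c r" for y using that r(2) by simp
  let ?H = "{y \<in> ball c r. 0 < (y - c) \<bullet> n}" and ?A = "ball (c + (r/2) *\<^sub>R n) (r/4)"
  have HT: "?H \<subseteq> T"
    using half_ball_in_simplex(2)[OF sT v rp x c \<mu>(2)] in\<delta> n(2) unfolding \<delta>_def by blast
  have oH: "open ?H"
  proof -
    have "?H = ball c r \<inter> {x. n \<bullet> c < n \<bullet> x}" by (auto simp: inner_diff_left inner_commute[of n])
    then show ?thesis by (simp add: open_Int open_halfspace_gt)
  qed
  then have Hm: "?H \<in> sets lebesgue" by simp
  have nn: "n \<bullet> n = 1" using n(1) by (simp add: dot_square_norm)
  have AH: "?A \<subseteq> ?H"
  proof
    fix y assume y: "y \<in> ?A"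
    define p where "p = y - c - (r/2) *\<^sub>R n"
    have p: "norm p < r/4" using y by (simp add: p_def dist_norm norm_minus_commute algebra_simps)
    have "(y - c) \<bullet> n = p \<bullet> n + r/2" by (simp add: p_def inner_diff_left nn)
    moreover have "\<bar>p \<bullet> n\<bar> \<le> norm p" using Cauchy_Schwarz_ineq2[of p n] n(1) by simp
    moreover have "norm (y - c) \<le> norm p + r/2"
      using norm_triangle_ineq[of p "(r/2) *\<^sub>R n"] n(1) r(1) by (simp add: p_def)
    ultimately show "y \<in> ?H" using p r(1) by (auto simp: dist_norm norm_minus_commute)
  qed
  have AT: "?A \<subseteq> T" using AH HT by blast
  have T\<Omega>: "T \<subseteq> \<Omega>" using mesh_subset[OF T] .
  have finB: "emeasure lebesgue (ball c r) < \<infinity>" using fmeasurableD2[OF lmeasurable_ball[of c r]] by (simp add: top.not_eq_extremum)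
  have finH: "emeasure lebesgue ?H < \<infinity>"
    by (rule le_less_trans[OF emeasure_mono finB]) auto
  have "(L2_norm ?A u)\<^sup>2 \<le> 4 * r\<^sup>2 * (\<Sum>b\<in>Basis. (L2_norm ?H (weak_partial \<Omega> b u))\<^sup>2)"
  proof (rule friedrichs_H10[OF open_\<Omega> u n(1) r(1) _ Hm])
    show "?H \<subseteq> \<Omega>" "?A \<subseteq> \<Omega>" using HT AT T\<Omega> by blast+
    fix y assume y: "y \<in> ball c r" "(y - c) \<bullet> n = 0"
    have ly: "bary T v y = 0" using n(3) y(2) by simp
    have "y \<in> closure T"
      using half_ball_in_simplex(3)[OF sT v rp x c \<mu>(2) _ ly] in\<delta>[OF y(1)] unfolding \<delta>_def by blast
    then show "y \<in> \<gamma>" using F\<gamma> ly by blast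
  qed
  also have "(\<Sum>b\<in>Basis. (L2_norm ?H (weak_partial \<Omega> b u))\<^sup>2) = (norm a)\<^sup>2 * vol ?H"
    by (rule weak_partial_affine_sq[OF open_\<Omega> H10_space_H1[OF u] B(1) T\<Omega> eq HT Hm finH])
  also have "4 * r\<^sup>2 * ((norm a)\<^sup>2 * vol ?H) \<le> 4 * r\<^sup>2 * ((norm a)\<^sup>2 * (\<omega> * r ^ DIM('a)))"
  proof (intro mult_left_mono)
    have "vol ?H \<le> vol (ball c r)" using Hm by (intro measure_mono_fmeasurable) auto
    then show "vol ?H \<le> \<omega> * r ^ DIM('a)" using vol_ball[of r c] r(1) by simp
  qed auto
  finally have up: "(L2_norm ?A u)\<^sup>2 \<le> 4 * r\<^sup>2 * ((norm a)\<^sup>2 * (\<omega> * r ^ DIM('a)))" .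
  have uA: "u \<in> L2_space ?A" by (rule L2_space_subset[OF H10_space_L2[OF u]]) (use AT T\<Omega> in auto)
  have "(L2_norm ?A (\<lambda>x. fc / 2))\<^sup>2 \<le> (L2_norm ?A u)\<^sup>2"
  proof (rule L2_norm_sq_mono_AE[OF _ uA])
    show "AE y in lebesgue_on ?A. \<bar>fc / 2\<bar> \<le> \<bar>u y\<bar>"
    proof (rule AE_I2)
      fix y assume "y \<in> space (lebesgue_on ?A)"
      then have y: "y \<in> ?A" by simp
      then have yH: "y \<in> ?H" and yT: "y \<in> T" using AH AT by blast+
      have "\<bar>a \<bullet> (y - c)\<bar> \<le> norm a * norm (y - c)" by (rule Cauchy_Schwarz_ineq2)
      also have "\<dots> \<le> norm a * r" using yH by (intro mult_left_mono) (auto simp: dist_norm norm_minus_commute)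
      also have "\<dots> \<le> fc / 2"
      proof -
        have "2 * (norm a * r) \<le> q * r"
        proof -
          have "2 * norm a \<le> q"
          proof -
            have "1 \<le> (2::real) ^ DIM('a)" by simp
            then have "8 \<le> 8 * (2::real) ^ DIM('a)" by linarith
            then have *: "8 * (norm a + 1) \<le> q" unfolding q_def by (intro mult_right_mono) auto
            have "2 * norm a \<le> 8 * (norm a + 1)" by simp
            then show ?thesis using * by (rule order_trans)
          qed
          then have "2 * norm a * r \<le> q * r" using r(1) by (intro mult_right_mono) auto
          then show ?thesis by simp
        qed
        then show ?thesis using rq by linarith
      qed
      finally have "\<bar>(a \<bullet> y + \<beta>) - (a \<bullet> c + \<beta>)\<bar> \<le> fc / 2" by (simp add: inner_diff_right)
      then have "fc - \<bar>u y\<bar> \<le> fc / 2"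
        using abs_triangle_ineq2_sym[of "a \<bullet> c + \<beta>" "a \<bullet> y + \<beta>"] eq[OF yT]
        unfolding fc_def[symmetric] by (simp only:)
      then have "fc / 2 \<le> \<bar>u y\<bar>" by (simp add: field_simps)
      moreover have "\<bar>fc / 2\<bar> = fc / 2" using fc by simp
      ultimately show "\<bar>fc / 2\<bar> \<le> \<bar>u y\<bar>" by (simp only:)
    qed
  qed
  then have "(fc / 2)\<^sup>2 * (\<omega> * (r/4) ^ DIM('a)) \<le> 4 * r\<^sup>2 * ((norm a)\<^sup>2 * (\<omega> * r ^ DIM('a)))"
    using up L2_norm_sq_const[of ?A "fc / 2"] vol_ball[of "r/4" "c + (r/2) *\<^sub>R n"] r(1) by simp
  moreover have "(fc / 2)\<^sup>2 * (\<omega> * (r/4) ^ DIM('a)) = fc\<^sup>2 * (\<omega> * r ^ DIM('a)) / (4 * 4 ^ DIM('a))"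
    by (simp add: power_divide)
  ultimately have "fc\<^sup>2 * (\<omega> * r ^ DIM('a)) \<le> (4 * r\<^sup>2 * ((norm a)\<^sup>2 * (\<omega> * r ^ DIM('a)))) * (4 * 4 ^ DIM('a))"
    by (simp add: pos_divide_le_eq)
  then have "fc\<^sup>2 * (\<omega> * r ^ DIM('a)) \<le> (16 * 4 ^ DIM('a) * r\<^sup>2 * (norm a)\<^sup>2) * (\<omega> * r ^ DIM('a))"
    by (simp add: mult_ac)
  then have 1: "fc\<^sup>2 \<le> 16 * 4 ^ DIM('a) * r\<^sup>2 * (norm a)\<^sup>2"
    using \<omega>_pos r(1) by (simp add: mult_le_cancel_right)
  have "16 * 4 ^ DIM('a) * r\<^sup>2 * (norm a)\<^sup>2 = (4 * 2 ^ DIM('a) * norm a * r)\<^sup>2"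
    by (simp add: power_mult_distrib power_even_eq[symmetric] flip: power_mult) (simp add: power_mult power2_eq_square flip: power_mult_distrib)
  also have "\<dots> \<le> (fc / 2)\<^sup>2"
  proof (rule power_mono)
    have "2 * (4 * 2 ^ DIM('a) * norm a) \<le> q" by (simp add: q_def algebra_simps)
    then have "2 * (4 * 2 ^ DIM('a) * norm a) * r \<le> q * r" using r(1) by (intro mult_right_mono) auto
    then show "4 * 2 ^ DIM('a) * norm a * r \<le> fc / 2" using rq by simp
  qed (use r in auto)
  finally have "fc\<^sup>2 \<le> (fc / 2)\<^sup>2" using 1 by linarith
  then show False using fc by (simp add: power_divide)
qed

text \<open>
  A point $z$ of the relative boundary of the facet is reached by affinity from the barycentre
  and the midpoint of $z$ and the barycentre, both of which lie in the relative interior.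
\<close>

lemma H10_affine_zero_on_facet:
  assumes T: "T \<in> \<T>" and F: "F facet_of closure T" "F \<subseteq> \<gamma>" and z: "z \<in> F"
    and u: "u \<in> H10_space \<Omega> \<gamma>" and eq: "\<And>x. x \<in> T \<Longrightarrow> u x = a \<bullet> x + \<beta>"
  shows "a \<bullet> z + \<beta> = 0"
proof -
  note sT = mesh_simplex[OF T]
  obtain v where v: "v \<in> vertices_of T" "F = convex hull (vertices_of T - {v})" "F = {x \<in> closure T. bary T v x = 0}"
    using facet_of_simplex[OF sT F(1)] .
  have F\<gamma>: "{x \<in> closure T. bary T v x = 0} \<subseteq> \<gamma>" using F(2) v(3) by simp
  let ?d = "real DIM('a)"
  define c where "c = barycenter (vertices_of T - {v})"
  have c: "bary T w c = (if w = v then 0 else 1 / ?d)" if "w \<in> vertices_of T" for w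
    unfolding c_def using bary_barycenter[OF sT v(1) that] .
  \<comment> \<open>The barycentre has all remaining coordinates equal to $1/d$, the midpoint at least half of this.\<close>
  have fc: "a \<bullet> c + \<beta> = 0"
    by (rule H10_affine_zero_relint[OF T v(1) F\<gamma> u eq, of c "1 / ?d"]) (use c v(1) in auto)
  define y where "y = (1/2) *\<^sub>R z + (1/2) *\<^sub>R c"
  have z': "z \<in> closure T" "bary T v z = 0" using z v(3) by auto
  have y: "bary T w y = (bary T w z + bary T w c) / 2" if w: "w \<in> vertices_of T" for w
  proof -
    obtain g b where "bary T w = (\<lambda>x. g \<bullet> x + b)" using bary_props(1)[OF sT w] by blast
    then show ?thesis by (simp add: y_def inner_add_right add_divide_distrib)
  qed
  have "a \<bullet> y + \<beta> = 0"
  proof (rule H10_affine_zero_relint[OF T v(1) F\<gamma> u eq, of y "1 / (2 * ?d)"])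
    show "bary T v y = 0" using y[OF v(1)] z'(2) c[OF v(1)] by simp
    show "1 / (2 * ?d) \<le> bary T w y" if "w \<in> vertices_of T" "w \<noteq> v" for w
      using y[OF that(1)] c[OF that(1)] that(2) z'(1) that(1) unfolding mem_closure_simplex_iff[OF sT]
      by (simp add: field_simps)
  qed auto
  then show ?thesis using fc by (simp add: y_def inner_add_right algebra_simps)
qed

lemma H10_continuous_affine_zero:
  assumes z: "z \<in> \<gamma>" and u: "u \<in> H10_space \<Omega> \<gamma>" and cont: "continuous_on (closure \<Omega>) u"
    and aff: "\<And>T. T \<in> \<T> \<Longrightarrow> \<exists>a \<beta>. \<forall>x\<in>closure T. u x = a \<bullet> x + \<beta>"
  shows "u z = 0"
proof -
  obtain F T where F: "F \<in> \<F>" "z \<in> F" "T \<in> \<T>" "F facet_of closure T" using z \<gamma> facets by blast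
  obtain a \<beta> where ab: "\<forall>x\<in>closure T. u x = a \<bullet> x + \<beta>" using aff[OF F(3)] by blast
  have "F \<subseteq> closure T" using F(4) by (simp add: facet_of_def face_of_def)
  then have "u z = a \<bullet> z + \<beta>" using ab F(2) by blast
  also have "\<dots> = 0"
    by (rule H10_affine_zero_on_facet[OF F(3,4) _ F(2) u]) (use F(1) \<gamma> ab closure_subset[of T] in auto)
  finally show ?thesis .
qed

end

locale nodal_mesh = mesh_gamma +
  fixes \<phi> :: "'a::euclidean_space \<Rightarrow> 'a \<Rightarrow> real"
  assumes nodal: "nodal_basis \<Omega> \<gamma> \<T> \<phi>"
begin

lemma nodal_H10: "\<nu> \<in> free_vertices \<gamma> \<T> \<Longrightarrow> \<phi> \<nu> \<in> H10_space \<Omega> \<gamma>"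
  using nodal by (auto simp: nodal_basis_def S01_space_def)

lemma nodal_S01: "\<nu> \<in> free_vertices \<gamma> \<T> \<Longrightarrow> \<phi> \<nu> \<in> S01_space \<Omega> \<gamma> \<T>"
  using nodal by (auto simp: nodal_basis_def)

lemma nodal_affine_closure:
  assumes \<nu>: "\<nu> \<in> free_vertices \<gamma> \<T>" and T: "T \<in> \<T>"
  shows "\<exists>a \<beta>. \<forall>x\<in>closure T. \<phi> \<nu> x = a \<bullet> x + \<beta>"
proof -
  obtain q where q: "q \<in> poly_space 1" "\<forall>x\<in>T. \<phi> \<nu> x = q x"
    using nodal_S01[OF \<nu>] T by (auto simp: S01_space_def)
  obtain a \<beta> where ab: "q = (\<lambda>x. a \<bullet> x + \<beta>)" using poly_space_1_affine[OF q(1)] .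
  have "continuous_on (closure \<Omega>) (\<phi> \<nu>)" using nodal \<nu> by (auto simp: nodal_basis_def)
  then have 1: "continuous_on (closure T) (\<phi> \<nu>)" using mesh_closure_subset[OF T] by (rule continuous_on_subset)
  have 2: "continuous_on (closure T) (\<lambda>x. \<phi> \<nu> x - (a \<bullet> x + \<beta>))"
    by (intro continuous_on_diff[OF 1] continuous_on_add continuous_on_inner continuous_on_const continuous_on_id)
  have "\<phi> \<nu> x - (a \<bullet> x + \<beta>) = 0" if "x \<in> closure T" for x
    by (rule continuous_constant_on_closure[OF 2 _ that]) (use q(2) ab in auto)
  then show ?thesis by (intro exI[of _ a] exI[of _ \<beta>]) simp
qed

text \<open>
  Both sides are affine on the element, so it suffices to compare them at the vertices. The
  Kronecker property covers the free vertices; at the vertices on \<open>\<gamma>\<close> both are zero by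
  \<open>H10_continuous_affine_zero\<close>.
\<close>

lemma nodal_on_simplex:
  assumes \<nu>: "\<nu> \<in> free_vertices \<gamma> \<T>" and T: "T \<in> \<T>" and x: "x \<in> closure T"
  shows "\<phi> \<nu> x = (if \<nu> \<in> vertices_of T then bary T \<nu> x else 0)"
proof -
  note sT = mesh_simplex[OF T]
  have cont: "continuous_on (closure \<Omega>) (\<phi> \<nu>)" using nodal \<nu> by (auto simp: nodal_basis_def)
  obtain a \<beta> where ab: "\<forall>x\<in>closure T. \<phi> \<nu> x = a \<bullet> x + \<beta>" using nodal_affine_closure[OF \<nu> T] by blast
  have val: "a \<bullet> w + \<beta> = (if w = \<nu> then 1 else 0)" if w: "w \<in> vertices_of T" for w
  proof -
    have "a \<bullet> w + \<beta> = \<phi> \<nu> w" using ab vertex_in_closure[OF w] by simp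
    also have "\<dots> = (if w = \<nu> then 1 else 0)"
    proof (cases "w \<in> \<gamma>")
      case True
      then have "w \<noteq> \<nu>" using \<nu> by (auto simp: free_vertices_def)
      moreover have "\<phi> \<nu> w = 0"
        by (rule H10_continuous_affine_zero[OF True nodal_H10[OF \<nu>] cont nodal_affine_closure[OF \<nu>]])
      ultimately show ?thesis by simp
    next
      case False
      then have "w \<in> free_vertices \<gamma> \<T>" using w T by (auto simp: free_vertices_def)
      then show ?thesis using nodal \<nu> by (auto simp: nodal_basis_def)
    qed
    finally show ?thesis .
  qed
  have "\<phi> \<nu> x = (\<Sum>w\<in>vertices_of T. bary T w x * (a \<bullet> w + \<beta>))"
    using ab x affine_fun_bary[OF sT, of a x \<beta>] by simp
  also have "\<dots> = (\<Sum>w\<in>vertices_of T. if w = \<nu> then bary T w x else 0)"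
    by (rule sum.cong[OF refl]) (simp add: val)
  also have "\<dots> = (if \<nu> \<in> vertices_of T then bary T \<nu> x else 0)"
    using open_simplex_vertices(1)[OF sT] by simp
  finally show ?thesis .
qed

end

section \<open>The averaging quasi-interpolant\<close>

context mesh
begin

lemma finite_vertices: "T \<in> \<T> \<Longrightarrow> finite (vertices_of T)"
  using open_simplex_vertices(1) mesh_simplex by blast

lemma card_vertices: "T \<in> \<T> \<Longrightarrow> card (vertices_of T) = DIM('a) + 1"
  using open_simplex_vertices(2) mesh_simplex by blast

lemma star_vertex: "T \<in> \<T> \<Longrightarrow> w \<in> vertices_of T \<Longrightarrow> T \<in> star w"
  using vertex_in_closure by (simp add: star_def)

lemma mesh_integral_sum:
  assumes h: "integrable (lebesgue_on \<Omega>) h"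
  shows "(\<integral>x. (h x :: real) \<partial>lebesgue_on \<Omega>) = (\<Sum>T\<in>\<T>. \<integral>x. h x \<partial>lebesgue_on T)"
proof -
  have i\<Omega>: "integrable lebesgue (\<lambda>x. indicator \<Omega> x *\<^sub>R h x)" using h by (simp add: integrable_restrict_space)
  have iT: "integrable lebesgue (\<lambda>x. indicator T x *\<^sub>R h x)" if T: "T \<in> \<T>" for T
  proof -
    have "integrable lebesgue (\<lambda>x. indicator T x *\<^sub>R (indicator \<Omega> x *\<^sub>R h x))"
      by (rule integrable_mult_indicator[OF mesh_meas[OF T] i\<Omega>])
    moreover have "(\<lambda>x. indicator T x *\<^sub>R (indicator \<Omega> x *\<^sub>R h x)) = (\<lambda>x. indicator T x *\<^sub>R h x)"
      using mesh_subset[OF T] by (intro ext) (auto simp: indicator_def)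
    ultimately show ?thesis by (rule back_subst)
  qed
  have "AE x in lebesgue. x \<notin> \<Omega> - \<Union>\<T>" using mesh_null by (rule AE_not_in)
  then have ae: "AE x in lebesgue. indicator \<Omega> x *\<^sub>R h x = (\<Sum>T\<in>\<T>. indicator T x *\<^sub>R h x)"
  proof eventually_elim
    case (elim x)
    show ?case
    proof (cases "x \<in> \<Omega>")
      case True
      then obtain X where X: "X \<in> \<T>" "x \<in> X" using elim by blast
      have "indicator T x *\<^sub>R h x = (if T = X then h x else 0)" if "T \<in> \<T>" for T
        using mesh_disjoint[OF that X(1)] X(2) by (cases "T = X") (auto simp: indicator_def)
      then have "(\<Sum>T\<in>\<T>. indicator T x *\<^sub>R h x) = (\<Sum>T\<in>\<T>. if T = X then h x else 0)" by (rule sum.cong[OF refl])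
      then show ?thesis using True X(1) finite_\<T> by simp
    next
      case False
      have "indicator T x *\<^sub>R h x = 0" if "T \<in> \<T>" for T using mesh_subset[OF that] False by (auto simp: indicator_def)
      then show ?thesis using False by (simp add: sum.neutral)
    qed
  qed
  have "(\<integral>x. h x \<partial>lebesgue_on \<Omega>) = (\<integral>x. indicator \<Omega> x *\<^sub>R h x \<partial>lebesgue)" by (simp add: integral_restrict_space)
  also have "\<dots> = (\<integral>x. (\<Sum>T\<in>\<T>. indicator T x *\<^sub>R h x) \<partial>lebesgue)"
    by (rule integral_cong_AE[OF borel_measurable_integrable[OF i\<Omega>] _ ae])
      (rule borel_measurable_integrable, rule Bochner_Integration.integrable_sum, rule iT)
  also have "\<dots> = (\<Sum>T\<in>\<T>. \<integral>x. indicator T x *\<^sub>R h x \<partial>lebesgue)"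
    by (rule Bochner_Integration.integral_sum) (rule iT)
  also have "\<dots> = (\<Sum>T\<in>\<T>. \<integral>x. h x \<partial>lebesgue_on T)"
    by (rule sum.cong[OF refl]) (simp add: integral_restrict_space)
  finally show ?thesis .
qed

lemma sum_sq_mesh: "f \<in> L2_space \<Omega> \<Longrightarrow> (\<Sum>T\<in>\<T>. (L2_norm T f)\<^sup>2) = (L2_norm \<Omega> f)\<^sup>2"
  unfolding L2_norm_sq_integral using mesh_integral_sum[OF L2_spaceD(2)] by simp

text \<open>
  Each element has $d+1$ vertices and each star has boundedly many elements, so every element is
  counted a bounded number of times.
\<close>

lemma star_sum_bound:
  assumes f: "\<And>T. 0 \<le> f T"
  shows "(\<Sum>T\<in>\<T>. \<Sum>w\<in>vertices_of T. \<Sum>T'\<in>star w. f T') \<le> real (DIM('a) + 1) * real star_card_bound * (\<Sum>T\<in>\<T>. (f T::real))"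
proof -
  let ?i = "\<lambda>w T'. if w \<in> closure T' then 1 else 0 :: real"
  have st: "(\<Sum>T'\<in>star w. f T') = (\<Sum>T'\<in>\<T>. ?i w T' * f T')" for w
    unfolding star_def using finite_\<T> by (simp add: sum.inter_filter[symmetric] if_distrib[of "\<lambda>c. c * f _"] cong: if_cong)
  have cnt: "(\<Sum>T\<in>\<T>. \<Sum>w\<in>vertices_of T. ?i w T') \<le> real (DIM('a) + 1) * real star_card_bound" if T': "T' \<in> \<T>" for T'
  proof -
    have "(\<Sum>w\<in>vertices_of T. ?i w T') \<le> (\<Sum>w\<in>vertices_of T'. ?i w T)" if T: "T \<in> \<T>" for T
    proof -
      have "(\<Sum>w\<in>vertices_of T. ?i w T') = (\<Sum>w\<in>{w \<in> vertices_of T. w \<in> closure T'}. 1)"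
        using finite_vertices[OF T] by (simp only: sum.inter_filter)
      also have "\<dots> \<le> (\<Sum>w\<in>{w \<in> vertices_of T'. w \<in> closure T}. 1)"
        using vertex_shared[OF T T'] vertex_in_closure finite_vertices[OF T'] by (intro sum_mono2) auto
      also have "\<dots> = (\<Sum>w\<in>vertices_of T'. ?i w T)"
        using finite_vertices[OF T'] by (simp only: sum.inter_filter)
      finally show ?thesis .
    qed
    then have "(\<Sum>T\<in>\<T>. \<Sum>w\<in>vertices_of T. ?i w T') \<le> (\<Sum>T\<in>\<T>. \<Sum>w\<in>vertices_of T'. ?i w T)" by (rule sum_mono)
    also have "\<dots> = (\<Sum>w\<in>vertices_of T'. \<Sum>T\<in>\<T>. ?i w T)" by (rule sum.swap)
    also have "\<dots> = (\<Sum>w\<in>vertices_of T'. real (card (star w)))"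
      unfolding star_def using finite_\<T> by (simp add: sum.inter_filter[symmetric])
    also have "\<dots> \<le> (\<Sum>w\<in>vertices_of T'. real star_card_bound)" using card_star_le by (intro sum_mono) simp
    also have "\<dots> = real (DIM('a) + 1) * real star_card_bound" using card_vertices[OF T'] by simp
    finally show ?thesis .
  qed
  have "(\<Sum>T\<in>\<T>. \<Sum>w\<in>vertices_of T. \<Sum>T'\<in>star w. f T') = (\<Sum>T\<in>\<T>. \<Sum>w\<in>vertices_of T. \<Sum>T'\<in>\<T>. ?i w T' * f T')"
    by (simp only: st)
  also have "\<dots> = (\<Sum>T\<in>\<T>. \<Sum>T'\<in>\<T>. \<Sum>w\<in>vertices_of T. ?i w T' * f T')"
    by (intro sum.cong refl sum.swap)
  also have "\<dots> = (\<Sum>T'\<in>\<T>. \<Sum>T\<in>\<T>. \<Sum>w\<in>vertices_of T. ?i w T' * f T')" by (rule sum.swap)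
  also have "\<dots> = (\<Sum>T'\<in>\<T>. (\<Sum>T\<in>\<T>. \<Sum>w\<in>vertices_of T. ?i w T') * f T')" by (simp only: sum_distrib_right)
  also have "\<dots> \<le> (\<Sum>T'\<in>\<T>. real (DIM('a) + 1) * real star_card_bound * f T')"
    using cnt f by (intro sum_mono mult_right_mono) auto
  finally show ?thesis by (simp add: sum_distrib_left)
qed

lemma sum_sq_le: "(\<Sum>i\<in>I. c i)\<^sup>2 \<le> real (card I) * (\<Sum>i\<in>I. (c i :: real)\<^sup>2)"
  using Cauchy_Schwarz_ineq_sum[of "\<lambda>_. 1" c I] by simp

lemma L2_norm_bary_sum_le:
  assumes T: "T \<in> \<T>" and f: "\<And>x. x \<in> T \<Longrightarrow> f x = (\<Sum>w\<in>vertices_of T. c w * bary T w x)"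
  shows "(L2_norm T f)\<^sup>2 \<le> real (DIM('a) + 1) * (\<Sum>w\<in>vertices_of T. (c w)\<^sup>2) * vol T"
proof -
  note sT = mesh_simplex[OF T]
  define M where "M = real (DIM('a) + 1) * (\<Sum>w\<in>vertices_of T. (c w)\<^sup>2)"
  have M0: "0 \<le> M" by (simp add: M_def sum_nonneg)
  have "(f x)\<^sup>2 \<le> M" if x: "x \<in> T" for x
  proof -
    have "(f x)\<^sup>2 \<le> real (card (vertices_of T)) * (\<Sum>w\<in>vertices_of T. (c w * bary T w x)\<^sup>2)"
      unfolding f[OF x] by (rule sum_sq_le)
    also have "\<dots> \<le> real (card (vertices_of T)) * (\<Sum>w\<in>vertices_of T. (c w)\<^sup>2)"
    proof (intro mult_left_mono sum_mono)
      fix w assume w: "w \<in> vertices_of T"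
      have "0 \<le> bary T w x" "bary T w x \<le> 1"
        using bary_le_1[OF sT w] mem_closure_simplex_iff[OF sT] w x closure_subset[of T] by blast+
      then have "(bary T w x)\<^sup>2 \<le> 1" by (simp add: power_le_one)
      then show "(c w * bary T w x)\<^sup>2 \<le> (c w)\<^sup>2" by (simp add: power_mult_distrib mult_left_le)
    qed simp
    finally show ?thesis using card_vertices[OF T] by (simp add: M_def)
  qed
  then have "(L2_norm T f)\<^sup>2 \<le> (L2_norm T (\<lambda>x. sqrt M))\<^sup>2"
    by (intro L2_norm_sq_mono_AE mesh_const_L2[OF T] AE_I2) (simp add: M0 real_le_rsqrt)
  also have "\<dots> = M * vol T" using L2_norm_sq_const[of T "sqrt M"] T M0 by simp
  finally show ?thesis by (simp add: M_def)
qed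

end

context nodal_mesh
begin

text \<open>
  The averaging quasi-interpolant with vanishing values on \<open>\<gamma>\<close>. It is the sum of the functions
  $\sigma_{\mathcal T,T}$ weighted by the means of \<open>u\<close> over \<open>T\<close>, see \<open>quasi_interp_eq_sig\<close>; grouped by
  vertices its boundedness and approximation property can be read off from the stars.
\<close>

definition quasi_coeff :: "('a \<Rightarrow> real) \<Rightarrow> 'a \<Rightarrow> real" where
  "quasi_coeff u \<nu> = (if \<nu> \<in> \<gamma> then 0 else (\<Sum>T\<in>star \<nu>. mean T u) / real (card (star \<nu>)))"

definition quasi_interp :: "('a \<Rightarrow> real) \<Rightarrow> 'a \<Rightarrow> real" where
  "quasi_interp u x = (\<Sum>\<nu>\<in>free_vertices \<gamma> \<T>. quasi_coeff u \<nu> * \<phi> \<nu> x)"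

lemma finite_free: "finite (free_vertices \<gamma> \<T>)"
  using finite_\<T> finite_vertices by (auto simp: free_vertices_def)

lemma quasi_interp_H10: "quasi_interp u \<in> H10_space \<Omega> \<gamma>"
  unfolding quasi_interp_def[abs_def]
  by (rule H10_space_sum[OF open_\<Omega> finite_free]) (rule H10_space_cmult[OF open_\<Omega> nodal_H10])

lemma quasi_interp_on_simplex:
  assumes T: "T \<in> \<T>" and x: "x \<in> closure T"
  shows "quasi_interp u x = (\<Sum>w\<in>vertices_of T. quasi_coeff u w * bary T w x)"
proof -
  have "quasi_interp u x = (\<Sum>\<nu>\<in>free_vertices \<gamma> \<T>. if \<nu> \<in> vertices_of T then quasi_coeff u \<nu> * bary T \<nu> x else 0)"
    unfolding quasi_interp_def by (rule sum.cong[OF refl]) (simp add: nodal_on_simplex[OF _ T x])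
  also have "\<dots> = (\<Sum>w\<in>{\<nu> \<in> free_vertices \<gamma> \<T>. \<nu> \<in> vertices_of T}. quasi_coeff u w * bary T w x)"
    using finite_free by (simp only: sum.inter_filter)
  also have "\<dots> = (\<Sum>w\<in>vertices_of T. quasi_coeff u w * bary T w x)"
    using finite_vertices[OF T] T by (intro sum.mono_neutral_left) (auto simp: free_vertices_def quasi_coeff_def)
  finally show ?thesis .
qed

lemma quasi_coeff_sq_le: "(quasi_coeff u w)\<^sup>2 \<le> (\<Sum>T\<in>star w. (mean T u)\<^sup>2)"
proof (cases "w \<in> \<gamma> \<or> card (star w) = 0")
  case True
  then show ?thesis by (auto simp: quasi_coeff_def sum_nonneg)
next
  case False
  then have n: "1 \<le> real (card (star w))" by simp
  have "(quasi_coeff u w)\<^sup>2 = (\<Sum>T\<in>star w. mean T u)\<^sup>2 / (real (card (star w)))\<^sup>2"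
    using False by (simp add: quasi_coeff_def power_divide)
  also have "\<dots> \<le> (real (card (star w)) * (\<Sum>T\<in>star w. (mean T u)\<^sup>2)) / (real (card (star w)))\<^sup>2"
    by (intro divide_right_mono sum_sq_le) auto
  also have "\<dots> = (\<Sum>T\<in>star w. (mean T u)\<^sup>2) / real (card (star w))"
    using n by (simp add: power2_eq_square)
  also have "\<dots> \<le> (\<Sum>T\<in>star w. (mean T u)\<^sup>2)" using n sum_nonneg[of "star w" "\<lambda>T. (mean T u)\<^sup>2"]
    by (simp add: divide_le_eq mult_right_mono mult_le_cancel_left1 mult_le_cancel_right1)
  finally show ?thesis .
qed

definition quasi_L2_const :: real where
  "quasi_L2_const = real (DIM('a) + 1) * (star_size_ratio * \<kappa>) ^ DIM('a) * (real (DIM('a) + 1) * real star_card_bound)"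

lemma quasi_L2_const_nonneg: "0 \<le> quasi_L2_const" using consts_nonneg \<kappa> by (simp add: quasi_L2_const_def)

definition quasi_error_const :: real where "quasi_error_const = 2 * poincare_const + 2 * real (DIM('a) + 1) * star_mean_const"
definition quasi_grad_const :: real where "quasi_grad_const = real (DIM('a) + 1) * star_mean_const * \<kappa>\<^sup>2 / 4"
definition quasi_H1_const :: real where "quasi_H1_const = quasi_L2_const + quasi_grad_const * (real (DIM('a) + 1) * real star_card_bound)"

lemma quasi_consts_nonneg: "0 \<le> quasi_error_const" "0 \<le> quasi_grad_const" "0 \<le> quasi_H1_const"
  using consts_nonneg quasi_L2_const_nonneg by (auto simp: quasi_error_const_def quasi_grad_const_def quasi_H1_const_def)

lemma star_vol:
  assumes T: "T \<in> star \<nu>" and T': "T' \<in> star \<nu>"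
  shows "vol T \<le> (star_size_ratio * \<kappa>) ^ DIM('a) * vol T'"
proof -
  have T1: "T \<in> \<T>" and T1': "T' \<in> \<T>" using T T' by (auto simp: star_def)
  have "vol T \<le> \<omega> * diameter T ^ DIM('a)" by (rule mesh_vol_le[OF T1])
  also have "\<dots> \<le> \<omega> * (star_size_ratio * diameter T') ^ DIM('a)"
    using \<omega>_pos star_diameter[OF T T'] mesh_diameter_pos[OF T1] by (intro mult_left_mono power_mono) auto
  also have "\<dots> = (star_size_ratio * \<kappa>) ^ DIM('a) * (\<omega> * (diameter T' / \<kappa>) ^ DIM('a))"
    using \<kappa> by (simp add: power_mult_distrib power_divide)
  also have "\<dots> \<le> (star_size_ratio * \<kappa>) ^ DIM('a) * vol T'"
    using consts_nonneg \<kappa> by (intro mult_left_mono mesh_vol_ge[OF T1']) auto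
  finally show ?thesis .
qed

lemma quasi_interp_L2_bound:
  assumes u: "u \<in> L2_space \<Omega>"
  shows "(L2_norm \<Omega> (quasi_interp u))\<^sup>2 \<le> quasi_L2_const * (L2_norm \<Omega> u)\<^sup>2"
proof -
  let ?d = "real (DIM('a) + 1)" and ?c = "(star_size_ratio * \<kappa>) ^ DIM('a)"
  have c0: "0 \<le> ?c" using consts_nonneg \<kappa> by simp
  have "(L2_norm T (quasi_interp u))\<^sup>2 \<le> ?d * ?c * (\<Sum>w\<in>vertices_of T. \<Sum>T'\<in>star w. (L2_norm T' u)\<^sup>2)" if T: "T \<in> \<T>" for T
  proof -
    have "(L2_norm T (quasi_interp u))\<^sup>2 \<le> ?d * (\<Sum>w\<in>vertices_of T. (quasi_coeff u w)\<^sup>2) * vol T"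
      using quasi_interp_on_simplex[OF T] closure_subset[of T] by (intro L2_norm_bary_sum_le[OF T]) auto
    also have "\<dots> = ?d * (\<Sum>w\<in>vertices_of T. (quasi_coeff u w)\<^sup>2 * vol T)" by (simp add: sum_distrib_right)
    also have "\<dots> \<le> ?d * (\<Sum>w\<in>vertices_of T. \<Sum>T'\<in>star w. ?c * (L2_norm T' u)\<^sup>2)"
    proof (intro mult_left_mono sum_mono)
      fix w assume w: "w \<in> vertices_of T"
      have Tw: "T \<in> star w" using star_vertex[OF T w] .
      have "(quasi_coeff u w)\<^sup>2 * vol T \<le> (\<Sum>T'\<in>star w. (mean T' u)\<^sup>2) * vol T"
        using mesh_vol_pos[OF T] by (intro mult_right_mono quasi_coeff_sq_le) auto
      also have "\<dots> = (\<Sum>T'\<in>star w. (mean T' u)\<^sup>2 * vol T)" by (simp add: sum_distrib_right)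
      also have "\<dots> \<le> (\<Sum>T'\<in>star w. ?c * (L2_norm T' u)\<^sup>2)"
      proof (rule sum_mono)
        fix T' assume T': "T' \<in> star w"
        then have T1': "T' \<in> \<T>" by (simp add: star_def)
        have "(mean T' u)\<^sup>2 * vol T \<le> (mean T' u)\<^sup>2 * (?c * vol T')" by (intro mult_left_mono star_vol[OF Tw T']) auto
        also have "\<dots> = ?c * ((mean T' u - 0)\<^sup>2 * vol T')" by simp
        also have "\<dots> \<le> ?c * (L2_norm T' (\<lambda>x. u x - 0))\<^sup>2" by (rule mult_left_mono[OF mean_diff_const_le[OF T1' u] c0])
        finally show "(mean T' u)\<^sup>2 * vol T \<le> ?c * (L2_norm T' u)\<^sup>2" by simp
      qed
      finally show "(quasi_coeff u w)\<^sup>2 * vol T \<le> (\<Sum>T'\<in>star w. ?c * (L2_norm T' u)\<^sup>2)" .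
    qed simp
    also have "\<dots> = ?d * ?c * (\<Sum>w\<in>vertices_of T. \<Sum>T'\<in>star w. (L2_norm T' u)\<^sup>2)"
      by (simp add: sum_distrib_left mult.assoc)
    finally show ?thesis .
  qed
  then have "(\<Sum>T\<in>\<T>. (L2_norm T (quasi_interp u))\<^sup>2) \<le> (\<Sum>T\<in>\<T>. ?d * ?c * (\<Sum>w\<in>vertices_of T. \<Sum>T'\<in>star w. (L2_norm T' u)\<^sup>2))"
    by (rule sum_mono)
  also have "\<dots> = ?d * ?c * (\<Sum>T\<in>\<T>. \<Sum>w\<in>vertices_of T. \<Sum>T'\<in>star w. (L2_norm T' u)\<^sup>2)" by (simp add: sum_distrib_left)
  also have "\<dots> \<le> ?d * ?c * (?d * real star_card_bound * (\<Sum>T\<in>\<T>. (L2_norm T u)\<^sup>2))"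
    using c0 by (intro mult_left_mono star_sum_bound) auto
  finally show ?thesis
    using sum_sq_mesh[OF u] sum_sq_mesh[OF H10_space_L2[OF quasi_interp_H10]] by (simp add: quasi_L2_const_def mult_ac)
qed

end

locale nodal_mesh_fun = nodal_mesh \<Omega> \<T> \<kappa> \<gamma> \<F> \<phi> + mesh_fun_gamma \<Omega> \<T> \<kappa> v \<gamma> \<F>
  for \<Omega> :: "'a::euclidean_space set" and \<T> \<kappa> \<gamma> \<F> \<phi> v
begin

text \<open>
  For a free vertex this is the difference of means within the star; for a vertex on \<open>\<gamma>\<close> it is the
  mean itself, controlled by \<open>star_mean_gamma\<close>.
\<close>

lemma quasi_coeff_diff:
  assumes T: "T \<in> star w"
  shows "(quasi_coeff v w - mean T v)\<^sup>2 * vol T \<le> star_mean_const * (diameter T)\<^sup>2 * star_energy w"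
proof (cases "w \<in> \<gamma>")
  case True
  then show ?thesis using star_mean_gamma[OF True T T] by (simp add: quasi_coeff_def)
next
  case False
  define N where "N = real (card (star w))"
  have N: "0 < N" using T finite_star by (auto simp: N_def card_gt_0_iff)
  define Q where "Q = star_mean_const * (diameter T)\<^sup>2 * star_energy w"
  have "quasi_coeff v w - mean T v = (\<Sum>T'\<in>star w. mean T' v - mean T v) / N"
    using False N by (simp add: quasi_coeff_def N_def sum_subtractf diff_divide_distrib)
  then have "(quasi_coeff v w - mean T v)\<^sup>2 * vol T = (\<Sum>T'\<in>star w. mean T' v - mean T v)\<^sup>2 * vol T / N\<^sup>2"
    by (simp add: power_divide)
  also have "\<dots> \<le> (N * (\<Sum>T'\<in>star w. (mean T' v - mean T v)\<^sup>2)) * vol T / N\<^sup>2"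
    unfolding N_def by (intro divide_right_mono mult_right_mono sum_sq_le) auto
  also have "\<dots> = N * (\<Sum>T'\<in>star w. (mean T' v - mean T v)\<^sup>2 * vol T) / N\<^sup>2" by (simp add: sum_distrib_right mult.assoc)
  also have "\<dots> \<le> N * (\<Sum>T'\<in>star w. Q) / N\<^sup>2"
    unfolding Q_def using N by (intro divide_right_mono mult_left_mono sum_mono star_mean_diff T) auto
  also have "\<dots> = Q" using N by (simp add: N_def power2_eq_square)
  finally show ?thesis by (simp add: Q_def)
qed

lemma quasi_interp_diff_on_simplex:
  assumes T: "T \<in> \<T>" and x: "x \<in> closure T"
  shows "quasi_interp v x = mean T v + (\<Sum>w\<in>vertices_of T. (quasi_coeff v w - mean T v) * bary T w x)"
  using bary_sum(1)[OF mesh_simplex[OF T], of x]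
  by (simp add: quasi_interp_on_simplex[OF T x] left_diff_distrib sum_subtractf flip: sum_distrib_left)

lemma sum_quasi_coeff_diff:
  assumes T: "T \<in> \<T>"
  shows "(\<Sum>w\<in>vertices_of T. (quasi_coeff v w - mean T v)\<^sup>2) * vol T \<le> star_mean_const * (diameter T)\<^sup>2 * (\<Sum>w\<in>vertices_of T. star_energy w)"
  unfolding sum_distrib_right sum_distrib_left
  by (rule sum_mono) (rule quasi_coeff_diff[OF star_vertex[OF T]])

lemma e_le_sum_star_energy: "T \<in> \<T> \<Longrightarrow> e T \<le> (\<Sum>w\<in>vertices_of T. star_energy w)"
proof -
  assume T: "T \<in> \<T>"
  have "vertices_of T \<noteq> {}" using card_vertices[OF T] by auto
  then obtain w where w: "w \<in> vertices_of T" by blast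
  have "e T \<le> star_energy w" by (rule e_le_star_energy[OF star_vertex[OF T w]])
  also have "\<dots> \<le> (\<Sum>w\<in>vertices_of T. star_energy w)"
    using finite_vertices[OF T] w star_energy_nonneg by (intro member_le_sum) auto
  finally show ?thesis .
qed

lemma quasi_interp_error:
  assumes T: "T \<in> \<T>"
  shows "(L2_norm T (\<lambda>x. v x - quasi_interp v x))\<^sup>2 \<le> quasi_error_const * (diameter T)\<^sup>2 * (\<Sum>w\<in>vertices_of T. star_energy w)"
proof -
  let ?S = "\<Sum>w\<in>vertices_of T. star_energy w" and ?m = "mean T v"
  have qL: "quasi_interp v \<in> L2_space \<Omega>" using H10_space_L2[OF quasi_interp_H10] .
  have d2: "(\<lambda>x. quasi_interp v x - ?m) \<in> L2_space T" using mesh_shift_L2[OF qL T] .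
  have "(L2_norm T (\<lambda>x. v x - quasi_interp v x))\<^sup>2 = (L2_norm T (\<lambda>x. 1 * (v x - ?m) + (-1) * (quasi_interp v x - ?m)))\<^sup>2" by simp
  also have "\<dots> \<le> 2 * 1\<^sup>2 * (L2_norm T (\<lambda>x. v x - ?m))\<^sup>2 + 2 * (-1)\<^sup>2 * (L2_norm T (\<lambda>x. quasi_interp v x - ?m))\<^sup>2"
    by (rule L2_norm_sq_lincomb_le[OF mesh_shift_L2[OF vL2 T] d2])
  finally have 1: "(L2_norm T (\<lambda>x. v x - quasi_interp v x))\<^sup>2 \<le> 2 * (L2_norm T (\<lambda>x. v x - ?m))\<^sup>2 + 2 * (L2_norm T (\<lambda>x. quasi_interp v x - ?m))\<^sup>2" by simp
  have "(L2_norm T (\<lambda>x. v x - ?m))\<^sup>2 \<le> poincare_const * (diameter T)\<^sup>2 * e T" by (rule mean_poincare[OF T])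
  also have "\<dots> \<le> poincare_const * (diameter T)\<^sup>2 * ?S" using consts_nonneg by (intro mult_left_mono e_le_sum_star_energy[OF T]) auto
  finally have 2: "(L2_norm T (\<lambda>x. v x - ?m))\<^sup>2 \<le> poincare_const * (diameter T)\<^sup>2 * ?S" .
  have "(L2_norm T (\<lambda>x. quasi_interp v x - ?m))\<^sup>2 \<le> real (DIM('a) + 1) * (\<Sum>w\<in>vertices_of T. (quasi_coeff v w - ?m)\<^sup>2) * vol T"
    using quasi_interp_diff_on_simplex[OF T] closure_subset[of T] by (intro L2_norm_bary_sum_le[OF T]) auto
  also have "\<dots> = real (DIM('a) + 1) * ((\<Sum>w\<in>vertices_of T. (quasi_coeff v w - ?m)\<^sup>2) * vol T)" by simp
  also have "\<dots> \<le> real (DIM('a) + 1) * (star_mean_const * (diameter T)\<^sup>2 * ?S)" by (rule mult_left_mono[OF sum_quasi_coeff_diff[OF T]]) simp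
  finally have 3: "(L2_norm T (\<lambda>x. quasi_interp v x - ?m))\<^sup>2 \<le> real (DIM('a) + 1) * (star_mean_const * (diameter T)\<^sup>2 * ?S)" .
  have "2 * (poincare_const * (diameter T)\<^sup>2 * ?S) + 2 * (real (DIM('a) + 1) * (star_mean_const * (diameter T)\<^sup>2 * ?S)) = quasi_error_const * (diameter T)\<^sup>2 * ?S"
    by (simp add: quasi_error_const_def algebra_simps)
  then show ?thesis using 1 2 3 by linarith
qed

text \<open>
  Subtracting the constant \<open>mean T v\<close> does not change the gradient; each barycentric coordinate
  contributes at most $\kappa/(2\,\mathrm{diam}\,T)$, which cancels the factor
  $\mathrm{diam}\,T$ gained from the differences of means.
\<close>

lemma quasi_interp_gradient:
  assumes T: "T \<in> \<T>"
  shows "(\<Sum>b\<in>Basis. (L2_norm T (weak_partial \<Omega> b (quasi_interp v)))\<^sup>2) \<le> quasi_grad_const * (\<Sum>w\<in>vertices_of T. star_energy w)"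
proof -
  note sT = mesh_simplex[OF T]
  let ?V = "vertices_of T" and ?c = "\<lambda>w. quasi_coeff v w - mean T v"
  have "\<forall>w. \<exists>a \<beta>. w \<in> ?V \<longrightarrow> bary T w = (\<lambda>x. a \<bullet> x + \<beta>)" using bary_props(1)[OF sT] by blast
  then obtain g b where g: "\<And>w. w \<in> ?V \<Longrightarrow> bary T w = (\<lambda>x. g w \<bullet> x + b w)" by metis
  define a where "a = (\<Sum>w\<in>?V. ?c w *\<^sub>R g w)"
  define \<beta> where "\<beta> = mean T v + (\<Sum>w\<in>?V. ?c w * b w)"
  have eq: "quasi_interp v x = a \<bullet> x + \<beta>" if x: "x \<in> T" for x
  proof -
    have "quasi_interp v x = mean T v + (\<Sum>w\<in>?V. ?c w * bary T w x)"
      using quasi_interp_diff_on_simplex[OF T] x closure_subset[of T] by blast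
    also have "(\<Sum>w\<in>?V. ?c w * bary T w x) = (\<Sum>w\<in>?V. (?c w *\<^sub>R g w) \<bullet> x + ?c w * b w)"
      by (rule sum.cong[OF refl]) (simp add: g distrib_left)
    finally show ?thesis by (simp add: a_def \<beta>_def sum.distrib inner_sum_left)
  qed
  obtain x where x: "ball x (diameter T / \<kappa>) \<subseteq> T" using mesh_ball[OF T] .
  have D: "0 < diameter T" using mesh_diameter_pos[OF T] .
  have rp: "0 < diameter T / \<kappa>" using D \<kappa> by auto
  define G where "G = \<kappa> / (2 * diameter T)"
  have G: "norm (g w) \<le> G" if "w \<in> ?V" for w
    using bary_grad_bound[OF sT that rp x g[OF that]] \<kappa> D by (simp add: G_def)
  have G0: "0 \<le> G" using \<kappa> D by (simp add: G_def)
  have "norm a \<le> (\<Sum>w\<in>?V. \<bar>?c w\<bar> * G)"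
    unfolding a_def using G by (intro order_trans[OF norm_sum] sum_mono) (simp add: mult_left_mono)
  then have "(norm a)\<^sup>2 \<le> (\<Sum>w\<in>?V. \<bar>?c w\<bar> * G)\<^sup>2" by (rule power_mono) simp
  also have "\<dots> \<le> real (card ?V) * (\<Sum>w\<in>?V. (\<bar>?c w\<bar> * G)\<^sup>2)" by (rule sum_sq_le)
  also have "\<dots> = real (DIM('a) + 1) * G\<^sup>2 * (\<Sum>w\<in>?V. (?c w)\<^sup>2)"
    using card_vertices[OF T] by (simp add: power_mult_distrib sum_distrib_left mult_ac)
  finally have na: "(norm a)\<^sup>2 \<le> real (DIM('a) + 1) * G\<^sup>2 * (\<Sum>w\<in>?V. (?c w)\<^sup>2)" .
  have "(\<Sum>b\<in>Basis. (L2_norm T (weak_partial \<Omega> b (quasi_interp v)))\<^sup>2) = (norm a)\<^sup>2 * vol T"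
    by (rule weak_partial_affine_sq[OF open_\<Omega> H10_space_H1[OF quasi_interp_H10] open_simplex_basic(1)[OF sT] mesh_subset[OF T] eq
          order_refl mesh_meas[OF T] mesh_emeasure[OF T]])
  also have "\<dots> \<le> real (DIM('a) + 1) * G\<^sup>2 * (\<Sum>w\<in>?V. (?c w)\<^sup>2) * vol T"
    using na mesh_vol_pos[OF T] by (intro mult_right_mono) auto
  also have "\<dots> = real (DIM('a) + 1) * G\<^sup>2 * ((\<Sum>w\<in>?V. (?c w)\<^sup>2) * vol T)" by simp
  also have "\<dots> \<le> real (DIM('a) + 1) * G\<^sup>2 * (star_mean_const * (diameter T)\<^sup>2 * (\<Sum>w\<in>?V. star_energy w))"
    by (rule mult_left_mono[OF sum_quasi_coeff_diff[OF T]]) simp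
  also have "\<dots> = quasi_grad_const * (\<Sum>w\<in>?V. star_energy w)"
    using D by (simp add: quasi_grad_const_def G_def power_divide power_mult_distrib)
  finally show ?thesis .
qed

lemma sum_star_energy_le: "(\<Sum>T\<in>\<T>. \<Sum>w\<in>vertices_of T. star_energy w) \<le> real (DIM('a) + 1) * real star_card_bound * (H1_norm \<Omega> v)\<^sup>2"
proof -
  have "(\<Sum>T\<in>\<T>. \<Sum>w\<in>vertices_of T. star_energy w) \<le> real (DIM('a) + 1) * real star_card_bound * (\<Sum>T\<in>\<T>. e T)"
    unfolding star_energy_def by (rule star_sum_bound) simp
  also have "(\<Sum>T\<in>\<T>. e T) = e \<Omega>"
    unfolding grad_energy_def by (subst sum.swap) (simp add: sum_sq_mesh gL2)
  also have "real (DIM('a) + 1) * real star_card_bound * e \<Omega> \<le> real (DIM('a) + 1) * real star_card_bound * (H1_norm \<Omega> v)\<^sup>2"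
    by (rule mult_left_mono[OF grad_energy_le_H1]) simp
  finally show ?thesis .
qed

lemma L2_le_H1: "(L2_norm \<Omega> v)\<^sup>2 \<le> (H1_norm \<Omega> v)\<^sup>2"
  unfolding H1_norm_sq by (simp add: sum_nonneg)

lemma quasi_interp_H1_bound: "(H1_norm \<Omega> (quasi_interp v))\<^sup>2 \<le> quasi_H1_const * (H1_norm \<Omega> v)\<^sup>2"
proof -
  have "(\<Sum>b\<in>Basis. (L2_norm \<Omega> (weak_partial \<Omega> b (quasi_interp v)))\<^sup>2)
     = (\<Sum>T\<in>\<T>. \<Sum>b\<in>Basis. (L2_norm T (weak_partial \<Omega> b (quasi_interp v)))\<^sup>2)"
    by (subst sum.swap) (simp add: sum_sq_mesh weak_partial_L2[OF H10_space_H1[OF quasi_interp_H10]])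
  also have "\<dots> \<le> (\<Sum>T\<in>\<T>. quasi_grad_const * (\<Sum>w\<in>vertices_of T. star_energy w))" by (rule sum_mono) (rule quasi_interp_gradient)
  also have "\<dots> = quasi_grad_const * (\<Sum>T\<in>\<T>. \<Sum>w\<in>vertices_of T. star_energy w)" by (simp add: sum_distrib_left)
  also have "\<dots> \<le> quasi_grad_const * (real (DIM('a) + 1) * real star_card_bound * (H1_norm \<Omega> v)\<^sup>2)"
    by (rule mult_left_mono[OF sum_star_energy_le quasi_consts_nonneg(2)])
  finally have 1: "(\<Sum>b\<in>Basis. (L2_norm \<Omega> (weak_partial \<Omega> b (quasi_interp v)))\<^sup>2) \<le> quasi_grad_const * (real (DIM('a) + 1) * real star_card_bound * (H1_norm \<Omega> v)\<^sup>2)" .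
  have "(L2_norm \<Omega> (quasi_interp v))\<^sup>2 \<le> quasi_L2_const * (H1_norm \<Omega> v)\<^sup>2"
    using quasi_interp_L2_bound[OF vL2] mult_left_mono[OF L2_le_H1 quasi_L2_const_nonneg] by linarith
  then show ?thesis using 1 unfolding H1_norm_sq[of \<Omega> "quasi_interp v"] by (simp add: quasi_H1_const_def algebra_simps)
qed

lemma quasi_interp_weighted_error:
  "(\<Sum>T\<in>\<T>. (1 / diameter T)\<^sup>2 * (L2_norm T (\<lambda>x. v x - quasi_interp v x))\<^sup>2)
     \<le> quasi_error_const * (real (DIM('a) + 1) * real star_card_bound * (H1_norm \<Omega> v)\<^sup>2)"
proof -
  have "(1 / diameter T)\<^sup>2 * (L2_norm T (\<lambda>x. v x - quasi_interp v x))\<^sup>2 \<le> quasi_error_const * (\<Sum>w\<in>vertices_of T. star_energy w)" if T: "T \<in> \<T>" for T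
  proof -
    have "(1 / diameter T)\<^sup>2 * (L2_norm T (\<lambda>x. v x - quasi_interp v x))\<^sup>2
        \<le> (1 / diameter T)\<^sup>2 * (quasi_error_const * (diameter T)\<^sup>2 * (\<Sum>w\<in>vertices_of T. star_energy w))"
      by (rule mult_left_mono[OF quasi_interp_error[OF T]]) simp
    also have "\<dots> = quasi_error_const * (\<Sum>w\<in>vertices_of T. star_energy w)"
      using mesh_diameter_pos[OF T] by (simp add: power_divide)
    finally show ?thesis .
  qed
  then have "(\<Sum>T\<in>\<T>. (1 / diameter T)\<^sup>2 * (L2_norm T (\<lambda>x. v x - quasi_interp v x))\<^sup>2) \<le> (\<Sum>T\<in>\<T>. quasi_error_const * (\<Sum>w\<in>vertices_of T. star_energy w))"
    by (rule sum_mono)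
  also have "\<dots> = quasi_error_const * (\<Sum>T\<in>\<T>. \<Sum>w\<in>vertices_of T. star_energy w)" by (simp add: sum_distrib_left)
  also have "\<dots> \<le> quasi_error_const * (real (DIM('a) + 1) * real star_card_bound * (H1_norm \<Omega> v)\<^sup>2)"
    by (rule mult_left_mono[OF sum_star_energy_le quasi_consts_nonneg(1)])
  finally show ?thesis .
qed

end

section \<open>The biorthogonal projector\<close>

text \<open>
  The constant is allowed to depend on the functions; it only serves to show continuity on the
  finite-dimensional range for one fixed partition.
\<close>

lemma H1_norm_finite_sum:
  assumes \<Omega>: "open \<Omega>" and I: "finite I" and f: "\<And>i. i \<in> I \<Longrightarrow> f i \<in> H10_space \<Omega> \<gamma>"
  shows "\<exists>K\<ge>0. \<forall>c. (H1_norm \<Omega> (\<lambda>x. \<Sum>i\<in>I. c i * f i x))\<^sup>2 \<le> K * (\<Sum>i\<in>I. (c i)\<^sup>2)"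
  using I f
proof (induction I rule: finite_induct)
  case empty
  then show ?case using H1_norm_zero[OF \<Omega>] by (intro exI[of _ 0]) simp
next
  case (insert j I)
  then obtain K where K: "0 \<le> K" "\<And>c. (H1_norm \<Omega> (\<lambda>x. \<Sum>i\<in>I. c i * f i x))\<^sup>2 \<le> K * (\<Sum>i\<in>I. (c i)\<^sup>2)" by auto
  define M where "M = 2 * (H1_norm \<Omega> (f j))\<^sup>2 + 2 * K"
  have M: "0 \<le> M" "2 * (H1_norm \<Omega> (f j))\<^sup>2 \<le> M" "2 * K \<le> M" using K by (auto simp: M_def)
  have "(H1_norm \<Omega> (\<lambda>x. \<Sum>i\<in>insert j I. c i * f i x))\<^sup>2 \<le> M * (\<Sum>i\<in>insert j I. (c i)\<^sup>2)" for c
  proof -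
    have sI: "(\<lambda>x. \<Sum>i\<in>I. c i * f i x) \<in> H1_space \<Omega>"
      using H10_space_H1[OF H10_space_sum[OF \<Omega> insert.hyps(1), of "\<lambda>i x. c i * f i x"]]
        H10_space_cmult[OF \<Omega>] insert.prems by blast
    have "(H1_norm \<Omega> (\<lambda>x. \<Sum>i\<in>insert j I. c i * f i x))\<^sup>2 = (H1_norm \<Omega> (\<lambda>x. c j * f j x + 1 * (\<Sum>i\<in>I. c i * f i x)))\<^sup>2"
      using insert.hyps by simp
    also have "\<dots> \<le> 2 * (c j)\<^sup>2 * (H1_norm \<Omega> (f j))\<^sup>2 + 2 * 1\<^sup>2 * (H1_norm \<Omega> (\<lambda>x. \<Sum>i\<in>I. c i * f i x))\<^sup>2"
      by (rule H1_norm_sq_lincomb_le[OF \<Omega> H10_space_H1 sI]) (use insert.prems in auto)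
    also have "\<dots> \<le> (c j)\<^sup>2 * M + M * (\<Sum>i\<in>I. (c i)\<^sup>2)"
    proof (rule add_mono)
      have "(c j)\<^sup>2 * (2 * (H1_norm \<Omega> (f j))\<^sup>2) \<le> (c j)\<^sup>2 * M" using M(2) by (rule mult_left_mono) simp
      then show "2 * (c j)\<^sup>2 * (H1_norm \<Omega> (f j))\<^sup>2 \<le> (c j)\<^sup>2 * M" by (simp add: mult_ac)
      have "2 * (H1_norm \<Omega> (\<lambda>x. \<Sum>i\<in>I. c i * f i x))\<^sup>2 \<le> 2 * (K * (\<Sum>i\<in>I. (c i)\<^sup>2))" using K(2)[of c] by linarith
      also have "\<dots> = (2 * K) * (\<Sum>i\<in>I. (c i)\<^sup>2)" by simp
      also have "\<dots> \<le> M * (\<Sum>i\<in>I. (c i)\<^sup>2)" using M(3) by (rule mult_right_mono) (simp add: sum_nonneg)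
      finally show "2 * 1\<^sup>2 * (H1_norm \<Omega> (\<lambda>x. \<Sum>i\<in>I. c i * f i x))\<^sup>2 \<le> M * (\<Sum>i\<in>I. (c i)\<^sup>2)" by simp
    qed
    also have "\<dots> = M * (\<Sum>i\<in>insert j I. (c i)\<^sup>2)" using insert.hyps by (simp add: algebra_simps)
    finally show ?thesis .
  qed
  then show ?case using M(1) by blast
qed

text \<open>
  \<open>Cx\<close>, \<open>Cb\<close> and \<open>Cs\<close> are the constants for the size of the \<open>\<xi>\<close>, for the biorthogonality, and for
  the stability of the bubbles.
\<close>

locale bubble_mesh = nodal_mesh \<Omega> \<T> \<kappa> \<gamma> \<F> \<phi>
  for \<Omega> :: "'a::euclidean_space set" and \<T> \<kappa> \<gamma> \<F> \<phi> +
  fixes m :: nat and \<xi> \<theta> :: "'a set \<Rightarrow> nat \<Rightarrow> 'a \<Rightarrow> real" and Cx Cb Cs :: real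
  assumes xi0: "\<And>T. T \<in> \<T> \<Longrightarrow> \<xi> T 0 = indicator T"
    and xi_out: "\<And>T i x. T \<in> \<T> \<Longrightarrow> i \<le> m \<Longrightarrow> x \<notin> T \<Longrightarrow> \<xi> T i x = 0"
    and xi_L2: "\<And>T i. T \<in> \<T> \<Longrightarrow> i \<le> m \<Longrightarrow> \<xi> T i \<in> L2_space \<Omega>"
    and xi_le: "\<And>T i. T \<in> \<T> \<Longrightarrow> i \<le> m \<Longrightarrow> L2_norm \<Omega> (\<xi> T i) \<le> Cx * sqrt (vol T)"
    and xi_ge: "\<And>T i. T \<in> \<T> \<Longrightarrow> i \<le> m \<Longrightarrow> sqrt (vol T) \<le> Cx * L2_norm \<Omega> (\<xi> T i)"
    and th_H10: "\<And>T i. T \<in> \<T> \<Longrightarrow> i \<le> m \<Longrightarrow> \<theta> T i \<in> H10_space \<Omega> \<gamma>"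
    and bi: "\<And>T i T' i'. T \<in> \<T> \<Longrightarrow> T' \<in> \<T> \<Longrightarrow> i \<le> m \<Longrightarrow> i' \<le> m \<Longrightarrow>
        L2_inner \<Omega> (\<theta> T i) (\<xi> T' i') = (if (T, i) = (T', i') then vol T else 0)"
    and th_xi: "\<And>T i. T \<in> \<T> \<Longrightarrow> i \<le> m \<Longrightarrow>
        L2_norm \<Omega> (\<theta> T i) * L2_norm \<Omega> (\<xi> T i) \<le> Cb * L2_inner \<Omega> (\<theta> T i) (\<xi> T i)"
    and stable: "\<And>k c. k \<in> {0, 1} \<Longrightarrow> (Hk_norm k \<Omega> (\<lambda>x. \<Sum>T\<in>\<T>. \<Sum>i\<le>m. c T i * \<theta> T i x))\<^sup>2
        \<le> Cs * (\<Sum>T\<in>\<T>. \<Sum>i\<le>m. inverse (mesh_size T) ^ (2 * k) * \<bar>c T i\<bar>\<^sup>2 * (L2_norm \<Omega> (\<theta> T i))\<^sup>2)"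
    and Cs: "0 \<le> Cs"
begin

abbreviation ip :: "('a \<Rightarrow> real) \<Rightarrow> ('a \<Rightarrow> real) \<Rightarrow> real" where "ip \<equiv> L2_inner \<Omega>"

lemma th_L2: "T \<in> \<T> \<Longrightarrow> i \<le> m \<Longrightarrow> \<theta> T i \<in> L2_space \<Omega>"
  using th_H10 H10_space_L2 by blast

lemma Cx_pos: assumes "T \<in> \<T>" shows "0 < Cx"
proof -
  have "0 < sqrt (vol T)" using mesh_vol_pos[OF assms] by simp
  then have "0 < Cx * L2_norm \<Omega> (\<xi> T 0)" using xi_ge[OF assms, of 0] by linarith
  then show ?thesis using L2_norm_nonneg[of \<Omega> "\<xi> T 0"] by (simp add: zero_less_mult_iff)
qed

lemma th_norm:
  assumes T: "T \<in> \<T>" and i: "i \<le> m"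
  shows "(L2_norm \<Omega> (\<theta> T i))\<^sup>2 \<le> (Cx * Cb)\<^sup>2 * vol T"
proof -
  let ?s = "sqrt (vol T)" and ?t = "L2_norm \<Omega> (\<theta> T i)"
  have s: "0 < ?s" "?s * ?s = vol T" using mesh_vol_pos[OF T] by auto
  have "?t * ?s \<le> ?t * (Cx * L2_norm \<Omega> (\<xi> T i))" by (rule mult_left_mono[OF xi_ge[OF T i]]) simp
  also have "\<dots> = Cx * (?t * L2_norm \<Omega> (\<xi> T i))" by simp
  also have "\<dots> \<le> Cx * (Cb * vol T)"
    using th_xi[OF T i] bi[OF T T i i] Cx_pos[OF T] by (intro mult_left_mono) auto
  also have "\<dots> = (Cx * Cb * ?s) * ?s" using s(2) by simp
  finally have "?t \<le> Cx * Cb * ?s" using s(1) by (simp only: mult_le_cancel_right_pos)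
  then have "?t\<^sup>2 \<le> (Cx * Cb * ?s)\<^sup>2" by (rule power_mono) simp
  also have "\<dots> = (Cx * Cb)\<^sup>2 * vol T" using mesh_vol_pos[OF T] by (simp add: power_mult_distrib)
  finally show ?thesis .
qed

lemma ip_xi_sq:
  assumes T: "T \<in> \<T>" and i: "i \<le> m" and w: "w \<in> L2_space \<Omega>"
  shows "(ip w (\<xi> T i))\<^sup>2 \<le> Cx\<^sup>2 * vol T * (L2_norm T w)\<^sup>2"
proof -
  have "ip w (\<xi> T i) = L2_inner T w (\<xi> T i)"
    using xi_out[OF T i] by (intro L2_inner_integral_restrict[OF mesh_subset[OF T]]) (use T in auto)
  then have "(ip w (\<xi> T i))\<^sup>2 \<le> (L2_norm T w)\<^sup>2 * (L2_norm T (\<xi> T i))\<^sup>2"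
    using L2_Cauchy_Schwarz[OF mesh_L2[OF w T] mesh_L2[OF xi_L2[OF T i] T]] by simp
  also have "\<dots> \<le> (L2_norm T w)\<^sup>2 * (Cx\<^sup>2 * vol T)"
  proof (rule mult_left_mono)
    have "(L2_norm T (\<xi> T i))\<^sup>2 \<le> (L2_norm \<Omega> (\<xi> T i))\<^sup>2"
      by (rule L2_norm_sq_subset_le[OF xi_L2[OF T i] mesh_subset[OF T]]) (use T in auto)
    also have "\<dots> \<le> (Cx * sqrt (vol T))\<^sup>2" by (rule power_mono[OF xi_le[OF T i]]) simp
    also have "\<dots> = Cx\<^sup>2 * vol T" using mesh_vol_pos[OF T] by (simp add: power_mult_distrib)
    finally show "(L2_norm T (\<xi> T i))\<^sup>2 \<le> Cx\<^sup>2 * vol T" .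
  qed simp
  finally show ?thesis by (simp add: mult_ac)
qed

text \<open>
  The biorthogonal projection onto the span of the bubbles: it adds bubbles so as to reproduce all
  the inner products of \<open>w\<close> with the \<open>\<xi>\<close>, see \<open>bubble_corr_ip\<close>.
\<close>

definition bubble_corr :: "('a \<Rightarrow> real) \<Rightarrow> 'a \<Rightarrow> real" where
  "bubble_corr w x = (\<Sum>T\<in>\<T>. \<Sum>i\<le>m. ip w (\<xi> T i) / vol T * \<theta> T i x)"

lemma bubble_corr_H10: "bubble_corr w \<in> H10_space \<Omega> \<gamma>"
  unfolding bubble_corr_def[abs_def]
  by (rule H10_space_sum[OF open_\<Omega> finite_\<T>], rule H10_space_sum[OF open_\<Omega>], simp,
      rule H10_space_cmult[OF open_\<Omega> th_H10]) auto

definition bubble_const :: real where "bubble_const = Cs * (real (Suc m) * (Cx\<^sup>2 * (Cx * Cb)\<^sup>2))"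

lemma bubble_const_nonneg: "0 \<le> bubble_const" using Cs by (simp add: bubble_const_def)

text \<open>
  The bubbles are stable in both norms and the coefficient of $\theta_{T,i}$ only sees \<open>w\<close> on \<open>T\<close>;
  the $H^1$ norm costs a factor $h_T^{-1}$ on each element.
\<close>

lemma bubble_corr_bound:
  assumes k: "k \<in> {0, 1}" and w: "w \<in> L2_space \<Omega>"
  shows "(Hk_norm k \<Omega> (bubble_corr w))\<^sup>2 \<le> bubble_const * (\<Sum>T\<in>\<T>. inverse (mesh_size T) ^ (2 * k) * (L2_norm T w)\<^sup>2)"
proof -
  let ?q = "\<lambda>T. inverse (mesh_size T) ^ (2 * k)"
  have "(Hk_norm k \<Omega> (bubble_corr w))\<^sup>2 \<le> Cs * (\<Sum>T\<in>\<T>. \<Sum>i\<le>m. ?q T * \<bar>ip w (\<xi> T i) / vol T\<bar>\<^sup>2 * (L2_norm \<Omega> (\<theta> T i))\<^sup>2)"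
    unfolding bubble_corr_def[abs_def] by (rule stable[OF k])
  also have "\<dots> \<le> Cs * (\<Sum>T\<in>\<T>. \<Sum>i\<le>m. ?q T * (Cx\<^sup>2 * (Cx * Cb)\<^sup>2 * (L2_norm T w)\<^sup>2))"
  proof (intro mult_left_mono sum_mono Cs)
    fix T i assume T: "T \<in> \<T>" and i: "i \<in> {..m}"
    have vp: "0 < vol T" using mesh_vol_pos[OF T] .
    have q: "0 \<le> ?q T" by (simp add: power_mult)
    have "\<bar>ip w (\<xi> T i) / vol T\<bar>\<^sup>2 * (L2_norm \<Omega> (\<theta> T i))\<^sup>2
        \<le> (Cx\<^sup>2 * vol T * (L2_norm T w)\<^sup>2 / (vol T)\<^sup>2) * ((Cx * Cb)\<^sup>2 * vol T)"
    proof (rule mult_mono)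
      show "\<bar>ip w (\<xi> T i) / vol T\<bar>\<^sup>2 \<le> Cx\<^sup>2 * vol T * (L2_norm T w)\<^sup>2 / (vol T)\<^sup>2"
        unfolding power2_abs power_divide using i by (intro divide_right_mono ip_xi_sq[OF T _ w]) auto
    qed (use th_norm[OF T] i vp in auto)
    also have "\<dots> = Cx\<^sup>2 * (Cx * Cb)\<^sup>2 * (L2_norm T w)\<^sup>2" using vp by (simp add: power2_eq_square)
    finally show "?q T * \<bar>ip w (\<xi> T i) / vol T\<bar>\<^sup>2 * (L2_norm \<Omega> (\<theta> T i))\<^sup>2
        \<le> ?q T * (Cx\<^sup>2 * (Cx * Cb)\<^sup>2 * (L2_norm T w)\<^sup>2)"
      unfolding mult.assoc[of "?q T"] using q by (intro mult_left_mono)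
  qed
  also have "\<dots> = bubble_const * (\<Sum>T\<in>\<T>. ?q T * (L2_norm T w)\<^sup>2)"
    by (simp add: bubble_const_def sum_distrib_left mult_ac)
  finally show ?thesis .
qed

lemma ip_double_sum:
  assumes w: "w \<in> L2_space \<Omega>" and f: "\<And>T i. T \<in> \<T> \<Longrightarrow> i \<in> I T \<Longrightarrow> f T i \<in> L2_space \<Omega>" and I: "\<And>T. finite (I T)"
  shows "ip (\<lambda>x. \<Sum>T\<in>\<T>. \<Sum>i\<in>I T. c T i * f T i x) w = (\<Sum>T\<in>\<T>. \<Sum>i\<in>I T. c T i * ip (f T i) w)"
proof -
  have 1: "(\<lambda>x. c T i * f T i x) \<in> L2_space \<Omega>" if "T \<in> \<T>" "i \<in> I T" for T i
    by (rule L2_space_cmult[OF f[OF that]])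
  have 2: "(\<lambda>x. \<Sum>i\<in>I T. c T i * f T i x) \<in> L2_space \<Omega>" if "T \<in> \<T>" for T
    by (rule L2_space_sum[OF I]) (rule 1[OF that])
  have "ip (\<lambda>x. \<Sum>T\<in>\<T>. \<Sum>i\<in>I T. c T i * f T i x) w = (\<Sum>T\<in>\<T>. ip (\<lambda>x. \<Sum>i\<in>I T. c T i * f T i x) w)"
    by (rule L2_inner_sum_left[OF finite_\<T> 2 w])
  also have "\<dots> = (\<Sum>T\<in>\<T>. \<Sum>i\<in>I T. ip (\<lambda>x. c T i * f T i x) w)"
    by (rule sum.cong[OF refl], rule L2_inner_sum_left[OF I 1 w])
  finally show ?thesis by (simp add: L2_inner_cmult_left)
qed

lemma double_delta:
  assumes "T' \<in> \<T>" "i' \<le> m"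
  shows "(\<Sum>T\<in>\<T>. \<Sum>i\<le>m. c T i * (if (T, i) = (T', i') then vol T else 0)) = c T' i' * (vol T' :: real)"
proof -
  have "(\<Sum>T\<in>\<T>. \<Sum>i\<le>m. c T i * (if (T, i) = (T', i') then vol T else 0))
     = (\<Sum>T\<in>\<T>. if T = T' then c T i' * vol T else 0)"
  proof (rule sum.cong[OF refl])
    fix T
    have "(\<Sum>i\<le>m. c T i * (if (T, i) = (T', i') then vol T else 0))
        = (\<Sum>i\<le>m. if i = i' then (if T = T' then c T i' * vol T else 0) else 0)"
      by (rule sum.cong[OF refl]) auto
    also have "\<dots> = (if T = T' then c T i' * vol T else 0)"
      using assms(2) by (simp only: sum.delta finite_atMost atMost_iff if_True)
    finally show "(\<Sum>i\<le>m. c T i * (if (T, i) = (T', i') then vol T else 0)) = (if T = T' then c T i' * vol T else 0)" .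
  qed
  also have "\<dots> = c T' i' * vol T'"
    using assms(1) finite_\<T> by (simp only: sum.delta if_True)
  finally show ?thesis .
qed

lemma bubble_corr_ip:
  assumes T': "T' \<in> \<T>" and i': "i' \<le> m"
  shows "ip (bubble_corr w) (\<xi> T' i') = ip w (\<xi> T' i')"
proof -
  have "ip (bubble_corr w) (\<xi> T' i') = (\<Sum>T\<in>\<T>. \<Sum>i\<le>m. ip w (\<xi> T i) / vol T * ip (\<theta> T i) (\<xi> T' i'))"
    unfolding bubble_corr_def[abs_def] by (rule ip_double_sum[OF xi_L2[OF T' i']]) (auto intro: th_L2)
  also have "\<dots> = (\<Sum>T\<in>\<T>. \<Sum>i\<le>m. ip w (\<xi> T i) / vol T * (if (T, i) = (T', i') then vol T else 0))"
    by (intro sum.cong refl arg_cong2[of _ _ _ _ "(*)"] bi T' i') auto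
  also have "\<dots> = ip w (\<xi> T' i') / vol T' * vol T'" by (rule double_delta[OF T' i'])
  finally show ?thesis using mesh_vol_pos[OF T'] by simp
qed

abbreviation sig :: "'a set \<Rightarrow> 'a \<Rightarrow> real" where "sig T \<equiv> sigma_fun \<gamma> \<T> \<phi> T"

lemma sig_H10: "sig T \<in> H10_space \<Omega> \<gamma>"
proof -
  have "sig T = (\<lambda>x. \<Sum>\<nu>\<in>vertices_of T \<inter> free_vertices \<gamma> \<T>. inverse (real (valence \<T> \<nu>)) * \<phi> \<nu> x)"
    by (rule ext) (simp add: sigma_fun_def)
  moreover have "\<dots> \<in> H10_space \<Omega> \<gamma>"
    using finite_free by (intro H10_space_sum[OF open_\<Omega>] H10_space_cmult[OF open_\<Omega>] nodal_H10) auto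
  ultimately show ?thesis by simp
qed

lemma sig_L2: "sig T \<in> L2_space \<Omega>" using sig_H10 by (rule H10_space_L2)

lemma one_L2: "(\<lambda>x. 1) \<in> L2_space \<Omega>"
proof (rule L2_space_const)
  have "emeasure lborel \<Omega> < \<infinity>" by (rule emeasure_bounded_finite[OF bounded_\<Omega>])
  then show "emeasure lebesgue \<Omega> < \<infinity>" using open_\<Omega> by simp
qed simp

lemma ip_mean:
  assumes T: "T \<in> \<T>"
  shows "ip u (\<xi> T 0) / vol T = mean T u"
proof -
  have "ip u (\<xi> T 0) = L2_inner T u (\<xi> T 0)"
    using xi_out[OF T, of 0] by (intro L2_inner_integral_restrict[OF mesh_subset[OF T]]) (use T in auto)
  also have "\<dots> = (\<integral>x. u x \<partial>lebesgue_on T)"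
    unfolding L2_inner_def xi0[OF T] by (intro Bochner_Integration.integral_cong) auto
  finally show ?thesis by (simp add: mean_def)
qed

lemma ip_one: assumes T: "T \<in> \<T>" shows "ip (\<lambda>x. 1) (\<xi> T 0) = vol T"
proof -
  have "mean T (\<lambda>x. 1) = 1" using mesh_vol_pos[OF T] T by (simp add: mean_def measure_restrict_space)
  then show ?thesis using ip_mean[OF T, of "\<lambda>x. 1"] mesh_vol_pos[OF T] by simp
qed

lemma psi0_eq:
  assumes T: "T \<in> \<T>"
  shows "psi0 \<Omega> \<gamma> \<T> \<phi> \<xi> \<theta> T x = sig T x + \<theta> T 0 x - (\<Sum>T'\<in>\<T>. ip (sig T) (\<xi> T' 0) / vol T' * \<theta> T' 0 x)"
proof -
  have vp: "vol T \<noteq> 0" using mesh_vol_pos[OF T] by simp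
  have 1: "ip (\<lambda>y. 1 - sig T y) (\<xi> T 0) = vol T - ip (sig T) (\<xi> T 0)"
    using L2_inner_diff_left[OF one_L2 sig_L2 xi_L2[OF T]] ip_one[OF T] by simp
  have 2: "(\<Sum>T'\<in>\<T> - {T}. ip (sig T) (\<xi> T' 0) / ip (\<theta> T' 0) (\<xi> T' 0) * \<theta> T' 0 x)
      = (\<Sum>T'\<in>\<T> - {T}. ip (sig T) (\<xi> T' 0) / vol T' * \<theta> T' 0 x)"
    by (rule sum.cong[OF refl]) (simp add: bi)
  have 3: "(\<Sum>T'\<in>\<T>. ip (sig T) (\<xi> T' 0) / vol T' * \<theta> T' 0 x)
     = ip (sig T) (\<xi> T 0) / vol T * \<theta> T 0 x + (\<Sum>T'\<in>\<T> - {T}. ip (sig T) (\<xi> T' 0) / vol T' * \<theta> T' 0 x)"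
    by (rule sum.remove[OF finite_\<T> T])
  have 4: "ip (\<theta> T 0) (\<xi> T 0) = vol T" using bi[OF T T] by simp
  show ?thesis unfolding psi0_def 1 2 3 4 using vp by (simp add: diff_divide_distrib left_diff_distrib)
qed

lemma psi0_ip:
  assumes T: "T \<in> \<T>" and T': "T' \<in> \<T>" and i': "i' \<in> {1..m}"
  shows "ip (psi0 \<Omega> \<gamma> \<T> \<phi> \<xi> \<theta> T) (\<xi> T' i') = ip (sig T) (\<xi> T' i')"
proof -
  have i'm: "i' \<le> m" "i' \<noteq> 0" using i' by auto
  note xL = xi_L2[OF T' i'm(1)]
  let ?g = "\<lambda>x. \<Sum>T'\<in>\<T>. \<Sum>i\<in>{0}. ip (sig T) (\<xi> T' i) / vol T' * \<theta> T' i x"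
  have e: "psi0 \<Omega> \<gamma> \<T> \<phi> \<xi> \<theta> T = (\<lambda>x. (sig T x + \<theta> T 0 x) - ?g x)"
    using psi0_eq[OF T] by (intro ext) simp
  have gL: "?g \<in> L2_space \<Omega>"
    by (intro L2_space_sum finite_\<T> L2_space_cmult th_L2) auto
  have "ip ?g (\<xi> T' i') = (\<Sum>T''\<in>\<T>. \<Sum>i\<in>{0}. ip (sig T) (\<xi> T'' i) / vol T'' * ip (\<theta> T'' i) (\<xi> T' i'))"
    by (rule ip_double_sum[OF xL]) (auto intro: th_L2)
  also have "\<dots> = 0" using i'm by (intro sum.neutral ballI) (simp add: bi[OF _ T'])
  finally have g0: "ip ?g (\<xi> T' i') = 0" .
  have t0: "ip (\<theta> T 0) (\<xi> T' i') = 0" using bi[OF T T' _ i'm(1), of 0] i'm(2) by simp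
  have tL: "\<theta> T 0 \<in> L2_space \<Omega>" using th_L2[OF T] by simp
  have "ip (\<lambda>x. (sig T x + \<theta> T 0 x) - ?g x) (\<xi> T' i') = ip (\<lambda>x. sig T x + \<theta> T 0 x) (\<xi> T' i') - ip ?g (\<xi> T' i')"
    by (rule L2_inner_diff_left[OF L2_space_add[OF sig_L2 tL] gL xL])
  also have "\<dots> = ip (sig T) (\<xi> T' i')"
    using L2_inner_add_left[OF sig_L2 tL xL] g0 t0 by simp
  finally show ?thesis unfolding e .
qed

text \<open>
  The two correction steps in the definition of $\psi_{\mathcal T,T,0}$, for the index 0 and for the
  higher indices, combine into one bubble correction: the function is $\sigma_T$ with its inner
  products removed, plus $\theta_T$.
\<close>

lemma psi_0_eq:
  assumes T: "T \<in> \<T>"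
  shows "psi \<Omega> \<gamma> \<T> m \<phi> \<xi> \<theta> T 0 x = sig T x + \<theta> T 0 x - bubble_corr (sig T) x"
proof -
  have s: "{..m} = insert 0 {1..m}" by auto
  have "(\<Sum>T'\<in>\<T>. \<Sum>i'\<in>{1..m}. ip (psi0 \<Omega> \<gamma> \<T> \<phi> \<xi> \<theta> T) (\<xi> T' i') / ip (\<theta> T' i') (\<xi> T' i') * \<theta> T' i' x)
     = (\<Sum>T'\<in>\<T>. \<Sum>i'\<in>{1..m}. ip (sig T) (\<xi> T' i') / vol T' * \<theta> T' i' x)"
    by (intro sum.cong refl) (simp add: psi0_ip[OF T] bi)
  moreover have "bubble_corr (sig T) x = (\<Sum>T'\<in>\<T>. ip (sig T) (\<xi> T' 0) / vol T' * \<theta> T' 0 x)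
     + (\<Sum>T'\<in>\<T>. \<Sum>i'\<in>{1..m}. ip (sig T) (\<xi> T' i') / vol T' * \<theta> T' i' x)"
    unfolding bubble_corr_def s by (simp add: sum.distrib)
  ultimately show ?thesis unfolding psi_def using psi0_eq[OF T, of x] by simp
qed

lemma psi_H10: assumes T: "T \<in> \<T>" and i: "i \<le> m" shows "psi \<Omega> \<gamma> \<T> m \<phi> \<xi> \<theta> T i \<in> H10_space \<Omega> \<gamma>"
proof (cases "i = 0")
  case True
  have "psi \<Omega> \<gamma> \<T> m \<phi> \<xi> \<theta> T 0 = (\<lambda>x. 1 * (sig T x + \<theta> T 0 x) + (-1) * bubble_corr (sig T) x)"
    using psi_0_eq[OF T] by (intro ext) simp
  moreover have "\<dots> \<in> H10_space \<Omega> \<gamma>"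
    by (intro H10_space_lincomb[OF open_\<Omega>] H10_space_add[OF open_\<Omega>] sig_H10 bubble_corr_H10 th_H10 T) simp
  ultimately show ?thesis using True by simp
next
  case False
  then have "psi \<Omega> \<gamma> \<T> m \<phi> \<xi> \<theta> T i = \<theta> T i" by (intro ext) (simp add: psi_def)
  then show ?thesis using th_H10[OF T i] by simp
qed

lemma psi_ip:
  assumes T: "T \<in> \<T>" and T': "T' \<in> \<T>" and i: "i \<le> m" and i': "i' \<le> m"
  shows "ip (psi \<Omega> \<gamma> \<T> m \<phi> \<xi> \<theta> T i) (\<xi> T' i') = (if (T, i) = (T', i') then vol T else 0)"
proof (cases "i = 0")
  case True
  note xL = xi_L2[OF T' i']
  have tL: "\<theta> T 0 \<in> L2_space \<Omega>" using th_L2[OF T] by simp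
  have "psi \<Omega> \<gamma> \<T> m \<phi> \<xi> \<theta> T 0 = (\<lambda>x. (sig T x + \<theta> T 0 x) - bubble_corr (sig T) x)"
    using psi_0_eq[OF T] by (intro ext) simp
  moreover have "ip (\<lambda>x. (sig T x + \<theta> T 0 x) - bubble_corr (sig T) x) (\<xi> T' i')
     = ip (\<lambda>x. sig T x + \<theta> T 0 x) (\<xi> T' i') - ip (bubble_corr (sig T)) (\<xi> T' i')"
    by (rule L2_inner_diff_left[OF L2_space_add[OF sig_L2 tL] H10_space_L2[OF bubble_corr_H10] xL])
  moreover have "ip (\<lambda>x. sig T x + \<theta> T 0 x) (\<xi> T' i') = ip (sig T) (\<xi> T' i') + ip (\<theta> T 0) (\<xi> T' i')"
    by (rule L2_inner_add_left[OF sig_L2 tL xL])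
  ultimately show ?thesis using bubble_corr_ip[OF T' i'] bi[OF T T' _ i', of 0] True by simp
next
  case False
  then have "psi \<Omega> \<gamma> \<T> m \<phi> \<xi> \<theta> T i = \<theta> T i" by (intro ext) (simp add: psi_def)
  then show ?thesis using bi[OF T T' i i'] by simp
qed

abbreviation P :: "('a \<Rightarrow> real) \<Rightarrow> 'a \<Rightarrow> real" where "P \<equiv> biorth_proj \<Omega> \<gamma> \<T> m \<phi> \<xi> \<theta>"

lemma P_eq: "P u x = (\<Sum>T\<in>\<T>. \<Sum>i\<le>m. ip u (\<xi> T i) / vol T * psi \<Omega> \<gamma> \<T> m \<phi> \<xi> \<theta> T i x)"
  unfolding biorth_proj_def by (intro sum.cong refl) (simp add: psi_ip)

lemma P_H10: "P u \<in> H10_space \<Omega> \<gamma>"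
proof -
  have "P u = (\<lambda>x. \<Sum>T\<in>\<T>. \<Sum>i\<le>m. ip u (\<xi> T i) / vol T * psi \<Omega> \<gamma> \<T> m \<phi> \<xi> \<theta> T i x)"
    by (rule ext) (rule P_eq)
  moreover have "\<dots> \<in> H10_space \<Omega> \<gamma>"
    by (rule H10_space_sum[OF open_\<Omega> finite_\<T>], rule H10_space_sum[OF open_\<Omega>], simp,
      rule H10_space_cmult[OF open_\<Omega> psi_H10]) auto
  ultimately show ?thesis by simp
qed

lemma P_ip:
  assumes T': "T' \<in> \<T>" and i': "i' \<le> m"
  shows "ip (P u) (\<xi> T' i') = ip u (\<xi> T' i')"
proof -
  have "P u = (\<lambda>x. \<Sum>T\<in>\<T>. \<Sum>i\<le>m. ip u (\<xi> T i) / vol T * psi \<Omega> \<gamma> \<T> m \<phi> \<xi> \<theta> T i x)"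
    by (rule ext) (rule P_eq)
  then have "ip (P u) (\<xi> T' i') = (\<Sum>T\<in>\<T>. \<Sum>i\<le>m. ip u (\<xi> T i) / vol T * ip (psi \<Omega> \<gamma> \<T> m \<phi> \<xi> \<theta> T i) (\<xi> T' i'))"
    by (simp only:) (rule ip_double_sum[OF xi_L2[OF T' i']], auto intro: H10_space_L2 psi_H10)
  also have "\<dots> = (\<Sum>T\<in>\<T>. \<Sum>i\<le>m. ip u (\<xi> T i) / vol T * (if (T, i) = (T', i') then vol T else 0))"
    by (intro sum.cong refl arg_cong2[of _ _ _ _ "(*)"] psi_ip T' i') auto
  also have "\<dots> = ip u (\<xi> T' i') / vol T' * vol T'" by (rule double_delta[OF T' i'])
  finally show ?thesis using mesh_vol_pos[OF T'] by simp
qed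

lemma P_cong: "(\<And>T i. T \<in> \<T> \<Longrightarrow> i \<le> m \<Longrightarrow> ip u (\<xi> T i) = ip w (\<xi> T i)) \<Longrightarrow> P u = P w"
  by (rule ext, unfold P_eq, intro sum.cong refl) simp

lemma P_idem: "P (P u) = P u"
  by (rule P_cong) (rule P_ip)

lemma P_lincomb:
  assumes u: "u \<in> L2_space \<Omega>" and w: "w \<in> L2_space \<Omega>"
  shows "P (\<lambda>y. a * u y + b * w y) x = a * P u x + b * P w x"
proof -
  have "P (\<lambda>y. a * u y + b * w y) x = (\<Sum>T\<in>\<T>. \<Sum>i\<le>m. a * (ip u (\<xi> T i) / vol T * psi \<Omega> \<gamma> \<T> m \<phi> \<xi> \<theta> T i x)
      + b * (ip w (\<xi> T i) / vol T * psi \<Omega> \<gamma> \<T> m \<phi> \<xi> \<theta> T i x))"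
    unfolding P_eq by (intro sum.cong refl) (simp add: L2_inner_lincomb_left[OF u w xi_L2] add_divide_distrib algebra_simps)
  then show ?thesis by (simp add: P_eq sum.distrib sum_distrib_left)
qed

lemma P_span: "P ` L2_space \<Omega> = span_of \<T> m (psi \<Omega> \<gamma> \<T> m \<phi> \<xi> \<theta>)"
proof
  show "P ` L2_space \<Omega> \<subseteq> span_of \<T> m (psi \<Omega> \<gamma> \<T> m \<phi> \<xi> \<theta>)"
  proof
    fix f assume "f \<in> P ` L2_space \<Omega>"
    then obtain u where "f = P u" by blast
    then have "f = (\<lambda>x. \<Sum>T\<in>\<T>. \<Sum>i\<le>m. (ip u (\<xi> T i) / vol T) * psi \<Omega> \<gamma> \<T> m \<phi> \<xi> \<theta> T i x)"
      by (simp add: fun_eq_iff P_eq)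
    then show "f \<in> span_of \<T> m (psi \<Omega> \<gamma> \<T> m \<phi> \<xi> \<theta>)"
      unfolding span_of_def by (intro CollectI exI[of _ "\<lambda>T i. ip u (\<xi> T i) / vol T"] conjI TrueI)
  qed
  show "span_of \<T> m (psi \<Omega> \<gamma> \<T> m \<phi> \<xi> \<theta>) \<subseteq> P ` L2_space \<Omega>"
  proof
    fix f assume "f \<in> span_of \<T> m (psi \<Omega> \<gamma> \<T> m \<phi> \<xi> \<theta>)"
    then obtain c where f: "f = (\<lambda>x. \<Sum>T\<in>\<T>. \<Sum>i\<le>m. c T i * psi \<Omega> \<gamma> \<T> m \<phi> \<xi> \<theta> T i x)"
      unfolding span_of_def by blast
    have fL: "f \<in> L2_space \<Omega>"
      unfolding f
      by (rule L2_space_sum[OF finite_\<T>], rule L2_space_sum, simp, rule L2_space_cmult, rule H10_space_L2, rule psi_H10) auto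
    have "ip f (\<xi> T' i') = c T' i' * vol T'" if T': "T' \<in> \<T>" and i': "i' \<le> m" for T' i'
    proof -
      have "ip f (\<xi> T' i') = (\<Sum>T\<in>\<T>. \<Sum>i\<le>m. c T i * ip (psi \<Omega> \<gamma> \<T> m \<phi> \<xi> \<theta> T i) (\<xi> T' i'))"
        unfolding f by (rule ip_double_sum[OF xi_L2[OF T' i']]) (auto intro: H10_space_L2 psi_H10)
      also have "\<dots> = (\<Sum>T\<in>\<T>. \<Sum>i\<le>m. c T i * (if (T, i) = (T', i') then vol T else 0))"
        by (intro sum.cong refl arg_cong2[of _ _ _ _ "(*)"] psi_ip T' i') auto
      also have "\<dots> = c T' i' * vol T'" by (rule double_delta[OF T' i'])
      finally show ?thesis .
    qed
    then have "P f x = f x" for x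
      unfolding P_eq f using mesh_vol_pos by (intro sum.cong refl) (simp add: less_imp_neq[symmetric])
    then have "f = P f" by (intro ext) simp
    then show "f \<in> P ` L2_space \<Omega>" using fL by blast
  qed
qed

text \<open>
  Exchange the sums over elements and over vertices; the valence of a vertex is the cardinality of
  its star.
\<close>

lemma quasi_interp_eq_sig: "quasi_interp u x = (\<Sum>T\<in>\<T>. mean T u * sig T x)"
proof -
  let ?F = "free_vertices \<gamma> \<T>"
  have "(\<Sum>T\<in>\<T>. mean T u * sig T x)
     = (\<Sum>T\<in>\<T>. \<Sum>\<nu>\<in>?F. if \<nu> \<in> vertices_of T then mean T u * (inverse (real (valence \<T> \<nu>)) * \<phi> \<nu> x) else 0)"
  proof (rule sum.cong[OF refl])
    fix T assume T: "T \<in> \<T>"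
    have "mean T u * sig T x = (\<Sum>\<nu>\<in>vertices_of T \<inter> ?F. mean T u * (inverse (real (valence \<T> \<nu>)) * \<phi> \<nu> x))"
      by (simp add: sigma_fun_def sum_distrib_left)
    also have "vertices_of T \<inter> ?F = {\<nu> \<in> ?F. \<nu> \<in> vertices_of T}" by blast
    also have "(\<Sum>\<nu>\<in>{\<nu> \<in> ?F. \<nu> \<in> vertices_of T}. mean T u * (inverse (real (valence \<T> \<nu>)) * \<phi> \<nu> x))
       = (\<Sum>\<nu>\<in>?F. if \<nu> \<in> vertices_of T then mean T u * (inverse (real (valence \<T> \<nu>)) * \<phi> \<nu> x) else 0)"
      by (rule sum.inter_filter[OF finite_free])
    finally show "mean T u * sig T x = (\<Sum>\<nu>\<in>?F. if \<nu> \<in> vertices_of T then mean T u * (inverse (real (valence \<T> \<nu>)) * \<phi> \<nu> x) else 0)" .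
  qed
  also have "\<dots> = (\<Sum>\<nu>\<in>?F. \<Sum>T\<in>\<T>. if \<nu> \<in> vertices_of T then mean T u * (inverse (real (valence \<T> \<nu>)) * \<phi> \<nu> x) else 0)"
    by (rule sum.swap)
  also have "\<dots> = (\<Sum>\<nu>\<in>?F. quasi_coeff u \<nu> * \<phi> \<nu> x)"
  proof (rule sum.cong[OF refl])
    fix \<nu> assume \<nu>: "\<nu> \<in> ?F"
    then obtain T0 where T0: "T0 \<in> \<T>" "\<nu> \<in> vertices_of T0" "\<nu> \<notin> \<gamma>" by (auto simp: free_vertices_def)
    have st: "{T \<in> \<T>. \<nu> \<in> vertices_of T} = star \<nu>"
      using vertex_shared[OF T0(1) _ T0(2)] vertex_in_closure by (auto simp: star_def)
    have "(\<Sum>T\<in>\<T>. if \<nu> \<in> vertices_of T then mean T u * (inverse (real (valence \<T> \<nu>)) * \<phi> \<nu> x) else 0)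
       = (\<Sum>T\<in>{T \<in> \<T>. \<nu> \<in> vertices_of T}. mean T u * (inverse (real (valence \<T> \<nu>)) * \<phi> \<nu> x))"
      by (rule sum.inter_filter[OF finite_\<T>, symmetric])
    also have "\<dots> = quasi_coeff u \<nu> * \<phi> \<nu> x"
      unfolding st using T0(3) by (simp add: quasi_coeff_def valence_def star_def[symmetric] sum_distrib_right[symmetric] divide_inverse mult.assoc)
    finally show "(\<Sum>T\<in>\<T>. if \<nu> \<in> vertices_of T then mean T u * (inverse (real (valence \<T> \<nu>)) * \<phi> \<nu> x) else 0) = quasi_coeff u \<nu> * \<phi> \<nu> x" .
  qed
  finally show ?thesis by (simp add: quasi_interp_def)
qed

text \<open>
  The key identity. The quasi-interpolant carries the approximation power, the bubbles correct its
  inner products with the \<open>\<xi>\<close>; it follows by summing \<open>psi_0_eq\<close> with the weights \<open>mean T u\<close>.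
\<close>

lemma P_decomp:
  assumes u: "u \<in> L2_space \<Omega>"
  shows "P u x = quasi_interp u x + bubble_corr (\<lambda>y. u y - quasi_interp u y) x"
proof -
  have s: "{..m} = insert 0 {1..m}" by auto
  have qL: "quasi_interp u \<in> L2_space \<Omega>" using quasi_interp_H10 H10_space_L2 by blast
  have "(\<Sum>i\<le>m. ip u (\<xi> T i) / vol T * psi \<Omega> \<gamma> \<T> m \<phi> \<xi> \<theta> T i x)
     = mean T u * sig T x - mean T u * bubble_corr (sig T) x + (\<Sum>i\<le>m. ip u (\<xi> T i) / vol T * \<theta> T i x)" if T: "T \<in> \<T>" for T
  proof -
    have split: "(\<Sum>i\<le>m. f i) = f 0 + (\<Sum>i\<in>{1..m}. f i)" for f :: "nat \<Rightarrow> real" unfolding s by simp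
    have "(\<Sum>i\<in>{1..m}. ip u (\<xi> T i) / vol T * psi \<Omega> \<gamma> \<T> m \<phi> \<xi> \<theta> T i x) = (\<Sum>i\<in>{1..m}. ip u (\<xi> T i) / vol T * \<theta> T i x)"
      by (intro sum.cong refl) (simp add: psi_def)
    then show ?thesis
      unfolding split psi_0_eq[OF T] ip_mean[OF T] by (simp add: algebra_simps)
  qed
  then have "P u x = (\<Sum>T\<in>\<T>. mean T u * sig T x - mean T u * bubble_corr (sig T) x + (\<Sum>i\<le>m. ip u (\<xi> T i) / vol T * \<theta> T i x))"
    unfolding P_eq by (rule sum.cong[OF refl])
  also have "\<dots> = quasi_interp u x - (\<Sum>T\<in>\<T>. mean T u * bubble_corr (sig T) x) + bubble_corr u x"
    by (simp add: sum.distrib sum_subtractf quasi_interp_eq_sig bubble_corr_def)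
  also have "(\<Sum>T\<in>\<T>. mean T u * bubble_corr (sig T) x) = bubble_corr (quasi_interp u) x"
  proof -
    have "ip (quasi_interp u) (\<xi> T' i) = (\<Sum>T\<in>\<T>. mean T u * ip (sig T) (\<xi> T' i))" if "T' \<in> \<T>" "i \<le> m" for T' i
    proof -
      have "ip (\<lambda>x. \<Sum>T\<in>\<T>. mean T u * sig T x) (\<xi> T' i) = (\<Sum>T\<in>\<T>. ip (\<lambda>x. mean T u * sig T x) (\<xi> T' i))"
        by (rule L2_inner_sum_left[OF finite_\<T> L2_space_cmult[OF sig_L2] xi_L2[OF that]])
      moreover have "quasi_interp u = (\<lambda>x. \<Sum>T\<in>\<T>. mean T u * sig T x)" by (rule ext) (rule quasi_interp_eq_sig)
      ultimately show ?thesis by (simp add: L2_inner_cmult_left)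
    qed
    then have "bubble_corr (quasi_interp u) x = (\<Sum>T'\<in>\<T>. \<Sum>i\<le>m. \<Sum>T\<in>\<T>. mean T u * (ip (sig T) (\<xi> T' i) / vol T' * \<theta> T' i x))"
      unfolding bubble_corr_def by (intro sum.cong refl) (simp add: sum_divide_distrib sum_distrib_right mult.assoc)
    also have "\<dots> = (\<Sum>T'\<in>\<T>. \<Sum>T\<in>\<T>. \<Sum>i\<le>m. mean T u * (ip (sig T) (\<xi> T' i) / vol T' * \<theta> T' i x))"
      by (intro sum.cong refl sum.swap)
    also have "\<dots> = (\<Sum>T\<in>\<T>. \<Sum>T'\<in>\<T>. \<Sum>i\<le>m. mean T u * (ip (sig T) (\<xi> T' i) / vol T' * \<theta> T' i x))"
      by (rule sum.swap)
    finally show ?thesis unfolding bubble_corr_def by (simp add: sum_distrib_left)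
  qed
  also have "bubble_corr u x = bubble_corr (quasi_interp u) x + bubble_corr (\<lambda>y. u y - quasi_interp u y) x"
    unfolding bubble_corr_def sum.distrib[symmetric]
    by (intro sum.cong refl) (simp add: L2_inner_diff_left[OF u qL xi_L2] diff_divide_distrib algebra_simps)
  finally show ?thesis by simp
qed

definition proj_L2_const :: real where "proj_L2_const = 2 * quasi_L2_const + 2 * bubble_const * (2 + 2 * quasi_L2_const)"

lemma P_L2_bound:
  assumes u: "u \<in> L2_space \<Omega>"
  shows "(L2_norm \<Omega> (P u))\<^sup>2 \<le> proj_L2_const * (L2_norm \<Omega> u)\<^sup>2"
proof -
  let ?w = "\<lambda>y. u y - quasi_interp u y"
  have qL: "quasi_interp u \<in> L2_space \<Omega>" using quasi_interp_H10 H10_space_L2 by blast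
  have wL: "?w \<in> L2_space \<Omega>" by (rule L2_space_diff[OF u qL])
  have "(L2_norm \<Omega> (P u))\<^sup>2 = (L2_norm \<Omega> (\<lambda>x. 1 * quasi_interp u x + 1 * bubble_corr ?w x))\<^sup>2"
  proof -
    have "P u = (\<lambda>x. 1 * quasi_interp u x + 1 * bubble_corr ?w x)" using P_decomp[OF u] by (intro ext) simp
    then show ?thesis by (rule arg_cong)
  qed
  also have "\<dots> \<le> 2 * 1\<^sup>2 * (L2_norm \<Omega> (quasi_interp u))\<^sup>2 + 2 * 1\<^sup>2 * (L2_norm \<Omega> (bubble_corr ?w))\<^sup>2"
    by (rule L2_norm_sq_lincomb_le[OF qL H10_space_L2[OF bubble_corr_H10]])
  finally have 1: "(L2_norm \<Omega> (P u))\<^sup>2 \<le> 2 * (L2_norm \<Omega> (quasi_interp u))\<^sup>2 + 2 * (L2_norm \<Omega> (bubble_corr ?w))\<^sup>2" by simp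
  have 2: "(L2_norm \<Omega> (bubble_corr ?w))\<^sup>2 \<le> bubble_const * (L2_norm \<Omega> ?w)\<^sup>2"
    using bubble_corr_bound[of 0, OF _ wL] sum_sq_mesh[OF wL] by (simp add: Hk_norm_def)
  have "(L2_norm \<Omega> ?w)\<^sup>2 = (L2_norm \<Omega> (\<lambda>x. 1 * u x + (-1) * quasi_interp u x))\<^sup>2" by simp
  also have "\<dots> \<le> 2 * 1\<^sup>2 * (L2_norm \<Omega> u)\<^sup>2 + 2 * (-1)\<^sup>2 * (L2_norm \<Omega> (quasi_interp u))\<^sup>2"
    by (rule L2_norm_sq_lincomb_le[OF u qL])
  finally have 3: "(L2_norm \<Omega> ?w)\<^sup>2 \<le> (2 + 2 * quasi_L2_const) * (L2_norm \<Omega> u)\<^sup>2"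
    using quasi_interp_L2_bound[OF u] by (simp add: distrib_right)
  have "bubble_const * (L2_norm \<Omega> ?w)\<^sup>2 \<le> bubble_const * ((2 + 2 * quasi_L2_const) * (L2_norm \<Omega> u)\<^sup>2)" by (rule mult_left_mono[OF 3 bubble_const_nonneg])
  then show ?thesis using 1 2 quasi_interp_L2_bound[OF u] by (simp add: proj_L2_const_def algebra_simps)
qed

text \<open>
  A mesh-dependent bound. It is only used to extend the uniform $H^1$ bound from smooth functions
  to their closure, where any constant will do.
\<close>

lemma P_H1_by_L2:
  "\<exists>K\<ge>0. \<forall>w\<in>L2_space \<Omega>. (H1_norm \<Omega> (P w))\<^sup>2 \<le> K * (L2_norm \<Omega> w)\<^sup>2"
proof -
  let ?I = "\<T> \<times> {..m}"
  have fI: "finite ?I" using finite_\<T> by simp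
  obtain K where K: "0 \<le> K" "\<And>c. (H1_norm \<Omega> (\<lambda>x. \<Sum>j\<in>?I. c j * psi \<Omega> \<gamma> \<T> m \<phi> \<xi> \<theta> (fst j) (snd j) x))\<^sup>2 \<le> K * (\<Sum>j\<in>?I. (c j)\<^sup>2)"
    using H1_norm_finite_sum[OF open_\<Omega> fI, of "\<lambda>j. psi \<Omega> \<gamma> \<T> m \<phi> \<xi> \<theta> (fst j) (snd j)" \<gamma>] psi_H10 by auto
  define M where "M = (\<Sum>j\<in>?I. (L2_norm \<Omega> (\<xi> (fst j) (snd j)))\<^sup>2 / (vol (fst j))\<^sup>2)"
  have M0: "0 \<le> M" by (simp add: M_def sum_nonneg)
  have "(H1_norm \<Omega> (P w))\<^sup>2 \<le> K * M * (L2_norm \<Omega> w)\<^sup>2" if w: "w \<in> L2_space \<Omega>" for w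
  proof -
    define c where "c j = ip w (\<xi> (fst j) (snd j)) / vol (fst j)" for j
    have "P w x = (\<Sum>j\<in>?I. c j * psi \<Omega> \<gamma> \<T> m \<phi> \<xi> \<theta> (fst j) (snd j) x)" for x
      unfolding P_eq sum.cartesian_product c_def by (simp add: case_prod_beta)
    then have "P w = (\<lambda>x. \<Sum>j\<in>?I. c j * psi \<Omega> \<gamma> \<T> m \<phi> \<xi> \<theta> (fst j) (snd j) x)" by (rule ext)
    then have "(H1_norm \<Omega> (P w))\<^sup>2 \<le> K * (\<Sum>j\<in>?I. (c j)\<^sup>2)" using K(2)[of c] by simp
    also have "(\<Sum>j\<in>?I. (c j)\<^sup>2) \<le> (\<Sum>j\<in>?I. (L2_norm \<Omega> (\<xi> (fst j) (snd j)))\<^sup>2 / (vol (fst j))\<^sup>2 * (L2_norm \<Omega> w)\<^sup>2)"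
    proof (rule sum_mono)
      fix j assume "j \<in> ?I"
      then have j: "fst j \<in> \<T>" "snd j \<le> m" by auto
      have "(ip w (\<xi> (fst j) (snd j)))\<^sup>2 \<le> (L2_norm \<Omega> w)\<^sup>2 * (L2_norm \<Omega> (\<xi> (fst j) (snd j)))\<^sup>2"
        by (rule L2_Cauchy_Schwarz[OF w xi_L2[OF j]])
      then have "(c j)\<^sup>2 \<le> ((L2_norm \<Omega> w)\<^sup>2 * (L2_norm \<Omega> (\<xi> (fst j) (snd j)))\<^sup>2) / (vol (fst j))\<^sup>2"
        unfolding c_def power_divide by (rule divide_right_mono) simp
      then show "(c j)\<^sup>2 \<le> (L2_norm \<Omega> (\<xi> (fst j) (snd j)))\<^sup>2 / (vol (fst j))\<^sup>2 * (L2_norm \<Omega> w)\<^sup>2" by (simp add: mult_ac)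
    qed
    also have "\<dots> = M * (L2_norm \<Omega> w)\<^sup>2" by (simp add: M_def sum_distrib_right)
    finally show ?thesis using K(1) by (simp add: mult.assoc mult_left_mono)
  qed
  then show ?thesis using K(1) M0 by (intro exI[of _ "K * M"]) simp
qed

lemma mesh_size_inverse:
  assumes T: "T \<in> \<T>"
  shows "inverse (mesh_size T) \<le> \<kappa> / root DIM('a) \<omega> * (1 / diameter T)" "0 < mesh_size T"
proof -
  have D: "0 < diameter T" using mesh_diameter_pos[OF T] .
  have r0: "0 < root DIM('a) \<omega>" using \<omega>_pos by simp
  have "root DIM('a) \<omega> * (diameter T / \<kappa>) = root DIM('a) (\<omega> * (diameter T / \<kappa>) ^ DIM('a))"
    using D \<kappa> by (simp add: real_root_mult real_root_power_cancel)
  also have "\<dots> \<le> mesh_size T" unfolding mesh_size_def by (rule real_root_le_mono[OF DIM_positive mesh_vol_ge[OF T]])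
  finally have le: "root DIM('a) \<omega> * (diameter T / \<kappa>) \<le> mesh_size T" .
  moreover have p: "0 < root DIM('a) \<omega> * (diameter T / \<kappa>)" using r0 D \<kappa> by simp
  ultimately show "0 < mesh_size T" by linarith
  have "inverse (mesh_size T) \<le> inverse (root DIM('a) \<omega> * (diameter T / \<kappa>))" by (rule le_imp_inverse_le[OF le p])
  also have "\<dots> = \<kappa> / root DIM('a) \<omega> * (1 / diameter T)" by (simp add: field_simps)
  finally show "inverse (mesh_size T) \<le> \<kappa> / root DIM('a) \<omega> * (1 / diameter T)" .
qed


definition proj_H1_const :: real where
  "proj_H1_const = 2 * quasi_H1_const + 2 * (bubble_const * ((\<kappa> / root DIM('a) \<omega>)\<^sup>2 * (quasi_error_const * (real (DIM('a) + 1) * real star_card_bound))))"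

lemma proj_H1_const_nonneg: "0 \<le> proj_H1_const"
  using quasi_consts_nonneg bubble_const_nonneg by (simp add: proj_H1_const_def)

text \<open>
  The factor $h_T^{-1}$ lost by the bubble correction is regained from the approximation property
  of the quasi-interpolant.
\<close>

lemma P_H1_smooth:
  assumes v: "v \<in> H1_space \<Omega>" "smooth_on \<Omega> v" "vanishes_at \<Omega> \<gamma> v"
  shows "(H1_norm \<Omega> (P v))\<^sup>2 \<le> proj_H1_const * (H1_norm \<Omega> v)\<^sup>2"
proof -
  interpret N: nodal_mesh_fun \<Omega> \<T> \<kappa> \<gamma> \<F> \<phi> v
    using facets \<gamma> by unfold_locales (use v smooth_on_Ck[OF v(2), of 1] in auto)
  let ?w = "\<lambda>y. v y - quasi_interp v y" and ?q = "(\<kappa> / root DIM('a) \<omega>)\<^sup>2"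
  have qL: "quasi_interp v \<in> L2_space \<Omega>" using quasi_interp_H10 H10_space_L2 by blast
  have wL: "?w \<in> L2_space \<Omega>" by (rule L2_space_diff[OF N.vL2 qL])
  have "P v = (\<lambda>x. 1 * quasi_interp v x + 1 * bubble_corr ?w x)" using P_decomp[OF N.vL2] by (intro ext) simp
  then have "(H1_norm \<Omega> (P v))\<^sup>2 = (H1_norm \<Omega> (\<lambda>x. 1 * quasi_interp v x + 1 * bubble_corr ?w x))\<^sup>2" by simp
  also have "\<dots> \<le> 2 * 1\<^sup>2 * (H1_norm \<Omega> (quasi_interp v))\<^sup>2 + 2 * 1\<^sup>2 * (H1_norm \<Omega> (bubble_corr ?w))\<^sup>2"
    by (rule H1_norm_sq_lincomb_le[OF open_\<Omega> H10_space_H1[OF quasi_interp_H10] H10_space_H1[OF bubble_corr_H10]])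
  finally have 1: "(H1_norm \<Omega> (P v))\<^sup>2 \<le> 2 * (H1_norm \<Omega> (quasi_interp v))\<^sup>2 + 2 * (H1_norm \<Omega> (bubble_corr ?w))\<^sup>2" by simp
  have "(H1_norm \<Omega> (bubble_corr ?w))\<^sup>2 \<le> bubble_const * (\<Sum>T\<in>\<T>. inverse (mesh_size T) ^ 2 * (L2_norm T ?w)\<^sup>2)"
    using bubble_corr_bound[of 1, OF _ wL] by (simp add: Hk_norm_def)
  also have "\<dots> \<le> bubble_const * (\<Sum>T\<in>\<T>. ?q * ((1 / diameter T)\<^sup>2 * (L2_norm T ?w)\<^sup>2))"
  proof (intro mult_left_mono sum_mono bubble_const_nonneg)
    fix T assume T: "T \<in> \<T>"
    have "inverse (mesh_size T) ^ 2 \<le> (\<kappa> / root DIM('a) \<omega> * (1 / diameter T))\<^sup>2"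
      using mesh_size_inverse[OF T] by (intro power_mono) auto
    then have "inverse (mesh_size T) ^ 2 * (L2_norm T ?w)\<^sup>2 \<le> (\<kappa> / root DIM('a) \<omega> * (1 / diameter T))\<^sup>2 * (L2_norm T ?w)\<^sup>2"
      by (rule mult_right_mono) simp
    then show "inverse (mesh_size T) ^ 2 * (L2_norm T ?w)\<^sup>2 \<le> ?q * ((1 / diameter T)\<^sup>2 * (L2_norm T ?w)\<^sup>2)"
      by (simp only: power_mult_distrib mult.assoc)
  qed
  also have "\<dots> = bubble_const * (?q * (\<Sum>T\<in>\<T>. (1 / diameter T)\<^sup>2 * (L2_norm T ?w)\<^sup>2))" by (simp only: sum_distrib_left)
  also have "\<dots> \<le> bubble_const * (?q * (quasi_error_const * (real (DIM('a) + 1) * real star_card_bound * (H1_norm \<Omega> v)\<^sup>2)))"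
    by (intro mult_left_mono N.quasi_interp_weighted_error bubble_const_nonneg) simp
  finally have "(H1_norm \<Omega> (bubble_corr ?w))\<^sup>2 \<le> bubble_const * (?q * (quasi_error_const * (real (DIM('a) + 1) * real star_card_bound * (H1_norm \<Omega> v)\<^sup>2)))" .
  then show ?thesis using 1 N.quasi_interp_H1_bound by (simp add: proj_H1_const_def algebra_simps)
qed

text \<open>
  Approximate \<open>u\<close> by a smooth \<open>v\<close> up to $\varepsilon$ and treat $P(u - v)$ with \<open>P_H1_by_L2\<close>; the
  mesh-dependent constant comes with $\varepsilon^2$ and disappears in the limit.
\<close>

lemma P_H1_bound:
  assumes u: "u \<in> H10_space \<Omega> \<gamma>"
  shows "(H1_norm \<Omega> (P u))\<^sup>2 \<le> 4 * proj_H1_const * (H1_norm \<Omega> u)\<^sup>2"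
proof -
  obtain K where K: "0 \<le> K" "\<And>w. w \<in> L2_space \<Omega> \<Longrightarrow> (H1_norm \<Omega> (P w))\<^sup>2 \<le> K * (L2_norm \<Omega> w)\<^sup>2"
    using P_H1_by_L2 by blast
  note u1 = H10_space_H1[OF u]
  have main: "(H1_norm \<Omega> (P u))\<^sup>2 \<le> 4 * proj_H1_const * (H1_norm \<Omega> u)\<^sup>2 + (4 * proj_H1_const + 2 * K) * \<epsilon>\<^sup>2" if \<epsilon>: "0 < \<epsilon>" for \<epsilon>
  proof -
    obtain v where v: "v \<in> H1_space \<Omega>" "smooth_on \<Omega> v" "vanishes_at \<Omega> \<gamma> v" "H1_norm \<Omega> (\<lambda>x. u x - v x) < \<epsilon>"
      using u \<epsilon> unfolding H10_space_def by blast
    let ?w = "\<lambda>x. u x - v x"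
    have w1: "?w \<in> H1_space \<Omega>" using H1_space_lincomb[OF open_\<Omega> u1 v(1), of 1 "-1"] by simp
    have w\<epsilon>: "(H1_norm \<Omega> ?w)\<^sup>2 \<le> \<epsilon>\<^sup>2" using v(4) by (intro power_mono) auto
    have "(L2_norm \<Omega> ?w)\<^sup>2 \<le> (H1_norm \<Omega> ?w)\<^sup>2" unfolding H1_norm_sq by (simp add: sum_nonneg)
    then have wL: "(L2_norm \<Omega> ?w)\<^sup>2 \<le> \<epsilon>\<^sup>2" using w\<epsilon> by linarith
    have "P (\<lambda>x. 1 * v x + 1 * ?w x) x = 1 * P v x + 1 * P ?w x" for x
      by (rule P_lincomb[OF H1_space_L2[OF v(1)] H1_space_L2[OF w1]])
    then have Pu: "P u = (\<lambda>x. 1 * P v x + 1 * P ?w x)" by (simp add: fun_eq_iff)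
    have "(H1_norm \<Omega> (P u))\<^sup>2 \<le> 2 * 1\<^sup>2 * (H1_norm \<Omega> (P v))\<^sup>2 + 2 * 1\<^sup>2 * (H1_norm \<Omega> (P ?w))\<^sup>2"
      unfolding Pu by (rule H1_norm_sq_lincomb_le[OF open_\<Omega> H10_space_H1[OF P_H10] H10_space_H1[OF P_H10]])
    then have 1: "(H1_norm \<Omega> (P u))\<^sup>2 \<le> 2 * (H1_norm \<Omega> (P v))\<^sup>2 + 2 * (H1_norm \<Omega> (P ?w))\<^sup>2" by simp
    have "(H1_norm \<Omega> v)\<^sup>2 = (H1_norm \<Omega> (\<lambda>x. 1 * u x + (-1) * ?w x))\<^sup>2" by simp
    also have "\<dots> \<le> 2 * 1\<^sup>2 * (H1_norm \<Omega> u)\<^sup>2 + 2 * (-1)\<^sup>2 * (H1_norm \<Omega> ?w)\<^sup>2"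
      by (rule H1_norm_sq_lincomb_le[OF open_\<Omega> u1 w1])
    finally have "(H1_norm \<Omega> v)\<^sup>2 \<le> 2 * (H1_norm \<Omega> u)\<^sup>2 + 2 * \<epsilon>\<^sup>2" using w\<epsilon> by simp
    then have "proj_H1_const * (H1_norm \<Omega> v)\<^sup>2 \<le> proj_H1_const * (2 * (H1_norm \<Omega> u)\<^sup>2 + 2 * \<epsilon>\<^sup>2)" by (rule mult_left_mono[OF _ proj_H1_const_nonneg])
    then have 2: "(H1_norm \<Omega> (P v))\<^sup>2 \<le> proj_H1_const * (2 * (H1_norm \<Omega> u)\<^sup>2 + 2 * \<epsilon>\<^sup>2)" using P_H1_smooth[OF v(1-3)] by linarith
    have 3: "(H1_norm \<Omega> (P ?w))\<^sup>2 \<le> K * \<epsilon>\<^sup>2"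
      using K(2)[OF H1_space_L2[OF w1]] mult_left_mono[OF wL K(1)] by linarith
    have "2 * (proj_H1_const * (2 * (H1_norm \<Omega> u)\<^sup>2 + 2 * \<epsilon>\<^sup>2)) + 2 * (K * \<epsilon>\<^sup>2) = 4 * proj_H1_const * (H1_norm \<Omega> u)\<^sup>2 + (4 * proj_H1_const + 2 * K) * \<epsilon>\<^sup>2"
      by (simp add: algebra_simps)
    then show ?thesis using 1 2 3 by linarith
  qed
  show ?thesis
  proof (rule field_le_epsilon)
    fix e :: real assume e: "0 < e"
    define q where "q = 4 * proj_H1_const + 2 * K + 1"
    have q: "0 < q" using proj_H1_const_nonneg K(1) by (simp add: q_def)
    define \<epsilon> where "\<epsilon> = sqrt (e / q)"
    have \<epsilon>: "0 < \<epsilon>" "q * \<epsilon>\<^sup>2 = e" using e q by (auto simp: \<epsilon>_def)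
    have "(4 * proj_H1_const + 2 * K) * \<epsilon>\<^sup>2 \<le> q * \<epsilon>\<^sup>2" by (rule mult_right_mono) (simp_all add: q_def)
    then show "(H1_norm \<Omega> (P u))\<^sup>2 \<le> 4 * proj_H1_const * (H1_norm \<Omega> u)\<^sup>2 + e" using main[OF \<epsilon>(1)] \<epsilon>(2) by linarith
  qed
qed

end

section \<open>Piecewise polynomials\<close>

definition multi_indices :: "nat \<Rightarrow> ('a::euclidean_space \<Rightarrow> nat) set" where
  "multi_indices n = {\<alpha> \<in> Basis \<rightarrow>\<^sub>E (UNIV :: nat set). (\<Sum>b\<in>Basis. \<alpha> b) \<le> n}"

definition monomial :: "('a::euclidean_space \<Rightarrow> nat) \<Rightarrow> 'a \<Rightarrow> real" where
  "monomial \<alpha> x = (\<Prod>b\<in>Basis. (x \<bullet> b) ^ \<alpha> b)"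

lemma poly_space_iff: "q \<in> poly_space n \<longleftrightarrow> (\<exists>c. q = (\<lambda>x. \<Sum>\<alpha>\<in>multi_indices n. c \<alpha> * monomial \<alpha> x))"
  by (simp add: poly_space_def multi_indices_def monomial_def fun_eq_iff)

lemma finite_multi_indices: "finite (multi_indices n :: ('a::euclidean_space \<Rightarrow> nat) set)"
proof (rule finite_subset)
  show "(multi_indices n :: ('a \<Rightarrow> nat) set) \<subseteq> Basis \<rightarrow>\<^sub>E {..n}"
  proof
    fix \<alpha> :: "'a \<Rightarrow> nat" assume a: "\<alpha> \<in> multi_indices n"
    have "\<alpha> b \<le> n" if "b \<in> Basis" for b
    proof -
      have "\<alpha> b \<le> (\<Sum>b\<in>Basis. \<alpha> b)" using that by (intro member_le_sum) auto
      then show ?thesis using a by (simp add: multi_indices_def)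
    qed
    then show "\<alpha> \<in> Basis \<rightarrow>\<^sub>E {..n}" using a by (auto simp: multi_indices_def PiE_iff)
  qed
  show "finite (Basis \<rightarrow>\<^sub>E {..n} :: ('a \<Rightarrow> nat) set)" by (rule finite_PiE) auto
qed

lemma monomial_poly_space: "\<alpha> \<in> multi_indices n \<Longrightarrow> monomial \<alpha> \<in> poly_space n"
  unfolding poly_space_iff
proof (intro exI ext)
  fix x :: 'a assume \<alpha>: "\<alpha> \<in> multi_indices n"
  have "(\<Sum>\<beta>\<in>multi_indices n. (if \<beta> = \<alpha> then 1 else 0) * monomial \<beta> x)
      = (\<Sum>\<beta>\<in>multi_indices n. if \<beta> = \<alpha> then monomial \<beta> x else 0)"
    by (rule sum.cong) auto
  also have "\<dots> = monomial \<alpha> x"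
    using \<alpha> by (simp add: finite_multi_indices)
  finally show "monomial \<alpha> x = (\<Sum>\<beta>\<in>multi_indices n. (if \<beta> = \<alpha> then 1 else 0) * monomial \<beta> x)" by (rule sym)
qed

lemma poly_space_lincomb:
  assumes "p \<in> poly_space n" "q \<in> poly_space n"
  shows "(\<lambda>x. a * p x + b * q x) \<in> poly_space n"
proof -
  obtain c d where c: "p = (\<lambda>x. \<Sum>\<alpha>\<in>multi_indices n. c \<alpha> * monomial \<alpha> x)"
    and d: "q = (\<lambda>x. \<Sum>\<alpha>\<in>multi_indices n. d \<alpha> * monomial \<alpha> x)" using assms unfolding poly_space_iff by blast
  show ?thesis unfolding poly_space_iff
    by (rule exI[of _ "\<lambda>\<alpha>. a * c \<alpha> + b * d \<alpha>"])
      (simp add: c d distrib_right sum.distrib sum_distrib_left mult.assoc)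
qed

lemma poly_space_zero: "(\<lambda>x. 0) \<in> poly_space n"
  unfolding poly_space_iff by (rule exI[of _ "\<lambda>_. 0"]) simp

lemma poly_space_sum:
  "finite I \<Longrightarrow> (\<And>i. i \<in> I \<Longrightarrow> f i \<in> poly_space n) \<Longrightarrow> (\<lambda>x. \<Sum>i\<in>I. c i * f i x) \<in> poly_space n"
proof (induction I rule: finite_induct)
  case empty
  then show ?case by (simp add: poly_space_zero)
next
  case (insert j I)
  have "(\<lambda>x. c j * f j x + 1 * (\<Sum>i\<in>I. c i * f i x)) \<in> poly_space n"
    by (rule poly_space_lincomb) (use insert in auto)
  then show ?case using insert.hyps by simp
qed

lemma poly_space_mono: assumes "p \<in> poly_space n" "n \<le> k" shows "p \<in> poly_space k"
proof -
  obtain c where c: "p = (\<lambda>x. \<Sum>\<alpha>\<in>multi_indices n. c \<alpha> * monomial \<alpha> x)" using assms(1) unfolding poly_space_iff by blast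
  show ?thesis unfolding c
    by (rule poly_space_sum[OF finite_multi_indices], rule monomial_poly_space) (use assms(2) in \<open>auto simp: multi_indices_def\<close>)
qed

lemma poly_space_mult_coord:
  assumes "p \<in> poly_space n" "b \<in> Basis"
  shows "(\<lambda>x. p x * (x \<bullet> b)) \<in> poly_space (Suc n)"
proof -
  obtain c where c: "p = (\<lambda>x. \<Sum>\<alpha>\<in>multi_indices n. c \<alpha> * monomial \<alpha> x)" using assms(1) unfolding poly_space_iff by blast
  have m: "(\<lambda>x. monomial \<alpha> x * (x \<bullet> b)) \<in> poly_space (Suc n)" if \<alpha>: "\<alpha> \<in> multi_indices n" for \<alpha>
  proof -
    let ?\<beta> = "\<alpha>(b := Suc (\<alpha> b))"
    have "monomial \<alpha> x * (x \<bullet> b) = monomial ?\<beta> x" for x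
    proof -
      have "monomial ?\<beta> x = (x \<bullet> b) ^ Suc (\<alpha> b) * (\<Prod>d\<in>Basis - {b}. (x \<bullet> d) ^ ?\<beta> d)"
        unfolding monomial_def using assms(2) by (subst prod.remove[of Basis b]) auto
      also have "(\<Prod>d\<in>Basis - {b}. (x \<bullet> d) ^ ?\<beta> d) = (\<Prod>d\<in>Basis - {b}. (x \<bullet> d) ^ \<alpha> d)"
        by (rule prod.cong) auto
      also have "(x \<bullet> b) ^ Suc (\<alpha> b) * \<dots> = ((x \<bullet> b) ^ \<alpha> b * (\<Prod>d\<in>Basis - {b}. (x \<bullet> d) ^ \<alpha> d)) * (x \<bullet> b)" by simp
      also have "(x \<bullet> b) ^ \<alpha> b * (\<Prod>d\<in>Basis - {b}. (x \<bullet> d) ^ \<alpha> d) = monomial \<alpha> x"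
        unfolding monomial_def using assms(2) by (subst prod.remove[of Basis b]) auto
      finally show ?thesis by (rule sym)
    qed
    then have "(\<lambda>x. monomial \<alpha> x * (x \<bullet> b)) = monomial ?\<beta>" by (rule ext)
    moreover have "?\<beta> \<in> multi_indices (Suc n)"
    proof -
      have "(\<Sum>d\<in>Basis. ?\<beta> d) = Suc (\<alpha> b) + (\<Sum>d\<in>Basis - {b}. ?\<beta> d)" using assms(2) by (simp add: sum.remove)
      also have "(\<Sum>d\<in>Basis - {b}. ?\<beta> d) = (\<Sum>d\<in>Basis - {b}. \<alpha> d)" by (rule sum.cong) auto
      also have "Suc (\<alpha> b) + \<dots> = Suc (\<Sum>d\<in>Basis. \<alpha> d)" using assms(2) by (simp add: sum.remove[of Basis b])
      finally have "(\<Sum>d\<in>Basis. ?\<beta> d) \<le> Suc n" using \<alpha> by (simp add: multi_indices_def)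
      moreover have "?\<beta> \<in> Basis \<rightarrow>\<^sub>E UNIV" using \<alpha> assms(2) by (auto simp: multi_indices_def PiE_iff extensional_def)
      ultimately show ?thesis by (simp add: multi_indices_def)
    qed
    ultimately show ?thesis using monomial_poly_space by metis
  qed
  have "(\<lambda>x. p x * (x \<bullet> b)) = (\<lambda>x. \<Sum>\<alpha>\<in>multi_indices n. c \<alpha> * (monomial \<alpha> x * (x \<bullet> b)))"
    unfolding c by (simp add: sum_distrib_right mult.assoc)
  also have "\<dots> \<in> poly_space (Suc n)" by (rule poly_space_sum[OF finite_multi_indices m])
  finally show ?thesis .
qed

lemma poly_space_mult_affine:
  assumes p: "p \<in> poly_space n"
  shows "(\<lambda>x. p x * (a \<bullet> x + \<beta>)) \<in> poly_space (Suc n)"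
proof -
  have "(\<lambda>x. 1 * (\<Sum>b\<in>Basis. (a \<bullet> b) * (p x * (x \<bullet> b))) + \<beta> * p x) \<in> poly_space (Suc n)"
    by (rule poly_space_lincomb[OF poly_space_sum[OF finite_Basis poly_space_mult_coord[OF p]] poly_space_mono[OF p]]) auto
  moreover have "1 * (\<Sum>b\<in>Basis. (a \<bullet> b) * (p x * (x \<bullet> b))) + \<beta> * p x = p x * (a \<bullet> x + \<beta>)" for x
  proof -
    have "(\<Sum>b\<in>Basis. (a \<bullet> b) * (p x * (x \<bullet> b))) = p x * (\<Sum>b\<in>Basis. (a \<bullet> b) * (x \<bullet> b))"
      by (simp add: sum_distrib_left mult_ac)
    then show ?thesis by (simp add: euclidean_inner[of a x] algebra_simps)
  qed
  ultimately show ?thesis by simp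
qed

lemma poly_space_mult_affine_power:
  assumes p: "p \<in> poly_space n"
  shows "(\<lambda>x. p x * (a \<bullet> x + \<beta>) ^ k) \<in> poly_space (n + k)"
proof (induction k)
  case 0 then show ?case using p by simp
next
  case (Suc k)
  then show ?case using poly_space_mult_affine[OF Suc, of a \<beta>] by (simp add: mult_ac)
qed

lemma poly_space_one: "(\<lambda>x::'a::euclidean_space. 1) \<in> poly_space 0"
proof -
  let ?z = "\<lambda>b::'a. if b \<in> Basis then 0 else undefined :: nat"
  have "?z \<in> multi_indices 0" by (auto simp: multi_indices_def PiE_iff extensional_def)
  then have "(\<lambda>x. monomial ?z x) \<in> poly_space 0" by (rule monomial_poly_space)
  moreover have "(\<lambda>x. monomial ?z x) = (\<lambda>x::'a. 1)"
    by (rule ext) (simp add: monomial_def)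
  ultimately show ?thesis by simp
qed

lemma poly_space_prod_affine:
  assumes "finite B"
  shows "(\<lambda>x. \<Prod>b\<in>B. (a b \<bullet> x + \<beta> b) ^ \<alpha> b) \<in> poly_space (\<Sum>b\<in>B. \<alpha> b)"
  using assms
proof (induction B rule: finite_induct)
  case empty then show ?case by (simp add: poly_space_one)
next
  case (insert b B)
  then show ?case using poly_space_mult_affine_power[OF insert.IH, of "a b" "\<beta> b" "\<alpha> b"] by (simp add: mult.commute add.commute)
qed

text \<open>
  A monomial composed with an affine map is a product of powers of affine functions, and multiplying
  by an affine function raises the degree by at most one.
\<close>

lemma poly_space_affine_comp:
  fixes L :: "'a::euclidean_space \<Rightarrow> 'a"
  assumes q: "q \<in> poly_space n" and L: "linear L"
  shows "(\<lambda>x. q (L x + a)) \<in> poly_space n"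
proof -
  obtain c where c: "q = (\<lambda>x. \<Sum>\<alpha>\<in>multi_indices n. c \<alpha> * monomial \<alpha> x)" using q unfolding poly_space_iff by blast
  have m: "(\<lambda>x. monomial \<alpha> (L x + a)) \<in> poly_space n" if \<alpha>: "\<alpha> \<in> multi_indices n" for \<alpha>
  proof -
    have "(L x + a) \<bullet> b = adjoint L b \<bullet> x + a \<bullet> b" for x b
      using adjoint_works[OF L, of x b] by (simp add: inner_add_left inner_commute[of _ x])
    then have "(\<lambda>x. monomial \<alpha> (L x + a)) = (\<lambda>x. \<Prod>b\<in>Basis. (adjoint L b \<bullet> x + a \<bullet> b) ^ \<alpha> b)"
      by (simp add: monomial_def)
    also have "\<dots> \<in> poly_space (\<Sum>b\<in>Basis. \<alpha> b)" by (rule poly_space_prod_affine) simp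
    finally show ?thesis by (rule poly_space_mono) (use \<alpha> in \<open>simp add: multi_indices_def\<close>)
  qed
  show ?thesis unfolding c by (rule poly_space_sum[OF finite_multi_indices m])
qed

lemma poly_space_continuous: "q \<in> poly_space n \<Longrightarrow> continuous_on UNIV q"
proof -
  assume "q \<in> poly_space n"
  then obtain c where c: "q = (\<lambda>x. \<Sum>\<alpha>\<in>multi_indices n. c \<alpha> * monomial \<alpha> x)" unfolding poly_space_iff by blast
  show ?thesis unfolding c monomial_def
    by (intro continuous_on_sum continuous_on_mult_left continuous_on_prod continuous_on_power continuous_on_inner
        continuous_on_id continuous_on_const)
qed

text \<open>
  The lifted bases are given by \<open>L\<close> and a shift, without saying that \<open>L\<close> is invertible; this
  follows as the image of an element has interior points.
\<close>

lemma linear_inverse_of_open_image: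
  fixes L :: "'a::euclidean_space \<Rightarrow> 'a"
  assumes L: "linear L" and im: "(\<lambda>x. L x + a) ` T = U" and U: "open U" "U \<noteq> {}"
  obtains g where "linear g" "\<And>x. g (L x) = x"
proof -
  have "(\<lambda>y. y - a) ` U \<subseteq> range L" using im by force
  moreover have "open ((\<lambda>y. y - a) ` U)" using open_translation[OF U(1), of "- a"] by (simp add: image_def add.commute)
  ultimately have "(\<lambda>y. y - a) ` U \<subseteq> interior (range L)" by (rule interior_maximal)
  then have "interior (range L) \<noteq> {}" using U(2) by auto
  then have "\<not> dim (range L) < DIM('a)" using empty_interior_lowdim by blast
  then have "dim (range L) = DIM('a)" using dim_subset_UNIV[of "range L"] by linarith
  then have full: "span (range L) = UNIV" by (rule dim_eq_full[THEN iffD1])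
  have "subspace (range L)" by (rule linear_subspace_image[OF L subspace_UNIV])
  then have "span (range L) = range L" by (rule span_eq_iff[THEN iffD2])
  then have "range L = span (range L)" by (rule sym)
  also note full
  finally have "surj L" .
  then have "inj L" by (rule linear_surjective_imp_injective[OF L]) (rule refl)
  then obtain g where "linear g" "g \<circ> L = id" using linear_injective_left_inverse[OF L] by blast
  then show ?thesis using that by (metis comp_apply id_apply)
qed

lemma truncated_continuous_L2:
  fixes f :: "'a::euclidean_space \<Rightarrow> real"
  assumes T: "open T" "bounded T" "T \<subseteq> \<Omega>" and \<Omega>: "\<Omega> \<in> sets lebesgue" and f: "continuous_on UNIV f"
  shows "(\<lambda>x. if x \<in> T then f x else 0) \<in> L2_space \<Omega>"
proof -
  have fm: "f \<in> borel_measurable lebesgue" using f by (rule continuous_imp_measurable_lebesgue)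
  have c: "compact (closure T)" using T(2) by (simp add: compact_closure)
  have "integrable lborel (\<lambda>x. indicator (closure T) x *\<^sub>R (f x)\<^sup>2)"
    using c f by (intro borel_integrable_compact continuous_on_power) (auto intro: continuous_on_subset)
  then have "integrable lebesgue (\<lambda>x. indicator (closure T) x *\<^sub>R (f x)\<^sup>2)"
    by (subst integrable_completion) (rule borel_measurable_integrable)
  then have "integrable lebesgue (\<lambda>x. indicator (T \<inter> \<Omega>) x *\<^sub>R (indicator (closure T) x *\<^sub>R (f x)\<^sup>2))"
    by (rule integrable_mult_indicator[rotated]) (use T(1) \<Omega> in \<open>simp add: sets.Int\<close>)
  moreover have "(\<lambda>x. indicator (T \<inter> \<Omega>) x *\<^sub>R (indicator (closure T) x *\<^sub>R (f x)\<^sup>2)) = (\<lambda>x. indicator \<Omega> x *\<^sub>R (if x \<in> T then f x else 0)\<^sup>2)"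
    using closure_subset[of T] by (intro ext) (auto simp: indicator_def)
  ultimately have "integrable lebesgue (\<lambda>x. indicator \<Omega> x *\<^sub>R (if x \<in> T then f x else 0)\<^sup>2)" by (rule back_subst)
  then have "integrable (lebesgue_on \<Omega>) (\<lambda>x. (if x \<in> T then f x else 0)\<^sup>2)" using \<Omega> by (simp add: integrable_restrict_space)
  moreover have "(\<lambda>x. if x \<in> T then f x else 0) \<in> borel_measurable lebesgue"
    by (rule borel_measurable_if_I[OF measurable_restrict_space1[OF fm]]) (use T(1) in simp)
  then have "(\<lambda>x. if x \<in> T then f x else 0) \<in> borel_measurable (lebesgue_on \<Omega>)" by (rule measurable_restrict_space1)
  ultimately show ?thesis by (simp add: L2_space_def)
qed

text \<open>
  Piecewise polynomials have arbitrary values outside the elements; such functions are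
  nevertheless measurable because Lebesgue measure is complete.
\<close>

lemma measurable_lebesgue_on_modify_null:
  fixes v v' :: "'a::euclidean_space \<Rightarrow> real"
  assumes S: "S \<in> sets lebesgue" and v': "v' \<in> borel_measurable (lebesgue_on S)" and N: "N \<in> null_sets lebesgue"
    and eq: "\<And>x. x \<in> S - N \<Longrightarrow> v x = v' x"
  shows "v \<in> borel_measurable (lebesgue_on S)"
proof (rule measurableI)
  fix A :: "real set" assume A: "A \<in> sets borel"
  have "v' -` A \<inter> S \<in> sets (lebesgue_on S)" using measurable_sets[OF v' A] by simp
  then have 1: "v' -` A \<inter> S \<in> sets lebesgue" using S by (simp add: sets_restrict_space_iff)
  have 2: "v -` A \<inter> S \<inter> N \<in> sets lebesgue"
    by (rule null_setsD2, rule null_sets_completion_subset[OF _ N]) blast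
  have "v -` A \<inter> S = (v' -` A \<inter> S - N) \<union> (v -` A \<inter> S \<inter> N)" using eq by auto
  also have "\<dots> \<in> sets lebesgue" using 1 2 N by (intro sets.Un sets.Diff) auto
  finally show "v -` A \<inter> space (lebesgue_on S) \<in> sets (lebesgue_on S)" using S by (simp add: sets_restrict_space_iff)
qed simp

text \<open>
  The elementwise spans of the \<open>\<xi>\<close> are exactly the polynomials of degree \<open>l\<close>.
\<close>

locale dg_mesh = bubble_mesh \<Omega> \<T> \<kappa> \<gamma> \<F> \<phi> m \<xi> \<theta> Cx Cb Cs
  for \<Omega> :: "'a::euclidean_space set" and \<T> \<kappa> \<gamma> \<F> \<phi> m \<xi> \<theta> Cx Cb Cs +
  fixes l :: nat
  assumes xi_dg: "\<And>T i. T \<in> \<T> \<Longrightarrow> i \<le> m \<Longrightarrow> \<xi> T i \<in> dg_space l \<T>"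
    and dg_xi: "\<And>T q. T \<in> \<T> \<Longrightarrow> q \<in> poly_space l \<Longrightarrow> \<exists>c. \<forall>x\<in>T. q x = (\<Sum>i\<le>m. c i * \<xi> T i x)"
begin

lemma orthogonal_dg_iff:
  assumes w: "w \<in> L2_space \<Omega>"
  shows "(\<forall>v\<in>dg_space l \<T>. ip w v = 0) \<longleftrightarrow> (\<forall>T\<in>\<T>. \<forall>i\<le>m. ip w (\<xi> T i) = 0)"
proof
  assume "\<forall>v\<in>dg_space l \<T>. ip w v = 0"
  then show "\<forall>T\<in>\<T>. \<forall>i\<le>m. ip w (\<xi> T i) = 0" using xi_dg by blast
next
  assume z: "\<forall>T\<in>\<T>. \<forall>i\<le>m. ip w (\<xi> T i) = 0"
  show "\<forall>v\<in>dg_space l \<T>. ip w v = 0"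
  proof
    fix v assume v: "v \<in> dg_space l \<T>"
    have "\<forall>T. \<exists>c. T \<in> \<T> \<longrightarrow> (\<forall>x\<in>T. v x = (\<Sum>i\<le>m. c i * \<xi> T i x))"
    proof
      fix T
      show "\<exists>c. T \<in> \<T> \<longrightarrow> (\<forall>x\<in>T. v x = (\<Sum>i\<le>m. c i * \<xi> T i x))"
      proof (cases "T \<in> \<T>")
        case True
        then obtain q where q: "q \<in> poly_space l" "\<forall>x\<in>T. v x = q x" using v by (auto simp: dg_space_def)
        obtain c where "\<forall>x\<in>T. q x = (\<Sum>i\<le>m. c i * \<xi> T i x)" using dg_xi[OF True q(1)] by blast
        then show ?thesis using q(2) by auto
      qed simp
    qed
    then obtain c where c: "\<And>T x. T \<in> \<T> \<Longrightarrow> x \<in> T \<Longrightarrow> v x = (\<Sum>i\<le>m. c T i * \<xi> T i x)" by metis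
    define v' where "v' x = (\<Sum>T\<in>\<T>. \<Sum>i\<le>m. c T i * \<xi> T i x)" for x
    have v'L: "v' \<in> L2_space \<Omega>"
      unfolding v'_def[abs_def]
      by (rule L2_space_sum[OF finite_\<T>], rule L2_space_sum, simp, rule L2_space_cmult, rule xi_L2) auto
    have eq: "v x = v' x" if x: "x \<in> \<Omega> - (\<Omega> - \<Union>\<T>)" for x
    proof -
      obtain X where X: "X \<in> \<T>" "x \<in> X" using x by blast
      have "(\<Sum>i\<le>m. c T i * \<xi> T i x) = (if T = X then v x else 0)" if T: "T \<in> \<T>" for T
      proof (cases "T = X")
        case False
        then have "x \<notin> T" using mesh_disjoint[OF T X(1)] X(2) by blast
        then show ?thesis using False xi_out[OF T] by (simp add: sum.neutral)
      qed (use c[OF X] in simp)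
      then have "v' x = (\<Sum>T\<in>\<T>. if T = X then v x else 0)" unfolding v'_def by (rule sum.cong[OF refl])
      then show ?thesis using X(1) finite_\<T> by simp
    qed
    have vm: "v \<in> borel_measurable (lebesgue_on \<Omega>)"
      by (rule measurable_lebesgue_on_modify_null[OF \<Omega>_meas L2_spaceD(1)[OF v'L] mesh_null eq])
    have "AE x in lebesgue. x \<notin> \<Omega> - \<Union>\<T>" using mesh_null by (rule AE_not_in)
    then have "AE x in lebesgue. x \<in> \<Omega> \<longrightarrow> v x = v' x" using eq by (auto elim!: eventually_mono)
    then have ae: "AE x in lebesgue_on \<Omega>. v x = v' x" by (simp add: AE_restrict_space_iff)
    have "ip w v = ip v w" by (rule L2_inner_commute)
    also have "\<dots> = ip v' w"
      by (rule L2_inner_cong_AE[OF ae vm L2_spaceD(1)[OF v'L] L2_spaceD(1)[OF w]])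
    also have "\<dots> = (\<Sum>T\<in>\<T>. \<Sum>i\<le>m. c T i * ip (\<xi> T i) w)"
      unfolding v'_def[abs_def] by (rule ip_double_sum[OF w]) (auto intro: xi_L2)
    also have "\<dots> = 0" using z by (intro sum.neutral ballI) (simp add: L2_inner_commute[of _ _ w])
    finally show "ip w v = 0" .
  qed
qed

lemma P_is_projector:
  "is_projector \<Omega> \<gamma> (span_of \<T> m (psi \<Omega> \<gamma> \<T> m \<phi> \<xi> \<theta>)) (dg_space l \<T>) P"
  unfolding is_projector_def
proof (intro conjI ballI)
  show "linear_op \<Omega> (L2_space \<Omega>) P" unfolding linear_op_def using P_lincomb by auto
  show "P u \<in> H10_space \<Omega> \<gamma>" for u by (rule P_H10)
  show "AE x in lebesgue_on \<Omega>. P (P u) x = P u x" for u by (simp add: P_idem)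
  show "P ` L2_space \<Omega> = span_of \<T> m (psi \<Omega> \<gamma> \<T> m \<phi> \<xi> \<theta>)" by (rule P_span)
  show "(\<lambda>u x. u x - P u x) ` L2_space \<Omega> = {w \<in> L2_space \<Omega>. \<forall>v\<in>dg_space l \<T>. ip w v = 0}"
  proof (intro equalityI subsetI)
    fix w assume "w \<in> (\<lambda>u x. u x - P u x) ` L2_space \<Omega>"
    then obtain u where u: "u \<in> L2_space \<Omega>" "w = (\<lambda>x. u x - P u x)" by blast
    have PL: "P u \<in> L2_space \<Omega>" by (rule H10_space_L2[OF P_H10])
    have wL: "w \<in> L2_space \<Omega>" unfolding u(2) by (rule L2_space_diff[OF u(1) PL])
    have "ip w (\<xi> T i) = 0" if "T \<in> \<T>" "i \<le> m" for T i
      unfolding u(2) using L2_inner_diff_left[OF u(1) PL xi_L2[OF that]] P_ip[OF that, of u] by simp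
    then show "w \<in> {w \<in> L2_space \<Omega>. \<forall>v\<in>dg_space l \<T>. ip w v = 0}" using orthogonal_dg_iff[OF wL] wL by blast
  next
    fix w assume "w \<in> {w \<in> L2_space \<Omega>. \<forall>v\<in>dg_space l \<T>. ip w v = 0}"
    then have w: "w \<in> L2_space \<Omega>" "\<And>T i. T \<in> \<T> \<Longrightarrow> i \<le> m \<Longrightarrow> ip w (\<xi> T i) = 0"
      using orthogonal_dg_iff by auto
    have "P w x = 0" for x unfolding P_eq using w(2) by (intro sum.neutral ballI) simp
    then have "w = (\<lambda>x. w x - P w x)" by simp
    then show "w \<in> (\<lambda>u x. u x - P u x) ` L2_space \<Omega>" using w(1) by blast
  qed
qed

end

section \<open>Interpolation of operators\<close>

lemma K_functional_bdd_below:
  fixes n0 n1 :: "('a \<Rightarrow> real) \<Rightarrow> real"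
  assumes "\<And>w. 0 \<le> n0 w" "\<And>w. 0 \<le> n1 w" "0 \<le> t"
  shows "bdd_below ((\<lambda>v. n0 (\<lambda>x. u x - v x) + t * n1 v) ` X1)"
proof (rule bdd_belowI2)
  fix v
  show "0 \<le> n0 (\<lambda>x. u x - v x) + t * n1 v" using assms(1)[of "\<lambda>x. u x - v x"] assms(2)[of v] assms(3) by simp
qed

lemma K_functional_nonneg:
  assumes "\<And>w. 0 \<le> n0 w" "\<And>w. 0 \<le> n1 w" "0 \<le> t" "X1 \<noteq> {}"
  shows "0 \<le> K_functional n0 X1 n1 t u"
  unfolding K_functional_def
proof (rule cINF_greatest[OF assms(4)])
  fix v
  show "0 \<le> n0 (\<lambda>x. u x - v x) + t * n1 v" using assms(1)[of "\<lambda>x. u x - v x"] assms(2)[of v] assms(3) by simp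
qed

lemma K_functional_mono:
  assumes n: "\<And>w. 0 \<le> n0 w" "\<And>w. 0 \<le> n1 w" and t: "0 \<le> t" "t \<le> t'" and X1: "X1 \<noteq> {}"
  shows "K_functional n0 X1 n1 t u \<le> K_functional n0 X1 n1 t' u"
  unfolding K_functional_def
proof (rule cINF_mono[OF X1 K_functional_bdd_below[OF n t(1)]])
  fix v assume "v \<in> X1"
  then show "\<exists>w\<in>X1. n0 (\<lambda>x. u x - w x) + t * n1 w \<le> n0 (\<lambda>x. u x - v x) + t' * n1 v"
    using mult_right_mono[OF t(2) n(2)[of v]] by (intro bexI[of _ v]) simp_all
qed

text \<open>
  The K-functional is monotone in $t$, hence Borel measurable, which allows the scalar to be pulled
  out of the integral.
\<close>

lemma interp_energy_measurable:
  fixes n0 n1 :: "('a \<Rightarrow> real) \<Rightarrow> real"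
  assumes n: "\<And>w. 0 \<le> n0 w" "\<And>w. 0 \<le> n1 w" and X1: "X1 \<noteq> {}"
  shows "(\<lambda>t. ennreal ((t powr (- s) * K_functional n0 X1 n1 t u)\<^sup>2 / t) * indicator {0<..} t)
    \<in> borel_measurable lborel"
proof -
  define k where "k t = K_functional n0 X1 n1 (max t 0) u" for t
  have "mono k" unfolding k_def by (intro monoI K_functional_mono n X1) auto
  then have [measurable]: "k \<in> borel_measurable borel" by (rule borel_measurable_mono)
  have "(\<lambda>t. ennreal ((t powr (- s) * k t)\<^sup>2 / t) * indicator {0<..} t) \<in> borel_measurable lborel"
    by measurable
  moreover have "(\<lambda>t. ennreal ((t powr (- s) * k t)\<^sup>2 / t) * indicator {0<..} t)
      = (\<lambda>t. ennreal ((t powr (- s) * K_functional n0 X1 n1 t u)\<^sup>2 / t) * indicator {0<..} t)"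
    by (rule ext) (simp add: k_def indicator_def)
  ultimately show ?thesis by (simp only:)
qed

text \<open>
  A decomposition $u = (u - v) + v$ is mapped to a decomposition of $Pu$.
\<close>

lemma K_functional_operator:
  assumes n: "\<And>w. 0 \<le> n0 w" "\<And>w. 0 \<le> n1 w" and X1: "X1 \<noteq> {}" and C: "0 < C" and t: "0 < t"
    and b0: "\<And>v. v \<in> X1 \<Longrightarrow> n0 (\<lambda>x. P u x - P v x) \<le> C * n0 (\<lambda>x. u x - v x)"
    and P1: "\<And>v. v \<in> X1 \<Longrightarrow> P v \<in> X1" and b1: "\<And>v. v \<in> X1 \<Longrightarrow> n1 (P v) \<le> C * n1 v"
  shows "K_functional n0 X1 n1 t (P u) \<le> C * K_functional n0 X1 n1 t u"
proof -
  have "K_functional n0 X1 n1 t (P u) / C \<le> K_functional n0 X1 n1 t u"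
    unfolding K_functional_def[of n0 X1 n1 t u]
  proof (rule cINF_greatest[OF X1])
    fix v assume v: "v \<in> X1"
    have "K_functional n0 X1 n1 t (P u) \<le> n0 (\<lambda>x. P u x - P v x) + t * n1 (P v)"
      unfolding K_functional_def
      by (rule cINF_lower[OF K_functional_bdd_below[OF n less_imp_le[OF t]] P1[OF v]])
    also have "\<dots> \<le> C * n0 (\<lambda>x. u x - v x) + t * (C * n1 v)"
      using b0[OF v] mult_left_mono[OF b1[OF v] less_imp_le[OF t]] by (rule add_mono)
    finally show "K_functional n0 X1 n1 t (P u) / C \<le> n0 (\<lambda>x. u x - v x) + t * n1 v"
      using C by (simp add: divide_le_eq algebra_simps)
  qed
  then show ?thesis using C by (simp add: divide_le_eq mult.commute)
qed

lemma interp_energy_operator: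
  assumes n: "\<And>w. 0 \<le> n0 w" "\<And>w. 0 \<le> n1 w" and X1: "X1 \<noteq> {}" and C: "0 < C"
    and b0: "\<And>v. v \<in> X1 \<Longrightarrow> n0 (\<lambda>x. P u x - P v x) \<le> C * n0 (\<lambda>x. u x - v x)"
    and P1: "\<And>v. v \<in> X1 \<Longrightarrow> P v \<in> X1" and b1: "\<And>v. v \<in> X1 \<Longrightarrow> n1 (P v) \<le> C * n1 v"
  shows "interp_energy n0 X1 n1 s (P u) \<le> ennreal (C\<^sup>2) * interp_energy n0 X1 n1 s u"
proof -
  let ?k = "\<lambda>t w. K_functional n0 X1 n1 t w"
  have "interp_energy n0 X1 n1 s (P u)
      \<le> (\<integral>\<^sup>+t. ennreal (C\<^sup>2) * (ennreal ((t powr (- s) * ?k t u)\<^sup>2 / t) * indicator {0<..} t) \<partial>lborel)"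
    unfolding interp_energy_def
  proof (rule nn_integral_mono)
    fix t :: real
    show "ennreal ((t powr (- s) * ?k t (P u))\<^sup>2 / t) * indicator {0<..} t
      \<le> ennreal (C\<^sup>2) * (ennreal ((t powr (- s) * ?k t u)\<^sup>2 / t) * indicator {0<..} t)"
    proof (cases "0 < t")
      case True
      have "t powr (- s) * ?k t (P u) \<le> t powr (- s) * (C * ?k t u)"
        by (rule mult_left_mono[OF K_functional_operator[where P = P and ?n0.0 = n0 and ?n1.0 = n1 and ?X1.0 = X1 and u = u, OF n X1 C True b0 P1 b1]]) auto
      moreover have "0 \<le> t powr (- s) * ?k t (P u)"
        by (intro mult_nonneg_nonneg K_functional_nonneg n X1) (use True in auto)
      ultimately have "(t powr (- s) * ?k t (P u))\<^sup>2 \<le> (t powr (- s) * (C * ?k t u))\<^sup>2" by (rule power_mono)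
      then have "(t powr (- s) * ?k t (P u))\<^sup>2 / t \<le> (t powr (- s) * (C * ?k t u))\<^sup>2 / t"
        using True by (simp add: divide_right_mono)
      also have "\<dots> = C\<^sup>2 * ((t powr (- s) * ?k t u)\<^sup>2 / t)" by (simp add: power_mult_distrib)
      finally have "ennreal ((t powr (- s) * ?k t (P u))\<^sup>2 / t) \<le> ennreal (C\<^sup>2 * ((t powr (- s) * ?k t u)\<^sup>2 / t))"
        by (rule ennreal_leI)
      also have "\<dots> = ennreal (C\<^sup>2) * ennreal ((t powr (- s) * ?k t u)\<^sup>2 / t)"
        using True by (intro ennreal_mult) auto
      finally show ?thesis using True by simp
    qed simp
  qed
  also have "\<dots> = ennreal (C\<^sup>2) * interp_energy n0 X1 n1 s u"
    unfolding interp_energy_def by (rule nn_integral_cmult[OF interp_energy_measurable[OF n X1]])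
  finally show ?thesis .
qed

lemma W_space_L2: "u \<in> W_space \<Omega> \<gamma> s \<Longrightarrow> u \<in> L2_space \<Omega>"
  by (auto simp: W_space_def H10_space_L2 split: if_splits)

lemma W_zero:
  assumes \<Omega>: "open \<Omega>"
  shows "(\<lambda>x. 0) \<in> W_space \<Omega> \<gamma> s" "W_norm \<Omega> \<gamma> s (\<lambda>x. 0) = 0"
proof -
  note z = H10_space_zero[OF \<Omega>, of \<gamma>]
  have L0: "L2_norm \<Omega> (\<lambda>x. 0) = 0" by (simp add: L2_norm_def L2_inner_def)
  have "K_functional (L2_norm \<Omega>) (H10_space \<Omega> \<gamma>) (H1_norm \<Omega>) t (\<lambda>x. 0) = 0" if t: "0 < t" for t
  proof (rule antisym)
    have "K_functional (L2_norm \<Omega>) (H10_space \<Omega> \<gamma>) (H1_norm \<Omega>) t (\<lambda>x. 0)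
        \<le> L2_norm \<Omega> (\<lambda>x. 0 - 0) + t * H1_norm \<Omega> (\<lambda>x. 0)"
      unfolding K_functional_def
      by (rule cINF_lower[OF K_functional_bdd_below z]) (use t in auto)
    then show "K_functional (L2_norm \<Omega>) (H10_space \<Omega> \<gamma>) (H1_norm \<Omega>) t (\<lambda>x. 0) \<le> 0"
      by (simp add: L0 H1_norm_zero[OF \<Omega>])
    show "0 \<le> K_functional (L2_norm \<Omega>) (H10_space \<Omega> \<gamma>) (H1_norm \<Omega>) t (\<lambda>x. 0)"
      by (rule K_functional_nonneg) (use t z in auto)
  qed
  then have "ennreal ((t powr (- s) * K_functional (L2_norm \<Omega>) (H10_space \<Omega> \<gamma>) (H1_norm \<Omega>) t (\<lambda>x. 0))\<^sup>2 / t)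
      * indicator {0<..} t = 0" for t
    by (cases "0 < t") simp_all
  then have e: "interp_energy (L2_norm \<Omega>) (H10_space \<Omega> \<gamma>) (H1_norm \<Omega>) s (\<lambda>x. 0) = 0"
    unfolding interp_energy_def by (simp only:) simp
  show "(\<lambda>x. 0) \<in> W_space \<Omega> \<gamma> s" using z e H10_space_L2[OF z] by (simp add: W_space_def)
  show "W_norm \<Omega> \<gamma> s (\<lambda>x. 0) = 0" using e by (simp add: W_norm_def L0 H1_norm_zero[OF \<Omega>])
qed

text \<open>
  The interpolation theorem for operators, with the end points \<open>s = 0\<close> and \<open>s = 1\<close> included.
\<close>

lemma interpolation_of_operators:
  assumes \<Omega>: "open \<Omega>" and C: "0 < C"
    and lin: "\<And>u v x. u \<in> L2_space \<Omega> \<Longrightarrow> v \<in> L2_space \<Omega> \<Longrightarrow> P (\<lambda>y. u y - v y) x = P u x - P v x"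
    and P0: "\<And>u. u \<in> L2_space \<Omega> \<Longrightarrow> P u \<in> L2_space \<Omega>"
    and b0: "\<And>u. u \<in> L2_space \<Omega> \<Longrightarrow> L2_norm \<Omega> (P u) \<le> C * L2_norm \<Omega> u"
    and P1: "\<And>u. u \<in> H10_space \<Omega> \<gamma> \<Longrightarrow> P u \<in> H10_space \<Omega> \<gamma>"
    and b1: "\<And>u. u \<in> H10_space \<Omega> \<gamma> \<Longrightarrow> H1_norm \<Omega> (P u) \<le> C * H1_norm \<Omega> u"
    and u: "u \<in> W_space \<Omega> \<gamma> s"
  shows "P u \<in> W_space \<Omega> \<gamma> s" "W_norm \<Omega> \<gamma> s (P u) \<le> C * W_norm \<Omega> \<gamma> s u"
proof -
  let ?e = "interp_energy (L2_norm \<Omega>) (H10_space \<Omega> \<gamma>) (H1_norm \<Omega>) s"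
  have "P u \<in> W_space \<Omega> \<gamma> s \<and> W_norm \<Omega> \<gamma> s (P u) \<le> C * W_norm \<Omega> \<gamma> s u"
  proof (cases "s = 0 \<or> s = 1")
    case True
    then show ?thesis
    proof
      assume "s = 0"
      then show ?thesis using P0[of u] b0[of u] u by (simp add: W_space_def W_norm_def)
    next
      assume "s = 1"
      then show ?thesis using P1[of u] b1[of u] u by (simp add: W_space_def W_norm_def)
    qed
  next
    case False
    then have uL: "u \<in> L2_space \<Omega>" and fin: "?e u < \<infinity>" using u by (auto simp: W_space_def)
    have le: "?e (P u) \<le> ennreal (C\<^sup>2) * ?e u"
    proof (rule interp_energy_operator[where P = P and ?n0.0 = "L2_norm \<Omega>" and ?n1.0 = "H1_norm \<Omega>" and ?X1.0 = "H10_space \<Omega> \<gamma>",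
          OF L2_norm_nonneg H1_norm_nonneg _ C _ P1 b1])
      show "H10_space \<Omega> \<gamma> \<noteq> {}" using H10_space_zero[OF \<Omega>] by blast
      fix v assume "v \<in> H10_space \<Omega> \<gamma>"
      then have vL: "v \<in> L2_space \<Omega>" by (rule H10_space_L2)
      have "(\<lambda>x. P u x - P v x) = P (\<lambda>x. u x - v x)" by (rule ext) (rule lin[OF uL vL, symmetric])
      then show "L2_norm \<Omega> (\<lambda>x. P u x - P v x) \<le> C * L2_norm \<Omega> (\<lambda>x. u x - v x)"
        using b0[OF L2_space_diff[OF uL vL]] by simp
    qed
    have fin': "ennreal (C\<^sup>2) * ?e u < \<infinity>" using fin by (simp add: ennreal_mult_less_top)
    have "enn2real (?e (P u)) \<le> enn2real (ennreal (C\<^sup>2) * ?e u)"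
      using enn2real_mono[OF le] fin' by simp
    also have "\<dots> = C\<^sup>2 * enn2real (?e u)" by (simp add: enn2real_mult)
    finally have "sqrt (enn2real (?e (P u))) \<le> sqrt (C\<^sup>2 * enn2real (?e u))" by (rule real_sqrt_le_mono)
    then have "sqrt (enn2real (?e (P u))) \<le> C * sqrt (enn2real (?e u))" using C by (simp add: real_sqrt_mult)
    then show ?thesis using False P0[OF uL] le_less_trans[OF le fin'] by (simp add: W_space_def W_norm_def)
  qed
  then show "P u \<in> W_space \<Omega> \<gamma> s" "W_norm \<Omega> \<gamma> s (P u) \<le> C * W_norm \<Omega> \<gamma> s u" by auto
qed

lemma (in bubble_mesh) proj_L2_const_nonneg: "0 \<le> proj_L2_const"
  using quasi_L2_const_nonneg bubble_const_nonneg by (simp add: proj_L2_const_def)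

lemma (in bubble_mesh) P_W_bound:
  fixes s :: real
  assumes u: "u \<in> W_space \<Omega> \<gamma> s"
  defines "C \<equiv> 1 + sqrt proj_L2_const + sqrt (4 * proj_H1_const)"
  shows "P u \<in> W_space \<Omega> \<gamma> s" "W_norm \<Omega> \<gamma> s (P u) \<le> C * W_norm \<Omega> \<gamma> s u"
proof -
  have quasi_L2_const: "0 \<le> proj_L2_const" by (rule proj_L2_const_nonneg)
  have C: "1 \<le> C" "sqrt proj_L2_const \<le> C" "sqrt (4 * proj_H1_const) \<le> C" using quasi_L2_const proj_H1_const_nonneg by (simp_all add: C_def)
  have lin: "P (\<lambda>y. u y - v y) x = P u x - P v x" if "u \<in> L2_space \<Omega>" "v \<in> L2_space \<Omega>" for u v x
    using P_lincomb[OF that, of 1 "-1" x] by simp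
  have b0: "L2_norm \<Omega> (P u) \<le> C * L2_norm \<Omega> u" if u: "u \<in> L2_space \<Omega>" for u
  proof -
    have "sqrt ((L2_norm \<Omega> (P u))\<^sup>2) \<le> sqrt (proj_L2_const * (L2_norm \<Omega> u)\<^sup>2)"
      by (rule real_sqrt_le_mono[OF P_L2_bound[OF u]])
    then have "L2_norm \<Omega> (P u) \<le> sqrt proj_L2_const * L2_norm \<Omega> u" by (simp add: real_sqrt_mult)
    also have "\<dots> \<le> C * L2_norm \<Omega> u" by (rule mult_right_mono[OF C(2)]) simp
    finally show ?thesis .
  qed
  have b1: "H1_norm \<Omega> (P u) \<le> C * H1_norm \<Omega> u" if u: "u \<in> H10_space \<Omega> \<gamma>" for u
  proof -
    have "sqrt ((H1_norm \<Omega> (P u))\<^sup>2) \<le> sqrt ((4 * proj_H1_const) * (H1_norm \<Omega> u)\<^sup>2)"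
      by (rule real_sqrt_le_mono[OF P_H1_bound[OF u]])
    then have "H1_norm \<Omega> (P u) \<le> sqrt (4 * proj_H1_const) * H1_norm \<Omega> u"
      by (simp only: real_sqrt_mult real_sqrt_abs abs_of_nonneg H1_norm_nonneg)
    also have "\<dots> \<le> C * H1_norm \<Omega> u" by (rule mult_right_mono[OF C(3)]) simp
    finally show ?thesis .
  qed
  have C0: "0 < C" using C(1) by simp
  note r = interpolation_of_operators[where P = P, OF open_\<Omega> C0 lin H10_space_L2[OF P_H10] b0 P_H10 b1 u]
  show "P u \<in> W_space \<Omega> \<gamma> s" by (rule r(1))
  show "W_norm \<Omega> \<gamma> s (P u) \<le> C * W_norm \<Omega> \<gamma> s u" by (rule r(2))
qed

lemma (in bubble_mesh) P_bounded_op: "bounded_op \<Omega> (W_space \<Omega> \<gamma> s) (W_norm \<Omega> \<gamma> s) P"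
  unfolding bounded_op_def
proof (intro conjI ballI)
  show "linear_op \<Omega> (W_space \<Omega> \<gamma> s) P"
    unfolding linear_op_def by (intro ballI allI always_eventually P_lincomb W_space_L2)
  show "P u \<in> W_space \<Omega> \<gamma> s" if "u \<in> W_space \<Omega> \<gamma> s" for u using P_W_bound(1)[OF that] .
  show "\<exists>C. \<forall>u\<in>W_space \<Omega> \<gamma> s. W_norm \<Omega> \<gamma> s (P u) \<le> C * W_norm \<Omega> \<gamma> s u" using P_W_bound(2) by blast
qed

lemma (in bubble_mesh) P_op_norm_le:
  "op_norm (W_space \<Omega> \<gamma> s) (W_norm \<Omega> \<gamma> s) P \<le> 1 + sqrt proj_L2_const + sqrt (4 * proj_H1_const)"
  unfolding op_norm_def
proof (rule cSUP_least)
  show "{u \<in> W_space \<Omega> \<gamma> s. W_norm \<Omega> \<gamma> s u \<le> 1} \<noteq> {}"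
    using W_zero[OF open_\<Omega>, of \<gamma> s] by (metis (mono_tags, lifting) empty_iff mem_Collect_eq zero_le_one)
  fix u assume u: "u \<in> {u \<in> W_space \<Omega> \<gamma> s. W_norm \<Omega> \<gamma> s u \<le> 1}"
  have "0 \<le> 1 + sqrt proj_L2_const + sqrt (4 * proj_H1_const)" using proj_L2_const_nonneg proj_H1_const_nonneg by simp
  then have "(1 + sqrt proj_L2_const + sqrt (4 * proj_H1_const)) * W_norm \<Omega> \<gamma> s u \<le> (1 + sqrt proj_L2_const + sqrt (4 * proj_H1_const)) * 1"
    using u by (intro mult_left_mono) auto
  then show "W_norm \<Omega> \<gamma> s (P u) \<le> 1 + sqrt proj_L2_const + sqrt (4 * proj_H1_const)" using P_W_bound(2)[of u s] u by auto
qed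

section \<open>Uniform bounds over the family\<close>

text \<open>
  Transport \<open>q\<close> to the reference simplex by the inverse affine map, expand it there, and go back.
\<close>

lemma lifted_basis_spans:
  fixes T R :: "'a::euclidean_space set"
  assumes L: "linear L" and im: "(\<lambda>x. L x + a) ` T = interior R" and T: "T \<noteq> {}"
    and q: "q \<in> poly_space l" and p: "\<And>q. q \<in> poly_space l \<Longrightarrow> \<exists>c. \<forall>x\<in>R. q x = (\<Sum>i\<le>m. c i * p i x)"
  shows "\<exists>c. \<forall>x\<in>T. q x = (\<Sum>i\<le>m. c i * p i (L x + a))"
proof -
  have "interior R \<noteq> {}" using T im by blast
  then obtain g where g: "linear g" "\<And>x. g (L x) = x"
    by (rule linear_inverse_of_open_image[OF L im open_interior]) blast
  have "(\<lambda>y. q (g y + g (- a))) \<in> poly_space l" by (rule poly_space_affine_comp[OF q g(1)])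
  then obtain c where c: "\<forall>y\<in>R. q (g y + g (- a)) = (\<Sum>i\<le>m. c i * p i y)" using p by blast
  have "q x = (\<Sum>i\<le>m. c i * p i (L x + a))" if x: "x \<in> T" for x
  proof -
    have "L x + a \<in> interior R" using x im by blast
    then have "L x + a \<in> R" by (rule subsetD[OF interior_subset])
    then have "q (g (L x + a) + g (- a)) = (\<Sum>i\<le>m. c i * p i (L x + a))" using c by blast
    moreover have "g (L x + a) + g (- a) = x" using g(2)[of x] by (simp add: linear_add[OF g(1)] linear_neg[OF g(1)])
    ultimately show ?thesis by simp
  qed
  then show ?thesis by blast
qed

lemma shape_regular_mono:
  assumes "shape_regular \<kappa> T" "\<kappa> \<le> \<kappa>'" shows "shape_regular \<kappa>' T"
proof -
  obtain x r where r: "0 < r" "ball x r \<subseteq> T" "diameter T \<le> \<kappa> * r"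
    using assms(1) unfolding shape_regular_def by blast
  have "\<kappa> * r \<le> \<kappa>' * r" using assms(2) r(1) by simp
  with r(3) have "diameter T \<le> \<kappa>' * r" by (rule order_trans)
  with r(1,2) show ?thesis unfolding shape_regular_def by blast
qed

text \<open>
  Collects the constants of the family. A common \<open>\<kappa>\<close> serves for shape regularity and for the
  comparability of neighbours in one dimension; only the set of facets is chosen for each
  partition separately.
\<close>

lemma uniform_dg_mesh:
  fixes \<Omega> \<gamma> R :: "'a::euclidean_space set"
  assumes dom: "polytopal_domain \<Omega>" and adm: "admissible_family \<Omega> \<gamma> TT"
    and nodal: "\<And>\<T>. \<T> \<in> TT \<Longrightarrow> nodal_basis \<Omega> \<gamma> \<T> (\<phi> \<T>)"
    and ref: "reference_basis R l m p" and lift: "lifted_bases \<Omega> TT R m p \<xi>"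
    and bubble_corr: "bubble_collections \<Omega> \<gamma> TT m \<xi> \<theta>"
  obtains \<kappa> Cx Cb Cs where
    "\<And>\<T>. \<T> \<in> TT \<Longrightarrow> \<exists>\<F>. dg_mesh \<Omega> \<T> \<kappa> \<gamma> \<F> (\<phi> \<T>) m (\<xi> \<T>) (\<theta> \<T>) Cx Cb Cs l"
proof -
  note B0 = bubble_corr[unfolded bubble_collections_def]
  note B = B0[THEN conjunct1] B0[THEN conjunct2, THEN conjunct1] B0[THEN conjunct2, THEN conjunct2, THEN conjunct1]
    B0[THEN conjunct2, THEN conjunct2, THEN conjunct2, THEN conjunct1]
    B0[THEN conjunct2, THEN conjunct2, THEN conjunct2, THEN conjunct2, THEN conjunct1]
    B0[THEN conjunct2, THEN conjunct2, THEN conjunct2, THEN conjunct2, THEN conjunct2, THEN conjunct1]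
  note L0 = lift[unfolded lifted_bases_def]
  note A0 = adm[unfolded admissible_family_def]
  obtain \<kappa>0 where \<kappa>0: "\<forall>\<T>\<in>TT. \<forall>T\<in>\<T>. shape_regular \<kappa>0 T"
    using A0[THEN conjunct2, THEN conjunct2, THEN conjunct1] by (rule exE)
  obtain \<kappa>1 where \<kappa>1: "DIM('a) = 1 \<longrightarrow> (\<forall>\<T>\<in>TT. \<forall>T\<in>\<T>. \<forall>T'\<in>\<T>.
      closure T \<inter> closure T' \<noteq> {} \<longrightarrow> vol T \<le> \<kappa>1 * vol T')"
  proof (cases "DIM('a) = 1")
    case True
    then show thesis using A0[THEN conjunct2, THEN conjunct2, THEN conjunct2] that by (elim impE exE) simp_all
  qed (rule that, simp)
  \<comment> \<open>The \<open>1\<close> guarantees positivity; outside dimension one \<open>\<kappa>1\<close> is arbitrary and does no harm.\<close>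
  define \<kappa> where "\<kappa> = max 1 (max \<kappa>0 \<kappa>1)"
  obtain Cx where Cx: "\<forall>\<T>\<in>TT. \<forall>T\<in>\<T>. \<forall>i\<le>m.
      L2_norm \<Omega> (\<xi> \<T> T i) \<le> Cx * sqrt (vol T) \<and> sqrt (vol T) \<le> Cx * L2_norm \<Omega> (\<xi> \<T> T i)"
    using L0[THEN conjunct2, THEN conjunct2] by (rule exE)
  obtain Cb where Cb: "\<forall>\<T>\<in>TT. \<forall>T\<in>\<T>. \<forall>i\<le>m.
      L2_inner \<Omega> (\<theta> \<T> T i) (\<xi> \<T> T i) \<le> Cb * (L2_norm \<Omega> (\<theta> \<T> T i) * L2_norm \<Omega> (\<xi> \<T> T i)) \<and>
      L2_norm \<Omega> (\<theta> \<T> T i) * L2_norm \<Omega> (\<xi> \<T> T i) \<le> Cb * L2_inner \<Omega> (\<theta> \<T> T i) (\<xi> \<T> T i)"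
    using B(4) by (rule exE)
  obtain C where C: "\<forall>\<T>\<in>TT. \<forall>k\<in>{0, 1}. \<forall>c.
      let lhs = (Hk_norm k \<Omega> (\<lambda>x. \<Sum>T\<in>\<T>. \<Sum>i\<le>m. c T i * \<theta> \<T> T i x))\<^sup>2;
          rhs = (\<Sum>T\<in>\<T>. \<Sum>i\<le>m. inverse (mesh_size T) ^ (2 * k) * \<bar>c T i\<bar>\<^sup>2 * (L2_norm \<Omega> (\<theta> \<T> T i))\<^sup>2)
      in lhs \<le> C * rhs \<and> rhs \<le> C * lhs"
    using B(6) by (rule exE)
  \<comment> \<open>For an empty family of bubbles nothing forces \<open>C\<close> to be nonnegative.\<close>
  define Cs where "Cs = max C 0"
  have \<Omega>: "open \<Omega>" "bounded \<Omega>" using dom by (auto simp: polytopal_domain_def)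
  then have \<Omega>_sets: "\<Omega> \<in> sets lebesgue" by simp
  have "\<exists>\<F>. dg_mesh \<Omega> \<T> \<kappa> \<gamma> \<F> (\<phi> \<T>) m (\<xi> \<T>) (\<theta> \<T>) Cx Cb Cs l" if \<T>: "\<T> \<in> TT" for \<T>
  proof -
    have conf: "conforming_partition \<Omega> \<T>" using A0[THEN conjunct1, rule_format, OF \<T>] .
    obtain \<F> where \<F>: "\<And>F. F \<in> \<F> \<Longrightarrow> \<exists>T\<in>\<T>. F facet_of closure T" "\<gamma> = \<Union>\<F>"
      using A0[THEN conjunct2, THEN conjunct1, rule_format, OF \<T>] by blast
    have elem: "open T" "bounded T" "T \<subseteq> \<Omega>" "T \<noteq> {}" if T: "T \<in> \<T>" for T
    proof -
      show "open T" using conf T unfolding conforming_partition_def by (metis open_interior)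
      show "T \<subseteq> \<Omega>" using conf T unfolding conforming_partition_def by blast
      then show "bounded T" using \<Omega>(2) bounded_subset by blast
      have "shape_regular \<kappa>0 T" using \<kappa>0 \<T> T by blast
      then obtain x r where r: "0 < r" "ball x r \<subseteq> T" unfolding shape_regular_def by blast
      have "x \<in> ball x r" using r(1) by simp
      then show "T \<noteq> {}" using r(2) by blast
    qed
    have lifting: "\<exists>L a. linear L \<and> (\<lambda>x. L x + a) ` T = interior R \<and>
        (\<forall>i\<le>m. \<forall>x. \<xi> \<T> T i x = (if x \<in> T then p i (L x + a) else 0))" if "T \<in> \<T>" for T
      using L0[THEN conjunct1, rule_format, OF \<T> that] .
    have poly: "p i \<in> poly_space l" if "i \<le> m" for i using ref that unfolding reference_basis_def by blast
    have "dg_mesh \<Omega> \<T> \<kappa> \<gamma> \<F> (\<phi> \<T>) m (\<xi> \<T>) (\<theta> \<T>) Cx Cb Cs l"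
    proof
      show "polytopal_domain \<Omega>" by (rule dom)
      show "conforming_partition \<Omega> \<T>" by (rule conf)
      show "0 < \<kappa>" by (simp add: \<kappa>_def)
      show "shape_regular \<kappa> T" if "T \<in> \<T>" for T
        by (rule shape_regular_mono[OF \<kappa>0[rule_format, OF \<T> that]]) (simp add: \<kappa>_def)
      show "vol T \<le> \<kappa> * vol T'" if "DIM('a) = 1" "T \<in> \<T>" "T' \<in> \<T>" "closure T \<inter> closure T' \<noteq> {}" for T T'
      proof -
        have "vol T \<le> \<kappa>1 * vol T'" by (rule \<kappa>1[rule_format, OF that(1) \<T> that(2-4)])
        also have "\<dots> \<le> \<kappa> * vol T'" by (rule mult_right_mono) (auto simp: \<kappa>_def)
        finally show ?thesis .
      qed
      show "\<exists>T\<in>\<T>. F facet_of closure T" if "F \<in> \<F>" for F by (rule \<F>(1)[OF that])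
      show "\<gamma> = \<Union>\<F>" by (rule \<F>(2))
      show "nodal_basis \<Omega> \<gamma> \<T> (\<phi> \<T>)" by (rule nodal[OF \<T>])
      show "\<xi> \<T> T 0 = indicator T" if "T \<in> \<T>" for T
        using L0[THEN conjunct2, THEN conjunct1, rule_format, OF \<T> that] .
      show "\<xi> \<T> T i x = 0" if "T \<in> \<T>" "i \<le> m" "x \<notin> T" for T i x
      proof -
        obtain L a where "\<forall>i\<le>m. \<forall>x. \<xi> \<T> T i x = (if x \<in> T then p i (L x + a) else 0)"
          using lifting[OF \<open>T \<in> \<T>\<close>] by blast
        from this[rule_format, OF that(2), of x] show ?thesis using that(3) by simp
      qed
      show "\<xi> \<T> T i \<in> L2_space \<Omega>" if T: "T \<in> \<T>" and i: "i \<le> m" for T i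
      proof -
        obtain L a where L: "linear L" "\<forall>i\<le>m. \<forall>x. \<xi> \<T> T i x = (if x \<in> T then p i (L x + a) else 0)"
          using lifting[OF T] by blast
        have "\<xi> \<T> T i = (\<lambda>x. if x \<in> T then p i (L x + a) else 0)" using L(2) i by (intro ext) blast
        also have "\<dots> \<in> L2_space \<Omega>"
          by (rule truncated_continuous_L2[OF elem(1-3)[OF T] \<Omega>_sets poly_space_continuous[OF poly_space_affine_comp[OF poly[OF i] L(1)]]])
        finally show ?thesis .
      qed
      show "L2_norm \<Omega> (\<xi> \<T> T i) \<le> Cx * sqrt (vol T)" if "T \<in> \<T>" "i \<le> m" for T i
        using Cx[rule_format, OF \<T> that] by (rule conjunct1)
      show "sqrt (vol T) \<le> Cx * L2_norm \<Omega> (\<xi> \<T> T i)" if "T \<in> \<T>" "i \<le> m" for T i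
        using Cx[rule_format, OF \<T> that] by (rule conjunct2)
      show "\<theta> \<T> T i \<in> H10_space \<Omega> \<gamma>" if "T \<in> \<T>" "i \<le> m" for T i
        using B(1)[rule_format, OF \<T> that] by (rule conjunct1)
      show "L2_inner \<Omega> (\<theta> \<T> T i) (\<xi> \<T> T' i') = (if (T, i) = (T', i') then vol T else 0)"
        if "T \<in> \<T>" "T' \<in> \<T>" "i \<le> m" "i' \<le> m" for T i T' i'
        using B(3)[rule_format, OF \<T> that] .
      show "L2_norm \<Omega> (\<theta> \<T> T i) * L2_norm \<Omega> (\<xi> \<T> T i) \<le> Cb * L2_inner \<Omega> (\<theta> \<T> T i) (\<xi> \<T> T i)"
        if "T \<in> \<T>" "i \<le> m" for T i
        using Cb[rule_format, OF \<T> that] by (rule conjunct2)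
      show "(Hk_norm k \<Omega> (\<lambda>x. \<Sum>T\<in>\<T>. \<Sum>i\<le>m. c T i * \<theta> \<T> T i x))\<^sup>2
        \<le> Cs * (\<Sum>T\<in>\<T>. \<Sum>i\<le>m. inverse (mesh_size T) ^ (2 * k) * \<bar>c T i\<bar>\<^sup>2 * (L2_norm \<Omega> (\<theta> \<T> T i))\<^sup>2)"
        if k: "k \<in> {0, 1}" for k c
      proof -
        let ?rhs = "\<Sum>T\<in>\<T>. \<Sum>i\<le>m. inverse (mesh_size T) ^ (2 * k) * \<bar>c T i\<bar>\<^sup>2 * (L2_norm \<Omega> (\<theta> \<T> T i))\<^sup>2"
        have "(Hk_norm k \<Omega> (\<lambda>x. \<Sum>T\<in>\<T>. \<Sum>i\<le>m. c T i * \<theta> \<T> T i x))\<^sup>2 \<le> C * ?rhs"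
          using C[rule_format, OF \<T> k, of c] unfolding Let_def by (rule conjunct1)
        also have "\<dots> \<le> Cs * ?rhs"
          by (rule mult_right_mono, simp add: Cs_def, intro sum_nonneg mult_nonneg_nonneg) (auto simp: mesh_size_def)
        finally show ?thesis .
      qed
      show "0 \<le> Cs" by (simp add: Cs_def)
      show "\<xi> \<T> T i \<in> dg_space l \<T>" if T: "T \<in> \<T>" and i: "i \<le> m" for T i
        unfolding dg_space_def
      proof (rule CollectI, rule ballI)
        fix T' assume T': "T' \<in> \<T>"
        obtain L a where L: "linear L" "\<forall>i\<le>m. \<forall>x. \<xi> \<T> T i x = (if x \<in> T then p i (L x + a) else 0)"
          using lifting[OF T] by blast
        show "\<exists>q\<in>poly_space l. \<forall>x\<in>T'. \<xi> \<T> T i x = q x"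
        proof (cases "T' = T")
          case True
          then show ?thesis using L(2) i by (intro bexI[OF _ poly_space_affine_comp[OF poly[OF i] L(1), of a]]) simp
        next
          case False
          have "disjoint \<T>" using conf unfolding conforming_partition_def by blast
          then have "T' \<inter> T = {}" using T' T False by (rule disjointD)
          then show ?thesis using L(2) i by (intro bexI[OF _ poly_space_zero]) auto
        qed
      qed
      show "\<exists>c. \<forall>x\<in>T. q x = (\<Sum>i\<le>m. c i * \<xi> \<T> T i x)" if T: "T \<in> \<T>" and q: "q \<in> poly_space l" for T q
      proof -
        obtain L a where L: "linear L" "(\<lambda>x. L x + a) ` T = interior R"
          "\<forall>i\<le>m. \<forall>x. \<xi> \<T> T i x = (if x \<in> T then p i (L x + a) else 0)"
          using lifting[OF T] by blast
        have span: "\<exists>c. \<forall>x\<in>R. q x = (\<Sum>i\<le>m. c i * p i x)" if "q \<in> poly_space l" for q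
          using ref that unfolding reference_basis_def by blast
        obtain c where c: "\<forall>x\<in>T. q x = (\<Sum>i\<le>m. c i * p i (L x + a))"
          using lifted_basis_spans[OF L(1,2) elem(4)[OF T] q, where m = m and p = p] span by blast
        then show ?thesis using L(3) by (intro exI[of _ c]) simp
      qed
    qed
    then show ?thesis by blast
  qed
  then show thesis by (rule that)
qed

theorem theorem5p1:
  fixes \<Omega> \<gamma> R :: "'a::euclidean_space set"
    and s :: real
    and l m :: nat
    and TT :: "'a set set set"
    and p :: "nat \<Rightarrow> 'a \<Rightarrow> real"
    and \<phi> :: "'a set set \<Rightarrow> 'a \<Rightarrow> 'a \<Rightarrow> real"
    and \<xi> \<theta> :: "'a set set \<Rightarrow> 'a set \<Rightarrow> nat \<Rightarrow> 'a \<Rightarrow> real"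
  assumes "polytopal_domain \<Omega>"
    and "\<gamma> \<subseteq> frontier \<Omega>" and "closed \<gamma>"
    and "0 \<le> s" and "s \<le> 1"
    and "admissible_family \<Omega> \<gamma> TT"
    and "\<And>\<T>. \<T> \<in> TT \<Longrightarrow> nodal_basis \<Omega> \<gamma> \<T> (\<phi> \<T>)"
    and "0 < l" and "m = (DIM('a) + l choose l) - 1"
    and "int DIM('a) simplex R" and "reference_basis R l m p"
    and "lifted_bases \<Omega> TT R m p \<xi>"
    and "bubble_collections \<Omega> \<gamma> TT m \<xi> \<theta>"
  shows "(\<forall>\<T>\<in>TT. is_projector \<Omega> \<gamma>
            (span_of \<T> m (psi \<Omega> \<gamma> \<T> m (\<phi> \<T>) (\<xi> \<T>) (\<theta> \<T>))) (dg_space l \<T>)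
            (biorth_proj \<Omega> \<gamma> \<T> m (\<phi> \<T>) (\<xi> \<T>) (\<theta> \<T>))) \<and>
         (\<forall>\<T>\<in>TT. bounded_op \<Omega> (W_space \<Omega> \<gamma> s) (W_norm \<Omega> \<gamma> s)
            (biorth_proj \<Omega> \<gamma> \<T> m (\<phi> \<T>) (\<xi> \<T>) (\<theta> \<T>))) \<and>
         bdd_above ((\<lambda>\<T>. op_norm (W_space \<Omega> \<gamma> s) (W_norm \<Omega> \<gamma> s)
            (biorth_proj \<Omega> \<gamma> \<T> m (\<phi> \<T>) (\<xi> \<T>) (\<theta> \<T>))) ` TT)"
proof -
  obtain \<kappa> Cx Cb Cs where
    mesh: "\<And>\<T>. \<T> \<in> TT \<Longrightarrow> \<exists>\<F>. dg_mesh \<Omega> \<T> \<kappa> \<gamma> \<F> (\<phi> \<T>) m (\<xi> \<T>) (\<theta> \<T>) Cx Cb Cs l"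
    by (rule uniform_dg_mesh[OF assms(1,6,7,11,12,13)]) (assumption | rule that)+
  \<comment> \<open>Its arguments are only \<open>\<kappa>\<close>, \<open>m\<close> and the constants of the \<open>\<xi>\<close> and the bubbles: this is the uniformity.\<close>
  let ?C = "1 + sqrt (bubble_mesh.proj_L2_const TYPE('a) \<kappa> m Cx Cb Cs) + sqrt (4 * bubble_mesh.proj_H1_const TYPE('a) \<kappa> m Cx Cb Cs)"
  have "is_projector \<Omega> \<gamma> (span_of \<T> m (psi \<Omega> \<gamma> \<T> m (\<phi> \<T>) (\<xi> \<T>) (\<theta> \<T>))) (dg_space l \<T>)
        (biorth_proj \<Omega> \<gamma> \<T> m (\<phi> \<T>) (\<xi> \<T>) (\<theta> \<T>)) \<and>
      bounded_op \<Omega> (W_space \<Omega> \<gamma> s) (W_norm \<Omega> \<gamma> s) (biorth_proj \<Omega> \<gamma> \<T> m (\<phi> \<T>) (\<xi> \<T>) (\<theta> \<T>)) \<and>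
      op_norm (W_space \<Omega> \<gamma> s) (W_norm \<Omega> \<gamma> s) (biorth_proj \<Omega> \<gamma> \<T> m (\<phi> \<T>) (\<xi> \<T>) (\<theta> \<T>)) \<le> ?C"
    if \<T>: "\<T> \<in> TT" for \<T>
  proof -
    obtain \<F> where "dg_mesh \<Omega> \<T> \<kappa> \<gamma> \<F> (\<phi> \<T>) m (\<xi> \<T>) (\<theta> \<T>) Cx Cb Cs l" using mesh[OF \<T>] by blast
    then interpret dg_mesh \<Omega> \<T> \<kappa> \<gamma> \<F> "\<phi> \<T>" m "\<xi> \<T>" "\<theta> \<T>" Cx Cb Cs l .
    show ?thesis using P_is_projector P_bounded_op P_op_norm_le by (intro conjI)
  qed
  then show ?thesis by (intro conjI ballI bdd_aboveI2[where M = ?C]) blast+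
qed

end
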